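(* Let $R$ be a semisimple finite-dimensional $k$-algebra, $B$ a smooth associative $R$-algebra, $N>0$ an integer, and $E_1,\dots,E_N$ finitely generated projective $B$-bimodules. Let $M_i:=E_i[-i]$ (that is, $E_i$ placed in weight $i$), $M:=M_1\oplus\cdots\oplus M_N$, and let $A=T_BM$ be the graded tensor algebra of $M$ over $B$. Let $\omega\in \mathrm{DR}^2_R(A)$ be a bi-symplectic form of weight $N$ on $A$. Then the isomorphism $\iota(\omega)\colon \mathbb{D}\mathrm{er}_RA\to\Omega^1_RA$, $\Theta\mapsto\iota_\Theta\omega$ (which raises weight by $N$), induces an isomorphism $$\widetilde{\iota}(\omega)\colon A\otimes_B\mathbb{D}\mathrm{er}_RB\otimes_BA\xrightarrow{\ \cong\ }A\otimes_BM_N\otimes_BA,$$ which, on the weight-zero part of the source, restricts to an isomorphism of $B$-bimodules $$\widetilde{\iota}(\omega)_{(0)}\colon\mathbb{D}\mathrm{er}_RB\xrightarrow{\ \cong\ }E_N .$$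
   Context: $k$ is a field of characteristic $0$, $\otimes=\otimes_k$; all algebras are unital, associative and finitely generated. Gradings are called weights, written $|\cdot|$; all constructions for graded objects follow the Koszul sign rule. An $R$-algebra is an algebra $A$ with a unital algebra map $R\to A$ (landing in weight $0$ if $A$ is graded). Noncommutative forms: $\Omega^1_RA$ is the graded $A$-bimodule carrying the universal $R$-linear derivation $d\colon A\to\Omega^1_RA$; $\Omega^\bullet_RA=T_A\Omega^1_RA$, bigraded by weight $|\cdot|$ and form degree $\|\cdot\|$, with Koszul sign $(-1)^{|u||v|+\|u\|\|v\|}$; $\mathrm{DR}^\bullet_RA=\Omega^\bullet_RA/[\Omega^\bullet_RA,\Omega^\bullet_RA]$ (bigraded commutators), with induced differential $d$. $B$ is smooth over $R$ if it is finitely generated over $R$ and $\Omega^1_RB$ is a projective $B$-bimodule. Double derivations: $\mathbb{D}\mathrm{er}_RA=\mathrm{Der}_R(A,(A\otimes A)_{\rm out})$, the $R$-linear graded derivations into $A\otimes A$ with outer bimodule structure $a(u\otimes v)b=au\otimes vb$; it is an $A$-bimodule via the inner structure $a*(u\otimes v)*b=\pm ub\otimes av$ (Koszul sign). For a bimodule $V$, $V^\vee$ is the bimodule of bimodule maps $V\to(A\otimes A)_{\rm out}$, with bimodule structure from the inner one. Contractions: $\Theta\in\mathbb{D}\mathrm{er}_RA$ extends to a double derivation $i_\Theta$ of $\Omega^\bullet_RA$ of bidegree $(|\Theta|,-1)$ with values in $\Omega^\bullet_RA\otimes\Omega^\bullet_RA$, with $i_\Theta(a)=0$ and $i_\Theta(da)=\Theta(a)$;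 writing $i_\Theta\alpha=i'_\Theta\alpha\otimes i''_\Theta\alpha$ (Sweedler), the reduced contraction is $\iota_\Theta\alpha=\pm\, i''_\Theta(\alpha)\,i'_\Theta(\alpha)$ with the bigraded Koszul sign; it descends to $\mathrm{DR}^\bullet_RA$. A bi-symplectic form of weight $N$ is a closed element $\omega\in\mathrm{DR}^2_R(A)$ of weight $N$ such that $\iota(\omega)\colon\Theta\mapsto\iota_\Theta\omega$ is an isomorphism of graded $A$-bimodules $\mathbb{D}\mathrm{er}_RA\to\Omega^1_RA$ (up to a shift of weight by $N$). Meaning of "induces": there are exact sequences of graded $A$-bimodules $0\to A\otimes_B\Omega^1_RB\otimes_BA\to\Omega^1_RA\xrightarrow{\nu}A\otimes_BM\otimes_BA\to0$ (with $\nu(dm)=1\otimes m\otimes 1$ for $m\in M$ and $\nu(db)=0$ for $b\in B$) and, dually, $0\to A\otimes_BM^\vee\otimes_BA\to\mathbb{D}\mathrm{er}_RA\xrightarrow{\varepsilon^\vee}A\otimes_B\mathbb{D}\mathrm{er}_RB\otimes_BA\to0$. The induced map $\widetilde\iota(\omega)$ is the map satisfying $\widetilde\iota(\omega)\circ\varepsilon^\vee=\mathrm{pr}_N\circ\nu\circ\iota(\omega)$, where $\mathrm{pr}_N$ is induced by the projection $M\to M_N$; it raises weight by $N$, so weight $0$ of the source (which is $\mathbb{D}\mathrm{er}_RB$) corresponds to weight $N$ of the target (which is $M_N$, i.e. $E_N$). *)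

theory Defs
  imports
    "HOL-Algebra.Algebra"
    "HOL-Library.Poly_Mapping"
    "HOL-Computational_Algebra.Group_Closure"
begin

section \<open>Algebras and bimodules\<close>

text \<open>
  Algebras over a (not necessarily commutative) ring \<open>S\<close> are rings with a structure map from \<open>S\<close>.
  If \<open>R\<close> is a \<open>k\<close>-algebra and \<open>A\<close> an \<open>R\<close>-algebra, the \<open>k\<close>-structure of \<open>A\<close> is the composite of the
  two structure maps.
\<close>

record ('s, 'a) alg = "'a ring" +
  umap :: "'s \<Rightarrow> 'a"

record ('s, 'a) galg = "('s, 'a) alg" +
  wt :: "int \<Rightarrow> 'a set"

text \<open>As for HOL-Algebra modules, the fields \<open>mult\<close> and \<open>one\<close> of a bimodule carry no information.\<close>

record ('b, 'm) bimod = "'m ring" +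
  lact :: "'b \<Rightarrow> 'm \<Rightarrow> 'm"
  ract :: "'m \<Rightarrow> 'b \<Rightarrow> 'm"

definition kmap :: "('k, 'r, 'y) alg_scheme \<Rightarrow> ('r, 'a, 'z) alg_scheme \<Rightarrow> 'k \<Rightarrow> 'a" where
  "kmap R A l = umap A (umap R l)"

definition char_zero :: "('k, 'z) ring_scheme \<Rightarrow> bool" where
  "char_zero K \<longleftrightarrow> (\<forall>n::nat. n > 0 \<longrightarrow> add_pow K n \<one>\<^bsub>K\<^esub> \<noteq> \<zero>\<^bsub>K\<^esub>)"

definition k_algebra :: "('k, 'z) ring_scheme \<Rightarrow> ('k, 'r, 'y) alg_scheme \<Rightarrow> bool" where
  "k_algebra K R \<longleftrightarrow> ring R \<and> umap R \<in> ring_hom K R \<and>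
     (\<forall>l\<in>carrier K. \<forall>x\<in>carrier R. umap R l \<otimes>\<^bsub>R\<^esub> x = x \<otimes>\<^bsub>R\<^esub> umap R l)"

definition R_algebra ::
  "('k, 'z) ring_scheme \<Rightarrow> ('k, 'r, 'y) alg_scheme \<Rightarrow> ('r, 'a, 'w) alg_scheme \<Rightarrow> bool" where
  "R_algebra K R A \<longleftrightarrow> ring A \<and> umap A \<in> ring_hom R A \<and>
     (\<forall>l\<in>carrier K. \<forall>x\<in>carrier A. kmap R A l \<otimes>\<^bsub>A\<^esub> x = x \<otimes>\<^bsub>A\<^esub> kmap R A l)"

definition finite_dim :: "('k, 'z) ring_scheme \<Rightarrow> ('k, 'r, 'y) alg_scheme \<Rightarrow> bool" where
  "finite_dim K R \<longleftrightarrow> (\<exists>U. finite U \<and> U \<subseteq> carrier R \<and>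
     carrier R = generate (add_monoid R) {umap R l \<otimes>\<^bsub>R\<^esub> x |l x. l \<in> carrier K \<and> x \<in> U})"

definition left_ideal :: "('r, 'z) ring_scheme \<Rightarrow> 'r set \<Rightarrow> bool" where
  "left_ideal R I \<longleftrightarrow> additive_subgroup I R \<and> (\<forall>r\<in>carrier R. \<forall>x\<in>I. r \<otimes>\<^bsub>R\<^esub> x \<in> I)"

definition minimal_left_ideal :: "('r, 'z) ring_scheme \<Rightarrow> 'r set \<Rightarrow> bool" where
  "minimal_left_ideal R I \<longleftrightarrow> left_ideal R I \<and> I \<noteq> {\<zero>\<^bsub>R\<^esub>} \<and>
     (\<forall>J. left_ideal R J \<and> J \<subseteq> I \<longrightarrow> J = {\<zero>\<^bsub>R\<^esub>} \<or> J = I)"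

text \<open>\<open>R\<close> is semisimple: as a left module over itself it is a sum of simple submodules.\<close>

definition semisimple_ring :: "('r, 'z) ring_scheme \<Rightarrow> bool" where
  "semisimple_ring R \<longleftrightarrow> carrier R = generate (add_monoid R) (\<Union>{I. minimal_left_ideal R I})"

definition fin_gen_over :: "('r, 'y) ring_scheme \<Rightarrow> ('r, 'b, 'z) alg_scheme \<Rightarrow> bool" where
  "fin_gen_over R B \<longleftrightarrow> (\<exists>F. finite F \<and> F \<subseteq> carrier B \<and>
     carrier B = generate_ring B (umap B ` carrier R \<union> F))"

text \<open>Bimodules over a \<open>k\<close>-algebra are \<open>k\<close>-central, i.e. modules over \<open>B \<otimes>\<^sub>k B\<^sup>o\<^sup>p\<close>.\<close>

definition bimodule ::
  "('k, 'x) ring_scheme \<Rightarrow> ('k, 'r, 'y) alg_scheme \<Rightarrow> ('r, 'b, 'z) alg_scheme \<Rightarrow>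
   ('b, 'm, 'w) bimod_scheme \<Rightarrow> bool" where
  "bimodule K R B V \<longleftrightarrow> abelian_group V \<and>
     (\<forall>b\<in>carrier B. \<forall>v\<in>carrier V. lact V b v \<in> carrier V \<and> ract V v b \<in> carrier V) \<and>
     (\<forall>b\<in>carrier B. \<forall>v\<in>carrier V. \<forall>w\<in>carrier V.
        lact V b (v \<oplus>\<^bsub>V\<^esub> w) = lact V b v \<oplus>\<^bsub>V\<^esub> lact V b w \<and>
        ract V (v \<oplus>\<^bsub>V\<^esub> w) b = ract V v b \<oplus>\<^bsub>V\<^esub> ract V w b) \<and>
     (\<forall>b\<in>carrier B. \<forall>c\<in>carrier B. \<forall>v\<in>carrier V.
        lact V (b \<oplus>\<^bsub>B\<^esub> c) v = lact V b v \<oplus>\<^bsub>V\<^esub> lact V c v \<and>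
        ract V v (b \<oplus>\<^bsub>B\<^esub> c) = ract V v b \<oplus>\<^bsub>V\<^esub> ract V v c \<and>
        lact V (b \<otimes>\<^bsub>B\<^esub> c) v = lact V b (lact V c v) \<and>
        ract V v (b \<otimes>\<^bsub>B\<^esub> c) = ract V (ract V v b) c \<and>
        ract V (lact V b v) c = lact V b (ract V v c)) \<and>
     (\<forall>v\<in>carrier V. lact V \<one>\<^bsub>B\<^esub> v = v \<and> ract V v \<one>\<^bsub>B\<^esub> = v) \<and>
     (\<forall>l\<in>carrier K. \<forall>v\<in>carrier V. lact V (kmap R B l) v = ract V v (kmap R B l))"

definition bimod_hom ::
  "('b, 'z) ring_scheme \<Rightarrow> ('b, 'm, 'x) bimod_scheme \<Rightarrow> ('b, 'n, 'y) bimod_scheme \<Rightarrow> ('m \<Rightarrow> 'n) set" where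
  "bimod_hom B V W = {f \<in> hom (add_monoid V) (add_monoid W).
     \<forall>b\<in>carrier B. \<forall>v\<in>carrier V. f (lact V b v) = lact W b (f v) \<and> f (ract V v b) = ract W (f v) b}"

definition bimod_iso ::
  "('b, 'z) ring_scheme \<Rightarrow> ('b, 'm, 'x) bimod_scheme \<Rightarrow> ('b, 'n, 'y) bimod_scheme \<Rightarrow> ('m \<Rightarrow> 'n) set" where
  "bimod_iso B V W = {f \<in> bimod_hom B V W. bij_betw f (carrier V) (carrier W)}"

definition fin_gen_bimod :: "('b, 'z) ring_scheme \<Rightarrow> ('b, 'm, 'x) bimod_scheme \<Rightarrow> bool" where
  "fin_gen_bimod B V \<longleftrightarrow> (\<exists>U. finite U \<and> U \<subseteq> carrier V \<and>
     carrier V = generate (add_monoid V)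
       {ract V (lact V b x) c |b x c. b \<in> carrier B \<and> x \<in> U \<and> c \<in> carrier B})"


section \<open>Abelian groups by generators and relations\<close>

text \<open>
  The elements of the abelian group with generators \<open>G\<close> and relators \<open>Q\<close> are the cosets, in the free
  abelian group, of the subgroup generated by \<open>Q\<close>.  All relators below are supported on \<open>G\<close>.
\<close>

type_synonym 'g pres = "('g \<Rightarrow>\<^sub>0 int) set"

abbreviation gn :: "'g \<Rightarrow> 'g \<Rightarrow>\<^sub>0 int" where
  "gn x \<equiv> Poly_Mapping.single x 1"

definition pcls :: "('g \<Rightarrow>\<^sub>0 int) set \<Rightarrow> ('g \<Rightarrow>\<^sub>0 int) \<Rightarrow> 'g pres" where
  "pcls Q f = {g. g - f \<in> group_closure Q}"

abbreviation gcls :: "('g \<Rightarrow>\<^sub>0 int) set \<Rightarrow> 'g \<Rightarrow> 'g pres" where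
  "gcls Q x \<equiv> pcls Q (gn x)"

definition pcarrier :: "'g set \<Rightarrow> ('g \<Rightarrow>\<^sub>0 int) set \<Rightarrow> 'g pres set" where
  "pcarrier G Q = {pcls Q f |f. Poly_Mapping.keys f \<subseteq> G}"

definition padd :: "'g pres \<Rightarrow> 'g pres \<Rightarrow> 'g pres" where
  "padd U Y = {f + g |f g. f \<in> U \<and> g \<in> Y}"

text \<open>The homomorphism (into the group with relators \<open>Q\<close>) that sends each generator \<open>x\<close> to the generator \<open>h x\<close>.\<close>

definition pmap :: "('h \<Rightarrow>\<^sub>0 int) set \<Rightarrow> ('g \<Rightarrow> 'h) \<Rightarrow> 'g pres \<Rightarrow> 'h pres" where
  "pmap Q h U = (\<Union>f\<in>U. pcls Q (\<Sum>x\<in>Poly_Mapping.keys f.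
      Poly_Mapping.single (h x) (Poly_Mapping.lookup f x)))"

text \<open>The biadditive product that is given by \<open>m\<close> on generators.\<close>

definition pmult :: "('g \<Rightarrow>\<^sub>0 int) set \<Rightarrow> ('g \<Rightarrow> 'g \<Rightarrow> 'g) \<Rightarrow> 'g pres \<Rightarrow> 'g pres \<Rightarrow> 'g pres" where
  "pmult Q m U Y = (\<Union>f\<in>U. \<Union>g\<in>Y. pcls Q (\<Sum>x\<in>Poly_Mapping.keys f. \<Sum>y\<in>Poly_Mapping.keys g.
      Poly_Mapping.single (m x y) (Poly_Mapping.lookup f x * Poly_Mapping.lookup g y)))"

definition pbimod ::
  "'g set \<Rightarrow> ('g \<Rightarrow>\<^sub>0 int) set \<Rightarrow> ('b \<Rightarrow> 'g \<Rightarrow> 'g) \<Rightarrow> ('g \<Rightarrow> 'b \<Rightarrow> 'g) \<Rightarrow> ('b, 'g pres) bimod" where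
  "pbimod G Q l r =
     \<lparr>carrier = pcarrier G Q, monoid.mult = undefined, one = undefined, ring.zero = pcls Q 0, add = padd,
      lact = (\<lambda>b. pmap Q (l b)), ract = (\<lambda>U b. pmap Q (\<lambda>x. r x b) U)\<rparr>"

definition span :: "('m, 'z) ring_scheme \<Rightarrow> 'm set \<Rightarrow> 'm set" where
  "span V U = generate (add_monoid V) U"

text \<open>
  The additive map satisfying \<open>P\<close>.  Following the Koszul convention, \<open>P\<close> usually prescribes the values
  on homogeneous elements (or on pure tensors of homogeneous elements), which span \<open>U\<close>.
\<close>

definition the_add_map ::
  "('m, 'x) ring_scheme \<Rightarrow> ('n, 'y) ring_scheme \<Rightarrow> (('m \<Rightarrow> 'n) \<Rightarrow> bool) \<Rightarrow> 'm \<Rightarrow> 'n" where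
  "the_add_map U Y P = (THE f. f \<in> extensional (carrier U) \<and> f \<in> hom (add_monoid U) (add_monoid Y) \<and> P f)"


section \<open>Gradings and signs\<close>

definition ksgn :: "('m, 'x) ring_scheme \<Rightarrow> int \<Rightarrow> 'm \<Rightarrow> 'm" where
  "ksgn V e x = (if even e then x else \<ominus>\<^bsub>V\<^esub> x)"

text \<open>\<open>V\<close> placed in weight \<open>n\<close>.\<close>

definition placed :: "int \<Rightarrow> ('m, 'x) ring_scheme \<Rightarrow> int \<Rightarrow> 'm set" where
  "placed n V p = (if p = n then carrier V else {\<zero>\<^bsub>V\<^esub>})"

definition ungraded :: "('s, 'a) alg \<Rightarrow> ('s, 'a) galg" where
  "ungraded B = alg.extend B (galg.fields (placed 0 B))"

text \<open>\<open>twist A n a = (-1)\<^bsup>n |a|\<^esup> a\<close>: the sign for moving \<open>a\<close> past something of weight \<open>n\<close>.\<close>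

definition twist :: "('s, 'a, 'z) galg_scheme \<Rightarrow> int \<Rightarrow> 'a \<Rightarrow> 'a" where
  "twist A n = the_add_map A A (\<lambda>f. \<forall>p. \<forall>a\<in>wt A p. f a = ksgn A (n * p) a)"

text \<open>
  Isomorphisms of graded \<open>A\<close>-bimodules \<open>V \<rightarrow> W\<close> up to a shift of weight by \<open>n\<close>.
  For \<open>\<Theta> \<mapsto> \<iota>\<^sub>\<Theta> \<omega>\<close> with \<open>\<omega>\<close> of weight \<open>n\<close>, the element \<open>b\<close> in \<open>\<Theta> b\<close> has to be moved past \<open>\<omega>\<close>,
  whence the sign \<open>(-1)\<^bsup>n |b|\<^esup>\<close> on the right.
\<close>

definition shift_iso ::
  "('s, 'a, 'z) galg_scheme \<Rightarrow> int \<Rightarrow> ('a, 'm, 'x) bimod_scheme \<Rightarrow> (int \<Rightarrow> 'm set) \<Rightarrow>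
   ('a, 'n, 'y) bimod_scheme \<Rightarrow> (int \<Rightarrow> 'n set) \<Rightarrow> ('m \<Rightarrow> 'n) set" where
  "shift_iso A n V gV W gW = {f \<in> hom (add_monoid V) (add_monoid W).
     bij_betw f (carrier V) (carrier W) \<and>
     (\<forall>p. f ` gV p = gW (p + n)) \<and>
     (\<forall>a\<in>carrier A. \<forall>v\<in>carrier V. f (lact V a v) = lact W a (f v)) \<and>
     (\<forall>v\<in>carrier V. \<forall>b\<in>carrier A. f (ract V v b) = ract W (f v) (twist A n b))}"


section \<open>Tensor products\<close>

subsection \<open>\<open>A \<otimes>\<^sub>k A\<close> with the outer bimodule structure\<close>

definition tens_rels ::
  "('k, 'x) ring_scheme \<Rightarrow> ('k, 'r, 'y) alg_scheme \<Rightarrow> ('r, 'a, 'z) alg_scheme \<Rightarrow> ('a \<times> 'a \<Rightarrow>\<^sub>0 int) set" where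
  "tens_rels K R A =
     {gn (u \<oplus>\<^bsub>A\<^esub> u', v) - gn (u, v) - gn (u', v) |u u' v. u \<in> carrier A \<and> u' \<in> carrier A \<and> v \<in> carrier A} \<union>
     {gn (u, v \<oplus>\<^bsub>A\<^esub> v') - gn (u, v) - gn (u, v') |u v v'. u \<in> carrier A \<and> v \<in> carrier A \<and> v' \<in> carrier A} \<union>
     {gn (u \<otimes>\<^bsub>A\<^esub> kmap R A l, v) - gn (u, kmap R A l \<otimes>\<^bsub>A\<^esub> v) |u v l.
        u \<in> carrier A \<and> v \<in> carrier A \<and> l \<in> carrier K}"

definition tens ::
  "('k, 'x) ring_scheme \<Rightarrow> ('k, 'r, 'y) alg_scheme \<Rightarrow> ('r, 'a, 'z) alg_scheme \<Rightarrow> ('a, ('a \<times> 'a) pres) bimod" where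
  "tens K R A = pbimod (carrier A \<times> carrier A) (tens_rels K R A)
     (\<lambda>a (u, v). (a \<otimes>\<^bsub>A\<^esub> u, v)) (\<lambda>(u, v) b. (u, v \<otimes>\<^bsub>A\<^esub> b))"

abbreviation ptens ::
  "('k, 'x) ring_scheme \<Rightarrow> ('k, 'r, 'y) alg_scheme \<Rightarrow> ('r, 'a, 'z) alg_scheme \<Rightarrow> 'a \<Rightarrow> 'a \<Rightarrow> ('a \<times> 'a) pres" where
  "ptens K R A u v \<equiv> gcls (tens_rels K R A) (u, v)"

text \<open>\<open>j \<otimes> j : A \<otimes> A \<rightarrow> C \<otimes> C\<close> for an algebra map \<open>j : A \<rightarrow> C\<close>.\<close>

abbreviation tens_map ::
  "('k, 'x) ring_scheme \<Rightarrow> ('k, 'r, 'y) alg_scheme \<Rightarrow> ('r, 'c, 'z) alg_scheme \<Rightarrow> ('a \<Rightarrow> 'c) \<Rightarrow>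
   ('a \<times> 'a) pres \<Rightarrow> ('c \<times> 'c) pres" where
  "tens_map K R C j \<equiv> pmap (tens_rels K R C) (map_prod j j)"

definition tens_wt ::
  "('k, 'x) ring_scheme \<Rightarrow> ('k, 'r, 'y) alg_scheme \<Rightarrow> ('r, 'a, 'z) galg_scheme \<Rightarrow> int \<Rightarrow> ('a \<times> 'a) pres set" where
  "tens_wt K R A n = span (tens K R A)
     {ptens K R A u v |u v p q. u \<in> wt A p \<and> v \<in> wt A q \<and> p + q = n}"

text \<open>
  The inner bimodule structure \<open>a * (u \<otimes> v) * b = (-1)\<^bsup>|a||u| + |a||b| + |b||v|\<^esup> ub \<otimes> av\<close>, as a pair of
  commuting actions \<open>a * (u \<otimes> v) = (-1)\<^bsup>|a||u|\<^esup> u \<otimes> av\<close> and \<open>(u \<otimes> v) * b = (-1)\<^bsup>|b||v|\<^esup> ub \<otimes> v\<close>.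
\<close>

definition inner_l ::
  "('k, 'x) ring_scheme \<Rightarrow> ('k, 'r, 'y) alg_scheme \<Rightarrow> ('r, 'a, 'z) galg_scheme \<Rightarrow>
   'a \<Rightarrow> ('a \<times> 'a) pres \<Rightarrow> ('a \<times> 'a) pres" where
  "inner_l K R A a = the_add_map (tens K R A) (tens K R A) (\<lambda>f. \<forall>p. \<forall>u\<in>wt A p. \<forall>v\<in>carrier A.
     f (ptens K R A u v) = ptens K R A u (twist A p a \<otimes>\<^bsub>A\<^esub> v))"

definition inner_r ::
  "('k, 'x) ring_scheme \<Rightarrow> ('k, 'r, 'y) alg_scheme \<Rightarrow> ('r, 'a, 'z) galg_scheme \<Rightarrow>
   ('a \<times> 'a) pres \<Rightarrow> 'a \<Rightarrow> ('a \<times> 'a) pres" where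
  "inner_r K R A t b = the_add_map (tens K R A) (tens K R A) (\<lambda>f. \<forall>p. \<forall>u\<in>carrier A. \<forall>v\<in>wt A p.
     f (ptens K R A u v) = ptens K R A (u \<otimes>\<^bsub>A\<^esub> twist A p b) v) t"


subsection \<open>Projective bimodules\<close>

text \<open>The free bimodule \<open>(B \<otimes> B)\<^sup>(\<^sup>I\<^sup>)\<close>.\<close>

definition free_bimod ::
  "('k, 'x) ring_scheme \<Rightarrow> ('k, 'r, 'y) alg_scheme \<Rightarrow> ('r, 'b, 'z) alg_scheme \<Rightarrow> 'i set \<Rightarrow>
   ('b, 'i \<Rightarrow> ('b \<times> 'b) pres) bimod" where
  "free_bimod K R B I = (let T = tens K R B in
     \<lparr>carrier = {f \<in> I \<rightarrow>\<^sub>E carrier T. finite {i \<in> I. f i \<noteq> \<zero>\<^bsub>T\<^esub>}}, monoid.mult = undefined, one = undefined,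
      ring.zero = (\<lambda>i\<in>I. \<zero>\<^bsub>T\<^esub>), add = (\<lambda>f g. \<lambda>i\<in>I. f i \<oplus>\<^bsub>T\<^esub> g i),
      lact = (\<lambda>b f. \<lambda>i\<in>I. lact T b (f i)), ract = (\<lambda>f b. \<lambda>i\<in>I. ract T (f i) b)\<rparr>)"

text \<open>
  Projective means direct summand of a free bimodule.  The index set may be taken inside the type of
  \<open>V\<close>, because a projective \<open>V\<close> is a direct summand of the free bimodule on the set \<open>carrier V\<close>.
\<close>

definition projective_bimod ::
  "('k, 'x) ring_scheme \<Rightarrow> ('k, 'r, 'y) alg_scheme \<Rightarrow> ('r, 'b, 'z) alg_scheme \<Rightarrow>
   ('b, 'm, 'w) bimod_scheme \<Rightarrow> bool" where
  "projective_bimod K R B V \<longleftrightarrow> (\<exists>(I :: 'm set) s p.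
     s \<in> bimod_hom B V (free_bimod K R B I) \<and> p \<in> bimod_hom B (free_bimod K R B I) V \<and>
     (\<forall>v\<in>carrier V. p (s v) = v))"


subsection \<open>The induced bimodule \<open>A \<otimes>\<^sub>B V \<otimes>\<^sub>B A\<close>\<close>

text \<open>Here \<open>j : B \<rightarrow> A\<close> is a ring homomorphism.\<close>

definition ind_rels ::
  "('a, 'x) ring_scheme \<Rightarrow> ('b \<Rightarrow> 'a) \<Rightarrow> ('b, 'y) ring_scheme \<Rightarrow> ('b, 'm, 'z) bimod_scheme \<Rightarrow>
   ('a \<times> 'm \<times> 'a \<Rightarrow>\<^sub>0 int) set" where
  "ind_rels A j B V =
     {gn (a \<oplus>\<^bsub>A\<^esub> a', v, c) - gn (a, v, c) - gn (a', v, c) |a a' v c.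
        a \<in> carrier A \<and> a' \<in> carrier A \<and> v \<in> carrier V \<and> c \<in> carrier A} \<union>
     {gn (a, v \<oplus>\<^bsub>V\<^esub> v', c) - gn (a, v, c) - gn (a, v', c) |a v v' c.
        a \<in> carrier A \<and> v \<in> carrier V \<and> v' \<in> carrier V \<and> c \<in> carrier A} \<union>
     {gn (a, v, c \<oplus>\<^bsub>A\<^esub> c') - gn (a, v, c) - gn (a, v, c') |a v c c'.
        a \<in> carrier A \<and> v \<in> carrier V \<and> c \<in> carrier A \<and> c' \<in> carrier A} \<union>
     {gn (a \<otimes>\<^bsub>A\<^esub> j b, v, c) - gn (a, lact V b v, c) |a b v c.
        a \<in> carrier A \<and> b \<in> carrier B \<and> v \<in> carrier V \<and> c \<in> carrier A} \<union>
     {gn (a, ract V v b, c) - gn (a, v, j b \<otimes>\<^bsub>A\<^esub> c) |a b v c.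
        a \<in> carrier A \<and> b \<in> carrier B \<and> v \<in> carrier V \<and> c \<in> carrier A}"

definition ind ::
  "('a, 'x) ring_scheme \<Rightarrow> ('b \<Rightarrow> 'a) \<Rightarrow> ('b, 'y) ring_scheme \<Rightarrow> ('b, 'm, 'z) bimod_scheme \<Rightarrow>
   ('a, ('a \<times> 'm \<times> 'a) pres) bimod" where
  "ind A j B V = pbimod (carrier A \<times> carrier V \<times> carrier A) (ind_rels A j B V)
     (\<lambda>x (a, v, c). (x \<otimes>\<^bsub>A\<^esub> a, v, c)) (\<lambda>(a, v, c) x. (a, v, c \<otimes>\<^bsub>A\<^esub> x))"

abbreviation pind ::
  "('a, 'x) ring_scheme \<Rightarrow> ('b \<Rightarrow> 'a) \<Rightarrow> ('b, 'y) ring_scheme \<Rightarrow> ('b, 'm, 'z) bimod_scheme \<Rightarrow>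
   'a \<Rightarrow> 'm \<Rightarrow> 'a \<Rightarrow> ('a \<times> 'm \<times> 'a) pres" where
  "pind A j B V a v c \<equiv> gcls (ind_rels A j B V) (a, v, c)"

definition ind_wt ::
  "('r, 'a, 'x) galg_scheme \<Rightarrow> ('b \<Rightarrow> 'a) \<Rightarrow> ('b, 'y) ring_scheme \<Rightarrow> ('b, 'm, 'z) bimod_scheme \<Rightarrow>
   (int \<Rightarrow> 'm set) \<Rightarrow> int \<Rightarrow> ('a \<times> 'm \<times> 'a) pres set" where
  "ind_wt A j B V gV n = span (ind A j B V)
     {pind A j B V a v c |a v c p q r. a \<in> wt A p \<and> v \<in> gV q \<and> c \<in> wt A r \<and> p + q + r = n}"


subsection \<open>Tensor algebras\<close>

text \<open>
  The tensor algebra \<open>T\<^sub>S V\<close>: the generator \<open>(s, [v\<^sub>1, \<dots>, v\<^sub>n])\<close> stands for \<open>s \<otimes> v\<^sub>1 \<otimes> \<dots> \<otimes> v\<^sub>n\<close> in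
  \<open>S \<otimes>\<^sub>S V \<otimes>\<^sub>S \<dots> \<otimes>\<^sub>S V\<close>, which is \<open>S\<close> for \<open>n = 0\<close> and the \<open>n\<close>-th tensor power of \<open>V\<close> for \<open>n > 0\<close>.
  No relator mixes lists of different lengths, so the group presented is the direct sum over \<open>n\<close>.
\<close>

definition T_rels :: "('s, 'x) ring_scheme \<Rightarrow> ('s, 'v, 'y) bimod_scheme \<Rightarrow> ('s \<times> 'v list \<Rightarrow>\<^sub>0 int) set" where
  "T_rels S V =
     {gn (s \<oplus>\<^bsub>S\<^esub> t, vs) - gn (s, vs) - gn (t, vs) |s t vs.
        s \<in> carrier S \<and> t \<in> carrier S \<and> vs \<in> lists (carrier V)} \<union>
     {gn (s, us @ (v \<oplus>\<^bsub>V\<^esub> w) # ws) - gn (s, us @ v # ws) - gn (s, us @ w # ws) |s us v w ws.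
        s \<in> carrier S \<and> us \<in> lists (carrier V) \<and> v \<in> carrier V \<and> w \<in> carrier V \<and> ws \<in> lists (carrier V)} \<union>
     {gn (s \<otimes>\<^bsub>S\<^esub> t, v # vs) - gn (s, lact V t v # vs) |s t v vs.
        s \<in> carrier S \<and> t \<in> carrier S \<and> v \<in> carrier V \<and> vs \<in> lists (carrier V)} \<union>
     {gn (s, us @ ract V v t # w # ws) - gn (s, us @ v # lact V t w # ws) |s us v t w ws.
        s \<in> carrier S \<and> us \<in> lists (carrier V) \<and> v \<in> carrier V \<and> t \<in> carrier S \<and>
        w \<in> carrier V \<and> ws \<in> lists (carrier V)}"

definition T_mult ::
  "('s, 'x) ring_scheme \<Rightarrow> ('s, 'v, 'y) bimod_scheme \<Rightarrow> 's \<times> 'v list \<Rightarrow> 's \<times> 'v list \<Rightarrow> 's \<times> 'v list" where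
  "T_mult S V x y = (case (x, y) of ((s, us), (t, vs)) \<Rightarrow>
     if us = [] then (s \<otimes>\<^bsub>S\<^esub> t, vs) else (s, butlast us @ ract V (last us) t # vs))"

definition T_base :: "('s, 'x) ring_scheme \<Rightarrow> ('s, 'v, 'y) bimod_scheme \<Rightarrow> 's \<Rightarrow> ('s \<times> 'v list) pres" where
  "T_base S V s = gcls (T_rels S V) (s, [])"

definition T_incl :: "('s, 'x) ring_scheme \<Rightarrow> ('s, 'v, 'y) bimod_scheme \<Rightarrow> 'v \<Rightarrow> ('s \<times> 'v list) pres" where
  "T_incl S V v = gcls (T_rels S V) (\<one>\<^bsub>S\<^esub>, [v])"

definition tensor_alg ::
  "('r, 's, 'x) alg_scheme \<Rightarrow> ('s, 'v, 'y) bimod_scheme \<Rightarrow> ('r, ('s \<times> 'v list) pres) alg" where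
  "tensor_alg S V =
     \<lparr>carrier = pcarrier (carrier S \<times> lists (carrier V)) (T_rels S V),
      monoid.mult = pmult (T_rels S V) (T_mult S V), one = T_base S V \<one>\<^bsub>S\<^esub>,
      ring.zero = pcls (T_rels S V) 0, add = padd, umap = T_base S V \<circ> umap S\<rparr>"

text \<open>The part of weight \<open>w\<close> and tensor degree \<open>n\<close>, for gradings \<open>gS\<close> of \<open>S\<close> and \<open>gV\<close> of \<open>V\<close>.\<close>

definition T_part ::
  "('r, 's, 'x) alg_scheme \<Rightarrow> ('s, 'v, 'y) bimod_scheme \<Rightarrow> (int \<Rightarrow> 's set) \<Rightarrow> (int \<Rightarrow> 'v set) \<Rightarrow>
   int \<Rightarrow> nat \<Rightarrow> ('s \<times> 'v list) pres set" where
  "T_part S V gS gV w n = span (tensor_alg S V)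
     {gcls (T_rels S V) (s, vs) |s vs p qs.
        s \<in> gS p \<and> list_all2 (\<lambda>v q. v \<in> gV q) vs qs \<and> length vs = n \<and> p + sum_list qs = w}"

definition tensor_galg ::
  "('r, 's, 'x) alg_scheme \<Rightarrow> ('s, 'v, 'y) bimod_scheme \<Rightarrow> (int \<Rightarrow> 's set) \<Rightarrow> (int \<Rightarrow> 'v set) \<Rightarrow>
   ('r, ('s \<times> 'v list) pres) galg" where
  "tensor_galg S V gS gV = alg.extend (tensor_alg S V)
     (galg.fields (\<lambda>w. span (tensor_alg S V) (\<Union>n. T_part S V gS gV w n)))"


section \<open>Noncommutative differential forms\<close>

text \<open>
  The bimodule carrying the universal \<open>R\<close>-linear derivation; the generator \<open>(a, x, c)\<close> stands for \<open>a dx c\<close>.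
  It is \<open>k\<close>-central, since \<open>d\<close> is additive and kills the image of \<open>k\<close>.
\<close>

definition Om1_rels :: "('r, 'x) ring_scheme \<Rightarrow> ('r, 'a, 'y) alg_scheme \<Rightarrow> ('a \<times> 'a \<times> 'a \<Rightarrow>\<^sub>0 int) set" where
  "Om1_rels R A =
     {gn (a \<oplus>\<^bsub>A\<^esub> a', x, c) - gn (a, x, c) - gn (a', x, c) |a a' x c.
        a \<in> carrier A \<and> a' \<in> carrier A \<and> x \<in> carrier A \<and> c \<in> carrier A} \<union>
     {gn (a, x \<oplus>\<^bsub>A\<^esub> x', c) - gn (a, x, c) - gn (a, x', c) |a x x' c.
        a \<in> carrier A \<and> x \<in> carrier A \<and> x' \<in> carrier A \<and> c \<in> carrier A} \<union>
     {gn (a, x, c \<oplus>\<^bsub>A\<^esub> c') - gn (a, x, c) - gn (a, x, c') |a x c c'.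
        a \<in> carrier A \<and> x \<in> carrier A \<and> c \<in> carrier A \<and> c' \<in> carrier A} \<union>
     {gn (a, x \<otimes>\<^bsub>A\<^esub> y, c) - gn (a, x, y \<otimes>\<^bsub>A\<^esub> c) - gn (a \<otimes>\<^bsub>A\<^esub> x, y, c) |a x y c.
        a \<in> carrier A \<and> x \<in> carrier A \<and> y \<in> carrier A \<and> c \<in> carrier A} \<union>
     {gn (a, umap A r, c) |a r c. a \<in> carrier A \<and> r \<in> carrier R \<and> c \<in> carrier A}"

definition Om1 ::
  "('r, 'x) ring_scheme \<Rightarrow> ('r, 'a, 'y) alg_scheme \<Rightarrow> ('a, ('a \<times> 'a \<times> 'a) pres) bimod" where
  "Om1 R A = pbimod (carrier A \<times> carrier A \<times> carrier A) (Om1_rels R A)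
     (\<lambda>b (a, x, c). (b \<otimes>\<^bsub>A\<^esub> a, x, c)) (\<lambda>(a, x, c) b. (a, x, c \<otimes>\<^bsub>A\<^esub> b))"

definition du :: "('r, 'x) ring_scheme \<Rightarrow> ('r, 'a, 'y) alg_scheme \<Rightarrow> 'a \<Rightarrow> ('a \<times> 'a \<times> 'a) pres" where
  "du R A x = gcls (Om1_rels R A) (\<one>\<^bsub>A\<^esub>, x, \<one>\<^bsub>A\<^esub>)"

definition Om1_wt ::
  "('r, 'x) ring_scheme \<Rightarrow> ('r, 'a, 'y) galg_scheme \<Rightarrow> int \<Rightarrow> ('a \<times> 'a \<times> 'a) pres set" where
  "Om1_wt R A n = span (Om1 R A)
     {gcls (Om1_rels R A) (a, x, c) |a x c p q r. a \<in> wt A p \<and> x \<in> wt A q \<and> c \<in> wt A r \<and> p + q + r = n}"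

definition smooth ::
  "('k, 'x) ring_scheme \<Rightarrow> ('k, 'r, 'y) alg_scheme \<Rightarrow> ('r, 'b, 'z) alg_scheme \<Rightarrow> bool" where
  "smooth K R B \<longleftrightarrow> fin_gen_over R B \<and> projective_bimod K R B (Om1 R B)"

type_synonym 'a forms = "('a \<times> ('a \<times> 'a \<times> 'a) pres list) pres"

definition Om :: "('r, 'x) ring_scheme \<Rightarrow> ('r, 'a, 'y) alg_scheme \<Rightarrow> ('r, 'a forms) alg" where
  "Om R A = tensor_alg A (Om1 R A)"

definition Om_part :: "('r, 'x) ring_scheme \<Rightarrow> ('r, 'a, 'y) galg_scheme \<Rightarrow> int \<Rightarrow> nat \<Rightarrow> 'a forms set" where
  "Om_part R A = T_part A (Om1 R A) (wt A) (Om1_wt R A)"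

abbreviation Om_base :: "('r, 'x) ring_scheme \<Rightarrow> ('r, 'a, 'y) alg_scheme \<Rightarrow> 'a \<Rightarrow> 'a forms" where
  "Om_base R A \<equiv> T_base A (Om1 R A)"

abbreviation Om_incl ::
  "('r, 'x) ring_scheme \<Rightarrow> ('r, 'a, 'y) alg_scheme \<Rightarrow> ('a \<times> 'a \<times> 'a) pres \<Rightarrow> 'a forms" where
  "Om_incl R A \<equiv> T_incl A (Om1 R A)"

definition Om_d :: "('r, 'x) ring_scheme \<Rightarrow> ('r, 'a, 'y) galg_scheme \<Rightarrow> 'a forms \<Rightarrow> 'a forms" where
  "Om_d R A = the_add_map (Om R A) (Om R A) (\<lambda>f.
     (\<forall>a\<in>carrier A. f (Om_base R A a) = Om_incl R A (du R A a)) \<and>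
     (\<forall>a\<in>carrier A. f (Om_incl R A (du R A a)) = \<zero>\<^bsub>Om R A\<^esub>) \<and>
     (\<forall>w p. \<forall>\<alpha>\<in>Om_part R A w p. \<forall>\<beta>\<in>carrier (Om R A).
        f (\<alpha> \<otimes>\<^bsub>Om R A\<^esub> \<beta>) = f \<alpha> \<otimes>\<^bsub>Om R A\<^esub> \<beta> \<oplus>\<^bsub>Om R A\<^esub> ksgn (Om R A) (int p) (\<alpha> \<otimes>\<^bsub>Om R A\<^esub> f \<beta>)))"

text \<open>The span of the bigraded commutators, whose cosets are the elements of \<open>DR\<close>.\<close>

definition Om_comm :: "('r, 'x) ring_scheme \<Rightarrow> ('r, 'a, 'y) galg_scheme \<Rightarrow> 'a forms set" where
  "Om_comm R A = span (Om R A)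
     {\<alpha> \<otimes>\<^bsub>Om R A\<^esub> \<beta> \<ominus>\<^bsub>Om R A\<^esub> ksgn (Om R A) (w * w' + int p * int p') (\<beta> \<otimes>\<^bsub>Om R A\<^esub> \<alpha>) |\<alpha> \<beta> w p w' p'.
        \<alpha> \<in> Om_part R A w p \<and> \<beta> \<in> Om_part R A w' p'}"

definition DR_part :: "('r, 'x) ring_scheme \<Rightarrow> ('r, 'a, 'y) galg_scheme \<Rightarrow> int \<Rightarrow> nat \<Rightarrow> 'a forms set set" where
  "DR_part R A w p = {Om_comm R A +>\<^bsub>Om R A\<^esub> \<alpha> |\<alpha>. \<alpha> \<in> Om_part R A w p}"

definition DR_d :: "('r, 'x) ring_scheme \<Rightarrow> ('r, 'a, 'y) galg_scheme \<Rightarrow> 'a forms set \<Rightarrow> 'a forms set" where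
  "DR_d R A \<omega> = (\<Union>\<alpha>\<in>\<omega>. Om_comm R A +>\<^bsub>Om R A\<^esub> Om_d R A \<alpha>)"


section \<open>Double derivations\<close>

definition DDer_wt ::
  "('k, 'x) ring_scheme \<Rightarrow> ('k, 'r, 'y) alg_scheme \<Rightarrow> ('r, 'a, 'z) galg_scheme \<Rightarrow> int \<Rightarrow>
   ('a \<Rightarrow> ('a \<times> 'a) pres) set" where
  "DDer_wt K R A n = {\<Theta> \<in> extensional (carrier A) \<inter> hom (add_monoid A) (add_monoid (tens K R A)).
     (\<forall>p. \<forall>x\<in>wt A p. \<Theta> x \<in> tens_wt K R A (p + n)) \<and>
     (\<forall>r\<in>carrier R. \<Theta> (umap A r) = \<zero>\<^bsub>tens K R A\<^esub>) \<and>
     (\<forall>x\<in>carrier A. \<forall>y\<in>carrier A. \<Theta> (x \<otimes>\<^bsub>A\<^esub> y) =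
        ract (tens K R A) (\<Theta> x) y \<oplus>\<^bsub>tens K R A\<^esub> lact (tens K R A) (twist A n x) (\<Theta> y))}"

definition fun_group :: "('m, 'x) ring_scheme \<Rightarrow> ('n, 'y) ring_scheme \<Rightarrow> ('m \<Rightarrow> 'n) ring" where
  "fun_group U Y = \<lparr>carrier = carrier U \<rightarrow>\<^sub>E carrier Y, monoid.mult = undefined, one = undefined,
     ring.zero = (\<lambda>x\<in>carrier U. \<zero>\<^bsub>Y\<^esub>), add = (\<lambda>f g. \<lambda>x\<in>carrier U. f x \<oplus>\<^bsub>Y\<^esub> g x)\<rparr>"

text \<open>
  The elements are the finite sums of homogeneous double derivations.  The actions are
  \<open>(a \<Theta>)(x) = a * \<Theta>(x)\<close> and \<open>(\<Theta> b)(x) = (-1)\<^bsup>|b||x|\<^esup> \<Theta>(x) * b\<close>, the latter sign coming from moving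
  \<open>b\<close> past \<open>x\<close>; without it \<open>\<Theta> b\<close> would not be a graded derivation.
\<close>

definition DDer ::
  "('k, 'x) ring_scheme \<Rightarrow> ('k, 'r, 'y) alg_scheme \<Rightarrow> ('r, 'a, 'z) galg_scheme \<Rightarrow>
   ('a, 'a \<Rightarrow> ('a \<times> 'a) pres) bimod" where
  "DDer K R A = (let F = fun_group A (tens K R A) in
     \<lparr>carrier = span F (\<Union>n. DDer_wt K R A n), monoid.mult = undefined, one = undefined, ring.zero = ring.zero F, add = ring.add F,
      lact = (\<lambda>a \<Theta>. \<lambda>x\<in>carrier A. inner_l K R A a (\<Theta> x)),
      ract = (\<lambda>\<Theta> b. the_add_map A (tens K R A) (\<lambda>f. \<forall>p. \<forall>x\<in>wt A p.
                f x = inner_r K R A (\<Theta> x) (twist A p b)))\<rparr>)"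

text \<open>
  The extension \<open>i\<^sub>\<Theta>\<close> to \<open>\<Omega>\<close>, for \<open>\<Theta>\<close> of weight \<open>n\<close>.  It has bidegree \<open>(n, -1)\<close>, whence the sign
  \<open>(-1)\<^bsup>n |\<alpha>| - \<parallel>\<alpha>\<parallel>\<^esup>\<close> in the Leibniz rule.
\<close>

definition contr ::
  "('k, 'x) ring_scheme \<Rightarrow> ('k, 'r, 'y) alg_scheme \<Rightarrow> ('r, 'a, 'z) galg_scheme \<Rightarrow> int \<Rightarrow>
   ('a \<Rightarrow> ('a \<times> 'a) pres) \<Rightarrow> 'a forms \<Rightarrow> ('a forms \<times> 'a forms) pres" where
  "contr K R A n \<Theta> = (let T = tens K R (Om R A) in the_add_map (Om R A) T (\<lambda>f.
     (\<forall>a\<in>carrier A. f (Om_base R A a) = \<zero>\<^bsub>T\<^esub>) \<and>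
     (\<forall>a\<in>carrier A. f (Om_incl R A (du R A a)) = tens_map K R (Om R A) (Om_base R A) (\<Theta> a)) \<and>
     (\<forall>w p. \<forall>\<alpha>\<in>Om_part R A w p. \<forall>\<beta>\<in>carrier (Om R A).
        f (\<alpha> \<otimes>\<^bsub>Om R A\<^esub> \<beta>) = ract T (f \<alpha>) \<beta> \<oplus>\<^bsub>T\<^esub> ksgn T (n * w - int p) (lact T \<alpha> (f \<beta>)))))"

definition swap_mult ::
  "('k, 'x) ring_scheme \<Rightarrow> ('k, 'r, 'y) alg_scheme \<Rightarrow> ('r, 'a, 'z) galg_scheme \<Rightarrow>
   ('a forms \<times> 'a forms) pres \<Rightarrow> 'a forms" where
  "swap_mult K R A = the_add_map (tens K R (Om R A)) (Om R A) (\<lambda>f.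
     \<forall>w p w' p'. \<forall>\<alpha>\<in>Om_part R A w p. \<forall>\<beta>\<in>Om_part R A w' p'.
       f (ptens K R (Om R A) \<alpha> \<beta>) = ksgn (Om R A) (w * w' + int p * int p') (\<beta> \<otimes>\<^bsub>Om R A\<^esub> \<alpha>))"

text \<open>The reduced contraction of a homogeneous \<open>\<Theta>\<close> with a form.\<close>

definition red_contr ::
  "('k, 'x) ring_scheme \<Rightarrow> ('k, 'r, 'y) alg_scheme \<Rightarrow> ('r, 'a, 'z) galg_scheme \<Rightarrow> int \<Rightarrow>
   ('a \<Rightarrow> ('a \<times> 'a) pres) \<Rightarrow> 'a forms \<Rightarrow> 'a forms" where
  "red_contr K R A n \<Theta> \<alpha> = swap_mult K R A (contr K R A n \<Theta> \<alpha>)"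

text \<open>
  \<open>\<Theta> \<mapsto> \<iota>\<^sub>\<Theta> \<omega>\<close> for a class \<open>\<omega>\<close> of 2-forms modulo commutators.  The reduced contraction does not depend on
  the representative \<open>\<alpha>\<close>; its value, a 1-form inside \<open>\<Omega>\<close>, is regarded as an element of \<open>\<Omega>\<^sup>1\<close>.
\<close>

definition iota ::
  "('k, 'x) ring_scheme \<Rightarrow> ('k, 'r, 'y) alg_scheme \<Rightarrow> ('r, 'a, 'z) galg_scheme \<Rightarrow> 'a forms set \<Rightarrow>
   ('a \<Rightarrow> ('a \<times> 'a) pres) \<Rightarrow> ('a \<times> 'a \<times> 'a) pres" where
  "iota K R A \<omega> = the_add_map (DDer K R A) (Om1 R A) (\<lambda>f.
     \<forall>n. \<forall>\<Theta>\<in>DDer_wt K R A n. \<forall>\<alpha>\<in>\<omega>. Om_incl R A (f \<Theta>) = red_contr K R A n \<Theta> \<alpha>)"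

definition bisymplectic ::
  "('k, 'x) ring_scheme \<Rightarrow> ('k, 'r, 'y) alg_scheme \<Rightarrow> ('r, 'a, 'z) galg_scheme \<Rightarrow> int \<Rightarrow> 'a forms set \<Rightarrow> bool" where
  "bisymplectic K R A n \<omega> \<longleftrightarrow> \<omega> \<in> DR_part R A n 2 \<and> DR_d R A \<omega> = Om_comm R A \<and>
     iota K R A \<omega> \<in> shift_iso A n (DDer K R A) (DDer_wt K R A) (Om1 R A) (Om1_wt R A)"


section \<open>The tensor algebra of \<open>M = E\<^sub>1[-1] \<oplus> \<dots> \<oplus> E\<^sub>N[-N]\<close> and the induced map\<close>

definition dsum :: "nat \<Rightarrow> (nat \<Rightarrow> ('b, 'e) bimod) \<Rightarrow> ('b, nat \<Rightarrow> 'e) bimod" where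
  "dsum N E = \<lparr>carrier = (\<Pi>\<^sub>E i\<in>{1..N}. carrier (E i)), monoid.mult = undefined, one = undefined,
     ring.zero = (\<lambda>i\<in>{1..N}. \<zero>\<^bsub>E i\<^esub>), add = (\<lambda>m m'. \<lambda>i\<in>{1..N}. m i \<oplus>\<^bsub>E i\<^esub> m' i),
     lact = (\<lambda>b m. \<lambda>i\<in>{1..N}. lact (E i) b (m i)), ract = (\<lambda>m b. \<lambda>i\<in>{1..N}. ract (E i) (m i) b)\<rparr>"

definition dsum_wt :: "nat \<Rightarrow> (nat \<Rightarrow> ('b, 'e) bimod) \<Rightarrow> int \<Rightarrow> (nat \<Rightarrow> 'e) set" where
  "dsum_wt N E n = {m \<in> carrier (dsum N E). \<forall>i\<in>{1..N}. int i \<noteq> n \<longrightarrow> m i = \<zero>\<^bsub>E i\<^esub>}"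

definition TBM ::
  "('r, 'b) alg \<Rightarrow> nat \<Rightarrow> (nat \<Rightarrow> ('b, 'e) bimod) \<Rightarrow> ('r, ('b \<times> (nat \<Rightarrow> 'e) list) pres) galg" where
  "TBM B N E = tensor_galg B (dsum N E) (placed 0 B) (dsum_wt N E)"

text \<open>The structure map \<open>B \<rightarrow> A\<close>.\<close>

abbreviation TBM_base ::
  "('r, 'b) alg \<Rightarrow> nat \<Rightarrow> (nat \<Rightarrow> ('b, 'e) bimod) \<Rightarrow> 'b \<Rightarrow> ('b \<times> (nat \<Rightarrow> 'e) list) pres" where
  "TBM_base B N E \<equiv> T_base B (dsum N E)"

text \<open>\<open>\<nu> : \<Omega>\<^sup>1 A \<rightarrow> A \<otimes>\<^sub>B M \<otimes>\<^sub>B A\<close>\<close>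

definition nu ::
  "('r, 'x) ring_scheme \<Rightarrow> ('r, 'b) alg \<Rightarrow> nat \<Rightarrow> (nat \<Rightarrow> ('b, 'e) bimod) \<Rightarrow>
   (('b \<times> (nat \<Rightarrow> 'e) list) pres \<times> ('b \<times> (nat \<Rightarrow> 'e) list) pres \<times> ('b \<times> (nat \<Rightarrow> 'e) list) pres) pres \<Rightarrow>
   (('b \<times> (nat \<Rightarrow> 'e) list) pres \<times> (nat \<Rightarrow> 'e) \<times> ('b \<times> (nat \<Rightarrow> 'e) list) pres) pres" where
  "nu R B N E = (let A = TBM B N E; M = dsum N E; j = TBM_base B N E in
     the_add_map (Om1 R A) (ind A j B M) (\<lambda>f.
       f \<in> bimod_hom A (Om1 R A) (ind A j B M) \<and>
       (\<forall>m\<in>carrier M. f (du R A (T_incl B M m)) = pind A j B M \<one>\<^bsub>A\<^esub> m \<one>\<^bsub>A\<^esub>) \<and>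
       (\<forall>b\<in>carrier B. f (du R A (j b)) = \<zero>\<^bsub>ind A j B M\<^esub>)))"

text \<open>\<open>pr\<^sub>N : A \<otimes>\<^sub>B M \<otimes>\<^sub>B A \<rightarrow> A \<otimes>\<^sub>B E\<^sub>N \<otimes>\<^sub>B A\<close>\<close>

definition prN ::
  "('r, 'b) alg \<Rightarrow> nat \<Rightarrow> (nat \<Rightarrow> ('b, 'e) bimod) \<Rightarrow>
   (('b \<times> (nat \<Rightarrow> 'e) list) pres \<times> (nat \<Rightarrow> 'e) \<times> ('b \<times> (nat \<Rightarrow> 'e) list) pres) pres \<Rightarrow>
   (('b \<times> (nat \<Rightarrow> 'e) list) pres \<times> 'e \<times> ('b \<times> (nat \<Rightarrow> 'e) list) pres) pres" where
  "prN B N E = pmap (ind_rels (TBM B N E) (TBM_base B N E) B (E N)) (\<lambda>(a, m, c). (a, m N, c))"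

text \<open>
  \<open>\<epsilon>\<^sup>\<or>\<close> is dual to \<open>A \<otimes>\<^sub>B \<Omega>\<^sup>1 B \<otimes>\<^sub>B A \<rightarrow> \<Omega>\<^sup>1 A\<close>, i.e. it is the restriction of \<open>\<Theta>\<close> to \<open>B\<close>, read through the
  canonical isomorphism of \<open>A \<otimes>\<^sub>B DDer B \<otimes>\<^sub>B A\<close> with the derivations \<open>B \<rightarrow> A \<otimes> A\<close>, which takes
  \<open>a \<otimes> \<Delta> \<otimes> c\<close> to \<open>b \<mapsto> a * \<Delta>(b) * c\<close> and is evaluated at \<open>b\<close> by \<open>ev_der\<close>.
\<close>

definition ev_der ::
  "('k, 'x) ring_scheme \<Rightarrow> ('k, 'r, 'y) alg_scheme \<Rightarrow> ('r, 'b) alg \<Rightarrow> ('r, 'a, 'z) galg_scheme \<Rightarrow> ('b \<Rightarrow> 'a) \<Rightarrow>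
   'b \<Rightarrow> ('a \<times> ('b \<Rightarrow> ('b \<times> 'b) pres) \<times> 'a) pres \<Rightarrow> ('a \<times> 'a) pres" where
  "ev_der K R B A j b = (let D = DDer K R (ungraded B) in
     the_add_map (ind A j B D) (tens K R A) (\<lambda>f.
       \<forall>a\<in>carrier A. \<forall>\<Delta>\<in>carrier D. \<forall>c\<in>carrier A.
         f (pind A j B D a \<Delta> c) = inner_l K R A a (inner_r K R A (tens_map K R A j (\<Delta> b)) c)))"

definition eps_dual ::
  "('k, 'x) ring_scheme \<Rightarrow> ('k, 'r, 'y) alg_scheme \<Rightarrow> ('r, 'b) alg \<Rightarrow> ('r, 'a, 'z) galg_scheme \<Rightarrow> ('b \<Rightarrow> 'a) \<Rightarrow>
   ('a \<Rightarrow> ('a \<times> 'a) pres) \<Rightarrow> ('a \<times> ('b \<Rightarrow> ('b \<times> 'b) pres) \<times> 'a) pres" where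
  "eps_dual K R B A j \<Theta> = (THE x. x \<in> carrier (ind A j B (DDer K R (ungraded B))) \<and>
     (\<forall>b\<in>carrier B. ev_der K R B A j b x = \<Theta> (j b)))"

text \<open>\<open>t\<close> is a map \<open>A \<otimes>\<^sub>B DDer B \<otimes>\<^sub>B A \<rightarrow> A \<otimes>\<^sub>B E\<^sub>N \<otimes>\<^sub>B A\<close> induced by \<open>\<iota>(\<omega>)\<close>.\<close>

definition induced_by_iota ::
  "('k, 'x) ring_scheme \<Rightarrow> ('k, 'r, 'y) alg_scheme \<Rightarrow> ('r, 'b) alg \<Rightarrow> nat \<Rightarrow> (nat \<Rightarrow> ('b, 'e) bimod) \<Rightarrow>
   ('b \<times> (nat \<Rightarrow> 'e) list) pres forms set \<Rightarrow>
   ((('b \<times> (nat \<Rightarrow> 'e) list) pres \<times> ('b \<Rightarrow> ('b \<times> 'b) pres) \<times> ('b \<times> (nat \<Rightarrow> 'e) list) pres) pres \<Rightarrow>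
    (('b \<times> (nat \<Rightarrow> 'e) list) pres \<times> 'e \<times> ('b \<times> (nat \<Rightarrow> 'e) list) pres) pres) \<Rightarrow> bool" where
  "induced_by_iota K R B N E \<omega> t \<longleftrightarrow>
     (let A = TBM B N E; j = TBM_base B N E; U = ind A j B (DDer K R (ungraded B)); Y = ind A j B (E N) in
       t \<in> extensional (carrier U) \<and> t \<in> hom (add_monoid U) (add_monoid Y) \<and>
       (\<forall>\<Theta>\<in>carrier (DDer K R A).
          t (eps_dual K R B A j \<Theta>) = prN B N E (nu R B N E (iota K R A \<omega> \<Theta>))))"

end

(*
  Write Phi = pr_N o nu o iota(omega), a weight-raising map from the double derivations of A to
  A (x)_B M_N (x)_B A. Two opposite vanishing facts, both consequences of A living in weights >= 0,
  make it factor through an isomorphism.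
  (1) Phi kills the kernel of epsilon^v. Since the E_i are finitely generated projective, a double
  derivation vanishing on B is an A-combination of double derivations of weight -i < 0 dual to E_i,
  and these are sent to weight N - i < N of A (x)_B M_N (x)_B A, which is 0. As epsilon^v is onto
  (double derivations of B lift along a connection on M built from dual bases), Phi induces t.
  (2) epsilon^v o iota(omega)^-1 kills db and dm for m in M_i, i < N, because it lowers weight by N
  and A (x)_B DDer B (x)_B A has no negative weights. Hence it factors through pr_N o nu, and the
  factorization is inverse to t.
  Throughout, 1/2 in k is used to split A into even and odd part, which turns the Koszul signs into
  an honest automorphism of A.
*)
theory Submission
  imports Defs
begin

text \<open>Most maps in the statement are definite descriptions: the additive map with prescribed
  values on homogeneous elements. Uniqueness is cheap, since these span. Existence is the obstacle:
  a prescription with Koszul signs is consistent only if even and odd parts do not overlap. The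
  universal property of T_B M supplies an involution acting by the parity sign; its two
  eigenprojections give the separation without a proof that the weight decomposition is direct.
  Smoothness enters through a finite dual basis of Omega^1 B. It identifies A (x)_B DDer B (x)_B A
  with the derivations from B to A (x) A, so that the element described by \<open>eps_dual\<close>
  exists and is unique. Dual bases of the E_i expand double derivations that vanish on B, and patch
  local liftings of a derivation of B into a global one. The map t and a map s back are both defined
  on pure tensors. For bijectivity, s after t is the identity, and t is onto because iota(omega) and
  pr_N o nu are.\<close>

abbreviation keys where "keys \<equiv> Poly_Mapping.keys"

section \<open>Additive maps between abelian groups\<close>

abbreviation addhom :: "('m, 'x) ring_scheme \<Rightarrow> ('n, 'y) ring_scheme \<Rightarrow> ('m \<Rightarrow> 'n) set" where
  "addhom V W \<equiv> hom (add_monoid V) (add_monoid W)"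

lemma addhomI:
  assumes "\<And>x. x \<in> carrier V \<Longrightarrow> f x \<in> carrier W"
    and "\<And>x y. x \<in> carrier V \<Longrightarrow> y \<in> carrier V \<Longrightarrow> f (x \<oplus>\<^bsub>V\<^esub> y) = f x \<oplus>\<^bsub>W\<^esub> f y"
  shows "f \<in> addhom V W"
  using assms by (auto simp: hom_def)

lemma addhom_closed: "f \<in> addhom V W \<Longrightarrow> x \<in> carrier V \<Longrightarrow> f x \<in> carrier W"
  by (auto simp: hom_def)

lemma addhom_add:
  "\<lbrakk>f \<in> addhom V W; x \<in> carrier V; y \<in> carrier V\<rbrakk> \<Longrightarrow> f (x \<oplus>\<^bsub>V\<^esub> y) = f x \<oplus>\<^bsub>W\<^esub> f y"
  by (auto simp: hom_def)

lemma addhom_zero: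
  "\<lbrakk>abelian_group V; abelian_group W; f \<in> addhom V W\<rbrakk> \<Longrightarrow> f \<zero>\<^bsub>V\<^esub> = \<zero>\<^bsub>W\<^esub>"
  using hom_one[of f "add_monoid V" "add_monoid W"] abelian_group.a_comm_group[of V] abelian_group.a_comm_group[of W]
  by (simp add: comm_group_def)

lemma addhom_inv:
  assumes "abelian_group V" "abelian_group W" "f \<in> addhom V W" "x \<in> carrier V"
  shows "f (\<ominus>\<^bsub>V\<^esub> x) = \<ominus>\<^bsub>W\<^esub> f x"
proof -
  interpret group_hom "add_monoid V" "add_monoid W" f
    using assms abelian_group.a_comm_group[of V] abelian_group.a_comm_group[of W]
    by (auto simp: group_hom_def group_hom_axioms_def comm_group_def)
  show ?thesis using hom_inv[of x] assms(4) by (simp add: a_inv_def)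
qed

lemma addhom_minus:
  assumes "abelian_group V" "abelian_group W" "f \<in> addhom V W" "x \<in> carrier V" "y \<in> carrier V"
  shows "f (x \<ominus>\<^bsub>V\<^esub> y) = f x \<ominus>\<^bsub>W\<^esub> f y"
  using assms by (simp add: a_minus_def addhom_inv addhom_add abelian_group.a_inv_closed)

lemma addhom_finsum:
  assumes "abelian_group V" "abelian_group W" "f \<in> addhom V W" "finite I" "g \<in> I \<rightarrow> carrier V"
  shows "f (finsum V g I) = finsum W (\<lambda>i. f (g i)) I"
proof -
  interpret V: abelian_group V by fact
  interpret W: abelian_group W by fact
  show ?thesis using assms(4,5)
  proof (induction rule: finite_induct)
    case empty
    then show ?case by (simp add: addhom_zero[OF assms(1-3)])
  next
    case (insert i I)
    then have "(\<lambda>i. f (g i)) \<in> I \<rightarrow> carrier W" "f (g i) \<in> carrier W" "g \<in> I \<rightarrow> carrier V" "g i \<in> carrier V"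
      using addhom_closed[OF assms(3)] by auto
    with insert show ?case by (simp add: addhom_add[OF assms(3)])
  qed
qed

lemma addhom_comp: "f \<in> addhom U V \<Longrightarrow> g \<in> addhom V W \<Longrightarrow> (\<lambda>x. g (f x)) \<in> addhom U W"
  by (rule addhomI) (simp_all add: addhom_closed addhom_add)

lemma addhom_id: "(\<lambda>x. x) \<in> addhom V V"
  by (auto simp: hom_def)

lemma addhom_sum2:
  assumes "abelian_group W" "f \<in> addhom V W" "g \<in> addhom V W"
  shows "(\<lambda>x. f x \<oplus>\<^bsub>W\<^esub> g x) \<in> addhom V W"
proof -
  interpret W: abelian_group W by fact
  show ?thesis
    by (rule addhomI) (simp_all add: addhom_closed[OF assms(2)] addhom_closed[OF assms(3)]
      addhom_add[OF assms(2)] addhom_add[OF assms(3)] W.a_ac)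
qed

lemma addhom_const_zero: "abelian_group W \<Longrightarrow> (\<lambda>x. \<zero>\<^bsub>W\<^esub>) \<in> addhom V W"
  by (rule addhomI) (simp_all add: abelian_group.axioms abelian_monoid.zero_closed abelian_monoid.l_zero)

lemma addhom_finsum_maps:
  assumes "abelian_group W" "finite I" "\<And>i. i \<in> I \<Longrightarrow> f i \<in> addhom V W"
  shows "(\<lambda>x. finsum W (\<lambda>i. f i x) I) \<in> addhom V W"
proof -
  interpret W: abelian_group W by fact
  show ?thesis
  proof (rule addhomI)
    show "finsum W (\<lambda>i. f i x) I \<in> carrier W" if "x \<in> carrier V" for x
      using that assms(3) addhom_closed by (intro W.finsum_closed) fastforce
    fix x y assume xy: "x \<in> carrier V" "y \<in> carrier V"
    have "finsum W (\<lambda>i. f i (x \<oplus>\<^bsub>V\<^esub> y)) I = finsum W (\<lambda>i. f i x \<oplus>\<^bsub>W\<^esub> f i y) I"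
      using xy addhom_add[OF assms(3)] addhom_closed[OF assms(3)] by (intro W.finsum_cong') auto
    also have "\<dots> = finsum W (\<lambda>i. f i x) I \<oplus>\<^bsub>W\<^esub> finsum W (\<lambda>i. f i y) I"
      using xy assms(3) addhom_closed by (intro W.finsum_addf) fastforce+
    finally show "finsum W (\<lambda>i. f i (x \<oplus>\<^bsub>V\<^esub> y)) I = finsum W (\<lambda>i. f i x) I \<oplus>\<^bsub>W\<^esub> finsum W (\<lambda>i. f i y) I" .
  qed
qed

lemma addhom_neg:
  assumes "abelian_group W" "f \<in> addhom V W"
  shows "(\<lambda>x. \<ominus>\<^bsub>W\<^esub> f x) \<in> addhom V W"
proof -
  interpret W: abelian_group W by fact
  show ?thesis
    by (rule addhomI) (simp_all add: addhom_closed[OF assms(2)] addhom_add[OF assms(2)] W.minus_add)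
qed

lemma (in abelian_group) minus_eq_zero_iff:
  assumes "a \<in> carrier G" "b \<in> carrier G"
  shows "a \<ominus> b = \<zero> \<longleftrightarrow> a = b"
  using assms by (metis a_minus_def add.inv_solve_right r_neg l_zero zero_closed)

lemma (in abelian_group) zero_inv: "\<ominus> \<zero> = \<zero>"
  using add.inv_one by (simp add: a_inv_def)

section \<open>Spans\<close>

lemma span_incl: "x \<in> U \<Longrightarrow> x \<in> span V U"
  unfolding span_def by (rule generate.incl)

lemma span_zero: "\<zero>\<^bsub>V\<^esub> \<in> span V U"
  unfolding span_def using generate.one[of "add_monoid V"] by simp

lemma span_add: "x \<in> span V U \<Longrightarrow> y \<in> span V U \<Longrightarrow> x \<oplus>\<^bsub>V\<^esub> y \<in> span V U"
  unfolding span_def using generate.eng[of _ "add_monoid V"] by simp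

lemma span_induct [consumes 1, case_names zero incl inv add]:
  assumes "x \<in> span V U" "P \<zero>\<^bsub>V\<^esub>" "\<And>x. x \<in> U \<Longrightarrow> P x" "\<And>x. x \<in> U \<Longrightarrow> P (\<ominus>\<^bsub>V\<^esub> x)"
    "\<And>x y. \<lbrakk>x \<in> span V U; y \<in> span V U; P x; P y\<rbrakk> \<Longrightarrow> P (x \<oplus>\<^bsub>V\<^esub> y)"
  shows "P x"
  using assms(1) unfolding span_def
proof (induction rule: generate.induct)
  case (eng h1 h2) then show ?case using assms(5) by (simp add: span_def)
qed (use assms in \<open>simp_all add: a_inv_def\<close>)

lemma span_closed:
  assumes "abelian_group V" "U \<subseteq> carrier V" "x \<in> span V U"
  shows "x \<in> carrier V"
proof -
  interpret abelian_group V by fact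
  show ?thesis using assms(3) by (induction rule: span_induct) (use assms(2) in auto)
qed

lemma span_inv:
  assumes "abelian_group V" "U \<subseteq> carrier V" "x \<in> span V U"
  shows "\<ominus>\<^bsub>V\<^esub> x \<in> span V U"
proof -
  interpret abelian_group V by fact
  show ?thesis
    using assms(3)
  proof (induction rule: span_induct)
    case zero
    have "\<ominus>\<^bsub>V\<^esub> \<zero>\<^bsub>V\<^esub> = \<zero>\<^bsub>V\<^esub>" using add.inv_one by (simp add: a_inv_def)
    then show ?case by (simp only: span_zero)
  next
    case (incl x) then show ?case unfolding span_def using generate.inv[of x U "add_monoid V"] by (simp add: a_inv_def)
  next
    case (inv x) then have "x \<in> carrier V" using assms(2) by auto
    then show ?case using inv by (simp add: span_incl)
  next
    case (add x y)
    then have "x \<in> carrier V" "y \<in> carrier V" using span_closed[OF assms(1,2)] by auto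
    then show ?case using add by (simp add: minus_add span_add)
  qed
qed

lemma span_least:
  assumes "x \<in> span V U" "U \<subseteq> H" "\<zero>\<^bsub>V\<^esub> \<in> H" "\<And>x y. x \<in> H \<Longrightarrow> y \<in> H \<Longrightarrow> x \<oplus>\<^bsub>V\<^esub> y \<in> H"
    "\<And>x. x \<in> H \<Longrightarrow> \<ominus>\<^bsub>V\<^esub> x \<in> H"
  shows "x \<in> H"
  using assms(1) by (induction rule: span_induct) (use assms in auto)

lemma span_trivial:
  assumes "abelian_group V" "x \<in> span V U" "\<And>x. x \<in> U \<Longrightarrow> x = \<zero>\<^bsub>V\<^esub>"
  shows "x = \<zero>\<^bsub>V\<^esub>"
proof -
  interpret abelian_group V by fact
  note z = zero_inv
  show ?thesis using assms(2)
  proof (induction rule: span_induct)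
    case (incl x) then show ?case by (rule assms(3))
  next
    case (inv x) show ?case unfolding assms(3)[OF inv] by (rule z)
  next
    case (add x y) show ?case unfolding add.IH by simp
  qed simp
qed

lemma span_mono: "U \<subseteq> U' \<Longrightarrow> span V U \<subseteq> span V U'"
proof
  fix x assume "U \<subseteq> U'" "x \<in> span V U"
  from this(2) show "x \<in> span V U'" unfolding span_def
  proof (induction rule: generate.induct)
    case one show ?case by (rule generate.one)
  next
    case (eng h1 h2) show ?case by (rule generate.eng) fact+
  qed (use \<open>U \<subseteq> U'\<close> in \<open>auto intro: generate.incl generate.inv\<close>)
qed

lemma addhom_span:
  assumes "abelian_group V" "abelian_group W" "f \<in> addhom V W" "U \<subseteq> carrier V"
    "\<And>x. x \<in> U \<Longrightarrow> f x \<in> span W U'" "U' \<subseteq> carrier W" "x \<in> span V U"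
  shows "f x \<in> span W U'"
  using assms(7)
proof (induction rule: span_induct)
  case zero then show ?case by (simp add: addhom_zero[OF assms(1-3)] span_zero)
next
  case (inv x) then show ?case using assms(4)
    by (subst addhom_inv[OF assms(1-3)]) (auto intro!: span_inv assms)
next
  case (add x y) then show ?case using span_closed[OF assms(1,4)]
    by (subst addhom_add[OF assms(3)]) (auto intro: span_add)
qed (use assms in auto)

lemma span_image:
  assumes "abelian_group V" "abelian_group W" "f \<in> addhom V W" "H \<subseteq> carrier V" "\<zero>\<^bsub>V\<^esub> \<in> H"
    "\<And>x y. x \<in> H \<Longrightarrow> y \<in> H \<Longrightarrow> x \<oplus>\<^bsub>V\<^esub> y \<in> H" "\<And>x. x \<in> H \<Longrightarrow> \<ominus>\<^bsub>V\<^esub> x \<in> H" "U \<subseteq> f ` H" "x \<in> span W U"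
  shows "x \<in> f ` H"
  using assms(9,8)
proof (rule span_least)
  show "\<zero>\<^bsub>W\<^esub> \<in> f ` H" using addhom_zero[OF assms(1-3)] assms(5) by force
  fix x assume "x \<in> f ` H"
  then obtain y where y: "x = f y" "y \<in> H" "y \<in> carrier V" using assms(4) by blast
  show "\<ominus>\<^bsub>W\<^esub> x \<in> f ` H" unfolding y(1) addhom_inv[OF assms(1-3) y(3), symmetric] using assms(7)[OF y(2)] by blast
  fix x' assume "x' \<in> f ` H"
  then obtain z where z: "x' = f z" "z \<in> H" "z \<in> carrier V" using assms(4) by blast
  show "x \<oplus>\<^bsub>W\<^esub> x' \<in> f ` H"
    unfolding y(1) z(1) addhom_add[OF assms(3) y(3) z(3), symmetric] using assms(6)[OF y(2) z(2)] by blast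
qed

lemma addhom_eq_on_span:
  assumes "abelian_group V" "abelian_group W" "f \<in> addhom V W" "g \<in> addhom V W" "U \<subseteq> carrier V"
    "\<And>x. x \<in> U \<Longrightarrow> f x = g x" "x \<in> span V U"
  shows "f x = g x"
  using assms(7)
proof (induction rule: span_induct)
  case zero then show ?case by (simp add: addhom_zero[OF assms(1,2)] assms)
next
  case (inv x)
  then have "x \<in> carrier V" using assms(5) by auto
  then show ?case using inv assms(6) by (simp add: addhom_inv[OF assms(1,2)] assms(3,4))
next
  case (add x y) then show ?case using span_closed[OF assms(1,5)]
    by (simp add: addhom_add[OF assms(3)] addhom_add[OF assms(4)])
qed (use assms in auto)

text \<open>The pattern by which the definite descriptions of additive maps are resolved. Values
  matter on the carrier only, so the description also asks for extensionality, which
  \<open>restrict\<close> supplies; that is why \<open>P\<close> is required of the restricted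
  map.\<close>

lemma the_add_map_eq:
  assumes "f \<in> addhom U Y" "P (restrict f (carrier U))"
    and ag: "abelian_group U"
    and "\<And>g. g \<in> addhom U Y \<Longrightarrow> P g \<Longrightarrow> \<forall>x\<in>carrier U. g x = f x"
  shows "the_add_map U Y P = restrict f (carrier U)"
proof -
  interpret U: abelian_group U by fact
  show ?thesis unfolding the_add_map_def
  proof (rule the_equality)
    show "restrict f (carrier U) \<in> extensional (carrier U) \<and> restrict f (carrier U) \<in> addhom U Y \<and> P (restrict f (carrier U))"
      using assms(1,2) by (auto simp: hom_def)
    fix g assume "g \<in> extensional (carrier U) \<and> g \<in> addhom U Y \<and> P g"
    then show "g = restrict f (carrier U)" using assms(4)[of g] by (auto simp: extensional_def restrict_def)
  qed
qed

section \<open>Groups by generators and relations\<close>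

lemma pcls_eq_iff: "pcls Q f = pcls Q g \<longleftrightarrow> f - g \<in> group_closure Q"
proof
  assume "pcls Q f = pcls Q g"
  moreover have "f \<in> pcls Q f" by (simp add: pcls_def)
  ultimately show "f - g \<in> group_closure Q" by (auto simp: pcls_def)
next
  assume *: "f - g \<in> group_closure Q"
  have "h - f \<in> group_closure Q \<longleftrightarrow> h - g \<in> group_closure Q" for h
    using group_closure_add[OF _ *, of "h - f"] group_closure.diff[OF _ *, of "h - g"] by auto
  then show "pcls Q f = pcls Q g" by (auto simp: pcls_def)
qed

lemma pcls_self: "f \<in> pcls Q f"
  by (simp add: pcls_def)

lemma padd_pcls: "padd (pcls Q f) (pcls Q g) = pcls Q (f + g)"
proof -
  have "\<exists>f' g'. h = f' + g' \<and> f' \<in> pcls Q f \<and> g' \<in> pcls Q g" if "h \<in> pcls Q (f + g)" for h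
    using that by (intro exI[of _ "h - g"] exI[of _ g]) (auto simp: pcls_def algebra_simps)
  moreover have "f' + g' \<in> pcls Q (f + g)" if "f' \<in> pcls Q f" "g' \<in> pcls Q g" for f' g'
    using group_closure_add[of "f' - f" Q "g' - g"] that by (simp add: pcls_def algebra_simps)
  ultimately show ?thesis unfolding padd_def by blast
qed

lemma keys_gn_diff: "x \<in> G \<Longrightarrow> y \<in> G \<Longrightarrow> keys (gn x - gn y :: _ \<Rightarrow>\<^sub>0 int) \<subseteq> G"
  using Poly_Mapping.keys_diff[of "gn x :: _ \<Rightarrow>\<^sub>0 int" "gn y"] by auto

lemma keys_rel3: "\<lbrakk>x \<in> G; y \<in> G; z \<in> G\<rbrakk> \<Longrightarrow> keys (gn x - gn y - gn z :: _ \<Rightarrow>\<^sub>0 int) \<subseteq> G"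
  using Poly_Mapping.keys_diff[of "gn x - gn y :: _ \<Rightarrow>\<^sub>0 int" "gn z"] keys_gn_diff[of x G y] by auto

text \<open>An arbitrary difference-preserving extension of \<open>h\<close> to formal sums. That
  \<open>h\<close> kills the relators has to be expressed before any homomorphism on the quotient
  exists. Quantifying over all such extensions in \<open>respects_rels\<close> lets a relator be
  checked by its shape alone, with no formula for the extension.\<close>

definition prelift :: "('w, 'y) ring_scheme \<Rightarrow> 'g set \<Rightarrow> ('g \<Rightarrow> 'w) \<Rightarrow> (('g \<Rightarrow>\<^sub>0 int) \<Rightarrow> 'w) \<Rightarrow> bool" where
  "prelift W G h L \<longleftrightarrow> (\<forall>x\<in>G. L (gn x) = h x) \<and>
     (\<forall>f g. keys f \<subseteq> G \<and> keys g \<subseteq> G \<longrightarrow> L (f - g) = L f \<ominus>\<^bsub>W\<^esub> L g)"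

definition respects_rels :: "('w, 'y) ring_scheme \<Rightarrow> 'g set \<Rightarrow> ('g \<Rightarrow>\<^sub>0 int) set \<Rightarrow> ('g \<Rightarrow> 'w) \<Rightarrow> bool" where
  "respects_rels W G Q h \<longleftrightarrow> (\<forall>L. prelift W G h L \<longrightarrow> (\<forall>q\<in>Q. L q = \<zero>\<^bsub>W\<^esub>))"

lemma respectsD:
  assumes "respects_rels W G Q h" "\<And>x. x \<in> G \<Longrightarrow> L (gn x) = h x"
    "\<And>f g. keys f \<subseteq> G \<Longrightarrow> keys g \<subseteq> G \<Longrightarrow> L (f - g) = L f \<ominus>\<^bsub>W\<^esub> L g" "q \<in> Q"
  shows "L q = \<zero>\<^bsub>W\<^esub>"
  using assms(1)[unfolded respects_rels_def, THEN spec, THEN mp, of L] assms(2-4) by (auto simp: prelift_def)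

lemma respectsI:
  assumes "\<And>L q. prelift W G h L \<Longrightarrow> q \<in> Q \<Longrightarrow> L q = \<zero>\<^bsub>W\<^esub>"
  shows "respects_rels W G Q h"
  unfolding respects_rels_def using assms by blast

text \<open>Additivity and Leibniz relators all have the form x - y - z, balancing relators the form
  x - y. This lemma and the next one dispose of everything except the R-linearity relators of
  one-forms, which are single generators.\<close>

lemma rel_diff3:
  assumes "abelian_group W" "prelift W G h L"
    and "x \<in> G" "y \<in> G" "z \<in> G" "h y \<in> carrier W" "h z \<in> carrier W" "h x = h y \<oplus>\<^bsub>W\<^esub> h z"
  shows "L (gn x - gn y - gn z) = \<zero>\<^bsub>W\<^esub>"
proof -
  interpret W: abelian_group W by fact
  have "L (gn x - gn y - gn z) = (h y \<oplus>\<^bsub>W\<^esub> h z) \<ominus>\<^bsub>W\<^esub> h y \<ominus>\<^bsub>W\<^esub> h z"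
    using assms keys_gn_diff[of x G y] by (simp add: prelift_def)
  also have "\<dots> = \<zero>\<^bsub>W\<^esub>" using assms(6,7)
    by (metis W.a_assoc W.add.m_closed W.minus_add W.r_neg W.a_inv_closed a_minus_def)
  finally show ?thesis .
qed

lemma rel_diff2:
  assumes "abelian_group W" "prelift W G h L" "x \<in> G" "y \<in> G" "h y \<in> carrier W" "h x = h y"
  shows "L (gn x - gn y) = \<zero>\<^bsub>W\<^esub>"
proof -
  interpret W: abelian_group W by fact
  show ?thesis using assms by (simp add: W.minus_eq_zero_iff prelift_def)
qed

text \<open>Only the additive structure is fixed, so the tensor square, the induced bimodule, the
  one-forms and the tensor algebra are all instances. Because of \<open>supp\<close>, a coset with
  one representative supported on \<open>G\<close> has only such representatives, which makes
  formulas over representatives meaningful.\<close>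

locale presented =
  fixes V :: "('g pres, 'z) ring_scheme" (structure) and G :: "'g set" and Q
  assumes carrier_eq: "carrier V = pcarrier G Q" and zero_eq: "\<zero> = pcls Q 0" and add_eq: "add V = padd"
    and supp: "\<And>q. q \<in> Q \<Longrightarrow> keys q \<subseteq> G"
begin

lemma pcls_closed: "keys f \<subseteq> G \<Longrightarrow> pcls Q f \<in> carrier V"
  by (auto simp: carrier_eq pcarrier_def)

lemma gcls_closed: "x \<in> G \<Longrightarrow> gcls Q x \<in> carrier V"
  by (rule pcls_closed) simp

lemma pcls_add: "pcls Q (f + g) = pcls Q f \<oplus> pcls Q g"
  by (simp add: add_eq padd_pcls)

sublocale abelian_group V
proof (rule abelian_groupI)
  fix x y z assume "x \<in> carrier V" "y \<in> carrier V" "z \<in> carrier V"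
  then obtain f g h where *: "x = pcls Q f" "y = pcls Q g" "z = pcls Q h"
    "keys f \<subseteq> G" "keys g \<subseteq> G" by (auto simp: carrier_eq pcarrier_def)
  show "x \<oplus> y \<in> carrier V" using * pcls_closed[of "f + g"] Poly_Mapping.keys_add[of f g]
    by (auto simp: add_eq padd_pcls)
  show "x \<oplus> y \<oplus> z = x \<oplus> (y \<oplus> z)" "x \<oplus> y = y \<oplus> x" "\<zero> \<oplus> x = x"
    using * by (simp_all add: add_eq zero_eq padd_pcls ac_simps)
  show "\<exists>y\<in>carrier V. y \<oplus> x = \<zero>"
    using * pcls_closed[of "- f"] by (auto intro!: bexI[of _ "pcls Q (- f)"] simp: add_eq zero_eq padd_pcls)
next
  show "\<zero> \<in> carrier V" using pcls_closed[of 0] by (simp add: zero_eq)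
qed

lemma pcls_uminus: "keys f \<subseteq> G \<Longrightarrow> pcls Q (- f) = \<ominus> pcls Q f"
  using pcls_closed[of f] pcls_closed[of "- f"] by (intro minus_equality[symmetric]) (auto simp: add_eq zero_eq padd_pcls)

lemma pcls_diff:
  assumes "keys f \<subseteq> G" "keys g \<subseteq> G"
  shows "pcls Q (f - g) = pcls Q f \<ominus> pcls Q g"
  using assms pcls_add[of f "- g"] by (simp add: pcls_uminus a_minus_def)

lemma pcls_rel: "q \<in> Q \<Longrightarrow> pcls Q q = \<zero>"
  by (simp add: zero_eq pcls_eq_iff group_closure.base)

lemma closure_keys: "q \<in> group_closure Q \<Longrightarrow> keys q \<subseteq> G"
proof (induction rule: group_closure.induct)
  case (base s) then show ?case using supp by auto
next
  case (diff s t) then show ?case using Poly_Mapping.keys_diff[of s t] by auto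
qed

lemma pcls_keys:
  assumes "g \<in> pcls Q f" "keys f \<subseteq> G"
  shows "keys g \<subseteq> G"
proof -
  have "g - f \<in> group_closure Q" using assms by (simp add: pcls_def)
  then show ?thesis using closure_keys[of "g - f"] Poly_Mapping.keys_add[of "g - f" f] assms by auto
qed

lemma rel1: "gn x \<in> Q \<Longrightarrow> gcls Q x = \<zero>"
  by (rule pcls_rel)

lemma rel2:
  assumes "gn x - gn y \<in> Q" "x \<in> G" "y \<in> G"
  shows "gcls Q x = gcls Q y"
  using pcls_rel[OF assms(1)] assms(2,3) gcls_closed by (simp add: pcls_diff minus_eq_zero_iff)

lemma rel3:
  assumes "gn x - gn y - gn z \<in> Q" "x \<in> G" "y \<in> G" "z \<in> G"
  shows "gcls Q x = gcls Q y \<oplus> gcls Q z"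
proof -
  have "gcls Q x \<ominus> gcls Q y \<ominus> gcls Q z = \<zero>"
    using pcls_rel[OF assms(1)] assms(2-4) keys_gn_diff[OF assms(2,3)] by (simp add: pcls_diff)
  then have "gcls Q x \<ominus> gcls Q y = gcls Q z"
    using gcls_closed assms(2-4) by (simp add: minus_eq_zero_iff)
  then show ?thesis using gcls_closed assms(2-4)
    by (metis a_minus_def a_comm add.inv_solve_right' minus_closed)
qed

text \<open>Differences take the place of sums and negatives, as in the induction principle for
  formal sums on which this rests.\<close>

lemma gen_induct [consumes 1, case_names gen diff zero]:
  assumes "x \<in> carrier V" "\<And>g. g \<in> G \<Longrightarrow> P (gcls Q g)"
    "\<And>x y. \<lbrakk>x \<in> carrier V; y \<in> carrier V; P x; P y\<rbrakk> \<Longrightarrow> P (x \<ominus> y)"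
    "P \<zero>"
  shows "P x"
proof -
  obtain f where f: "x = pcls Q f" "keys f \<subseteq> G" using assms(1) by (auto simp: carrier_eq pcarrier_def)
  have "keys f \<subseteq> G \<and> P (pcls Q f)" using f(2)
  proof (induction rule: frag_induction)
    case zero then show ?case using assms(4) by (simp add: zero_eq)
  next
    case (one x) then show ?case using assms(2) by simp
  next
    case (diff a b)
    then show ?case using assms(3) Poly_Mapping.keys_diff[of a b] by (auto simp: pcls_diff pcls_closed)
  qed
  then show ?thesis using f by simp
qed

lemma carrier_span: "carrier V = span V (gcls Q ` G)"
proof
  show "carrier V \<subseteq> span V (gcls Q ` G)"
  proof
    fix x assume "x \<in> carrier V"
    then show "x \<in> span V (gcls Q ` G)"
    proof (induction rule: gen_induct)
      case (diff x y) then show ?case unfolding a_minus_def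
        by (intro span_add span_inv abelian_group_axioms) (auto intro: gcls_closed)
    qed (auto intro: span_incl span_zero)
  qed
  show "span V (gcls Q ` G) \<subseteq> carrier V"
    using span_closed[OF abelian_group_axioms, of "gcls Q ` G"] gcls_closed by auto
qed

lemma hom_ext:
  assumes "abelian_group W" "f \<in> addhom V W" "g \<in> addhom V W" "\<And>x. x \<in> G \<Longrightarrow> f (gcls Q x) = g (gcls Q x)"
    "x \<in> carrier V"
  shows "f x = g x"
  using assms(5)
proof (induction rule: gen_induct)
  case (diff x y) then show ?case by (simp add: addhom_minus[OF abelian_group_axioms assms(1)] assms)
next
  case zero then show ?case by (simp add: addhom_zero[OF abelian_group_axioms assms(1)] assms)
qed (use assms in auto)

text \<open>The extension \<open>F\<close> of \<open>h\<close> to the free abelian group kills the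
  subgroup generated by the relators, so it is constant on cosets and descends to \<open>L\<close>.
  The statement keeps \<open>F\<close> because \<open>pmap\<close> is computed from representatives,
  and that computation is compared with \<open>F\<close>.\<close>

lemma lift_pcls:
  assumes W: "abelian_group W" and h: "\<And>x. x \<in> G \<Longrightarrow> h x \<in> carrier W"
    and rel: "respects_rels W G Q h"
  shows "\<exists>L F. L \<in> addhom V W \<and> (\<forall>x\<in>G. L (gcls Q x) = h x) \<and>
    (\<forall>f g. g \<in> pcls Q f \<longrightarrow> keys f \<subseteq> G \<longrightarrow> F g = L (pcls Q f)) \<and>
    (\<forall>x\<in>G. F (gn x) = h x) \<and> F 0 = \<zero>\<^bsub>W\<^esub> \<and>
    (\<forall>f g. keys f \<subseteq> G \<longrightarrow> keys g \<subseteq> G \<longrightarrow> F (f - g) = F f \<ominus>\<^bsub>W\<^esub> F g)"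
proof -
  interpret W: abelian_group W by fact
  have "h ` G \<subseteq> carrier (add_monoid W)" using h by auto
  from comm_group.free_Abelian_group_universal[OF W.a_comm_group this]
  obtain F where F: "F \<in> hom (free_Abelian_group G) (add_monoid W)" "\<And>x. x \<in> G \<Longrightarrow> F (gn x) = h x"
    by blast
  interpret F: group_hom "free_Abelian_group G" "add_monoid W" F
    using F W.a_group by (auto simp: group_hom_def group_hom_axioms_def)
  have Fc: "F f \<in> carrier W" if "keys f \<subseteq> G" for f
    using F.hom_closed[of f] that by (simp add: carrier_free_Abelian_group_iff)
  have Fadd: "F (f + g) = F f \<oplus>\<^bsub>W\<^esub> F g" if "keys f \<subseteq> G" "keys g \<subseteq> G" for f g
    using F.hom_mult[of f g] that by (simp add: carrier_free_Abelian_group_iff)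
  have Finv: "F (- f) = \<ominus>\<^bsub>W\<^esub> F f" if "keys f \<subseteq> G" for f
    using F.hom_inv[of f] that by (simp add: a_inv_def)
  have Fdiff: "F (f - g) = F f \<ominus>\<^bsub>W\<^esub> F g" if "keys f \<subseteq> G" "keys g \<subseteq> G" for f g
    using Fadd[of f "- g"] Finv[of g] that by (simp add: a_minus_def)
  have F0: "F 0 = \<zero>\<^bsub>W\<^esub>" using F.hom_one by simp
  have Fcl: "F q = \<zero>\<^bsub>W\<^esub>" if "q \<in> group_closure Q" for q
    using that
  proof (induction rule: group_closure.induct)
    case (base s) then show ?case using respectsD[OF rel F(2) Fdiff, of s] F0 by auto
  next
    case (diff s t) then show ?case using closure_keys by (simp add: Fdiff W.minus_eq_zero_iff)
  qed
  have key: "keys g \<subseteq> G \<and> F g = F f" if "g \<in> pcls Q f" "keys f \<subseteq> G" for f g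
  proof -
    have *: "g - f \<in> group_closure Q" using that by (simp add: pcls_def)
    have k: "keys g \<subseteq> G" using closure_keys[OF *] Poly_Mapping.keys_add[of "g - f" f] that by auto
    show ?thesis using Fcl[OF *] Fdiff[OF k that(2)] Fc k that by (simp add: W.minus_eq_zero_iff)
  qed
  \<comment> \<open>Any representative will do: by \<open>key\<close>, \<open>F\<close> takes the
    same value on all of them.\<close>
  define L where "L U = F (SOME f. f \<in> U)" for U
  have L: "L (pcls Q f) = F f" if "keys f \<subseteq> G" for f
    unfolding L_def using key[OF _ that] someI[of "\<lambda>g. g \<in> pcls Q f", OF pcls_self] by blast
  have "L \<in> addhom V W"
  proof (rule addhomI)
    fix x y assume "x \<in> carrier V" "y \<in> carrier V"
    then obtain f g where *: "x = pcls Q f" "y = pcls Q g" "keys f \<subseteq> G" "keys g \<subseteq> G"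
      by (auto simp: carrier_eq pcarrier_def)
    show "L x \<in> carrier W" using * by (simp add: L Fc)
    have "keys (f + g) \<subseteq> G" using * Poly_Mapping.keys_add[of f g] by auto
    then show "L (x \<oplus> y) = L x \<oplus>\<^bsub>W\<^esub> L y" using * by (simp add: pcls_add[symmetric] L Fadd)
  qed
  moreover have "\<And>x. x \<in> G \<Longrightarrow> L (gcls Q x) = h x" using L F(2) by simp
  moreover have "F g = L (pcls Q f)" if "g \<in> pcls Q f" "keys f \<subseteq> G" for f g
    unfolding L[OF that(2)] using key[OF that] by blast
  ultimately show ?thesis using F(2) F0 Fdiff by blast
qed

lemma lift:
  assumes W: "abelian_group W" and h: "\<And>x. x \<in> G \<Longrightarrow> h x \<in> carrier W"
    and rel: "respects_rels W G Q h"
  shows "\<exists>L. L \<in> addhom V W \<and> (\<forall>x\<in>G. L (gcls Q x) = h x)"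
proof -
  have "\<exists>L F. L \<in> addhom V W \<and> (\<forall>x\<in>G. L (gcls Q x) = h x) \<and>
    (\<forall>f g. g \<in> pcls Q f \<longrightarrow> keys f \<subseteq> G \<longrightarrow> F g = L (pcls Q f)) \<and>
    (\<forall>x\<in>G. F (gn x) = h x) \<and> F 0 = \<zero>\<^bsub>W\<^esub> \<and>
    (\<forall>f g. keys f \<subseteq> G \<longrightarrow> keys g \<subseteq> G \<longrightarrow> F (f - g) = F f \<ominus>\<^bsub>W\<^esub> F g)"
    by (rule lift_pcls[OF W h rel])
  then show ?thesis by blast
qed

end

lemma frag_cmul_single: "frag_cmul c (Poly_Mapping.single x d) = Poly_Mapping.single x (c * d)"
  by (intro poly_mapping_eqI) (simp add: lookup_single when_def)

lemma frag_cmul_minus_right: "frag_cmul c (a - b) = frag_cmul c a - frag_cmul c b"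
  by (intro poly_mapping_eqI) (simp add: lookup_minus algebra_simps)

text \<open>\<open>pmap\<close> is a union over all representatives of a coset. The union is a
  single coset because the class of the image of each representative equals the value of the lift on
  that coset.\<close>

lemma pmap_lift:
  assumes "presented V G Q" "presented V' G' Q'" and h: "\<And>x. x \<in> G \<Longrightarrow> h x \<in> G'"
    and rel: "respects_rels V' G Q (\<lambda>x. gcls Q' (h x))"
  shows "pmap Q' h \<in> addhom V V'" "\<And>x. x \<in> G \<Longrightarrow> pmap Q' h (gcls Q x) = gcls Q' (h x)"
proof -
  interpret V: presented V G Q by fact
  interpret V': presented V' G' Q' by fact
  have "\<exists>L F. L \<in> addhom V V' \<and> (\<forall>x\<in>G. L (gcls Q x) = gcls Q' (h x)) \<and>
    (\<forall>f g. g \<in> pcls Q f \<longrightarrow> keys f \<subseteq> G \<longrightarrow> F g = L (pcls Q f)) \<and>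
    (\<forall>x\<in>G. F (gn x) = gcls Q' (h x)) \<and> F 0 = \<zero>\<^bsub>V'\<^esub> \<and>
    (\<forall>f g. keys f \<subseteq> G \<longrightarrow> keys g \<subseteq> G \<longrightarrow> F (f - g) = F f \<ominus>\<^bsub>V'\<^esub> F g)"
    by (rule V.lift_pcls[OF V'.abelian_group_axioms V'.gcls_closed[OF h] rel])
  then obtain L F where LF: "L \<in> addhom V V'" "\<forall>x\<in>G. L (gcls Q x) = gcls Q' (h x)"
    "\<forall>f g. g \<in> pcls Q f \<longrightarrow> keys f \<subseteq> G \<longrightarrow> F g = L (pcls Q f)"
    "\<forall>x\<in>G. F (gn x) = gcls Q' (h x)" "F 0 = \<zero>\<^bsub>V'\<^esub>"
    "\<forall>f g. keys f \<subseteq> G \<longrightarrow> keys g \<subseteq> G \<longrightarrow> F (f - g) = F f \<ominus>\<^bsub>V'\<^esub> F g"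
    by (elim exE conjE)
  note L = LF(1) LF(2)[rule_format] and key = LF(3)[rule_format] and F = LF(4)[rule_format] LF(5) LF(6)[rule_format]
  \<comment> \<open>The sum in the definition of \<open>pmap\<close> is recognised as
    \<open>frag_extend\<close>, for which additivity laws are available.\<close>
  have fe: "(\<Sum>x\<in>keys f. Poly_Mapping.single (h x) (Poly_Mapping.lookup f x)) = frag_extend (\<lambda>x. frag_of (h x)) f" for f
    by (simp add: frag_extend_def frag_cmul_single)
  have "keys f \<subseteq> G \<and> keys (frag_extend (\<lambda>x. frag_of (h x)) f) \<subseteq> G' \<and> pcls Q' (frag_extend (\<lambda>x. frag_of (h x)) f) = F f"
    if "keys f \<subseteq> G" for f
    using that
  proof (induction rule: frag_induction)
    case zero then show ?case by (simp add: F(2) V'.zero_eq)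
  next
    case (one x) then show ?case by (simp add: F(1) h)
  next
    case (diff a b)
    then show ?case using Poly_Mapping.keys_diff[of a b]
        Poly_Mapping.keys_diff[of "frag_extend (\<lambda>x. frag_of (h x)) a" "frag_extend (\<lambda>x. frag_of (h x)) b"]
      by (auto simp: frag_extend_diff V'.pcls_diff F(3))
  qed
  then have ev: "pcls Q' (frag_extend (\<lambda>x. frag_of (h x)) f) = F f" if "keys f \<subseteq> G" for f
    using that by blast
  have "pmap Q' h (pcls Q f) = L (pcls Q f)" if "keys f \<subseteq> G" for f
  proof -
    have "pcls Q' (frag_extend (\<lambda>x. frag_of (h x)) g) = L (pcls Q f)" if "g \<in> pcls Q f" for g
      using ev[OF V.pcls_keys[OF that]] key[OF that] \<open>keys f \<subseteq> G\<close> by simp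
    then show ?thesis unfolding pmap_def fe using pcls_self[of f Q] by auto
  qed
  then have *: "pmap Q' h U = L U" if "U \<in> carrier V" for U
    using that by (auto simp: V.carrier_eq pcarrier_def)
  show "pmap Q' h \<in> addhom V V'"
    using L(1) by (auto simp: hom_def *)
  show "pmap Q' h (gcls Q x) = gcls Q' (h x)" if "x \<in> G" for x
    using * V.gcls_closed L(2) that by simp
qed

text \<open>\<open>E\<close> is the biadditive extension of \<open>m\<close> to formal sums. With a
  generator fixed in one argument, relators in the other argument go to the relator subgroup, and
  additivity carries this to all formal sums. The union in \<open>pmult\<close> therefore runs over
  copies of one coset.\<close>

lemma pmult_lift:
  assumes "presented V G Q" and m: "\<And>x y. x \<in> G \<Longrightarrow> y \<in> G \<Longrightarrow> m x y \<in> G"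
    and rel1: "\<And>y. y \<in> G \<Longrightarrow> respects_rels V G Q (\<lambda>x. gcls Q (m x y))"
    and rel2: "\<And>x. x \<in> G \<Longrightarrow> respects_rels V G Q (\<lambda>y. gcls Q (m x y))"
  shows "\<And>U. U \<in> carrier V \<Longrightarrow> pmult Q m U \<in> addhom V V"
    "\<And>Y. Y \<in> carrier V \<Longrightarrow> (\<lambda>U. pmult Q m U Y) \<in> addhom V V"
    "\<And>x y. x \<in> G \<Longrightarrow> y \<in> G \<Longrightarrow> pmult Q m (gcls Q x) (gcls Q y) = gcls Q (m x y)"
proof -
  interpret V: presented V G Q by fact
  define E where "E f g = frag_extend (\<lambda>x. frag_extend (\<lambda>y. frag_of (m x y)) g) f" for f g :: "'a \<Rightarrow>\<^sub>0 int"
  have E_eq: "(\<Sum>x\<in>keys f. \<Sum>y\<in>keys g.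
      Poly_Mapping.single (m x y) (Poly_Mapping.lookup f x * Poly_Mapping.lookup g y)) = E f g" for f g
    unfolding E_def frag_extend_def
    by (simp add: frag_cmul_sum frag_cmul_single)
  have E_dl: "E (f - f') g = E f g - E f' g" for f f' g by (simp add: E_def frag_extend_diff)
  have E_dr: "E f (g - g') = E f g - E f g'" for f g g'
    unfolding E_def frag_extend_diff
    by (simp add: frag_extend_def frag_cmul_minus_right sum_subtractf)
  have E_0l: "E 0 g = 0" and E_0r: "E f 0 = 0" for f g by (simp_all add: E_def frag_extend_def)
  have E_gn: "E (gn x) (gn y) = gn (m x y)" for x y by (simp add: E_def)
  have E_keys: "keys (E f g) \<subseteq> G" if f: "keys f \<subseteq> G" and g: "keys g \<subseteq> G" for f g
    using f
  proof (induction rule: frag_induction)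
    case (one x)
    show ?case using g
    proof (induction rule: frag_induction)
      case (diff a b) then show ?case using Poly_Mapping.keys_diff[of "E (gn x) a" "E (gn x) b"] by (auto simp: E_dr)
    qed (use one m in \<open>simp_all add: E_0r E_gn\<close>)
  next
    case (diff a b) then show ?case using Poly_Mapping.keys_diff[of "E a g" "E b g"] by (auto simp: E_dl)
  qed (simp add: E_0l)
  have E_Ql: "E q g \<in> group_closure Q" if "q \<in> group_closure Q" "keys g \<subseteq> G" for q g
    using that(2)
  proof (induction rule: frag_induction)
    case (one y)
    show ?case using that(1)
    proof (induction rule: group_closure.induct)
      case (base s)
      show ?case
      proof (cases "s = 0")
        case False
        then have "s \<in> Q" using base by auto
        have "pcls Q (E s (gn y)) = \<zero>\<^bsub>V\<^esub>"
        proof (rule respectsD[OF rel1[OF one], of "\<lambda>s. pcls Q (E s (gn y))" s])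
          show "pcls Q (E (gn z) (gn y)) = gcls Q (m z y)" if "z \<in> G" for z by (simp only: E_gn)
          show "pcls Q (E (f - g) (gn y)) = pcls Q (E f (gn y)) \<ominus>\<^bsub>V\<^esub> pcls Q (E g (gn y))"
            if "keys f \<subseteq> G" "keys g \<subseteq> G" for f g
            unfolding E_dl by (rule V.pcls_diff) (rule E_keys; use that one in simp)+
        qed fact
        then show ?thesis unfolding V.zero_eq pcls_eq_iff by simp
      qed (simp add: E_0l)
    next
      case (diff s t) show ?case unfolding E_dl by (rule group_closure.diff) fact+
    qed
  next
    case zero show ?case unfolding E_0r by simp
  next
    case (diff a b) then show ?case unfolding E_dr by (rule group_closure.diff)
  qed
  have E_Qr: "E f q \<in> group_closure Q" if "q \<in> group_closure Q" "keys f \<subseteq> G" for q f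
    using that(2)
  proof (induction rule: frag_induction)
    case (one x)
    show ?case using that(1)
    proof (induction rule: group_closure.induct)
      case (base s)
      show ?case
      proof (cases "s = 0")
        case False
        then have "s \<in> Q" using base by auto
        have "pcls Q (E (gn x) s) = \<zero>\<^bsub>V\<^esub>"
        proof (rule respectsD[OF rel2[OF one], of "\<lambda>s. pcls Q (E (gn x) s)" s])
          show "pcls Q (E (gn x) (gn z)) = gcls Q (m x z)" if "z \<in> G" for z by (simp only: E_gn)
          show "pcls Q (E (gn x) (f - g)) = pcls Q (E (gn x) f) \<ominus>\<^bsub>V\<^esub> pcls Q (E (gn x) g)"
            if "keys f \<subseteq> G" "keys g \<subseteq> G" for f g
            unfolding E_dr by (rule V.pcls_diff) (rule E_keys; use that one in simp)+
        qed fact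
        then show ?thesis unfolding V.zero_eq pcls_eq_iff by simp
      qed (simp add: E_0r)
    next
      case (diff s t) show ?case unfolding E_dr by (rule group_closure.diff) fact+
    qed
  next
    case zero show ?case unfolding E_0l by simp
  next
    case (diff a b) then show ?case unfolding E_dl by (rule group_closure.diff)
  qed
  have eq: "pmult Q m (pcls Q f) (pcls Q g) = pcls Q (E f g)"
    if f: "keys f \<subseteq> G" and g: "keys g \<subseteq> G" for f g
  proof -
    define C where "C = pcls Q (E f g)"
    have "pcls Q (E f' g') = C" if "f' \<in> pcls Q f" "g' \<in> pcls Q g" for f' g'
    proof -
      have *: "f' - f \<in> group_closure Q" "g' - g \<in> group_closure Q" using that by (auto simp: pcls_def)
      have k: "keys g' \<subseteq> G" using V.closure_keys[OF *(2)] Poly_Mapping.keys_add[of "g' - g" g] g by auto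
      have c: "g - g' \<in> group_closure Q"
        using *(2) group_closure_minus_iff[of "g' - g" Q] by simp
      \<comment> \<open>One representative is changed at a time, so that each term has an element of
        the relator subgroup as one of its arguments.\<close>
      have "E f' g' - E f g = E (f' - f) g' - E f (g - g')" by (simp add: E_dl E_dr)
      then have "E f' g' - E f g \<in> group_closure Q"
        using group_closure.diff[OF E_Ql[OF *(1) k] E_Qr[OF c f]] by simp
      then show ?thesis by (simp only: C_def pcls_eq_iff)
    qed
    then show ?thesis unfolding pmult_def E_eq C_def[symmetric] using pcls_self[of f Q] pcls_self[of g Q] by auto
  qed
  have E_al: "E (f + f') g = E f g + E f' g" for f f' g by (simp add: E_def frag_extend_add)
  have E_ar: "E f (g + g') = E f g + E f g'" for f g g'
    using E_dr[of f g "- g'"] E_dr[of f 0 "g'"] by (simp add: E_0r)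
  have ka: "keys (f + g) \<subseteq> G" if "keys f \<subseteq> G" "keys g \<subseteq> G" for f g :: "'a \<Rightarrow>\<^sub>0 int"
    using that Poly_Mapping.keys_add[of f g] by auto
  show "pmult Q m U \<in> addhom V V" if U: "U \<in> carrier V" for U
  proof (rule addhomI)
    fix x y assume "x \<in> carrier V" "y \<in> carrier V"
    then obtain f g u where *: "x = pcls Q f" "y = pcls Q g" "U = pcls Q u"
       "keys f \<subseteq> G" "keys g \<subseteq> G" "keys u \<subseteq> G"
      using U by (auto simp: V.carrier_eq pcarrier_def)
    show "pmult Q m U x \<in> carrier V" "pmult Q m U (x \<oplus>\<^bsub>V\<^esub> y) = pmult Q m U x \<oplus>\<^bsub>V\<^esub> pmult Q m U y"
      using * by (simp_all add: eq E_keys V.pcls_closed V.pcls_add[symmetric] ka E_ar)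
  qed
  show "(\<lambda>U. pmult Q m U Y) \<in> addhom V V" if U: "Y \<in> carrier V" for Y
  proof (rule addhomI)
    fix x y assume "x \<in> carrier V" "y \<in> carrier V"
    then obtain f g u where *: "x = pcls Q f" "y = pcls Q g" "Y = pcls Q u"
       "keys f \<subseteq> G" "keys g \<subseteq> G" "keys u \<subseteq> G"
      using U by (auto simp: V.carrier_eq pcarrier_def)
    show "pmult Q m x Y \<in> carrier V" "pmult Q m (x \<oplus>\<^bsub>V\<^esub> y) Y = pmult Q m x Y \<oplus>\<^bsub>V\<^esub> pmult Q m y Y"
      using * by (simp_all add: eq E_keys V.pcls_closed V.pcls_add[symmetric] ka E_al)
  qed
  show "pmult Q m (gcls Q x) (gcls Q y) = gcls Q (m x y)" if "x \<in> G" "y \<in> G" for x y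
    using that by (simp add: eq E_gn)
qed

section \<open>Bimodules\<close>

text \<open>The actions are arbitrary functions and not the fields of a record. One group can then
  be a bimodule in several ways: A (x) A occurs over A, over B along \<open>j\<close>, and over A
  with the left action twisted by a sign.\<close>

locale biact =
  fixes S :: "('s, 'x) ring_scheme" and V :: "('v, 'y) ring_scheme" (structure)
    and l :: "'s \<Rightarrow> 'v \<Rightarrow> 'v" and r :: "'v \<Rightarrow> 's \<Rightarrow> 'v"
  assumes ring_S: "ring S" and grp_V: "abelian_group V"
    and l_closed [simp]: "\<And>b v. b \<in> carrier S \<Longrightarrow> v \<in> carrier V \<Longrightarrow> l b v \<in> carrier V"
    and r_closed [simp]: "\<And>b v. b \<in> carrier S \<Longrightarrow> v \<in> carrier V \<Longrightarrow> r v b \<in> carrier V"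
    and l_add: "\<And>b v w. \<lbrakk>b \<in> carrier S; v \<in> carrier V; w \<in> carrier V\<rbrakk> \<Longrightarrow> l b (v \<oplus> w) = l b v \<oplus> l b w"
    and r_add: "\<And>b v w. \<lbrakk>b \<in> carrier S; v \<in> carrier V; w \<in> carrier V\<rbrakk> \<Longrightarrow> r (v \<oplus> w) b = r v b \<oplus> r w b"
    and l_plus: "\<And>b c v. \<lbrakk>b \<in> carrier S; c \<in> carrier S; v \<in> carrier V\<rbrakk> \<Longrightarrow> l (b \<oplus>\<^bsub>S\<^esub> c) v = l b v \<oplus> l c v"
    and r_plus: "\<And>b c v. \<lbrakk>b \<in> carrier S; c \<in> carrier S; v \<in> carrier V\<rbrakk> \<Longrightarrow> r v (b \<oplus>\<^bsub>S\<^esub> c) = r v b \<oplus> r v c"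
    and l_mult: "\<And>b c v. \<lbrakk>b \<in> carrier S; c \<in> carrier S; v \<in> carrier V\<rbrakk> \<Longrightarrow> l (b \<otimes>\<^bsub>S\<^esub> c) v = l b (l c v)"
    and r_mult: "\<And>b c v. \<lbrakk>b \<in> carrier S; c \<in> carrier S; v \<in> carrier V\<rbrakk> \<Longrightarrow> r v (b \<otimes>\<^bsub>S\<^esub> c) = r (r v b) c"
    and lr_assoc: "\<And>b c v. \<lbrakk>b \<in> carrier S; c \<in> carrier S; v \<in> carrier V\<rbrakk> \<Longrightarrow> r (l b v) c = l b (r v c)"
    and l_one [simp]: "\<And>v. v \<in> carrier V \<Longrightarrow> l \<one>\<^bsub>S\<^esub> v = v"
    and r_one [simp]: "\<And>v. v \<in> carrier V \<Longrightarrow> r v \<one>\<^bsub>S\<^esub> = v"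
begin

sublocale S: ring S by (rule ring_S)
sublocale V: abelian_group V by (rule grp_V)

lemma l_hom: "b \<in> carrier S \<Longrightarrow> l b \<in> addhom V V"
  by (rule addhomI) (simp_all add: l_add)

lemma r_hom: "b \<in> carrier S \<Longrightarrow> (\<lambda>v. r v b) \<in> addhom V V"
  by (rule addhomI) (simp_all add: r_add)

lemma l_hom_left: "v \<in> carrier V \<Longrightarrow> (\<lambda>b. l b v) \<in> addhom S V"
  by (rule addhomI) (simp_all add: l_plus)

lemma r_hom_left: "v \<in> carrier V \<Longrightarrow> r v \<in> addhom S V"
  by (rule addhomI) (simp_all add: r_plus)

lemma l_zero [simp]: "b \<in> carrier S \<Longrightarrow> l b \<zero> = \<zero>"
  by (rule addhom_zero[OF grp_V grp_V l_hom])

lemma r_zero [simp]: "b \<in> carrier S \<Longrightarrow> r \<zero> b = \<zero>"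
  by (rule addhom_zero[OF grp_V grp_V r_hom])

end

lemma bimodule_biact:
  assumes "bimodule K R B V" "ring B"
  shows "biact B V (lact V) (ract V)"
  using assms unfolding bimodule_def by (intro biact.intro) auto

context presented
begin

text \<open>Once both actions are additive in the module element, every axiom compares additive
  maps, and generators suffice.\<close>

lemma biactI:
  fixes S :: "('s, 'x) ring_scheme"
  assumes S: "ring S" and lh: "\<And>b. b \<in> carrier S \<Longrightarrow> l b \<in> addhom V V"
    and rh: "\<And>b. b \<in> carrier S \<Longrightarrow> (\<lambda>v. r v b) \<in> addhom V V"
    and lp: "\<And>b c x. \<lbrakk>b \<in> carrier S; c \<in> carrier S; x \<in> G\<rbrakk> \<Longrightarrow> l (b \<oplus>\<^bsub>S\<^esub> c) (gcls Q x) = l b (gcls Q x) \<oplus> l c (gcls Q x)"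
    and rp: "\<And>b c x. \<lbrakk>b \<in> carrier S; c \<in> carrier S; x \<in> G\<rbrakk> \<Longrightarrow> r (gcls Q x) (b \<oplus>\<^bsub>S\<^esub> c) = r (gcls Q x) b \<oplus> r (gcls Q x) c"
    and lm: "\<And>b c x. \<lbrakk>b \<in> carrier S; c \<in> carrier S; x \<in> G\<rbrakk> \<Longrightarrow> l (b \<otimes>\<^bsub>S\<^esub> c) (gcls Q x) = l b (l c (gcls Q x))"
    and rm: "\<And>b c x. \<lbrakk>b \<in> carrier S; c \<in> carrier S; x \<in> G\<rbrakk> \<Longrightarrow> r (gcls Q x) (b \<otimes>\<^bsub>S\<^esub> c) = r (r (gcls Q x) b) c"
    and lr: "\<And>b c x. \<lbrakk>b \<in> carrier S; c \<in> carrier S; x \<in> G\<rbrakk> \<Longrightarrow> r (l b (gcls Q x)) c = l b (r (gcls Q x) c)"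
    and l1: "\<And>x. x \<in> G \<Longrightarrow> l \<one>\<^bsub>S\<^esub> (gcls Q x) = gcls Q x"
    and r1: "\<And>x. x \<in> G \<Longrightarrow> r (gcls Q x) \<one>\<^bsub>S\<^esub> = gcls Q x"
  shows "biact S V l r"
proof -
  interpret S: ring S by fact
  note V = abelian_group_axioms
  have ext: "f v = g v" if "f \<in> addhom V V" "g \<in> addhom V V" "\<And>x. x \<in> G \<Longrightarrow> f (gcls Q x) = g (gcls Q x)" "v \<in> carrier V" for f g v
    by (rule hom_ext[OF V that])
  show ?thesis
  proof (rule biact.intro[OF S V])
    show "l b v \<in> carrier V" "r v b \<in> carrier V" if "b \<in> carrier S" "v \<in> carrier V" for b v
      using addhom_closed[OF lh[OF that(1)] that(2)] addhom_closed[OF rh[OF that(1)] that(2)] by auto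
    show "l b (v \<oplus> w) = l b v \<oplus> l b w" "r (v \<oplus> w) b = r v b \<oplus> r w b"
      if "b \<in> carrier S" "v \<in> carrier V" "w \<in> carrier V" for b v w
      using addhom_add[OF lh[OF that(1)] that(2,3)] addhom_add[OF rh[OF that(1)] that(2,3)] by auto
    show "l \<one>\<^bsub>S\<^esub> v = v" "r v \<one>\<^bsub>S\<^esub> = v" if "v \<in> carrier V" for v
      using ext[OF lh addhom_id l1 that, OF S.one_closed] ext[OF rh addhom_id r1 that, OF S.one_closed] by auto
    fix b c v assume b: "b \<in> carrier S" and c: "c \<in> carrier S" and v: "v \<in> carrier V"
    note bc = S.a_closed[OF b c] S.m_closed[OF b c]
    show "l (b \<oplus>\<^bsub>S\<^esub> c) v = l b v \<oplus> l c v"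
      by (rule ext[OF lh[OF bc(1)] addhom_sum2[OF V lh[OF b] lh[OF c]] lp[OF b c] v])
    show "r v (b \<oplus>\<^bsub>S\<^esub> c) = r v b \<oplus> r v c"
      by (rule ext[OF rh[OF bc(1)] addhom_sum2[OF V rh[OF b] rh[OF c]] rp[OF b c] v])
    show "l (b \<otimes>\<^bsub>S\<^esub> c) v = l b (l c v)"
      by (rule ext[OF lh[OF bc(2)] addhom_comp[OF lh[OF c] lh[OF b]] lm[OF b c] v])
    show "r v (b \<otimes>\<^bsub>S\<^esub> c) = r (r v b) c"
      by (rule ext[OF rh[OF bc(2)] addhom_comp[OF rh[OF b] rh[OF c]] rm[OF b c] v])
    show "r (l b v) c = l b (r v c)"
      by (rule ext[OF addhom_comp[OF lh[OF b] rh[OF c]] addhom_comp[OF rh[OF c] lh[OF b]] lr[OF b c] v])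
  qed
qed

end

section \<open>The tensor square \<open>A \<otimes> A\<close>\<close>

locale kalg =
  fixes K :: "('k, 'x) ring_scheme" and R :: "('k, 'r, 'y) alg_scheme" and A :: "('r, 'a, 'z) alg_scheme" (structure)
  assumes kR: "k_algebra K R" and RA: "R_algebra K R A"
begin

sublocale A: ring A using RA by (simp add: R_algebra_def)

lemma umap_hom: "umap A \<in> ring_hom R A" using RA by (simp add: R_algebra_def)

lemma umap_closed [simp]: "x \<in> carrier R \<Longrightarrow> umap A x \<in> carrier A"
  using umap_hom by (rule ring_hom_closed)

lemma kmap_in_R: "c \<in> carrier K \<Longrightarrow> umap R c \<in> carrier R"
  using kR ring_hom_closed[of "umap R" K R] by (simp add: k_algebra_def)

lemma kmap_closed [simp]: "c \<in> carrier K \<Longrightarrow> kmap R A c \<in> carrier A"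
  by (simp add: kmap_def kmap_in_R)

lemma kmap_comm: "c \<in> carrier K \<Longrightarrow> x \<in> carrier A \<Longrightarrow> kmap R A c \<otimes> x = x \<otimes> kmap R A c"
  using RA by (simp add: R_algebra_def)

lemma tens_supp: "q \<in> tens_rels K R A \<Longrightarrow> keys q \<subseteq> carrier A \<times> carrier A"
  unfolding tens_rels_def by (elim UnE CollectE exE conjE; hypsubst; intro keys_rel3 keys_gn_diff; simp)

sublocale T: presented "tens K R A" "carrier A \<times> carrier A" "tens_rels K R A"
  by unfold_locales (simp_all add: tens_def pbimod_def tens_supp)

abbreviation pt :: "'a \<Rightarrow> 'a \<Rightarrow> ('a \<times> 'a) pres" where "pt \<equiv> ptens K R A"

lemma pt_closed [simp]: "u \<in> carrier A \<Longrightarrow> v \<in> carrier A \<Longrightarrow> pt u v \<in> carrier (tens K R A)"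
  by (rule T.gcls_closed) simp

lemma pt_add_left:
  assumes "u \<in> carrier A" "u' \<in> carrier A" "v \<in> carrier A"
  shows "pt (u \<oplus> u') v = pt u v \<oplus>\<^bsub>tens K R A\<^esub> pt u' v"
  by (rule T.rel3) (use assms in \<open>auto simp: tens_rels_def\<close>)

lemma pt_add_right:
  assumes "u \<in> carrier A" "v \<in> carrier A" "v' \<in> carrier A"
  shows "pt u (v \<oplus> v') = pt u v \<oplus>\<^bsub>tens K R A\<^esub> pt u v'"
  by (rule T.rel3) (use assms in \<open>auto simp: tens_rels_def\<close>)

lemma pt_balanced:
  assumes "u \<in> carrier A" "v \<in> carrier A" "c \<in> carrier K"
  shows "pt (u \<otimes> kmap R A c) v = pt u (kmap R A c \<otimes> v)"
  by (rule T.rel2) (use assms in \<open>auto simp: tens_rels_def\<close>)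

text \<open>The universal property of the tensor product over k in two forms. The first feeds
  \<open>pmap_lift\<close>, where the map is prescribed to be a \<open>pmap\<close>; the second
  yields maps to arbitrary abelian groups.\<close>

lemma
  assumes W: "abelian_group W" and h: "\<And>u v. u \<in> carrier A \<Longrightarrow> v \<in> carrier A \<Longrightarrow> h u v \<in> carrier W"
    and "\<And>u u' v. \<lbrakk>u \<in> carrier A; u' \<in> carrier A; v \<in> carrier A\<rbrakk> \<Longrightarrow> h (u \<oplus> u') v = h u v \<oplus>\<^bsub>W\<^esub> h u' v"
    and "\<And>u v v'. \<lbrakk>u \<in> carrier A; v \<in> carrier A; v' \<in> carrier A\<rbrakk> \<Longrightarrow> h u (v \<oplus> v') = h u v \<oplus>\<^bsub>W\<^esub> h u v'"
    and "\<And>u v c. \<lbrakk>u \<in> carrier A; v \<in> carrier A; c \<in> carrier K\<rbrakk> \<Longrightarrow> h (u \<otimes> kmap R A c) v = h u (kmap R A c \<otimes> v)"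
  shows tens_respects: "respects_rels W (carrier A \<times> carrier A) (tens_rels K R A) (\<lambda>(u, v). h u v)"
    and tens_lift: "\<exists>L. L \<in> addhom (tens K R A) W \<and> (\<forall>u\<in>carrier A. \<forall>v\<in>carrier A. L (pt u v) = h u v)"
proof -
  show r: "respects_rels W (carrier A \<times> carrier A) (tens_rels K R A) (\<lambda>(u, v). h u v)"
  proof (rule respectsI)
    fix L q
    assume L: "prelift W (carrier A \<times> carrier A) (\<lambda>(u, v). h u v) L" and q: "q \<in> tens_rels K R A"
    note rd3 = rel_diff3[OF W L] and rd2 = rel_diff2[OF W L]
    show "L q = \<zero>\<^bsub>W\<^esub>"
      by (insert q[unfolded tens_rels_def], elim UnE CollectE exE conjE; hypsubst; (rule rd3 | rule rd2)) (simp_all add: assms)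
  qed
  have "\<exists>L. L \<in> addhom (tens K R A) W \<and> (\<forall>x\<in>carrier A \<times> carrier A. L (gcls (tens_rels K R A) x) = (\<lambda>(u, v). h u v) x)"
    by (rule T.lift[OF W _ r]) (use h in auto)
  then show "\<exists>L. L \<in> addhom (tens K R A) W \<and> (\<forall>u\<in>carrier A. \<forall>v\<in>carrier A. L (pt u v) = h u v)" by auto
qed

lemma tens_ext:
  assumes "abelian_group W" "f \<in> addhom (tens K R A) W" "g \<in> addhom (tens K R A) W"
    "\<And>u v. u \<in> carrier A \<Longrightarrow> v \<in> carrier A \<Longrightarrow> f (pt u v) = g (pt u v)" "x \<in> carrier (tens K R A)"
  shows "f x = g x"
  by (rule T.hom_ext[OF assms(1-3) _ assms(5)]) (use assms(4) in auto)

lemma lact_tens: "lact (tens K R A) a = pmap (tens_rels K R A) (\<lambda>(u, v). (a \<otimes> u, v))"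
  by (simp add: tens_def pbimod_def)

lemma ract_tens: "ract (tens K R A) t a = pmap (tens_rels K R A) (\<lambda>(u, v). (u, v \<otimes> a)) t"
  by (simp add: tens_def pbimod_def case_prod_beta' )

lemma pt_respects:
  assumes "\<And>u v. u \<in> carrier A \<Longrightarrow> v \<in> carrier A \<Longrightarrow> f u \<in> carrier A \<and> g v \<in> carrier A"
    and "\<And>u v. u \<in> carrier A \<Longrightarrow> v \<in> carrier A \<Longrightarrow> f (u \<oplus> v) = f u \<oplus> f v \<and> g (u \<oplus> v) = g u \<oplus> g v"
    and "\<And>u c. u \<in> carrier A \<Longrightarrow> c \<in> carrier K \<Longrightarrow> f (u \<otimes> kmap R A c) = f u \<otimes> kmap R A c \<and> g (kmap R A c \<otimes> u) = kmap R A c \<otimes> g u"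
  shows "respects_rels (tens K R A) (carrier A \<times> carrier A) (tens_rels K R A) (\<lambda>(u, v). pt (f u) (g v))"
  by (rule tens_respects[OF T.abelian_group_axioms]) (simp_all add: assms pt_add_left pt_add_right pt_balanced)

lemma lact_tens_hom:
  assumes "a \<in> carrier A"
  shows "lact (tens K R A) a \<in> addhom (tens K R A) (tens K R A)"
    and "u \<in> carrier A \<Longrightarrow> v \<in> carrier A \<Longrightarrow> lact (tens K R A) a (pt u v) = pt (a \<otimes> u) v"
proof -
  have h: "(\<lambda>(u, v). (a \<otimes> u, v)) x \<in> carrier A \<times> carrier A" if "x \<in> carrier A \<times> carrier A" for x
    using that assms by auto
  have r: "respects_rels (tens K R A) (carrier A \<times> carrier A) (tens_rels K R A) (\<lambda>x. gcls (tens_rels K R A) ((\<lambda>(u, v). (a \<otimes> u, v)) x))"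
    using pt_respects[of "\<lambda>u. a \<otimes> u" "\<lambda>v. v"] assms by (simp add: case_prod_beta' A.r_distr A.m_assoc)
  note * = pmap_lift[OF T.presented_axioms T.presented_axioms h r]
  show "lact (tens K R A) a \<in> addhom (tens K R A) (tens K R A)"
    using *(1) by (simp add: lact_tens)
  show "u \<in> carrier A \<Longrightarrow> v \<in> carrier A \<Longrightarrow> lact (tens K R A) a (pt u v) = pt (a \<otimes> u) v"
    using *(2)[of "(u, v)"] by (simp add: lact_tens)
qed

lemma ract_tens_hom:
  assumes "a \<in> carrier A"
  shows "(\<lambda>t. ract (tens K R A) t a) \<in> addhom (tens K R A) (tens K R A)"
    and "u \<in> carrier A \<Longrightarrow> v \<in> carrier A \<Longrightarrow> ract (tens K R A) (pt u v) a = pt u (v \<otimes> a)"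
proof -
  have h: "(\<lambda>(u, v). (u, v \<otimes> a)) x \<in> carrier A \<times> carrier A" if "x \<in> carrier A \<times> carrier A" for x
    using that assms by auto
  have r: "respects_rels (tens K R A) (carrier A \<times> carrier A) (tens_rels K R A) (\<lambda>x. gcls (tens_rels K R A) ((\<lambda>(u, v). (u, v \<otimes> a)) x))"
    using pt_respects[of "\<lambda>v. v" "\<lambda>v. v \<otimes> a"] assms by (simp add: case_prod_beta' A.l_distr A.m_assoc)
  note * = pmap_lift[OF T.presented_axioms T.presented_axioms h r]
  show "(\<lambda>t. ract (tens K R A) t a) \<in> addhom (tens K R A) (tens K R A)"
    using *(1) by (simp add: ract_tens[abs_def])
  show "u \<in> carrier A \<Longrightarrow> v \<in> carrier A \<Longrightarrow> ract (tens K R A) (pt u v) a = pt u (v \<otimes> a)"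
    using *(2)[of "(u, v)"] by (simp add: ract_tens)
qed

sublocale TB: biact A "tens K R A" "lact (tens K R A)" "ract (tens K R A)"
  by (rule T.biactI[OF A.ring_axioms])
     (auto simp: lact_tens_hom ract_tens_hom pt_add_left pt_add_right A.l_distr A.r_distr A.m_assoc)

text \<open>Scalars cross the tensor sign and are central in each factor.\<close>

lemma tens_central:
  assumes c: "c \<in> carrier K" and t: "t \<in> carrier (tens K R A)"
  shows "lact (tens K R A) (kmap R A c) t = ract (tens K R A) t (kmap R A c)"
proof -
  have "lact (tens K R A) (kmap R A c) (pt u v) = ract (tens K R A) (pt u v) (kmap R A c)"
    if "u \<in> carrier A" "v \<in> carrier A" for u v
  proof -
    have "lact (tens K R A) (kmap R A c) (pt u v) = pt (u \<otimes> kmap R A c) v"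
      using that c kmap_comm[of c u] by (simp add: lact_tens_hom)
    also have "\<dots> = ract (tens K R A) (pt u v) (kmap R A c)"
      using that c kmap_comm[of c v] by (simp add: pt_balanced ract_tens_hom)
    finally show ?thesis .
  qed
  then show ?thesis
    using tens_ext[OF T.abelian_group_axioms lact_tens_hom(1) ract_tens_hom(1) _ t, OF kmap_closed[OF c] kmap_closed[OF c]]
    by blast
qed

end

section \<open>Evaluating \<open>b \<otimes> b'\<close> on a bimodule element\<close>

locale kbiact = kalg K R B + biact B V l r
  for K :: "('k, 'x) ring_scheme" and R :: "('k, 'r, 'y) alg_scheme" and B :: "('r, 'b, 'z) alg_scheme"
    and V :: "('v, 'w) ring_scheme" and l r +
  assumes central: "\<And>c v. c \<in> carrier K \<Longrightarrow> v \<in> carrier V \<Longrightarrow> l (kmap R B c) v = r v (kmap R B c)"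
begin

text \<open>The bimodule map from the free bimodule of rank one that sends the tensor of units to
  \<open>v\<close>; centrality of k makes it well defined. In these terms a dual basis says that v
  is the sum of the elements \<open>tact (x k) (\<phi> k v)\<close>.\<close>

definition tact :: "'v \<Rightarrow> ('b \<times> 'b) pres \<Rightarrow> 'v" where
  "tact v = (SOME L. L \<in> addhom (tens K R B) V \<and> (\<forall>b\<in>carrier B. \<forall>b'\<in>carrier B. L (pt b b') = l b (r v b')))"

lemma tact_hom:
  assumes "v \<in> carrier V"
  shows "tact v \<in> addhom (tens K R B) V"
    and "b \<in> carrier B \<Longrightarrow> b' \<in> carrier B \<Longrightarrow> tact v (pt b b') = l b (r v b')"
proof -
  have "\<exists>L. L \<in> addhom (tens K R B) V \<and> (\<forall>b\<in>carrier B. \<forall>b'\<in>carrier B. L (pt b b') = l b (r v b'))"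
  proof (rule tens_lift[OF grp_V])
    fix b b' c assume *: "b \<in> carrier B" "b' \<in> carrier B" "c \<in> carrier K"
    have "r v (kmap R B c \<otimes>\<^bsub>B\<^esub> b') = l (kmap R B c) (r v b')"
      using * assms by (simp add: r_mult central[symmetric] lr_assoc)
    then show "l (b \<otimes>\<^bsub>B\<^esub> kmap R B c) (r v b') = l b (r v (kmap R B c \<otimes>\<^bsub>B\<^esub> b'))"
      using * assms by (simp add: l_mult)
  qed (use assms in \<open>simp_all add: l_plus r_plus l_add\<close>)
  note * = someI_ex[OF this, folded tact_def]
  show "tact v \<in> addhom (tens K R B) V" using * by (rule conjunct1)
  show "tact v (pt b b') = l b (r v b')" if "b \<in> carrier B" "b' \<in> carrier B"
    using conjunct2[OF *] that by blast
qed

lemma tact_closed: "v \<in> carrier V \<Longrightarrow> t \<in> carrier (tens K R B) \<Longrightarrow> tact v t \<in> carrier V"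
  by (rule addhom_closed[OF tact_hom(1)])

end

text \<open>Both sides are additive in \<open>t\<close> and agree on pure tensors by linearity of
  \<open>f\<close>. This transports a dual basis expansion along a bimodule map, which is how values
  of derivations come to be expanded.\<close>

lemma tact_natural:
  assumes "kbiact K R B V l r" "kbiact K R B W l' r'" "f \<in> addhom V W"
    "\<And>b v. b \<in> carrier B \<Longrightarrow> v \<in> carrier V \<Longrightarrow> f (l b v) = l' b (f v) \<and> f (r v b) = r' (f v) b"
    "v \<in> carrier V" "t \<in> carrier (tens K R B)"
  shows "f (kbiact.tact K R B V l r v t) = kbiact.tact K R B W l' r' (f v) t"
proof -
  interpret V: kbiact K R B V l r by fact
  interpret W: kbiact K R B W l' r' by fact
  have fv: "f v \<in> carrier W" by (rule addhom_closed[OF assms(3,5)])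
  have "f (V.tact v (V.pt b b')) = W.tact (f v) (V.pt b b')" if "b \<in> carrier B" "b' \<in> carrier B" for b b'
    using that assms(4)[of b "r v b'"] assms(4)[of b' v] assms(5) fv by (simp add: V.tact_hom W.tact_hom)
  then show ?thesis
    by (rule V.tens_ext[OF W.grp_V addhom_comp[OF V.tact_hom(1)[OF assms(5)] assms(3)] W.tact_hom(1)[OF fv] _ assms(6)])
qed

section \<open>The induced bimodule\<close>

locale induced = j: ring A + biact B V "lact V" "ract V"
  for A :: "('a, 'x) ring_scheme" (structure) and B :: "('b, 'y) ring_scheme" and V :: "('b, 'm, 'w) bimod_scheme" +
  fixes j :: "'b \<Rightarrow> 'a"
  assumes j_hom: "j \<in> ring_hom B A"
begin

lemma j_closed [simp]: "b \<in> carrier B \<Longrightarrow> j b \<in> carrier A"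
  using j_hom by (rule ring_hom_closed)

lemma ind_supp: "q \<in> ind_rels A j B V \<Longrightarrow> keys q \<subseteq> carrier A \<times> carrier V \<times> carrier A"
  unfolding ind_rels_def by (elim UnE CollectE exE conjE; hypsubst; intro keys_rel3 keys_gn_diff; simp)

sublocale I: presented "ind A j B V" "carrier A \<times> carrier V \<times> carrier A" "ind_rels A j B V"
  by unfold_locales (simp_all add: ind_def pbimod_def ind_supp)

abbreviation pi3 :: "'a \<Rightarrow> 'm \<Rightarrow> 'a \<Rightarrow> ('a \<times> 'm \<times> 'a) pres" where "pi3 \<equiv> pind A j B V"

lemma pi3_closed [simp]: "\<lbrakk>a \<in> carrier A; v \<in> carrier V; c \<in> carrier A\<rbrakk> \<Longrightarrow> pi3 a v c \<in> carrier (ind A j B V)"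
  by (rule I.gcls_closed) simp

text \<open>One conclusion for each family of relators. The proof body is empty; the closing method
  works through the five goals in turn.\<close>

lemma pi3_rules:
  assumes "a \<in> carrier A" "c \<in> carrier A" "v \<in> carrier V"
  shows "a' \<in> carrier A \<Longrightarrow> pi3 (a \<oplus> a') v c = pi3 a v c \<oplus>\<^bsub>ind A j B V\<^esub> pi3 a' v c"
    and "v' \<in> carrier V \<Longrightarrow> pi3 a (v \<oplus>\<^bsub>V\<^esub> v') c = pi3 a v c \<oplus>\<^bsub>ind A j B V\<^esub> pi3 a v' c"
    and "c' \<in> carrier A \<Longrightarrow> pi3 a v (c \<oplus> c') = pi3 a v c \<oplus>\<^bsub>ind A j B V\<^esub> pi3 a v c'"
    and "b \<in> carrier B \<Longrightarrow> pi3 (a \<otimes> j b) v c = pi3 a (lact V b v) c"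
    and "b \<in> carrier B \<Longrightarrow> pi3 a (ract V v b) c = pi3 a v (j b \<otimes> c)"
proof -
qed ((insert assms)[1], ((rule I.rel3 | rule I.rel2); (unfold ind_rels_def, blast | simp))[1])+

lemma
  assumes W: "abelian_group W"
    and c: "\<And>a v c. \<lbrakk>a \<in> carrier A; v \<in> carrier V; c \<in> carrier A\<rbrakk> \<Longrightarrow> h a v c \<in> carrier W"
    and "\<And>a a' v c. \<lbrakk>a \<in> carrier A; a' \<in> carrier A; v \<in> carrier V; c \<in> carrier A\<rbrakk> \<Longrightarrow> h (a \<oplus> a') v c = h a v c \<oplus>\<^bsub>W\<^esub> h a' v c"
    and "\<And>a v v' c. \<lbrakk>a \<in> carrier A; v \<in> carrier V; v' \<in> carrier V; c \<in> carrier A\<rbrakk> \<Longrightarrow> h a (v \<oplus>\<^bsub>V\<^esub> v') c = h a v c \<oplus>\<^bsub>W\<^esub> h a v' c"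
    and "\<And>a v c c'. \<lbrakk>a \<in> carrier A; v \<in> carrier V; c \<in> carrier A; c' \<in> carrier A\<rbrakk> \<Longrightarrow> h a v (c \<oplus> c') = h a v c \<oplus>\<^bsub>W\<^esub> h a v c'"
    and "\<And>a b v c. \<lbrakk>a \<in> carrier A; b \<in> carrier B; v \<in> carrier V; c \<in> carrier A\<rbrakk> \<Longrightarrow> h (a \<otimes> j b) v c = h a (lact V b v) c"
    and "\<And>a b v c. \<lbrakk>a \<in> carrier A; b \<in> carrier B; v \<in> carrier V; c \<in> carrier A\<rbrakk> \<Longrightarrow> h a (ract V v b) c = h a v (j b \<otimes> c)"
  shows ind_respects: "respects_rels W (carrier A \<times> carrier V \<times> carrier A) (ind_rels A j B V) (\<lambda>(a, v, c). h a v c)"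
    and ind_lift: "\<exists>L. L \<in> addhom (ind A j B V) W \<and> (\<forall>a\<in>carrier A. \<forall>v\<in>carrier V. \<forall>c\<in>carrier A. L (pi3 a v c) = h a v c)"
proof -
  show r: "respects_rels W (carrier A \<times> carrier V \<times> carrier A) (ind_rels A j B V) (\<lambda>(a, v, c). h a v c)"
  proof (rule respectsI)
    fix L q
    assume L: "prelift W (carrier A \<times> carrier V \<times> carrier A) (\<lambda>(a, v, c). h a v c) L" and q: "q \<in> ind_rels A j B V"
    note rd3 = rel_diff3[OF W L] and rd2 = rel_diff2[OF W L]
    show "L q = \<zero>\<^bsub>W\<^esub>"
      by (insert q[unfolded ind_rels_def], elim UnE CollectE exE conjE; hypsubst; (rule rd3 | rule rd2)) (simp_all add: assms)
  qed
  have "\<exists>L. L \<in> addhom (ind A j B V) W \<and> (\<forall>x\<in>carrier A \<times> carrier V \<times> carrier A. L (gcls (ind_rels A j B V) x) = (\<lambda>(a, v, c). h a v c) x)"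
    by (rule I.lift[OF W _ r]) (use c in auto)
  then show "\<exists>L. L \<in> addhom (ind A j B V) W \<and> (\<forall>a\<in>carrier A. \<forall>v\<in>carrier V. \<forall>c\<in>carrier A. L (pi3 a v c) = h a v c)" by auto
qed

lemma ind_ext:
  assumes "abelian_group W" "f \<in> addhom (ind A j B V) W" "g \<in> addhom (ind A j B V) W"
    "\<And>a v c. \<lbrakk>a \<in> carrier A; v \<in> carrier V; c \<in> carrier A\<rbrakk> \<Longrightarrow> f (pi3 a v c) = g (pi3 a v c)" "x \<in> carrier (ind A j B V)"
  shows "f x = g x"
  by (rule I.hom_ext[OF assms(1-3) _ assms(5)]) (use assms(4) in auto)

lemma ind_hom:
  assumes x: "x \<in> carrier A"
  shows "lact (ind A j B V) x \<in> addhom (ind A j B V) (ind A j B V)"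
    and "\<lbrakk>a \<in> carrier A; v \<in> carrier V; c \<in> carrier A\<rbrakk> \<Longrightarrow> lact (ind A j B V) x (pi3 a v c) = pi3 (x \<otimes> a) v c"
    and "(\<lambda>t. ract (ind A j B V) t x) \<in> addhom (ind A j B V) (ind A j B V)"
    and "\<lbrakk>a \<in> carrier A; v \<in> carrier V; c \<in> carrier A\<rbrakk> \<Longrightarrow> ract (ind A j B V) (pi3 a v c) x = pi3 a v (c \<otimes> x)"
proof -
  let ?l = "\<lambda>(a, v, c). (x \<otimes> a, v, c)" and ?r = "\<lambda>(a, v, c). (a, v, c \<otimes> x)"
  let ?G = "carrier A \<times> carrier V \<times> carrier A"
  have hl: "?l y \<in> ?G" and hr: "?r y \<in> ?G" if "y \<in> ?G" for y
    using that x by auto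
  have rl: "respects_rels (ind A j B V) ?G (ind_rels A j B V) (\<lambda>y. gcls (ind_rels A j B V) (?l y))"
    using ind_respects[OF I.abelian_group_axioms, of "\<lambda>a v c. pi3 (x \<otimes> a) v c"] x
    by (simp add: case_prod_beta' pi3_rules j.r_distr j.m_assoc[symmetric])
  have rr: "respects_rels (ind A j B V) ?G (ind_rels A j B V) (\<lambda>y. gcls (ind_rels A j B V) (?r y))"
    using ind_respects[OF I.abelian_group_axioms, of "\<lambda>a v c. pi3 a v (c \<otimes> x)"] x
    by (simp add: case_prod_beta' pi3_rules j.l_distr j.m_assoc)
  note L = pmap_lift[OF I.presented_axioms I.presented_axioms hl rl]
  note R = pmap_lift[OF I.presented_axioms I.presented_axioms hr rr]
  show "lact (ind A j B V) x \<in> addhom (ind A j B V) (ind A j B V)"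
    "(\<lambda>t. ract (ind A j B V) t x) \<in> addhom (ind A j B V) (ind A j B V)"
    using L(1) R(1) by (simp_all add: ind_def pbimod_def case_prod_beta')
  show "lact (ind A j B V) x (pi3 a v c) = pi3 (x \<otimes> a) v c" "ract (ind A j B V) (pi3 a v c) x = pi3 a v (c \<otimes> x)"
    if "a \<in> carrier A" "v \<in> carrier V" "c \<in> carrier A"
    using L(2)[of "(a, v, c)"] R(2)[of "(a, v, c)"] that by (simp_all add: ind_def pbimod_def case_prod_beta')
qed

sublocale IB: biact A "ind A j B V" "lact (ind A j B V)" "ract (ind A j B V)"
  by (rule I.biactI[OF j.ring_axioms]) (auto simp: ind_hom pi3_rules j.l_distr j.r_distr j.m_assoc)

end

section \<open>Noncommutative one-forms\<close>

locale oneforms = ring A for A :: "('r, 'a, 'z) alg_scheme" (structure) +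
  fixes R :: "('r, 'x) ring_scheme"
  assumes uhom: "umap A \<in> ring_hom R A"
begin

lemma umap_cl [simp]: "x \<in> carrier R \<Longrightarrow> umap A x \<in> carrier A"
  using uhom by (rule ring_hom_closed)

abbreviation p1 :: "'a \<Rightarrow> 'a \<Rightarrow> 'a \<Rightarrow> ('a \<times> 'a \<times> 'a) pres" where
  "p1 a x c \<equiv> gcls (Om1_rels R A) (a, x, c)"

lemma keys_rel1: "x \<in> G \<Longrightarrow> keys (gn x :: _ \<Rightarrow>\<^sub>0 int) \<subseteq> G"
  by simp

lemma Om1_supp: "q \<in> Om1_rels R A \<Longrightarrow> keys q \<subseteq> carrier A \<times> carrier A \<times> carrier A"
  unfolding Om1_rels_def by (elim UnE CollectE exE conjE; hypsubst; intro keys_rel3 keys_rel1; simp)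

sublocale O: presented "Om1 R A" "carrier A \<times> carrier A \<times> carrier A" "Om1_rels R A"
  by unfold_locales (simp_all add: Om1_def pbimod_def Om1_supp)

lemma p1_closed [simp]: "\<lbrakk>a \<in> carrier A; x \<in> carrier A; c \<in> carrier A\<rbrakk> \<Longrightarrow> p1 a x c \<in> carrier (Om1 R A)"
  by (rule O.gcls_closed) simp

lemma p1_rules:
  assumes "a \<in> carrier A" "x \<in> carrier A" "c \<in> carrier A"
  shows "y \<in> carrier A \<Longrightarrow> p1 (a \<oplus> y) x c = p1 a x c \<oplus>\<^bsub>Om1 R A\<^esub> p1 y x c"
    and "y \<in> carrier A \<Longrightarrow> p1 a (x \<oplus> y) c = p1 a x c \<oplus>\<^bsub>Om1 R A\<^esub> p1 a y c"
    and "y \<in> carrier A \<Longrightarrow> p1 a x (c \<oplus> y) = p1 a x c \<oplus>\<^bsub>Om1 R A\<^esub> p1 a x y"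
    and "y \<in> carrier A \<Longrightarrow> p1 a (x \<otimes> y) c = p1 a x (y \<otimes> c) \<oplus>\<^bsub>Om1 R A\<^esub> p1 (a \<otimes> x) y c"
    and "t \<in> carrier R \<Longrightarrow> p1 a (umap A t) c = \<zero>\<^bsub>Om1 R A\<^esub>"
proof -
qed ((insert assms)[1], ((rule O.rel3 | rule O.rel1); (unfold Om1_rels_def, blast | simp))[1])+

lemma Om1_respects:
  assumes W: "abelian_group W"
    and "\<And>a x c. \<lbrakk>a \<in> carrier A; x \<in> carrier A; c \<in> carrier A\<rbrakk> \<Longrightarrow> h a x c \<in> carrier W"
    and "\<And>a a' x c. \<lbrakk>a \<in> carrier A; a' \<in> carrier A; x \<in> carrier A; c \<in> carrier A\<rbrakk> \<Longrightarrow> h (a \<oplus> a') x c = h a x c \<oplus>\<^bsub>W\<^esub> h a' x c"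
    and "\<And>a x x' c. \<lbrakk>a \<in> carrier A; x \<in> carrier A; x' \<in> carrier A; c \<in> carrier A\<rbrakk> \<Longrightarrow> h a (x \<oplus> x') c = h a x c \<oplus>\<^bsub>W\<^esub> h a x' c"
    and "\<And>a x c c'. \<lbrakk>a \<in> carrier A; x \<in> carrier A; c \<in> carrier A; c' \<in> carrier A\<rbrakk> \<Longrightarrow> h a x (c \<oplus> c') = h a x c \<oplus>\<^bsub>W\<^esub> h a x c'"
    and "\<And>a x y c. \<lbrakk>a \<in> carrier A; x \<in> carrier A; y \<in> carrier A; c \<in> carrier A\<rbrakk> \<Longrightarrow> h a (x \<otimes> y) c = h a x (y \<otimes> c) \<oplus>\<^bsub>W\<^esub> h (a \<otimes> x) y c"
    and "\<And>a t c. \<lbrakk>a \<in> carrier A; t \<in> carrier R; c \<in> carrier A\<rbrakk> \<Longrightarrow> h a (umap A t) c = \<zero>\<^bsub>W\<^esub>"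
  shows "respects_rels W (carrier A \<times> carrier A \<times> carrier A) (Om1_rels R A) (\<lambda>(a, x, c). h a x c)"
proof (rule respectsI)
  fix L q
  assume L: "prelift W (carrier A \<times> carrier A \<times> carrier A) (\<lambda>(a, x, c). h a x c) L" and q: "q \<in> Om1_rels R A"
  note rd3 = rel_diff3[OF W L]
  have rd1: "L (gn (a, umap A t, c)) = \<zero>\<^bsub>W\<^esub>" if "a \<in> carrier A" "t \<in> carrier R" "c \<in> carrier A" for a t c
    using L that assms(7)[OF that] by (simp add: prelift_def)
  show "L q = \<zero>\<^bsub>W\<^esub>"
    by (insert q[unfolded Om1_rels_def], elim UnE CollectE exE conjE; hypsubst; (rule rd3 | rule rd1)) (simp_all add: assms)
qed

lemma Om1_ext:
  assumes "abelian_group W" "f \<in> addhom (Om1 R A) W" "g \<in> addhom (Om1 R A) W"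
    "\<And>a x c. \<lbrakk>a \<in> carrier A; x \<in> carrier A; c \<in> carrier A\<rbrakk> \<Longrightarrow> f (p1 a x c) = g (p1 a x c)" "\<xi> \<in> carrier (Om1 R A)"
  shows "f \<xi> = g \<xi>"
  by (rule O.hom_ext[OF assms(1-3) _ assms(5)]) (use assms(4) in auto)

lemma Om1_hom:
  assumes y: "y \<in> carrier A"
  shows "lact (Om1 R A) y \<in> addhom (Om1 R A) (Om1 R A)"
    and "\<lbrakk>a \<in> carrier A; x \<in> carrier A; c \<in> carrier A\<rbrakk> \<Longrightarrow> lact (Om1 R A) y (p1 a x c) = p1 (y \<otimes> a) x c"
    and "(\<lambda>t. ract (Om1 R A) t y) \<in> addhom (Om1 R A) (Om1 R A)"
    and "\<lbrakk>a \<in> carrier A; x \<in> carrier A; c \<in> carrier A\<rbrakk> \<Longrightarrow> ract (Om1 R A) (p1 a x c) y = p1 a x (c \<otimes> y)"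
proof -
  let ?l = "\<lambda>(a, x, c). (y \<otimes> a, x, c)" and ?r = "\<lambda>(a, x, c). (a, x, c \<otimes> y)"
  let ?G = "carrier A \<times> carrier A \<times> carrier A"
  have hl: "?l z \<in> ?G" and hr: "?r z \<in> ?G" if "z \<in> ?G" for z
    using that y by auto
  have rl: "respects_rels (Om1 R A) ?G (Om1_rels R A) (\<lambda>z. gcls (Om1_rels R A) (?l z))"
    using Om1_respects[OF O.abelian_group_axioms, of "\<lambda>a x c. p1 (y \<otimes> a) x c"] y
    by (simp add: case_prod_beta' p1_rules r_distr m_assoc[symmetric])
  have rr: "respects_rels (Om1 R A) ?G (Om1_rels R A) (\<lambda>z. gcls (Om1_rels R A) (?r z))"
    using Om1_respects[OF O.abelian_group_axioms, of "\<lambda>a x c. p1 a x (c \<otimes> y)"] y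
    by (simp add: case_prod_beta' p1_rules l_distr m_assoc)
  note L = pmap_lift[OF O.presented_axioms O.presented_axioms hl rl]
  note R = pmap_lift[OF O.presented_axioms O.presented_axioms hr rr]
  show "lact (Om1 R A) y \<in> addhom (Om1 R A) (Om1 R A)"
    "(\<lambda>t. ract (Om1 R A) t y) \<in> addhom (Om1 R A) (Om1 R A)"
    using L(1) R(1) by (simp_all add: Om1_def pbimod_def case_prod_beta')
  show "lact (Om1 R A) y (p1 a x c) = p1 (y \<otimes> a) x c" "ract (Om1 R A) (p1 a x c) y = p1 a x (c \<otimes> y)"
    if "a \<in> carrier A" "x \<in> carrier A" "c \<in> carrier A"
    using L(2)[of "(a, x, c)"] R(2)[of "(a, x, c)"] that by (simp_all add: Om1_def pbimod_def case_prod_beta')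
qed

sublocale OB: biact A "Om1 R A" "lact (Om1 R A)" "ract (Om1 R A)"
  by (rule O.biactI[OF ring_axioms]) (auto simp: Om1_hom p1_rules l_distr r_distr m_assoc)

lemma du_closed [simp]: "x \<in> carrier A \<Longrightarrow> du R A x \<in> carrier (Om1 R A)"
  by (simp add: du_def)

lemma p1_eq:
  assumes "a \<in> carrier A" "x \<in> carrier A" "c \<in> carrier A"
  shows "p1 a x c = lact (Om1 R A) a (ract (Om1 R A) (du R A x) c)"
  using assms by (simp add: Om1_hom du_def)

lemma du_rules:
  assumes "x \<in> carrier A" "y \<in> carrier A"
  shows "du R A (x \<oplus> y) = du R A x \<oplus>\<^bsub>Om1 R A\<^esub> du R A y"
    and "du R A (x \<otimes> y) = ract (Om1 R A) (du R A x) y \<oplus>\<^bsub>Om1 R A\<^esub> lact (Om1 R A) x (du R A y)"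
    and "t \<in> carrier R \<Longrightarrow> du R A (umap A t) = \<zero>\<^bsub>Om1 R A\<^esub>"
  using assms by (simp_all add: du_def p1_rules Om1_hom)

text \<open>The form a dx c goes to a D(x) c. The Leibniz relator becomes the Leibniz rule of D,
  multiplied by a from the left and by c from the right.\<close>

lemma Om1_universal:
  assumes W: "biact A W l r" and D: "D \<in> addhom A W"
    and leib: "\<And>x y. x \<in> carrier A \<Longrightarrow> y \<in> carrier A \<Longrightarrow> D (x \<otimes> y) = r (D x) y \<oplus>\<^bsub>W\<^esub> l x (D y)"
    and DR: "\<And>t. t \<in> carrier R \<Longrightarrow> D (umap A t) = \<zero>\<^bsub>W\<^esub>"
  shows "\<exists>L. L \<in> addhom (Om1 R A) W \<and> (\<forall>a\<in>carrier A. \<forall>x\<in>carrier A. \<forall>c\<in>carrier A. L (p1 a x c) = l a (r (D x) c))"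
proof -
  interpret W: biact A W l r by fact
  have Dc [simp]: "x \<in> carrier A \<Longrightarrow> D x \<in> carrier W" for x using addhom_closed[OF D] .
  let ?h = "\<lambda>a x c. l a (r (D x) c)"
  have r: "respects_rels W (carrier A \<times> carrier A \<times> carrier A) (Om1_rels R A) (\<lambda>(a, x, c). ?h a x c)"
    by (rule Om1_respects[OF W.grp_V])
       (simp_all add: W.l_plus W.r_plus W.l_add W.r_add addhom_add[OF D] leib DR W.l_mult W.r_mult W.lr_assoc)
  have "\<exists>L. L \<in> addhom (Om1 R A) W \<and> (\<forall>x\<in>carrier A \<times> carrier A \<times> carrier A. L (gcls (Om1_rels R A) x) = (\<lambda>(a, x, c). ?h a x c) x)"
    by (rule O.lift[OF W.grp_V _ r]) auto
  then show ?thesis by auto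
qed

end

section \<open>Tensor algebras\<close>

locale talg = biact S V "lact V" "ract V"
  for S :: "('r, 's, 'x) alg_scheme" and V :: "('s, 'v, 'y) bimod_scheme"
begin

abbreviation TA :: "('r, ('s \<times> 'v list) pres) alg" where "TA \<equiv> tensor_alg S V"
abbreviation tg :: "'s \<Rightarrow> 'v list \<Rightarrow> ('s \<times> 'v list) pres" where "tg s vs \<equiv> gcls (T_rels S V) (s, vs)"
abbreviation L :: "'v list set" where "L \<equiv> lists (carrier V)"

lemma T_supp: "q \<in> T_rels S V \<Longrightarrow> keys q \<subseteq> carrier S \<times> L"
  unfolding T_rels_def by (elim UnE CollectE exE conjE; hypsubst; intro keys_rel3 keys_gn_diff; simp)

sublocale P: presented TA "carrier S \<times> L" "T_rels S V"
  by unfold_locales (simp_all add: tensor_alg_def T_supp)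

lemma tg_closed [simp]: "s \<in> carrier S \<Longrightarrow> vs \<in> L \<Longrightarrow> tg s vs \<in> carrier TA"
  by (rule P.gcls_closed) simp

lemma tg_add:
  assumes "s \<in> carrier S" "t \<in> carrier S" "vs \<in> L"
  shows "tg (s \<oplus>\<^bsub>S\<^esub> t) vs = tg s vs \<oplus>\<^bsub>TA\<^esub> tg t vs"
proof -
  have "gn (s \<oplus>\<^bsub>S\<^esub> t, vs) - gn (s, vs) - gn (t, vs) \<in> T_rels S V"
    unfolding T_rels_def using assms by blast
  then show ?thesis by (rule P.rel3) (use assms in auto)
qed

lemma tg_add_list:
  assumes "s \<in> carrier S" "us \<in> L" "v \<in> carrier V" "w \<in> carrier V" "ws \<in> L"
  shows "tg s (us @ (v \<oplus>\<^bsub>V\<^esub> w) # ws) = tg s (us @ v # ws) \<oplus>\<^bsub>TA\<^esub> tg s (us @ w # ws)"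
proof -
  have "gn (s, us @ (v \<oplus>\<^bsub>V\<^esub> w) # ws) - gn (s, us @ v # ws) - gn (s, us @ w # ws) \<in> T_rels S V"
    unfolding T_rels_def using assms by blast
  then show ?thesis by (rule P.rel3) (use assms in auto)
qed

lemma tg_head:
  assumes "s \<in> carrier S" "t \<in> carrier S" "v \<in> carrier V" "vs \<in> L"
  shows "tg (s \<otimes>\<^bsub>S\<^esub> t) (v # vs) = tg s (lact V t v # vs)"
proof -
  have "gn (s \<otimes>\<^bsub>S\<^esub> t, v # vs) - gn (s, lact V t v # vs) \<in> T_rels S V"
    unfolding T_rels_def using assms by blast
  then show ?thesis by (rule P.rel2) (use assms in auto)
qed

lemma tg_shift:
  assumes "s \<in> carrier S" "us \<in> L" "v \<in> carrier V" "t \<in> carrier S" "w \<in> carrier V" "ws \<in> L"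
  shows "tg s (us @ ract V v t # w # ws) = tg s (us @ v # lact V t w # ws)"
proof -
  have "gn (s, us @ ract V v t # w # ws) - gn (s, us @ v # lact V t w # ws) \<in> T_rels S V"
    unfolding T_rels_def using assms by blast
  then show ?thesis by (rule P.rel2) (use assms in auto)
qed

lemma T_respects:
  assumes W: "abelian_group W"
    and "\<And>s vs. s \<in> carrier S \<Longrightarrow> vs \<in> L \<Longrightarrow> h s vs \<in> carrier W"
    and "\<And>s t vs. \<lbrakk>s \<in> carrier S; t \<in> carrier S; vs \<in> L\<rbrakk> \<Longrightarrow> h (s \<oplus>\<^bsub>S\<^esub> t) vs = h s vs \<oplus>\<^bsub>W\<^esub> h t vs"
    and "\<And>s us v w ws. \<lbrakk>s \<in> carrier S; us \<in> L; v \<in> carrier V; w \<in> carrier V; ws \<in> L\<rbrakk> \<Longrightarrow>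
       h s (us @ (v \<oplus>\<^bsub>V\<^esub> w) # ws) = h s (us @ v # ws) \<oplus>\<^bsub>W\<^esub> h s (us @ w # ws)"
    and "\<And>s t v vs. \<lbrakk>s \<in> carrier S; t \<in> carrier S; v \<in> carrier V; vs \<in> L\<rbrakk> \<Longrightarrow>
       h (s \<otimes>\<^bsub>S\<^esub> t) (v # vs) = h s (lact V t v # vs)"
    and "\<And>s us v t w ws. \<lbrakk>s \<in> carrier S; us \<in> L; v \<in> carrier V; t \<in> carrier S; w \<in> carrier V; ws \<in> L\<rbrakk> \<Longrightarrow>
       h s (us @ ract V v t # w # ws) = h s (us @ v # lact V t w # ws)"
  shows "respects_rels W (carrier S \<times> L) (T_rels S V) (\<lambda>(s, vs). h s vs)"
proof (rule respectsI)
  fix F q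
  assume F: "prelift W (carrier S \<times> L) (\<lambda>(s, vs). h s vs) F" and q: "q \<in> T_rels S V"
  note rd3 = rel_diff3[OF W F] and rd2 = rel_diff2[OF W F]
  show "F q = \<zero>\<^bsub>W\<^esub>"
    by (insert q[unfolded T_rels_def], elim UnE CollectE exE conjE; hypsubst; (rule rd3 | rule rd2)) (simp_all add: assms)
qed

lemma T_mult_closed: "x \<in> carrier S \<times> L \<Longrightarrow> y \<in> carrier S \<times> L \<Longrightarrow> T_mult S V x y \<in> carrier S \<times> L"
proof -
  assume *: "x \<in> carrier S \<times> L" "y \<in> carrier S \<times> L"
  obtain s us t ws where [simp]: "x = (s, us)" "y = (t, ws)" by (cases x, cases y)
  show ?thesis using * by (cases us rule: rev_cases) (auto simp: T_mult_def)
qed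

text \<open>In a product the coefficient of the right factor acts on the last letter of the left
  word. A relator in the left factor is disturbed only if it involves that letter, and then
  additivity of the right action, or its commuting with the left action, repairs it. Hence the case
  split on the tail behind the affected letter.\<close>

lemma T_mult_respects_left:
  assumes y: "y \<in> carrier S \<times> L"
  shows "respects_rels TA (carrier S \<times> L) (T_rels S V) (\<lambda>x. gcls (T_rels S V) (T_mult S V x y))"
proof -
  obtain t ws where [simp]: "y = (t, ws)" and t: "t \<in> carrier S" and ws: "ws \<in> L" using y by auto
  define h where "h s us = gcls (T_rels S V) (T_mult S V (s, us) y)" for s us
  have hN: "h s [] = tg (s \<otimes>\<^bsub>S\<^esub> t) ws" for s by (simp add: h_def T_mult_def)
  have hC: "h s (us @ [u]) = tg s (us @ ract V u t # ws)" for s us u by (simp add: h_def T_mult_def)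
  \<comment> \<open>Instances of \<open>hC\<close>, bracketed as the words occur in the relators so
    that rewriting recognises them.\<close>
  have hC1: "h s [u] = tg s (ract V u t # ws)" for s u using hC[of s "[]" u] by simp
  have hC2: "h s (us @ v # vs @ [u]) = tg s (us @ v # vs @ ract V u t # ws)" for s us v vs u
    using hC[of s "us @ v # vs" u] by simp
  have hC3: "h s (us @ v # w # vs @ [u]) = tg s (us @ v # w # vs @ ract V u t # ws)" for s us v w vs u
    using hC[of s "us @ v # w # vs" u] by simp
  have hC4: "h s (us @ [v, u]) = tg s (us @ v # ract V u t # ws)" for s us v u
    using hC[of s "us @ [v]" u] by simp
  have hC5: "h s (v # vs @ [u]) = tg s (v # vs @ ract V u t # ws)" for s v vs u
    using hC[of s "v # vs" u] by simp
  have "respects_rels TA (carrier S \<times> L) (T_rels S V) (\<lambda>(s, us). h s us)"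
  proof (rule T_respects[OF P.abelian_group_axioms])
    show "h s us \<in> carrier TA" if "s \<in> carrier S" "us \<in> L" for s us
      using T_mult_closed[of "(s, us)" y] y that unfolding h_def by (intro P.gcls_closed) simp
    show "h (s \<oplus>\<^bsub>S\<^esub> s') us = h s us \<oplus>\<^bsub>TA\<^esub> h s' us" if "s \<in> carrier S" "s' \<in> carrier S" "us \<in> L" for s s' us
      using that t ws by (cases us rule: rev_cases) (simp_all add: hN hC S.l_distr tg_add)
    show "h s (us @ (v \<oplus>\<^bsub>V\<^esub> w) # vs) = h s (us @ v # vs) \<oplus>\<^bsub>TA\<^esub> h s (us @ w # vs)"
      if "s \<in> carrier S" "us \<in> L" "v \<in> carrier V" "w \<in> carrier V" "vs \<in> L" for s us v w vs
      using that t ws by (cases vs rule: rev_cases) (simp_all add: hC hC2 r_add tg_add_list)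
    show "h (s \<otimes>\<^bsub>S\<^esub> s') (v # vs) = h s (lact V s' v # vs)"
      if "s \<in> carrier S" "s' \<in> carrier S" "v \<in> carrier V" "vs \<in> L" for s s' v vs
      using that t ws by (cases vs rule: rev_cases) (simp_all add: hC1 hC5 tg_head lr_assoc)
    show "h s (us @ ract V v s' # w # vs) = h s (us @ v # lact V s' w # vs)"
      if "s \<in> carrier S" "us \<in> L" "v \<in> carrier V" "s' \<in> carrier S" "w \<in> carrier V" "vs \<in> L" for s us v s' w vs
      using that t ws by (cases vs rule: rev_cases) (simp_all add: hC4 hC3 tg_shift lr_assoc)
  qed
  then show ?thesis by (simp add: h_def case_prod_beta')
qed

lemma T_mult_respects_right:
  assumes x: "x \<in> carrier S \<times> L"
  shows "respects_rels TA (carrier S \<times> L) (T_rels S V) (\<lambda>y. gcls (T_rels S V) (T_mult S V x y))"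
proof -
  obtain s us where [simp]: "x = (s, us)" and s: "s \<in> carrier S" and us: "us \<in> L" using x by auto
  define h where "h t ws = gcls (T_rels S V) (T_mult S V x (t, ws))" for t ws
  have "respects_rels TA (carrier S \<times> L) (T_rels S V) (\<lambda>(t, ws). h t ws)"
  proof (cases us rule: rev_cases)
    case Nil
    then have h: "h t ws = tg (s \<otimes>\<^bsub>S\<^esub> t) ws" for t ws by (simp add: h_def T_mult_def)
    show ?thesis
      by (rule T_respects[OF P.abelian_group_axioms])
        (use s in \<open>simp_all add: h S.r_distr tg_add tg_add_list tg_shift tg_head S.m_assoc[symmetric]\<close>)
  next
    case (snoc us' u)
    then have h: "h t ws = tg s (us' @ ract V u t # ws)" for t ws by (simp add: h_def T_mult_def)
    have us': "us' \<in> L" and u: "u \<in> carrier V" using us snoc by auto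
    show ?thesis
    proof (rule T_respects[OF P.abelian_group_axioms])
      show "h t (ws @ (v \<oplus>\<^bsub>V\<^esub> w) # vs) = h t (ws @ v # vs) \<oplus>\<^bsub>TA\<^esub> h t (ws @ w # vs)"
        if "t \<in> carrier S" "ws \<in> L" "v \<in> carrier V" "w \<in> carrier V" "vs \<in> L" for t ws v w vs
        using tg_add_list[of s "us' @ ract V u t # ws" v w vs] that s us' u by (simp add: h)
      show "h t (ws @ ract V v s' # w # vs) = h t (ws @ v # lact V s' w # vs)"
        if "t \<in> carrier S" "ws \<in> L" "v \<in> carrier V" "s' \<in> carrier S" "w \<in> carrier V" "vs \<in> L" for t ws v s' w vs
        using tg_shift[of s "us' @ ract V u t # ws" v s' w vs] that s us' u by (simp add: h)
    qed (use s us' u in \<open>simp_all add: h r_plus tg_add_list tg_shift r_mult\<close>)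
  qed
  then show ?thesis by (simp add: h_def case_prod_beta')
qed

lemma mult_eq: "monoid.mult TA = pmult (T_rels S V) (T_mult S V)"
  by (simp add: tensor_alg_def)

lemma mult_lift:
  shows "x \<in> carrier TA \<Longrightarrow> (\<lambda>y. x \<otimes>\<^bsub>TA\<^esub> y) \<in> addhom TA TA"
    and "y \<in> carrier TA \<Longrightarrow> (\<lambda>x. x \<otimes>\<^bsub>TA\<^esub> y) \<in> addhom TA TA"
    and "p \<in> carrier S \<times> L \<Longrightarrow> q \<in> carrier S \<times> L \<Longrightarrow>
      gcls (T_rels S V) p \<otimes>\<^bsub>TA\<^esub> gcls (T_rels S V) q = gcls (T_rels S V) (T_mult S V p q)"
  unfolding mult_eq
  subgoal by (rule pmult_lift(1)[OF P.presented_axioms T_mult_closed T_mult_respects_left T_mult_respects_right])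
  subgoal by (rule pmult_lift(2)[OF P.presented_axioms T_mult_closed T_mult_respects_left T_mult_respects_right])
  subgoal by (rule pmult_lift(3)[OF P.presented_axioms T_mult_closed T_mult_respects_left T_mult_respects_right])
  done

lemma mult_gcls: "x \<in> carrier S \<times> L \<Longrightarrow> y \<in> carrier S \<times> L \<Longrightarrow>
    gcls (T_rels S V) x \<otimes>\<^bsub>TA\<^esub> gcls (T_rels S V) y = gcls (T_rels S V) (T_mult S V x y)"
  by (rule mult_lift(3))

lemma T_mult_assoc:
  assumes "x \<in> carrier S \<times> L" "y \<in> carrier S \<times> L" "z \<in> carrier S \<times> L"
  shows "T_mult S V (T_mult S V x y) z = T_mult S V x (T_mult S V y z)"
proof -
  obtain s us t ws p vs where [simp]: "x = (s, us)" "y = (t, ws)" "z = (p, vs)" by (cases x, cases y, cases z)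
  show ?thesis using assms
    by (cases us rule: rev_cases; cases ws rule: rev_cases) (auto simp: T_mult_def S.m_assoc r_mult butlast_append)
qed

lemma one_eq: "\<one>\<^bsub>TA\<^esub> = tg \<one>\<^bsub>S\<^esub> []"
  by (simp add: tensor_alg_def T_base_def)

text \<open>On generators the product is associative already as an operation on words. Both
  bracketings are additive in each argument, so associativity is extended to the whole group one
  argument at a time, from the right to the left.\<close>

lemma ring_TA: "ring TA"
proof -
  have cl: "x \<otimes>\<^bsub>TA\<^esub> y \<in> carrier TA" if "x \<in> carrier TA" "y \<in> carrier TA" for x y
    by (rule addhom_closed[OF mult_lift(1)[OF that(1)] that(2)])
  have ld: "(x \<oplus>\<^bsub>TA\<^esub> y) \<otimes>\<^bsub>TA\<^esub> z = x \<otimes>\<^bsub>TA\<^esub> z \<oplus>\<^bsub>TA\<^esub> y \<otimes>\<^bsub>TA\<^esub> z" if "x \<in> carrier TA" "y \<in> carrier TA" "z \<in> carrier TA" for x y z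
    by (rule addhom_add[OF mult_lift(2)[OF that(3)] that(1,2)])
  have rd: "z \<otimes>\<^bsub>TA\<^esub> (x \<oplus>\<^bsub>TA\<^esub> y) = z \<otimes>\<^bsub>TA\<^esub> x \<oplus>\<^bsub>TA\<^esub> z \<otimes>\<^bsub>TA\<^esub> y" if "x \<in> carrier TA" "y \<in> carrier TA" "z \<in> carrier TA" for x y z
    by (rule addhom_add[OF mult_lift(1)[OF that(3)] that(1,2)])
  note A = P.abelian_group_axioms
  let ?g = "gcls (T_rels S V)" and ?G = "carrier S \<times> L"
  have as1: "(?g x \<otimes>\<^bsub>TA\<^esub> ?g y) \<otimes>\<^bsub>TA\<^esub> z = ?g x \<otimes>\<^bsub>TA\<^esub> (?g y \<otimes>\<^bsub>TA\<^esub> z)" if "x \<in> ?G" "y \<in> ?G" "z \<in> carrier TA" for x y z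
  proof -
    have e: "(?g x \<otimes>\<^bsub>TA\<^esub> ?g y) \<otimes>\<^bsub>TA\<^esub> ?g w = ?g x \<otimes>\<^bsub>TA\<^esub> (?g y \<otimes>\<^bsub>TA\<^esub> ?g w)" if w: "w \<in> ?G" for w
      using \<open>x \<in> ?G\<close> \<open>y \<in> ?G\<close> w by (simp only: mult_gcls T_mult_closed T_mult_assoc)
    have c: "?g x \<in> carrier TA" "?g y \<in> carrier TA" using that(1,2) by (auto intro: P.gcls_closed)
    show ?thesis
      by (rule P.hom_ext[OF A mult_lift(1)[OF cl[OF c]] addhom_comp[OF mult_lift(1)[OF c(2)] mult_lift(1)[OF c(1)]] e that(3)])
  qed
  have as2: "(?g x \<otimes>\<^bsub>TA\<^esub> y) \<otimes>\<^bsub>TA\<^esub> z = ?g x \<otimes>\<^bsub>TA\<^esub> (y \<otimes>\<^bsub>TA\<^esub> z)" if "x \<in> ?G" "y \<in> carrier TA" "z \<in> carrier TA" for x y z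
  proof -
    have c: "?g x \<in> carrier TA" using that(1) by (rule P.gcls_closed)
    show ?thesis
      by (rule P.hom_ext[OF A addhom_comp[OF mult_lift(1)[OF c] mult_lift(2)[OF that(3)]] addhom_comp[OF mult_lift(2)[OF that(3)] mult_lift(1)[OF c]] as1[OF that(1) _ that(3)] that(2)])
  qed
  have as: "(x \<otimes>\<^bsub>TA\<^esub> y) \<otimes>\<^bsub>TA\<^esub> z = x \<otimes>\<^bsub>TA\<^esub> (y \<otimes>\<^bsub>TA\<^esub> z)" if "x \<in> carrier TA" "y \<in> carrier TA" "z \<in> carrier TA" for x y z
    by (rule P.hom_ext[OF A addhom_comp[OF mult_lift(2)[OF that(2)] mult_lift(2)[OF that(3)]] mult_lift(2)[OF cl[OF that(2,3)]] as2[OF _ that(2,3)] that(1)])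
  have o: "\<one>\<^bsub>TA\<^esub> \<in> carrier TA" by (simp add: one_eq)
  have "\<one>\<^bsub>TA\<^esub> \<otimes>\<^bsub>TA\<^esub> ?g x = ?g x" if "x \<in> ?G" for x
    using that by (auto simp: one_eq mult_gcls T_mult_def)
  from P.hom_ext[OF A mult_lift(1)[OF o] addhom_id this] have lo: "\<one>\<^bsub>TA\<^esub> \<otimes>\<^bsub>TA\<^esub> x = x" if "x \<in> carrier TA" for x
    using that by blast
  have "?g x \<otimes>\<^bsub>TA\<^esub> \<one>\<^bsub>TA\<^esub> = ?g x" if "x \<in> ?G" for x
  proof -
    obtain s us where [simp]: "x = (s, us)" by (cases x)
    show ?thesis using that by (cases us rule: rev_cases) (auto simp: one_eq mult_gcls T_mult_def)
  qed
  from P.hom_ext[OF A mult_lift(2)[OF o] addhom_id this] have ro: "x \<otimes>\<^bsub>TA\<^esub> \<one>\<^bsub>TA\<^esub> = x" if "x \<in> carrier TA" for x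
    using that by blast
  have "monoid TA" by (rule monoidI) (fact cl o as lo ro)+
  then show ?thesis by (rule ringI[OF A]) (fact ld rd)+
qed

sublocale TR: ring TA by (rule ring_TA)

lemma base_closed [simp]: "s \<in> carrier S \<Longrightarrow> T_base S V s \<in> carrier TA"
  by (simp add: T_base_def)

lemma incl_closed [simp]: "v \<in> carrier V \<Longrightarrow> T_incl S V v \<in> carrier TA"
  by (simp add: T_incl_def)

lemma base_ring_hom: "T_base S V \<in> ring_hom S TA"
  by (rule ring_hom_memI) (simp_all add: T_base_def tg_add mult_gcls T_mult_def one_eq)

lemma incl_addhom: "T_incl S V \<in> addhom V TA"
  using tg_add_list[of "\<one>\<^bsub>S\<^esub>" "[]" _ _ "[]"] by (intro addhomI) (simp_all add: T_incl_def)

lemma incl_lact: "s \<in> carrier S \<Longrightarrow> v \<in> carrier V \<Longrightarrow> T_incl S V (lact V s v) = T_base S V s \<otimes>\<^bsub>TA\<^esub> T_incl S V v"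
  using tg_head[of "\<one>\<^bsub>S\<^esub>" s v "[]"] by (simp add: T_incl_def T_base_def mult_gcls T_mult_def)

lemma incl_ract: "s \<in> carrier S \<Longrightarrow> v \<in> carrier V \<Longrightarrow> T_incl S V (ract V v s) = T_incl S V v \<otimes>\<^bsub>TA\<^esub> T_base S V s"
  by (simp add: T_incl_def T_base_def mult_gcls T_mult_def)

lemma tg_snoc: "\<lbrakk>s \<in> carrier S; vs \<in> L; v \<in> carrier V\<rbrakk> \<Longrightarrow> tg s (vs @ [v]) = tg s vs \<otimes>\<^bsub>TA\<^esub> T_incl S V v"
  by (cases vs rule: rev_cases) (simp_all add: T_incl_def mult_gcls T_mult_def)

lemma TA_induct [consumes 1, case_names base incl mult diff]:
  assumes "x \<in> carrier TA"
    and b: "\<And>s. s \<in> carrier S \<Longrightarrow> Q (T_base S V s)" and i: "\<And>v. v \<in> carrier V \<Longrightarrow> Q (T_incl S V v)"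
    and m: "\<And>x y. \<lbrakk>x \<in> carrier TA; y \<in> carrier TA; Q x; Q y\<rbrakk> \<Longrightarrow> Q (x \<otimes>\<^bsub>TA\<^esub> y)"
    and d: "\<And>x y. \<lbrakk>x \<in> carrier TA; y \<in> carrier TA; Q x; Q y\<rbrakk> \<Longrightarrow> Q (x \<ominus>\<^bsub>TA\<^esub> y)"
  shows "Q x"
  using assms(1)
proof (induction rule: P.gen_induct)
  case (gen g)
  obtain s vs where g: "g = (s, vs)" "s \<in> carrier S" "vs \<in> L" using gen by auto
  have "Q (tg s vs)" using g(3)
  proof (induction vs rule: rev_induct)
    case Nil show ?case using b[OF g(2)] by (simp add: T_base_def)
  next
    case (snoc v vs)
    then show ?case using m[of "tg s vs" "T_incl S V v"] i[of v] g(2) by (simp add: tg_snoc)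
  qed
  then show ?case using g by simp
next
  case (diff x y) then show ?case by (rule d)
next
  case zero
  \<comment> \<open>Zero is a difference of units, so the induction needs no case of its own for
    it.\<close>
  have "T_base S V \<one>\<^bsub>S\<^esub> \<ominus>\<^bsub>TA\<^esub> T_base S V \<one>\<^bsub>S\<^esub> = \<zero>\<^bsub>TA\<^esub>"
    by (simp add: P.minus_eq_zero_iff)
  moreover have "Q (T_base S V \<one>\<^bsub>S\<^esub> \<ominus>\<^bsub>TA\<^esub> T_base S V \<one>\<^bsub>S\<^esub>)"
    by (rule d) (use b[of "\<one>\<^bsub>S\<^esub>"] in simp_all)
  ultimately show ?case by (simp only:)
qed

text \<open>A word goes to the product of the images of its coefficient and its letters. Three uses
  follow: derivations by way of square-zero extensions, the sign automorphism, and the augmentation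
  onto B.\<close>

lemma T_universal:
  assumes C: "ring C" and f0: "f0 \<in> ring_hom S C" and f1: "f1 \<in> addhom V C"
    and fl: "\<And>s v. s \<in> carrier S \<Longrightarrow> v \<in> carrier V \<Longrightarrow> f1 (lact V s v) = f0 s \<otimes>\<^bsub>C\<^esub> f1 v"
    and fr: "\<And>s v. s \<in> carrier S \<Longrightarrow> v \<in> carrier V \<Longrightarrow> f1 (ract V v s) = f1 v \<otimes>\<^bsub>C\<^esub> f0 s"
  shows "\<exists>F. F \<in> ring_hom TA C \<and> (\<forall>s\<in>carrier S. F (T_base S V s) = f0 s) \<and> (\<forall>v\<in>carrier V. F (T_incl S V v) = f1 v)"
proof -
  interpret C: ring C by fact
  have f0c [simp]: "s \<in> carrier S \<Longrightarrow> f0 s \<in> carrier C" for s using ring_hom_closed[OF f0] .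
  have f1c [simp]: "v \<in> carrier V \<Longrightarrow> f1 v \<in> carrier C" for v using addhom_closed[OF f1] .
  define lp where "lp vs = foldr (\<lambda>v c. f1 v \<otimes>\<^bsub>C\<^esub> c) vs \<one>\<^bsub>C\<^esub>" for vs
  have lp0 [simp]: "lp [] = \<one>\<^bsub>C\<^esub>" and lp1 [simp]: "lp (v # vs) = f1 v \<otimes>\<^bsub>C\<^esub> lp vs" for v vs by (simp_all add: lp_def)
  have lpc [simp]: "lp vs \<in> carrier C" if "vs \<in> L" for vs using that by (induction vs) auto
  have lpa: "lp (us @ vs) = lp us \<otimes>\<^bsub>C\<^esub> lp vs" if "us \<in> L" "vs \<in> L" for us vs
    using that by (induction us) (auto simp: C.m_assoc)
  let ?h = "\<lambda>s vs. f0 s \<otimes>\<^bsub>C\<^esub> lp vs"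
  have r: "respects_rels C (carrier S \<times> L) (T_rels S V) (\<lambda>(s, vs). ?h s vs)"
    by (rule T_respects[OF C.abelian_group_axioms])
      (simp_all add: lpa addhom_add[OF f1] C.l_distr C.r_distr ring_hom_add[OF f0] ring_hom_mult[OF f0] C.m_assoc fl fr)
  have "\<exists>F. F \<in> addhom TA C \<and> (\<forall>x\<in>carrier S \<times> L. F (gcls (T_rels S V) x) = (\<lambda>(s, vs). ?h s vs) x)"
  proof (rule P.lift[OF C.abelian_group_axioms _ r])
    fix x assume x: "x \<in> carrier S \<times> L"
    obtain s vs where "x = (s, vs)" by (cases x)
    then show "(\<lambda>(s, vs). ?h s vs) x \<in> carrier C" using x lpc[of vs] by simp
  qed
  then obtain F where F: "F \<in> addhom TA C" and Fg: "\<And>s vs. s \<in> carrier S \<Longrightarrow> vs \<in> L \<Longrightarrow> F (tg s vs) = ?h s vs" by auto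
  have Fb: "F (T_base S V s) = f0 s" if "s \<in> carrier S" for s using Fg[of s "[]"] that by (simp add: T_base_def)
  have Fi: "F (T_incl S V v) = f1 v" if "v \<in> carrier V" for v
    using Fg[of "\<one>\<^bsub>S\<^esub>" "[v]"] that by (simp add: T_incl_def ring_hom_one[OF f0])
  have Fm0: "F (gcls (T_rels S V) x \<otimes>\<^bsub>TA\<^esub> gcls (T_rels S V) y) = F (gcls (T_rels S V) x) \<otimes>\<^bsub>C\<^esub> F (gcls (T_rels S V) y)"
    if "x \<in> carrier S \<times> L" "y \<in> carrier S \<times> L" for x y
  proof -
    obtain s us t ws where [simp]: "x = (s, us)" "y = (t, ws)" by (cases x, cases y)
    show ?thesis using that
      by (cases us rule: rev_cases) (auto simp: mult_gcls T_mult_def Fg lpa fr ring_hom_mult[OF f0] C.m_assoc simp del: in_lists_conv_set)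
  qed
  have m: "(\<lambda>y. c \<otimes>\<^bsub>C\<^esub> F y) \<in> addhom TA C" "(\<lambda>y. F y \<otimes>\<^bsub>C\<^esub> c) \<in> addhom TA C" if "c \<in> carrier C" for c
    using that addhom_closed[OF F] addhom_add[OF F] by (auto intro!: addhomI simp: C.l_distr C.r_distr)
  have Fm1: "F (gcls (T_rels S V) x \<otimes>\<^bsub>TA\<^esub> y) = F (gcls (T_rels S V) x) \<otimes>\<^bsub>C\<^esub> F y"
    if "x \<in> carrier S \<times> L" "y \<in> carrier TA" for x y
    by (rule P.hom_ext[OF C.abelian_group_axioms addhom_comp[OF mult_lift(1)[OF P.gcls_closed[OF that(1)]] F] m(1)[OF addhom_closed[OF F P.gcls_closed[OF that(1)]]] Fm0[OF that(1)] that(2)])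
  have Fm: "F (x \<otimes>\<^bsub>TA\<^esub> y) = F x \<otimes>\<^bsub>C\<^esub> F y" if "x \<in> carrier TA" "y \<in> carrier TA" for x y
    by (rule P.hom_ext[OF C.abelian_group_axioms addhom_comp[OF mult_lift(2)[OF that(2)] F] m(2)[OF addhom_closed[OF F that(2)]] Fm1[OF _ that(2)] that(1)])
  have "F \<in> ring_hom TA C"
    by (rule ring_hom_memI) (use addhom_closed[OF F] addhom_add[OF F] Fm Fg[of "\<one>\<^bsub>S\<^esub>" "[]"] ring_hom_one[OF f0] in \<open>simp_all add: one_eq\<close>)
  then show ?thesis using Fb Fi by blast
qed

end

section \<open>Derivations of tensor algebras\<close>

text \<open>The square-zero extension of A by the bimodule W. Its purpose is that x maps to (x, D x)
  multiplicatively exactly when D satisfies the Leibniz rule, so derivations come from the universal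
  property for ring homomorphisms.\<close>

definition sqz :: "('a, 'x) ring_scheme \<Rightarrow> ('w, 'y) ring_scheme \<Rightarrow> ('a \<Rightarrow> 'w \<Rightarrow> 'w) \<Rightarrow> ('w \<Rightarrow> 'a \<Rightarrow> 'w) \<Rightarrow> ('a \<times> 'w) ring" where
  "sqz A W l r = \<lparr>carrier = carrier A \<times> carrier W,
     monoid.mult = (\<lambda>x y. (fst x \<otimes>\<^bsub>A\<^esub> fst y, r (snd x) (fst y) \<oplus>\<^bsub>W\<^esub> l (fst x) (snd y))), one = (\<one>\<^bsub>A\<^esub>, \<zero>\<^bsub>W\<^esub>),
     ring.zero = (\<zero>\<^bsub>A\<^esub>, \<zero>\<^bsub>W\<^esub>), add = (\<lambda>x y. (fst x \<oplus>\<^bsub>A\<^esub> fst y, snd x \<oplus>\<^bsub>W\<^esub> snd y))\<rparr>"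

lemma (in biact) ring_sqz: "ring (sqz S V l r)"
proof (rule ringI)
  show "abelian_group (sqz S V l r)"
  proof (rule abelian_groupI)
    fix x assume "x \<in> carrier (sqz S V l r)"
    then show "\<exists>y\<in>carrier (sqz S V l r). y \<oplus>\<^bsub>sqz S V l r\<^esub> x = \<zero>\<^bsub>sqz S V l r\<^esub>"
      by (intro bexI[of _ "(\<ominus>\<^bsub>S\<^esub> fst x, \<ominus> snd x)"]) (auto simp: sqz_def S.l_neg V.l_neg)
  qed (auto simp: sqz_def S.a_ac V.a_ac)
  show "monoid (sqz S V l r)"
    by (rule monoidI) (auto simp: sqz_def S.m_assoc r_add l_add r_mult l_mult lr_assoc V.a_assoc)
qed (auto simp: sqz_def S.l_distr S.r_distr l_add r_add l_plus r_plus V.a_ac)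

text \<open>The conditions on \<delta> and \<mu> say that the pairs (s, \<delta> s) and (v, \<mu> v)
  in the square-zero extension are compatible with the actions of S on V. \<open>T_universal\<close>
  then produces a ring homomorphism whose second component is the derivation.\<close>

lemma (in talg) derivation_extends:
  assumes W: "biact TA W l r" and d: "\<delta> \<in> addhom S W" and m: "\<mu> \<in> addhom V W"
    and dl: "\<And>s t. s \<in> carrier S \<Longrightarrow> t \<in> carrier S \<Longrightarrow> \<delta> (s \<otimes>\<^bsub>S\<^esub> t) = r (\<delta> s) (T_base S V t) \<oplus>\<^bsub>W\<^esub> l (T_base S V s) (\<delta> t)"
    and ml: "\<And>s v. s \<in> carrier S \<Longrightarrow> v \<in> carrier V \<Longrightarrow> \<mu> (lact V s v) = r (\<delta> s) (T_incl S V v) \<oplus>\<^bsub>W\<^esub> l (T_base S V s) (\<mu> v)"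
    and mr: "\<And>s v. s \<in> carrier S \<Longrightarrow> v \<in> carrier V \<Longrightarrow> \<mu> (ract V v s) = r (\<mu> v) (T_base S V s) \<oplus>\<^bsub>W\<^esub> l (T_incl S V v) (\<delta> s)"
  shows "\<exists>D. D \<in> addhom TA W \<and> (\<forall>x\<in>carrier TA. \<forall>y\<in>carrier TA. D (x \<otimes>\<^bsub>TA\<^esub> y) = r (D x) y \<oplus>\<^bsub>W\<^esub> l x (D y)) \<and>
    (\<forall>s\<in>carrier S. D (T_base S V s) = \<delta> s) \<and> (\<forall>v\<in>carrier V. D (T_incl S V v) = \<mu> v)"
proof -
  interpret W: biact TA W l r by fact
  let ?C = "sqz TA W l r"
  interpret C: ring ?C by (rule W.ring_sqz)
  have dc [simp]: "s \<in> carrier S \<Longrightarrow> \<delta> s \<in> carrier W" for s using addhom_closed[OF d] .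
  have mc [simp]: "s \<in> carrier V \<Longrightarrow> \<mu> s \<in> carrier W" for s using addhom_closed[OF m] .
  \<comment> \<open>The Leibniz rule for the product of the unit with itself makes the value at the
    unit equal to its own double, so it vanishes; without this the unit would not go to the
    unit.\<close>
  have "\<delta> \<one>\<^bsub>S\<^esub> = \<delta> \<one>\<^bsub>S\<^esub> \<oplus>\<^bsub>W\<^esub> \<delta> \<one>\<^bsub>S\<^esub>"
    using dl[of "\<one>\<^bsub>S\<^esub>" "\<one>\<^bsub>S\<^esub>"] by (simp add: ring_hom_one[OF base_ring_hom])
  then have d1: "\<delta> \<one>\<^bsub>S\<^esub> = \<zero>\<^bsub>W\<^esub>" using dc[of "\<one>\<^bsub>S\<^esub>"] W.V.add.l_cancel_one[of "\<delta> \<one>\<^bsub>S\<^esub>" "\<delta> \<one>\<^bsub>S\<^esub>"] by simp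
  have f0: "(\<lambda>s. (T_base S V s, \<delta> s)) \<in> ring_hom S ?C"
    by (rule ring_hom_memI)
      (simp_all add: sqz_def ring_hom_add[OF base_ring_hom] ring_hom_mult[OF base_ring_hom] ring_hom_one[OF base_ring_hom] addhom_add[OF d] dl d1)
  have f1: "(\<lambda>v. (T_incl S V v, \<mu> v)) \<in> addhom V ?C"
    by (rule addhomI) (simp_all add: sqz_def addhom_add[OF incl_addhom] addhom_add[OF m])
  have "\<exists>F. F \<in> ring_hom TA ?C \<and> (\<forall>s\<in>carrier S. F (T_base S V s) = (T_base S V s, \<delta> s)) \<and> (\<forall>v\<in>carrier V. F (T_incl S V v) = (T_incl S V v, \<mu> v))"
    by (rule T_universal[OF C.ring_axioms f0 f1]) (simp_all add: sqz_def incl_lact incl_ract ml mr)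
  then obtain F where F: "F \<in> ring_hom TA ?C" "\<forall>s\<in>carrier S. F (T_base S V s) = (T_base S V s, \<delta> s)" "\<forall>v\<in>carrier V. F (T_incl S V v) = (T_incl S V v, \<mu> v)"
    by blast
  have Fc: "F x \<in> carrier TA \<times> carrier W" if "x \<in> carrier TA" for x
    using ring_hom_closed[OF F(1) that] by (simp add: sqz_def)
  have Fc1: "fst (F x) \<in> carrier TA" and Fc2: "snd (F x) \<in> carrier W" if "x \<in> carrier TA" for x
    using Fc[OF that] by (simp_all add: mem_Times_iff)
  have Fadd: "F (x \<oplus>\<^bsub>TA\<^esub> y) = (fst (F x) \<oplus>\<^bsub>TA\<^esub> fst (F y), snd (F x) \<oplus>\<^bsub>W\<^esub> snd (F y))" if "x \<in> carrier TA" "y \<in> carrier TA" for x y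
    using ring_hom_add[OF F(1) that] by (simp add: sqz_def)
  have Fmult: "F (x \<otimes>\<^bsub>TA\<^esub> y) = (fst (F x) \<otimes>\<^bsub>TA\<^esub> fst (F y), r (snd (F x)) (fst (F y)) \<oplus>\<^bsub>W\<^esub> l (fst (F x)) (snd (F y)))" if "x \<in> carrier TA" "y \<in> carrier TA" for x y
    using ring_hom_mult[OF F(1) that] by (simp add: sqz_def)
  have fstF: "(\<lambda>x. fst (F x)) \<in> addhom TA TA"
    by (intro addhomI) (simp_all add: Fadd Fc1)
  \<comment> \<open>The first component is multiplicative and additive and fixes the generators, so
    it is the identity. Only then does the second component obey the Leibniz rule for the original
    actions.\<close>
  have fst: "fst (F x) = x" if "x \<in> carrier TA" for x
    using that
  proof (induction rule: TA_induct)
    case (diff x y)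
    then show ?case using addhom_minus[OF P.abelian_group_axioms P.abelian_group_axioms fstF] by simp
  qed (simp_all add: F Fmult)
  show ?thesis
  proof (intro exI[of _ "\<lambda>x. snd (F x)"] conjI ballI)
    show "(\<lambda>x. snd (F x)) \<in> addhom TA W"
      by (intro addhomI) (simp_all add: Fadd Fc2)
  qed (simp_all add: Fmult fst F)
qed

section \<open>Koszul signs\<close>

text \<open>\<sigma> acts by the parity sign and \<open>h\<close> is one half. The weight spaces are
  subgroups that span A; the existence of \<sigma> as a map on all of A keeps even and odd elements
  apart.\<close>

locale superalg = kalg K R A
  for K :: "('k, 'x) ring_scheme" and R :: "('k, 'r, 'y) alg_scheme" and A :: "('r, 'a, 'z) galg_scheme" (structure) +
  fixes \<sigma> :: "'a \<Rightarrow> 'a" and h :: 'k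
  assumes wt_carrier: "\<And>p a. a \<in> wt A p \<Longrightarrow> a \<in> carrier A"
    and wt_zero: "\<And>p. \<zero> \<in> wt A p"
    and wt_add: "\<And>p a b. a \<in> wt A p \<Longrightarrow> b \<in> wt A p \<Longrightarrow> a \<oplus> b \<in> wt A p"
    and wt_inv: "\<And>p a. a \<in> wt A p \<Longrightarrow> \<ominus> a \<in> wt A p"
    and wt_mult: "\<And>p q a b. a \<in> wt A p \<Longrightarrow> b \<in> wt A q \<Longrightarrow> a \<otimes> b \<in> wt A (p + q)"
    and wt_umap: "\<And>t. t \<in> carrier R \<Longrightarrow> umap A t \<in> wt A 0"
    and wt_span: "carrier A = span A (\<Union>p. wt A p)"
    and \<sigma>_hom: "\<sigma> \<in> ring_hom A A"
    and \<sigma>\<sigma>: "\<And>a. a \<in> carrier A \<Longrightarrow> \<sigma> (\<sigma> a) = a"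
    and \<sigma>_wt: "\<And>p a. a \<in> wt A p \<Longrightarrow> \<sigma> a = ksgn A p a"
    and h_K: "h \<in> carrier K" and h_half: "kmap R A h \<oplus> kmap R A h = \<one>"
begin

abbreviation TT :: "('a, ('a \<times> 'a) pres) bimod" where "TT \<equiv> tens K R A"

lemmas grp_T = T.abelian_group_axioms and grp_A = A.abelian_group_axioms

text \<open>The n-th power of the sign automorphism. On the carrier it coincides with
  \<open>twist A n\<close>, and being given outright it is visibly a ring homomorphism.\<close>

definition sg :: "int \<Rightarrow> 'a \<Rightarrow> 'a" where "sg n a = (if even n then a else \<sigma> a)"

lemma sg_hom: "sg n \<in> ring_hom A A"
proof -
  have "(\<lambda>a. a) \<in> ring_hom A A" by (rule ring_hom_memI) simp_all
  then show ?thesis using \<sigma>_hom by (cases "even n") (simp_all add: sg_def[abs_def])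
qed

lemma sg_closed [simp]: "a \<in> carrier A \<Longrightarrow> sg n a \<in> carrier A"
  by (rule ring_hom_closed[OF sg_hom])

lemma sg_addhom: "sg n \<in> addhom A A"
  by (rule addhomI) (simp_all add: ring_hom_add[OF sg_hom])

lemma sg_mult: "a \<in> carrier A \<Longrightarrow> b \<in> carrier A \<Longrightarrow> sg n (a \<otimes> b) = sg n a \<otimes> sg n b"
  by (rule ring_hom_mult[OF sg_hom])

lemma sg_add: "a \<in> carrier A \<Longrightarrow> b \<in> carrier A \<Longrightarrow> sg n (a \<oplus> b) = sg n a \<oplus> sg n b"
  by (rule ring_hom_add[OF sg_hom])

lemma sg_one [simp]: "sg n \<one> = \<one>"
  by (rule ring_hom_one[OF sg_hom])

lemma sg_zero [simp]: "sg 0 a = a"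
  by (simp add: sg_def)

lemma sg_sg: "a \<in> carrier A \<Longrightarrow> sg m (sg n a) = sg (m + n) a"
  by (auto simp: sg_def \<sigma>\<sigma>)

lemma sg_wt: "a \<in> wt A p \<Longrightarrow> sg n a = ksgn A (n * p) a"
  by (auto simp: sg_def \<sigma>_wt ksgn_def)

lemma sg_wt_closed: "a \<in> wt A p \<Longrightarrow> sg n a \<in> wt A p"
  by (simp add: sg_wt ksgn_def wt_inv)

lemma A_ext:
  assumes "abelian_group W" "f \<in> addhom A W" "g \<in> addhom A W" "\<And>p a. a \<in> wt A p \<Longrightarrow> f a = g a" "a \<in> carrier A"
  shows "f a = g a"
  by (rule addhom_eq_on_span[OF grp_A assms(1-3), of "\<Union>p. wt A p"]) (use assms(4,5) wt_span wt_carrier in auto)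

lemma twist_eq: "a \<in> carrier A \<Longrightarrow> twist A n a = sg n a"
proof -
  have "twist A n = restrict (sg n) (carrier A)"
    unfolding twist_def
  proof (rule the_add_map_eq[OF sg_addhom _ grp_A])
    show "\<forall>p. \<forall>a\<in>wt A p. restrict (sg n) (carrier A) a = ksgn A (n * p) a"
      by (auto simp: sg_wt[symmetric] wt_carrier)
    fix g assume g: "g \<in> addhom A A" "\<forall>p. \<forall>a\<in>wt A p. g a = ksgn A (n * p) a"
    have "g a = sg n a" if "a \<in> wt A p" for p a using g(2) that by (simp add: sg_wt)
    then show "\<forall>x\<in>carrier A. g x = sg n x" by (intro ballI, rule A_ext[OF grp_A g(1) sg_addhom])
  qed
  then show "a \<in> carrier A \<Longrightarrow> twist A n a = sg n a" by simp
qed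

lemma kmap_wt: "c \<in> carrier K \<Longrightarrow> kmap R A c \<in> wt A 0"
  by (simp add: kmap_def wt_umap kmap_in_R)

lemma sg_kmap [simp]: "c \<in> carrier K \<Longrightarrow> sg n (kmap R A c) = kmap R A c"
  by (simp add: sg_wt[OF kmap_wt] ksgn_def)

lemma pt_zero [simp]: "v \<in> carrier A \<Longrightarrow> pt \<zero> v = \<zero>\<^bsub>TT\<^esub>" "v \<in> carrier A \<Longrightarrow> pt v \<zero> = \<zero>\<^bsub>TT\<^esub>"
proof -
  assume v: "v \<in> carrier A"
  have "(\<lambda>u. pt u v) \<in> addhom A TT" "pt v \<in> addhom A TT"
    using v by (auto intro!: addhomI simp: pt_add_left pt_add_right)
  then show "pt \<zero> v = \<zero>\<^bsub>TT\<^esub>" "pt v \<zero> = \<zero>\<^bsub>TT\<^esub>"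
    using addhom_zero[OF grp_A grp_T] by auto
qed

lemma pt_inv:
  assumes "u \<in> carrier A" "v \<in> carrier A"
  shows "pt (\<ominus> u) v = \<ominus>\<^bsub>TT\<^esub> pt u v" "pt u (\<ominus> v) = \<ominus>\<^bsub>TT\<^esub> pt u v"
proof -
  have 1: "(\<lambda>u. pt u v) \<in> addhom A TT" and 2: "pt u \<in> addhom A TT"
    using assms by (auto intro!: addhomI simp: pt_add_left pt_add_right)
  show "pt (\<ominus> u) v = \<ominus>\<^bsub>TT\<^esub> pt u v" "pt u (\<ominus> v) = \<ominus>\<^bsub>TT\<^esub> pt u v"
    using addhom_inv[OF grp_A grp_T 1 assms(1)] addhom_inv[OF grp_A grp_T 2 assms(2)] by auto
qed

lemma pt_ksgn:
  assumes "u \<in> carrier A" "v \<in> carrier A"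
  shows "pt (ksgn A n u) v = ksgn TT n (pt u v)" "pt u (ksgn A n v) = ksgn TT n (pt u v)"
  using assms by (simp_all add: ksgn_def pt_inv)

lemma ksgn_mult: "u \<in> carrier A \<Longrightarrow> v \<in> carrier A \<Longrightarrow> ksgn A n u \<otimes> v = ksgn A n (u \<otimes> v)"
  "u \<in> carrier A \<Longrightarrow> v \<in> carrier A \<Longrightarrow> u \<otimes> ksgn A n v = ksgn A n (u \<otimes> v)"
  by (simp_all add: ksgn_def A.l_minus A.r_minus)

text \<open>The sign of moving a past u may be charged to either of the two. In the definition of
  the inner actions it is attached to the acting element; after the swap it sits on the tensor
  factor and the formula is additive in that factor.\<close>

lemma pt_sign_swap:
  assumes "u \<in> wt A p" "a \<in> wt A q" "v \<in> carrier A"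
  shows "pt u (sg p a \<otimes> v) = pt (sg q u) (a \<otimes> v)" "pt (v \<otimes> sg p a) u = pt (v \<otimes> a) (sg q u)"
  using assms wt_carrier[OF assms(1)] wt_carrier[OF assms(2)]
  by (simp_all add: sg_wt ksgn_mult pt_ksgn mult.commute)

definition ev :: "'a \<Rightarrow> 'a" where "ev a = kmap R A h \<otimes> (a \<oplus> \<sigma> a)"
definition od :: "'a \<Rightarrow> 'a" where "od a = kmap R A h \<otimes> (a \<ominus> \<sigma> a)"

lemma \<sigma>_closed [simp]: "a \<in> carrier A \<Longrightarrow> \<sigma> a \<in> carrier A"
  by (rule ring_hom_closed[OF \<sigma>_hom])

lemma half_double: "a \<in> carrier A \<Longrightarrow> kmap R A h \<otimes> (a \<oplus> a) = a"
  using h_K h_half A.l_distr[of "kmap R A h" "kmap R A h" a] by (simp add: A.r_distr)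

lemma ev_od_addhom: "ev \<in> addhom A A" "od \<in> addhom A A"
proof -
  have s: "\<sigma> \<in> addhom A A" by (rule addhomI) (simp_all add: ring_hom_add[OF \<sigma>_hom])
  have k: "(\<lambda>a. kmap R A h \<otimes> a) \<in> addhom A A" by (rule addhomI) (simp_all add: h_K A.r_distr)
  show "ev \<in> addhom A A" unfolding ev_def[abs_def]
    by (rule addhom_comp[OF addhom_sum2[OF grp_A addhom_id s] k])
  show "od \<in> addhom A A" unfolding od_def[abs_def] a_minus_def
    by (rule addhom_comp[OF addhom_sum2[OF grp_A addhom_id addhom_neg[OF grp_A s]] k])
qed

lemma ev_od_closed [simp]: "a \<in> carrier A \<Longrightarrow> ev a \<in> carrier A" "a \<in> carrier A \<Longrightarrow> od a \<in> carrier A"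
  using ev_od_addhom[THEN addhom_closed] by auto

lemma ev_od_wt:
  assumes "a \<in> wt A p"
  shows "ev a = (if even p then a else \<zero>)" "od a = (if even p then \<zero> else a)"
  using assms wt_carrier[OF assms] h_K
  by (simp_all add: ev_def od_def \<sigma>_wt ksgn_def half_double a_minus_def A.r_neg)

lemma ev_od_kmap:
  assumes "a \<in> carrier A" "c \<in> carrier K"
  shows "ev (a \<otimes> kmap R A c) = ev a \<otimes> kmap R A c" "od (a \<otimes> kmap R A c) = od a \<otimes> kmap R A c"
    "ev (kmap R A c \<otimes> a) = kmap R A c \<otimes> ev a" "od (kmap R A c \<otimes> a) = kmap R A c \<otimes> od a"
proof -
  have s: "\<sigma> (kmap R A c) = kmap R A c" using sg_kmap[of c 1] assms by (simp add: sg_def)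
  show 1: "ev (a \<otimes> kmap R A c) = ev a \<otimes> kmap R A c"
    and 2: "od (a \<otimes> kmap R A c) = od a \<otimes> kmap R A c"
    using assms h_K
    by (simp_all add: ev_def od_def ring_hom_mult[OF \<sigma>_hom] s A.m_assoc A.l_distr a_minus_def A.l_minus)
  show "ev (kmap R A c \<otimes> a) = kmap R A c \<otimes> ev a" "od (kmap R A c \<otimes> a) = kmap R A c \<otimes> od a"
    using assms 1 2 by (simp_all add: kmap_comm)
qed

text \<open>A prescription depending on the parity of one factor becomes biadditive when that factor
  is split as \<open>ev\<close> plus \<open>od\<close>. On a homogeneous element one of the two
  projections is zero and the other the identity, which recovers the prescription.\<close>

lemma tens_lift_parity:
  assumes W: "abelian_group W" and c: "\<And>i u v. u \<in> carrier A \<Longrightarrow> v \<in> carrier A \<Longrightarrow> f i u v \<in> carrier W"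
    and a1: "\<And>i u u' v. \<lbrakk>u \<in> carrier A; u' \<in> carrier A; v \<in> carrier A\<rbrakk> \<Longrightarrow> f i (u \<oplus> u') v = f i u v \<oplus>\<^bsub>W\<^esub> f i u' v"
    and a2: "\<And>i u v v'. \<lbrakk>u \<in> carrier A; v \<in> carrier A; v' \<in> carrier A\<rbrakk> \<Longrightarrow> f i u (v \<oplus> v') = f i u v \<oplus>\<^bsub>W\<^esub> f i u v'"
    and b: "\<And>i u v c. \<lbrakk>u \<in> carrier A; v \<in> carrier A; c \<in> carrier K\<rbrakk> \<Longrightarrow> f i (u \<otimes> kmap R A c) v = f i u (kmap R A c \<otimes> v)"
  shows "\<exists>L. L \<in> addhom TT W \<and> (\<forall>p. \<forall>u\<in>wt A p. \<forall>v\<in>carrier A. L (pt u v) = f (even p) u v)" (is ?left)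
    and "\<exists>L. L \<in> addhom TT W \<and> (\<forall>p. \<forall>u\<in>carrier A. \<forall>v\<in>wt A p. L (pt u v) = f (even p) u v)" (is ?right)
proof -
  interpret W: abelian_group W by fact
  have z: "f i \<zero> v = \<zero>\<^bsub>W\<^esub>" "f i v \<zero> = \<zero>\<^bsub>W\<^esub>" if v: "v \<in> carrier A" for i v
  proof -
    have 1: "(\<lambda>u. f i u v) \<in> addhom A W" "f i v \<in> addhom A W"
      using v by (auto intro!: addhomI simp: c a1 a2)
    show "f i \<zero> v = \<zero>\<^bsub>W\<^esub>" "f i v \<zero> = \<zero>\<^bsub>W\<^esub>"
      using addhom_zero[OF grp_A W 1(1)] addhom_zero[OF grp_A W 1(2)] by auto
  qed
  note ea = addhom_add[OF ev_od_addhom(1)] addhom_add[OF ev_od_addhom(2)]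
  have "\<exists>L. L \<in> addhom TT W \<and> (\<forall>u\<in>carrier A. \<forall>v\<in>carrier A. L (pt u v) = f True (ev u) v \<oplus>\<^bsub>W\<^esub> f False (od u) v)"
    by (rule tens_lift[OF W]) (simp_all add: c a1 a2 b ea ev_od_kmap W.a_ac)
  then obtain L where L: "L \<in> addhom TT W" "\<And>u v. u \<in> carrier A \<Longrightarrow> v \<in> carrier A \<Longrightarrow> L (pt u v) = f True (ev u) v \<oplus>\<^bsub>W\<^esub> f False (od u) v"
    by blast
  have "L (pt u v) = f (even p) u v" if "u \<in> wt A p" "v \<in> carrier A" for p u v
    using that wt_carrier[OF that(1)] by (simp add: L(2) ev_od_wt[OF that(1)] z c)
  then show ?left using L(1) by blast
  have "\<exists>L. L \<in> addhom TT W \<and> (\<forall>u\<in>carrier A. \<forall>v\<in>carrier A. L (pt u v) = f True u (ev v) \<oplus>\<^bsub>W\<^esub> f False u (od v))"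
    by (rule tens_lift[OF W]) (simp_all add: c a1 a2 b ea ev_od_kmap W.a_ac)
  then obtain L where L: "L \<in> addhom TT W" "\<And>u v. u \<in> carrier A \<Longrightarrow> v \<in> carrier A \<Longrightarrow> L (pt u v) = f True u (ev v) \<oplus>\<^bsub>W\<^esub> f False u (od v)"
    by blast
  have "L (pt u v) = f (even p) u v" if "u \<in> carrier A" "v \<in> wt A p" for p u v
    using that wt_carrier[OF that(2)] by (simp add: L(2) ev_od_wt[OF that(2)] z c)
  then show ?right using L(1) by blast
qed

lemma tens_ext_wt:
  assumes W: "abelian_group W" and f: "f \<in> addhom TT W" and g: "g \<in> addhom TT W"
    and fg: "\<And>p q u v. u \<in> wt A p \<Longrightarrow> v \<in> wt A q \<Longrightarrow> f (pt u v) = g (pt u v)" and x: "x \<in> carrier TT"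
  shows "f x = g x"
proof -
  have h: "(\<lambda>u. pt u v) \<in> addhom A TT" "pt v \<in> addhom A TT" if "v \<in> carrier A" for v
    using that by (auto intro!: addhomI simp: pt_add_left pt_add_right)
  have 1: "f (pt u v) = g (pt u v)" if "u \<in> wt A p" "v \<in> carrier A" for u v p
    by (rule A_ext[OF W addhom_comp[OF h(2)[OF wt_carrier[OF that(1)]] f] addhom_comp[OF h(2)[OF wt_carrier[OF that(1)]] g] fg[OF that(1)] that(2)])
  have 2: "f (pt u v) = g (pt u v)" if "u \<in> carrier A" "v \<in> carrier A" for u v
    by (rule A_ext[OF W addhom_comp[OF h(1)[OF that(2)] f] addhom_comp[OF h(1)[OF that(2)] g] 1[OF _ that(2)] that(1)])
  show ?thesis by (rule tens_ext[OF W f g 2 x])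
qed

section \<open>The inner bimodule structure\<close>

text \<open>The twist of \<open>a\<close> depends on the weight of \<open>u\<close> only through its
  parity, so existence is an instance of \<open>tens_lift_parity\<close>. Uniqueness holds because
  homogeneous pure tensors span.\<close>

lemma inner_l_char:
  assumes a: "a \<in> carrier A"
  shows "inner_l K R A a \<in> addhom TT TT"
    and "\<And>p u v. u \<in> wt A p \<Longrightarrow> v \<in> carrier A \<Longrightarrow> inner_l K R A a (pt u v) = pt u (sg p a \<otimes> v)"
proof -
  have "\<exists>L. L \<in> addhom TT TT \<and> (\<forall>p. \<forall>u\<in>wt A p. \<forall>v\<in>carrier A. L (pt u v) = (\<lambda>i u v. pt u ((if i then a else \<sigma> a) \<otimes> v)) (even p) u v)"
  proof (rule tens_lift_parity(1)[OF grp_T])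
    fix i u v c assume *: "u \<in> carrier A" "v \<in> carrier A" "c \<in> carrier K"
    then have "(if i then a else \<sigma> a) \<otimes> (kmap R A c \<otimes> v) = kmap R A c \<otimes> ((if i then a else \<sigma> a) \<otimes> v)"
      using a kmap_comm[of c v] kmap_comm[of c "(if i then a else \<sigma> a) \<otimes> v"] by (simp add: A.m_assoc)
    then show "pt (u \<otimes> kmap R A c) ((if i then a else \<sigma> a) \<otimes> v) = pt u ((if i then a else \<sigma> a) \<otimes> (kmap R A c \<otimes> v))"
      using * a by (simp add: pt_balanced)
  qed (use a in \<open>simp_all add: pt_add_left pt_add_right A.r_distr\<close>)
  then obtain L where L: "L \<in> addhom TT TT" "\<And>p u v. u \<in> wt A p \<Longrightarrow> v \<in> carrier A \<Longrightarrow> L (pt u v) = pt u (sg p a \<otimes> v)"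
    by (auto simp: sg_def)
  have "inner_l K R A a = restrict L (carrier TT)"
    unfolding inner_l_def
  proof (rule the_add_map_eq[OF L(1) _ grp_T])
    show "\<forall>p. \<forall>u\<in>wt A p. \<forall>v\<in>carrier A. restrict L (carrier TT) (pt u v) = pt u (twist A p a \<otimes> v)"
      using a by (auto simp: L(2) twist_eq wt_carrier)
    fix g assume g: "g \<in> addhom TT TT" "\<forall>p. \<forall>u\<in>wt A p. \<forall>v\<in>carrier A. g (pt u v) = pt u (twist A p a \<otimes> v)"
    have "g (pt u v) = L (pt u v)" if "u \<in> wt A p" "v \<in> wt A q" for p q u v
      using g(2) that a by (simp add: L(2) twist_eq wt_carrier)
    then show "\<forall>x\<in>carrier TT. g x = L x" by (intro ballI, rule tens_ext_wt[OF grp_T g(1) L(1)])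
  qed
  then show "inner_l K R A a \<in> addhom TT TT"
    and "\<And>p u v. u \<in> wt A p \<Longrightarrow> v \<in> carrier A \<Longrightarrow> inner_l K R A a (pt u v) = pt u (sg p a \<otimes> v)"
    using L by (auto simp: hom_def wt_carrier)
qed

lemma inner_r_char:
  assumes a: "a \<in> carrier A"
  shows "(\<lambda>t. inner_r K R A t a) \<in> addhom TT TT"
    and "\<And>p u v. u \<in> carrier A \<Longrightarrow> v \<in> wt A p \<Longrightarrow> inner_r K R A (pt u v) a = pt (u \<otimes> sg p a) v"
proof -
  have "\<exists>L. L \<in> addhom TT TT \<and> (\<forall>p. \<forall>u\<in>carrier A. \<forall>v\<in>wt A p. L (pt u v) = (\<lambda>i u v. pt (u \<otimes> (if i then a else \<sigma> a)) v) (even p) u v)"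
  proof (rule tens_lift_parity(2)[OF grp_T])
    fix i u v c assume *: "u \<in> carrier A" "v \<in> carrier A" "c \<in> carrier K"
    then have "u \<otimes> kmap R A c \<otimes> (if i then a else \<sigma> a) = u \<otimes> (if i then a else \<sigma> a) \<otimes> kmap R A c"
      using a by (simp add: A.m_assoc kmap_comm)
    then show "pt (u \<otimes> kmap R A c \<otimes> (if i then a else \<sigma> a)) v = pt (u \<otimes> (if i then a else \<sigma> a)) (kmap R A c \<otimes> v)"
      using * a by (simp add: pt_balanced)
  qed (use a in \<open>simp_all add: pt_add_left pt_add_right A.l_distr\<close>)
  then obtain L where L: "L \<in> addhom TT TT" "\<And>p u v. u \<in> carrier A \<Longrightarrow> v \<in> wt A p \<Longrightarrow> L (pt u v) = pt (u \<otimes> sg p a) v"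
    by (auto simp: sg_def)
  have "(\<lambda>t. inner_r K R A t a) = restrict L (carrier TT)"
    unfolding inner_r_def
  proof (rule the_add_map_eq[OF L(1) _ grp_T])
    show "\<forall>p. \<forall>u\<in>carrier A. \<forall>v\<in>wt A p. restrict L (carrier TT) (pt u v) = pt (u \<otimes> twist A p a) v"
      using a by (auto simp: L(2) twist_eq wt_carrier)
    fix g assume g: "g \<in> addhom TT TT" "\<forall>p. \<forall>u\<in>carrier A. \<forall>v\<in>wt A p. g (pt u v) = pt (u \<otimes> twist A p a) v"
    have "g (pt u v) = L (pt u v)" if "u \<in> wt A p" "v \<in> wt A q" for p q u v
      using g(2) that a by (simp add: L(2) twist_eq wt_carrier)
    then show "\<forall>x\<in>carrier TT. g x = L x" by (intro ballI, rule tens_ext_wt[OF grp_T g(1) L(1)])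
  qed
  then have *: "inner_r K R A t a = restrict L (carrier TT) t" for t by (rule fun_cong)
  show "(\<lambda>t. inner_r K R A t a) \<in> addhom TT TT"
    and "\<And>p u v. u \<in> carrier A \<Longrightarrow> v \<in> wt A p \<Longrightarrow> inner_r K R A (pt u v) a = pt (u \<otimes> sg p a) v"
    using L unfolding * by (auto simp: hom_def wt_carrier)
qed

abbreviation il :: "'a \<Rightarrow> ('a \<times> 'a) pres \<Rightarrow> ('a \<times> 'a) pres" where "il \<equiv> inner_l K R A"
abbreviation ir :: "('a \<times> 'a) pres \<Rightarrow> 'a \<Rightarrow> ('a \<times> 'a) pres" where "ir \<equiv> inner_r K R A"

lemma il_closed [simp]: "a \<in> carrier A \<Longrightarrow> t \<in> carrier TT \<Longrightarrow> il a t \<in> carrier TT"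
  using addhom_closed[OF inner_l_char(1)] .

lemma ir_closed [simp]: "a \<in> carrier A \<Longrightarrow> t \<in> carrier TT \<Longrightarrow> ir t a \<in> carrier TT"
  using addhom_closed[OF inner_r_char(1)] .

text \<open>For homogeneous \<open>a\<close> the sign can be carried by \<open>u\<close>, which
  frees \<open>u\<close> from being homogeneous.\<close>

lemma il_wt:
  assumes a: "a \<in> wt A q" and u: "u \<in> carrier A" and v: "v \<in> carrier A"
  shows "il a (pt u v) = pt (sg q u) (a \<otimes> v)"
proof -
  note ac = wt_carrier[OF a]
  have 1: "(\<lambda>u. il a (pt u v)) \<in> addhom A TT"
    by (rule addhomI) (use ac v in \<open>simp_all add: pt_add_left addhom_add[OF inner_l_char(1)[OF ac]]\<close>)
  have 2: "(\<lambda>u. pt (sg q u) (a \<otimes> v)) \<in> addhom A TT"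
    by (rule addhomI) (use ac v in \<open>simp_all add: pt_add_left sg_add\<close>)
  have 3: "il a (pt u v) = pt (sg q u) (a \<otimes> v)" if "u \<in> wt A p" for p u
    using that a v by (simp add: inner_l_char(2)[OF ac] pt_sign_swap)
  show ?thesis by (rule A_ext[OF grp_T 1 2 3 u])
qed

lemma ir_wt:
  assumes a: "a \<in> wt A q" and u: "u \<in> carrier A" and v: "v \<in> carrier A"
  shows "ir (pt u v) a = pt (u \<otimes> a) (sg q v)"
proof -
  note ac = wt_carrier[OF a]
  have 1: "(\<lambda>v. ir (pt u v) a) \<in> addhom A TT"
    by (rule addhomI) (use ac u in \<open>simp_all add: pt_add_right addhom_add[OF inner_r_char(1)[OF ac]]\<close>)
  have 2: "(\<lambda>v. pt (u \<otimes> a) (sg q v)) \<in> addhom A TT"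
    by (rule addhomI) (use ac u in \<open>simp_all add: pt_add_right sg_add\<close>)
  have 3: "ir (pt u v) a = pt (u \<otimes> a) (sg q v)" if "v \<in> wt A p" for p v
    using that a u by (simp add: inner_r_char(2)[OF ac] pt_sign_swap)
  show ?thesis by (rule A_ext[OF grp_T 1 2 3 v])
qed

lemma il_add:
  assumes "a \<in> carrier A" "b \<in> carrier A" "t \<in> carrier TT"
  shows "il (a \<oplus> b) t = il a t \<oplus>\<^bsub>TT\<^esub> il b t"
proof (rule tens_ext_wt[OF grp_T inner_l_char(1) addhom_sum2[OF grp_T inner_l_char(1) inner_l_char(1)] _ assms(3)])
  show "il (a \<oplus> b) (pt u v) = il a (pt u v) \<oplus>\<^bsub>TT\<^esub> il b (pt u v)" if "u \<in> wt A p" "v \<in> wt A q" for p q u v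
    using that assms by (simp add: inner_l_char(2) wt_carrier sg_add A.l_distr pt_add_right)
qed (use assms in auto)

lemma ir_add:
  assumes "a \<in> carrier A" "b \<in> carrier A" "t \<in> carrier TT"
  shows "ir t (a \<oplus> b) = ir t a \<oplus>\<^bsub>TT\<^esub> ir t b"
proof (rule tens_ext_wt[OF grp_T inner_r_char(1) addhom_sum2[OF grp_T inner_r_char(1) inner_r_char(1)] _ assms(3)])
  show "ir (pt u v) (a \<oplus> b) = ir (pt u v) a \<oplus>\<^bsub>TT\<^esub> ir (pt u v) b" if "u \<in> wt A p" "v \<in> wt A q" for p q u v
    using that assms by (simp add: inner_r_char(2) wt_carrier sg_add A.r_distr pt_add_left)
qed (use assms in auto)

lemma il_hom_left: "t \<in> carrier TT \<Longrightarrow> (\<lambda>a. il a t) \<in> addhom A TT"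
  by (rule addhomI) (simp_all add: il_add)

lemma ir_hom_left: "t \<in> carrier TT \<Longrightarrow> ir t \<in> addhom A TT"
  by (rule addhomI) (simp_all add: ir_add)

lemma il_mult:
  assumes "a \<in> carrier A" "b \<in> carrier A" "t \<in> carrier TT"
  shows "il (a \<otimes> b) t = il a (il b t)"
proof (rule tens_ext_wt[OF grp_T inner_l_char(1) addhom_comp[OF inner_l_char(1) inner_l_char(1)] _ assms(3)])
  show "il (a \<otimes> b) (pt u v) = il a (il b (pt u v))" if "u \<in> wt A p" "v \<in> wt A q" for p q u v
    using that assms by (simp add: inner_l_char(2) wt_carrier sg_mult A.m_assoc)
qed (use assms in auto)

lemma ir_mult:
  assumes "a \<in> carrier A" "b \<in> carrier A" "t \<in> carrier TT"
  shows "ir t (a \<otimes> b) = ir (ir t a) b"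
proof (rule tens_ext_wt[OF grp_T inner_r_char(1) addhom_comp[OF inner_r_char(1) inner_r_char(1)] _ assms(3)])
  show "ir (pt u v) (a \<otimes> b) = ir (ir (pt u v) a) b" if "u \<in> wt A p" "v \<in> wt A q" for p q u v
    using that assms by (simp add: inner_r_char(2) wt_carrier sg_mult A.m_assoc)
qed (use assms in auto)

lemma il_one: "t \<in> carrier TT \<Longrightarrow> il \<one> t = t"
  by (rule tens_ext_wt[OF grp_T inner_l_char(1) addhom_id]) (simp_all add: inner_l_char(2) wt_carrier)

lemma ir_one: "t \<in> carrier TT \<Longrightarrow> ir t \<one> = t"
  by (rule tens_ext_wt[OF grp_T inner_r_char(1) addhom_id]) (simp_all add: inner_r_char(2) wt_carrier)

lemma il_ract:
  assumes "a \<in> carrier A" "y \<in> carrier A" "t \<in> carrier TT"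
  shows "il a (ract TT t y) = ract TT (il a t) y"
proof (rule tens_ext_wt[OF grp_T addhom_comp[OF ract_tens_hom(1) inner_l_char(1)] addhom_comp[OF inner_l_char(1) ract_tens_hom(1)] _ assms(3)])
  show "il a (ract TT (pt u v) y) = ract TT (il a (pt u v)) y" if "u \<in> wt A p" "v \<in> wt A q" for p q u v
    using that assms by (simp add: inner_l_char(2) wt_carrier ract_tens_hom A.m_assoc)
qed (use assms in auto)

lemma ir_lact:
  assumes "a \<in> carrier A" "y \<in> carrier A" "t \<in> carrier TT"
  shows "ir (lact TT y t) a = lact TT y (ir t a)"
proof (rule tens_ext_wt[OF grp_T addhom_comp[OF lact_tens_hom(1) inner_r_char(1)] addhom_comp[OF inner_r_char(1) lact_tens_hom(1)] _ assms(3)])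
  show "ir (lact TT y (pt u v)) a = lact TT y (ir (pt u v) a)" if "u \<in> wt A p" "v \<in> wt A q" for p q u v
    using that assms by (simp add: inner_r_char(2) wt_carrier lact_tens_hom A.m_assoc)
qed (use assms in auto)

text \<open>The inner action places \<open>a\<close> between the two factors, so \<open>a\<close>
  has to pass the outer multiplier \<open>y\<close>, whence the twist. The outer right
  multiplication is not passed, and \<open>il_ract\<close> has no sign.\<close>

lemma il_lact:
  assumes a: "a \<in> wt A q" and "y \<in> carrier A" "t \<in> carrier TT"
  shows "il a (lact TT y t) = lact TT (sg q y) (il a t)"
proof (rule tens_ext_wt[OF grp_T addhom_comp[OF lact_tens_hom(1) inner_l_char(1)] addhom_comp[OF inner_l_char(1) lact_tens_hom(1)] _ assms(3)])
  show "il a (lact TT y (pt u v)) = lact TT (sg q y) (il a (pt u v))" if "u \<in> wt A p" "v \<in> wt A q'" for p q' u v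
    using that assms wt_carrier[OF a] by (simp add: il_wt[OF a] wt_carrier lact_tens_hom sg_mult)
qed (use assms wt_carrier[OF a] in auto)

lemma ir_ract:
  assumes a: "a \<in> wt A q" and "y \<in> carrier A" "t \<in> carrier TT"
  shows "ir (ract TT t y) a = ract TT (ir t a) (sg q y)"
proof (rule tens_ext_wt[OF grp_T addhom_comp[OF ract_tens_hom(1) inner_r_char(1)] addhom_comp[OF inner_r_char(1) ract_tens_hom(1)] _ assms(3)])
  show "ir (ract TT (pt u v) y) a = ract TT (ir (pt u v) a) (sg q y)" if "u \<in> wt A p" "v \<in> wt A q'" for p q' u v
    using that assms wt_carrier[OF a] by (simp add: ir_wt[OF a] wt_carrier ract_tens_hom sg_mult)
qed (use assms wt_carrier[OF a] in auto)

lemma il_ir: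
  assumes a: "a \<in> carrier A" and b: "b \<in> carrier A" and t: "t \<in> carrier TT"
  shows "il a (ir t b) = ir (il a t) b"
proof -
  have 1: "il a (ir t b) = ir (il a t) b" if a: "a \<in> wt A p" and b: "b \<in> wt A q" for p q a b
  proof -
    note c = wt_carrier[OF a] wt_carrier[OF b]
    show ?thesis
    proof (rule tens_ext_wt[OF grp_T addhom_comp[OF inner_r_char(1) inner_l_char(1)] addhom_comp[OF inner_l_char(1) inner_r_char(1)] _ t])
      show "il a (ir (pt u v) b) = ir (il a (pt u v)) b" if "u \<in> wt A m" "v \<in> wt A n" for m n u v
      proof -
        have "il a (ir (pt u v) b) = pt (sg p u \<otimes> sg p b) (a \<otimes> sg q v)"
          using that c wt_carrier[OF that(1)] wt_carrier[OF that(2)] by (simp add: il_wt[OF a] ir_wt[OF b] sg_mult)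
        \<comment> \<open>The sign of a and b passing each other is taken off \<open>b\<close> here
          and put on \<open>a\<close> in the next step, where the other order of the two actions
          needs it.\<close>
        also have "\<dots> = ksgn TT (p * q) (pt (sg p u \<otimes> b) (a \<otimes> sg q v))"
          using that c wt_carrier[OF that(1)] wt_carrier[OF that(2)] by (simp add: sg_wt[OF b] ksgn_mult pt_ksgn)
        also have "\<dots> = pt (sg p u \<otimes> b) (sg q a \<otimes> sg q v)"
          using that c wt_carrier[OF that(1)] wt_carrier[OF that(2)] by (simp add: sg_wt[OF a] ksgn_mult pt_ksgn mult.commute)
        also have "\<dots> = ir (il a (pt u v)) b"
          using that c wt_carrier[OF that(1)] wt_carrier[OF that(2)] by (simp add: il_wt[OF a] ir_wt[OF b] sg_mult)
        finally show ?thesis .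
      qed
    qed (use c in auto)
  qed
  have 2: "il a (ir t b) = ir (il a t) b" if a: "a \<in> wt A p" for p a
    by (rule A_ext[OF grp_T addhom_comp[OF ir_hom_left[OF t] inner_l_char(1)[OF wt_carrier[OF a]]]
      ir_hom_left[OF il_closed[OF wt_carrier[OF a] t]] 1[OF a] b])
  show ?thesis
    by (rule A_ext[OF grp_T il_hom_left[OF ir_closed[OF b t]] addhom_comp[OF il_hom_left[OF t] inner_r_char(1)[OF b]] 2 a])
qed

end

section \<open>Double derivations\<close>

lemma abelian_group_fun_group:
  assumes "abelian_group Y"
  shows "abelian_group (fun_group U Y)"
proof -
  interpret Y: abelian_group Y by fact
  show ?thesis
  proof (rule abelian_groupI)
    fix f assume f: "f \<in> carrier (fun_group U Y)"
    show "\<exists>g\<in>carrier (fun_group U Y). g \<oplus>\<^bsub>fun_group U Y\<^esub> f = \<zero>\<^bsub>fun_group U Y\<^esub>"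
      using f by (intro bexI[of _ "\<lambda>x\<in>carrier U. \<ominus>\<^bsub>Y\<^esub> f x"]) (auto simp: fun_group_def Y.l_neg PiE_iff intro!: restrict_ext)
    show "\<zero>\<^bsub>fun_group U Y\<^esub> \<oplus>\<^bsub>fun_group U Y\<^esub> f = f"
      using f by (auto simp: fun_group_def PiE_iff extensional_def restrict_def fun_eq_iff)
  qed (auto simp: fun_group_def PiE_iff Y.a_ac intro!: restrict_ext)
qed

lemma abelian_group_of_span:
  assumes F: "abelian_group F" and U: "U \<subseteq> carrier F"
    and V: "carrier V = span F U" "\<zero>\<^bsub>V\<^esub> = \<zero>\<^bsub>F\<^esub>" "add V = add F"
  shows "abelian_group V" "\<And>x. x \<in> carrier V \<Longrightarrow> \<ominus>\<^bsub>V\<^esub> x = \<ominus>\<^bsub>F\<^esub> x"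
proof -
  interpret F: abelian_group F by fact
  have c: "x \<in> carrier F" if "x \<in> carrier V" for x using span_closed[OF F U] that V(1) by simp
  show *: "abelian_group V"
  proof (rule abelian_groupI)
    fix x assume x: "x \<in> carrier V"
    then show "\<exists>y\<in>carrier V. y \<oplus>\<^bsub>V\<^esub> x = \<zero>\<^bsub>V\<^esub>"
      using span_inv[OF F U, of x] c[OF x] by (intro bexI[of _ "\<ominus>\<^bsub>F\<^esub> x"]) (simp_all add: V F.l_neg)
  qed (use c in \<open>simp_all add: V span_zero span_add F.a_ac\<close>)
  show "\<ominus>\<^bsub>V\<^esub> x = \<ominus>\<^bsub>F\<^esub> x" if x: "x \<in> carrier V" for x
  proof (rule abelian_group.minus_equality[OF *])
    show "\<ominus>\<^bsub>F\<^esub> x \<oplus>\<^bsub>V\<^esub> x = \<zero>\<^bsub>V\<^esub>" using c[OF x] by (simp add: V F.l_neg)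
    show "x \<in> carrier V" by fact
    show "\<ominus>\<^bsub>F\<^esub> x \<in> carrier V" using span_inv[OF F U, of x] x by (simp add: V)
  qed
qed

section \<open>Weights on A (x) A and the graded bimodule of double derivations\<close>

context superalg
begin

abbreviation TW :: "int \<Rightarrow> ('a \<times> 'a) pres set" where "TW \<equiv> tens_wt K R A"

lemma TW_incl: "u \<in> wt A p \<Longrightarrow> v \<in> wt A q \<Longrightarrow> pt u v \<in> TW (p + q)"
  unfolding tens_wt_def by (rule span_incl) blast

lemma TW_gens: "{pt u v |u v p q. u \<in> wt A p \<and> v \<in> wt A q \<and> p + q = n} \<subseteq> carrier TT"
  by (auto simp: wt_carrier)

lemma TW_closed: "t \<in> TW n \<Longrightarrow> t \<in> carrier TT"
  unfolding tens_wt_def by (rule span_closed[OF grp_T TW_gens])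

lemma TW_zero: "\<zero>\<^bsub>TT\<^esub> \<in> TW n"
  unfolding tens_wt_def by (rule span_zero)

lemma TW_add: "s \<in> TW n \<Longrightarrow> t \<in> TW n \<Longrightarrow> s \<oplus>\<^bsub>TT\<^esub> t \<in> TW n"
  unfolding tens_wt_def by (rule span_add)

lemma TW_inv: "t \<in> TW n \<Longrightarrow> \<ominus>\<^bsub>TT\<^esub> t \<in> TW n"
  unfolding tens_wt_def by (rule span_inv[OF grp_T TW_gens])

lemma TW_map:
  assumes f: "f \<in> addhom TT W" and W: "abelian_group W" and U: "U \<subseteq> carrier W"
    and pt: "\<And>p q u v. \<lbrakk>u \<in> wt A p; v \<in> wt A q; p + q = n\<rbrakk> \<Longrightarrow> f (pt u v) \<in> span W U" and t: "t \<in> TW n"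
  shows "f t \<in> span W U"
  by (rule addhom_span[OF grp_T W f TW_gens _ U, of n]) (use pt t in \<open>auto simp: tens_wt_def\<close>)

lemma TW_map_TW:
  assumes f: "f \<in> addhom TT TT"
    and pt: "\<And>p q u v. \<lbrakk>u \<in> wt A p; v \<in> wt A q; p + q = n\<rbrakk> \<Longrightarrow> f (pt u v) \<in> TW m" and t: "t \<in> TW n"
  shows "f t \<in> TW m"
  unfolding tens_wt_def by (rule TW_map[OF f grp_T TW_gens _ t]) (use pt in \<open>auto simp: tens_wt_def\<close>)

text \<open>Being of weight \<open>n\<close> is preserved under differences, so a map out of a
  presented group needs to be tested on generators only.\<close>

lemma TW_gen_map:
  assumes V: "presented V G Q" and f: "f \<in> addhom V TT" and g: "\<And>g. g \<in> G \<Longrightarrow> f (gcls Q g) \<in> TW n" and x: "x \<in> carrier V"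
  shows "f x \<in> TW n"
proof -
  interpret V: presented V G Q by fact
  show ?thesis using x
  proof (induction rule: V.gen_induct)
    case (diff x y)
    show ?case unfolding addhom_minus[OF V.abelian_group_axioms grp_T f diff(1,2)]
      by (simp only: a_minus_def TW_add TW_inv diff)
  next
    case zero show ?case unfolding addhom_zero[OF V.abelian_group_axioms grp_T f] by (rule TW_zero)
  qed (rule g)
qed

lemma TW_acts:
  assumes a: "a \<in> wt A q" and t: "t \<in> TW n"
  shows "il a t \<in> TW (n + q)" "ir t a \<in> TW (n + q)" "lact TT a t \<in> TW (n + q)" "ract TT t a \<in> TW (n + q)"
proof -
  note ac = wt_carrier[OF a]
  have *: "pt (sg q u) (a \<otimes> v) \<in> TW (n + q)" "pt (u \<otimes> a) (sg q v) \<in> TW (n + q)"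
      "pt (a \<otimes> u) v \<in> TW (n + q)" "pt u (v \<otimes> a) \<in> TW (n + q)"
    if "u \<in> wt A p" "v \<in> wt A p'" "p + p' = n" for u v p p'
    using TW_incl[OF sg_wt_closed[OF that(1), of q] wt_mult[OF a that(2)]] TW_incl[OF wt_mult[OF that(1) a] sg_wt_closed[OF that(2), of q]]
      TW_incl[OF wt_mult[OF a that(1)] that(2)] TW_incl[OF that(1) wt_mult[OF that(2) a]]
    by (simp_all add: that(3)[symmetric] ac_simps)
  show "il a t \<in> TW (n + q)"
    by (rule TW_map_TW[OF inner_l_char(1)[OF ac] _ t]) (use * in \<open>simp add: il_wt[OF a] wt_carrier\<close>)
  show "ir t a \<in> TW (n + q)"
    by (rule TW_map_TW[OF inner_r_char(1)[OF ac] _ t]) (use * in \<open>simp add: ir_wt[OF a] wt_carrier\<close>)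
  show "lact TT a t \<in> TW (n + q)"
    by (rule TW_map_TW[OF lact_tens_hom(1)[OF ac] _ t]) (use * ac in \<open>simp add: lact_tens_hom wt_carrier\<close>)
  show "ract TT t a \<in> TW (n + q)"
    by (rule TW_map_TW[OF ract_tens_hom(1)[OF ac] _ t]) (use * ac in \<open>simp add: ract_tens_hom wt_carrier\<close>)
qed

abbreviation DW :: "int \<Rightarrow> ('a \<Rightarrow> ('a \<times> 'a) pres) set" where "DW \<equiv> DDer_wt K R A"
abbreviation DD :: "('a, 'a \<Rightarrow> ('a \<times> 'a) pres) bimod" where "DD \<equiv> DDer K R A"

lemma DWI:
  assumes "\<Theta> \<in> extensional (carrier A)" "\<Theta> \<in> addhom A TT" "\<And>p x. x \<in> wt A p \<Longrightarrow> \<Theta> x \<in> TW (p + n)"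
    "\<And>t. t \<in> carrier R \<Longrightarrow> \<Theta> (umap A t) = \<zero>\<^bsub>TT\<^esub>"
    "\<And>x y. x \<in> carrier A \<Longrightarrow> y \<in> carrier A \<Longrightarrow> \<Theta> (x \<otimes> y) = ract TT (\<Theta> x) y \<oplus>\<^bsub>TT\<^esub> lact TT (sg n x) (\<Theta> y)"
  shows "\<Theta> \<in> DW n"
  using assms unfolding DDer_wt_def by (simp add: twist_eq)

lemma DWD:
  assumes "\<Theta> \<in> DW n"
  shows "\<Theta> \<in> extensional (carrier A)" "\<Theta> \<in> addhom A TT" "\<And>p x. x \<in> wt A p \<Longrightarrow> \<Theta> x \<in> TW (p + n)"
    "\<And>t. t \<in> carrier R \<Longrightarrow> \<Theta> (umap A t) = \<zero>\<^bsub>TT\<^esub>"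
    "\<And>x y. x \<in> carrier A \<Longrightarrow> y \<in> carrier A \<Longrightarrow> \<Theta> (x \<otimes> y) = ract TT (\<Theta> x) y \<oplus>\<^bsub>TT\<^esub> lact TT (sg n x) (\<Theta> y)"
  using assms unfolding DDer_wt_def by (simp_all add: twist_eq)

lemma DW_apply [simp]: "\<Theta> \<in> DW n \<Longrightarrow> x \<in> carrier A \<Longrightarrow> \<Theta> x \<in> carrier TT"
  by (rule addhom_closed[OF DWD(2)])

abbreviation FF :: "('a \<Rightarrow> ('a \<times> 'a) pres) ring" where "FF \<equiv> fun_group A TT"

lemma grp_FF: "abelian_group FF"
  by (rule abelian_group_fun_group[OF grp_T])

lemma DW_FF: "(\<Union>n. DW n) \<subseteq> carrier FF"
proof
  fix \<Theta> assume "\<Theta> \<in> (\<Union>n. DW n)"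
  then obtain n where "\<Theta> \<in> DW n" by blast
  then show "\<Theta> \<in> carrier FF" using DWD(1) DW_apply by (simp add: fun_group_def PiE_iff)
qed

lemma DD_simps: "carrier DD = span FF (\<Union>n. DW n)" "\<zero>\<^bsub>DD\<^esub> = \<zero>\<^bsub>FF\<^esub>" "add DD = add FF"
  by (simp_all add: DDer_def Let_def)

lemma grp_DD: "abelian_group DD" and inv_DD: "\<Theta> \<in> carrier DD \<Longrightarrow> \<ominus>\<^bsub>DD\<^esub> \<Theta> = \<ominus>\<^bsub>FF\<^esub> \<Theta>"
  using abelian_group_of_span[OF grp_FF DW_FF DD_simps] by auto

lemma DW_DD: "\<Theta> \<in> DW n \<Longrightarrow> \<Theta> \<in> carrier DD"
  unfolding DD_simps by (rule span_incl) blast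

lemma DD_FF: "\<Theta> \<in> carrier DD \<Longrightarrow> \<Theta> \<in> carrier FF"
  using span_closed[OF grp_FF DW_FF] by (simp add: DD_simps)

lemma DD_ext: "\<Theta> \<in> carrier DD \<Longrightarrow> \<Theta>' \<in> carrier DD \<Longrightarrow> (\<And>x. x \<in> carrier A \<Longrightarrow> \<Theta> x = \<Theta>' x) \<Longrightarrow> \<Theta> = \<Theta>'"
  using DD_FF by (intro extensionalityI[of _ "carrier A"]) (simp_all add: fun_group_def PiE_iff)

lemma DD_apply: "\<Theta> \<in> carrier DD \<Longrightarrow> x \<in> carrier A \<Longrightarrow> \<Theta> x \<in> carrier TT"
  using DD_FF by (simp add: fun_group_def PiE_iff)

lemma DD_zero_apply: "x \<in> carrier A \<Longrightarrow> \<zero>\<^bsub>DD\<^esub> x = \<zero>\<^bsub>TT\<^esub>"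
  by (simp add: DD_simps fun_group_def)

lemma DD_add_apply: "x \<in> carrier A \<Longrightarrow> (\<Theta> \<oplus>\<^bsub>DD\<^esub> \<Theta>') x = \<Theta> x \<oplus>\<^bsub>TT\<^esub> \<Theta>' x"
  by (simp add: DD_simps fun_group_def)

lemma DD_eval: "x \<in> carrier A \<Longrightarrow> (\<lambda>\<Theta>. \<Theta> x) \<in> addhom DD TT"
  by (rule addhomI) (simp_all add: DD_apply DD_add_apply)

lemma DD_inv_apply: "\<Theta> \<in> carrier DD \<Longrightarrow> x \<in> carrier A \<Longrightarrow> (\<ominus>\<^bsub>DD\<^esub> \<Theta>) x = \<ominus>\<^bsub>TT\<^esub> \<Theta> x"
  by (rule addhom_inv[OF grp_DD grp_T DD_eval])

lemma DD_hom_ext: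
  assumes W: "abelian_group W" and f: "f \<in> addhom DD W" and g: "g \<in> addhom DD W"
    and fg: "\<And>n \<Theta>. \<Theta> \<in> DW n \<Longrightarrow> f \<Theta> = g \<Theta>" and \<Theta>: "\<Theta> \<in> carrier DD"
  shows "f \<Theta> = g \<Theta>"
  using \<Theta> unfolding DD_simps(1)
proof (induction rule: span_induct)
  case zero then show ?case
    using addhom_zero[OF grp_DD W f] addhom_zero[OF grp_DD W g] by (simp add: DD_simps)
next
  case (incl \<Theta>) then show ?case using fg by blast
next
  case (inv \<Theta>)
  then obtain n where n: "\<Theta> \<in> DW n" by blast
  note c = DW_DD[OF n]
  show ?case using addhom_inv[OF grp_DD W f c] addhom_inv[OF grp_DD W g c] fg[OF n] by (simp add: inv_DD[OF c])
next
  case (add x y)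
  then have "x \<in> carrier DD" "y \<in> carrier DD" by (simp_all add: DD_simps)
  then show ?case using addhom_add[OF f] addhom_add[OF g] add by (simp add: DD_simps)
qed

lemma DW_zero: "\<zero>\<^bsub>DD\<^esub> \<in> DW n"
proof (rule DWI)
  show "\<zero>\<^bsub>DD\<^esub> \<in> extensional (carrier A)" by (simp add: DD_simps fun_group_def)
  show "\<zero>\<^bsub>DD\<^esub> \<in> addhom A TT" by (rule addhomI) (simp_all add: DD_zero_apply)
qed (simp_all add: DD_zero_apply TW_zero wt_carrier)

lemma DW_add:
  assumes "\<Theta> \<in> DW n" "\<Theta>' \<in> DW n"
  shows "\<Theta> \<oplus>\<^bsub>DD\<^esub> \<Theta>' \<in> DW n"
proof (rule DWI)
  show "\<Theta> \<oplus>\<^bsub>DD\<^esub> \<Theta>' \<in> extensional (carrier A)" by (simp add: DD_simps fun_group_def)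
  show "\<Theta> \<oplus>\<^bsub>DD\<^esub> \<Theta>' \<in> addhom A TT"
    by (rule addhomI) (use assms in \<open>simp_all add: DD_add_apply addhom_add[OF DWD(2)[OF assms(1)]] addhom_add[OF DWD(2)[OF assms(2)]] T.a_ac\<close>)
qed (use assms in \<open>simp_all add: DD_add_apply TW_add wt_carrier DWD(3,4,5) TB.l_add TB.r_add T.a_ac\<close>)

lemma DW_inv:
  assumes "\<Theta> \<in> DW n"
  shows "\<ominus>\<^bsub>DD\<^esub> \<Theta> \<in> DW n"
proof (rule DWI)
  note c = DW_DD[OF assms] and h = DWD(2)[OF assms]
  have "\<ominus>\<^bsub>DD\<^esub> \<Theta> \<in> carrier DD" by (rule abelian_group.a_inv_closed[OF grp_DD c])
  then show "\<ominus>\<^bsub>DD\<^esub> \<Theta> \<in> extensional (carrier A)" by (auto dest!: DD_FF simp: fun_group_def PiE_iff)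
  show "\<ominus>\<^bsub>DD\<^esub> \<Theta> \<in> addhom A TT"
    by (rule addhomI) (use assms in \<open>simp_all add: DD_inv_apply[OF c] addhom_add[OF h] T.minus_add\<close>)
  note z = T.zero_inv
  show "\<And>t. t \<in> carrier R \<Longrightarrow> (\<ominus>\<^bsub>DD\<^esub> \<Theta>) (umap A t) = \<zero>\<^bsub>TT\<^esub>"
    by (simp add: DD_inv_apply[OF c] DWD(4)[OF assms] z)
  fix x y assume xy: "x \<in> carrier A" "y \<in> carrier A"
  then show "(\<ominus>\<^bsub>DD\<^esub> \<Theta>) (x \<otimes> y) = ract TT ((\<ominus>\<^bsub>DD\<^esub> \<Theta>) x) y \<oplus>\<^bsub>TT\<^esub> lact TT (sg n x) ((\<ominus>\<^bsub>DD\<^esub> \<Theta>) y)"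
    using assms addhom_inv[OF grp_T grp_T ract_tens_hom(1)[OF xy(2)], of "\<Theta> x"] addhom_inv[OF grp_T grp_T lact_tens_hom(1)[of "sg n x"], of "\<Theta> y"]
    by (simp add: DD_inv_apply[OF c] DWD(5)[OF assms] T.minus_add)
qed (use assms in \<open>simp_all add: DD_inv_apply[OF DW_DD[OF assms]] TW_inv wt_carrier DWD(3)\<close>)

lemma lact_DD: "lact DD a \<Theta> = (\<lambda>x\<in>carrier A. il a (\<Theta> x))"
  by (simp add: DDer_def Let_def)

text \<open>In the Leibniz rule the inner action of \<open>a\<close> passes the left multiplier and
  twists it by the weight of \<open>a\<close>; this is exactly the change from the twist by n to the
  twist by n + q.\<close>

lemma DW_lact:
  assumes a: "a \<in> wt A q" and \<Theta>: "\<Theta> \<in> DW n"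
  shows "lact DD a \<Theta> \<in> DW (n + q)"
proof (rule DWI)
  note ac = wt_carrier[OF a] and h = DWD(2)[OF \<Theta>] and tc = DW_apply[OF \<Theta>]
  show "lact DD a \<Theta> \<in> extensional (carrier A)" by (simp add: lact_DD)
  show "lact DD a \<Theta> \<in> addhom A TT"
    by (rule addhomI) (use ac in \<open>simp_all add: lact_DD tc addhom_add[OF h] addhom_add[OF inner_l_char(1)]\<close>)
  show "lact DD a \<Theta> x \<in> TW (p + (n + q))" if "x \<in> wt A p" for p x
    using TW_acts(1)[OF a DWD(3)[OF \<Theta> that]] that by (simp add: lact_DD wt_carrier ac_simps)
  show "\<And>t. t \<in> carrier R \<Longrightarrow> lact DD a \<Theta> (umap A t) = \<zero>\<^bsub>TT\<^esub>"
    using ac by (simp add: lact_DD DWD(4)[OF \<Theta>] addhom_zero[OF grp_T grp_T inner_l_char(1)])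
  fix x y assume xy: "x \<in> carrier A" "y \<in> carrier A"
  then show "lact DD a \<Theta> (x \<otimes> y) = ract TT (lact DD a \<Theta> x) y \<oplus>\<^bsub>TT\<^esub> lact TT (sg (n + q) x) (lact DD a \<Theta> y)"
    using ac by (simp add: lact_DD DWD(5)[OF \<Theta>] tc addhom_add[OF inner_l_char(1)] il_ract il_lact[OF a] sg_sg add.commute)
qed

text \<open>By definition the sign sits on \<open>a\<close> and depends on the weight of the
  argument. For homogeneous \<open>a\<close> it is moved to the argument, which gives one formula
  for all arguments.\<close>

lemma ract_DD:
  assumes a: "a \<in> wt A q" and h: "\<Theta> \<in> addhom A TT"
  shows "ract DD \<Theta> a = (\<lambda>x\<in>carrier A. ir (\<Theta> (sg q x)) a)"
proof -
  note ac = wt_carrier[OF a]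
  have L: "(\<lambda>x. ir (\<Theta> (sg q x)) a) \<in> addhom A TT"
    by (rule addhom_comp[OF addhom_comp[OF sg_addhom h] inner_r_char(1)[OF ac]])
  have e: "ir (\<Theta> (sg q x)) a = ir (\<Theta> x) (sg p a)" if x: "x \<in> wt A p" for p x
  proof -
    note xc = wt_carrier[OF x] and tx = addhom_closed[OF h wt_carrier[OF x]]
    have "\<Theta> (sg q x) = ksgn TT (q * p) (\<Theta> x)"
      using xc by (simp add: sg_wt[OF x] ksgn_def addhom_inv[OF grp_A grp_T h])
    moreover have "ir (ksgn TT (q * p) (\<Theta> x)) a = ksgn TT (q * p) (ir (\<Theta> x) a)"
      using ac tx by (simp add: ksgn_def addhom_inv[OF grp_T grp_T inner_r_char(1)])
    moreover have "ir (\<Theta> x) (sg p a) = ksgn TT (q * p) (ir (\<Theta> x) a)"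
      using ac tx by (simp add: sg_wt[OF a] ksgn_def addhom_inv[OF grp_A grp_T ir_hom_left] mult.commute)
    ultimately show ?thesis by simp
  qed
  have "ract DD \<Theta> a = the_add_map A TT (\<lambda>f. \<forall>p. \<forall>x\<in>wt A p. f x = ir (\<Theta> x) (twist A p a))"
    by (simp add: DDer_def Let_def)
  also have "\<dots> = restrict (\<lambda>x. ir (\<Theta> (sg q x)) a) (carrier A)"
  proof (rule the_add_map_eq[OF L _ grp_A])
    show "\<forall>p. \<forall>x\<in>wt A p. restrict (\<lambda>x. ir (\<Theta> (sg q x)) a) (carrier A) x = ir (\<Theta> x) (twist A p a)"
      using ac by (simp add: wt_carrier twist_eq e)
    fix g assume g: "g \<in> addhom A TT" "\<forall>p. \<forall>x\<in>wt A p. g x = ir (\<Theta> x) (twist A p a)"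
    have "g x = ir (\<Theta> (sg q x)) a" if "x \<in> wt A p" for p x
      using g(2) that ac by (simp add: twist_eq e)
    then show "\<forall>x\<in>carrier A. g x = ir (\<Theta> (sg q x)) a"
      by (intro ballI, rule A_ext[OF grp_T g(1) L])
  qed
  finally show ?thesis .
qed

lemma DW_ract:
  assumes a: "a \<in> wt A q" and \<Theta>: "\<Theta> \<in> DW n"
  shows "ract DD \<Theta> a \<in> DW (n + q)"
proof (rule DWI)
  note ac = wt_carrier[OF a] and h = DWD(2)[OF \<Theta>] and tc = DW_apply[OF \<Theta>]
  note eq = ract_DD[OF a h]
  show "ract DD \<Theta> a \<in> extensional (carrier A)" by (simp add: eq)
  show "ract DD \<Theta> a \<in> addhom A TT"
    by (rule addhomI) (use ac in \<open>simp_all add: eq tc addhom_add[OF h] sg_add addhom_add[OF inner_r_char(1)]\<close>)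
  show "ract DD \<Theta> a x \<in> TW (p + (n + q))" if "x \<in> wt A p" for p x
    using TW_acts(2)[OF a DWD(3)[OF \<Theta> sg_wt_closed[OF that, of q]]] that by (simp add: eq wt_carrier ac_simps)
  show "\<And>t. t \<in> carrier R \<Longrightarrow> ract DD \<Theta> a (umap A t) = \<zero>\<^bsub>TT\<^esub>"
    using ac by (simp add: eq sg_wt[OF wt_umap] ksgn_def DWD(4)[OF \<Theta>] addhom_zero[OF grp_T grp_T inner_r_char(1)])
  fix x y assume xy: "x \<in> carrier A" "y \<in> carrier A"
  \<comment> \<open>Here \<open>y\<close> is twisted twice by q, once by the argument of \<Theta>
    and once by the inner right action, and the two cancel. The twist of \<open>x\<close> survives
    and raises the weight of the derivation.\<close>
  have "ir (ract TT (\<Theta> (sg q x)) (sg q y)) a = ract TT (ir (\<Theta> (sg q x)) a) y"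
    using xy by (simp add: ir_ract[OF a] tc sg_sg, simp add: sg_def)
  then show "ract DD \<Theta> a (x \<otimes> y) = ract TT (ract DD \<Theta> a x) y \<oplus>\<^bsub>TT\<^esub> lact TT (sg (n + q) x) (ract DD \<Theta> a y)"
    using xy ac by (simp add: eq sg_mult DWD(5)[OF \<Theta>] tc addhom_add[OF inner_r_char(1)] ir_lact sg_sg)
qed

end

section \<open>Double derivations of an ungraded algebra\<close>

lemma ungraded_simps [simp]:
  "carrier (ungraded B) = carrier B" "monoid.mult (ungraded B) = monoid.mult B" "one (ungraded B) = one B"
  "ring.zero (ungraded B) = ring.zero B" "add (ungraded B) = add B" "umap (ungraded B) = umap B"
  "wt (ungraded B) = placed 0 B" "kmap R (ungraded B) = kmap R B"
  by (simp_all add: ungraded_def alg.defs galg.defs kmap_def[abs_def])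

lemma ungraded_inv [simp]: "\<ominus>\<^bsub>ungraded B\<^esub> x = \<ominus>\<^bsub>B\<^esub> x"
  by (simp add: a_inv_def m_inv_def)

lemma ungraded_tens [simp]: "tens_rels K R (ungraded B) = tens_rels K R B" "tens K R (ungraded B) = tens K R B"
  by (simp_all add: tens_rels_def tens_def)

lemma ring_ungraded:
  assumes "ring B"
  shows "ring (ungraded B)"
proof -
  interpret ring B by fact
  show ?thesis
  proof (intro ringI abelian_groupI monoidI)
    fix x assume "x \<in> carrier (ungraded B)"
    then show "\<exists>y\<in>carrier (ungraded B). y \<oplus>\<^bsub>ungraded B\<^esub> x = \<zero>\<^bsub>ungraded B\<^esub>"
      by (intro bexI[of _ "\<ominus>\<^bsub>B\<^esub> x"]) (simp_all add: l_neg)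
  qed (simp_all add: a_ac m_assoc l_distr r_distr)
qed

locale base_alg = kalg K R B for K :: "('k, 'x) ring_scheme" and R :: "('k, 'r, 'y) alg_scheme" and B :: "('r, 'b) alg" +
  fixes h :: 'k
  assumes h_in_K: "h \<in> carrier K" and h_half_B: "kmap R B h \<oplus>\<^bsub>B\<^esub> kmap R B h = \<one>\<^bsub>B\<^esub>"
begin

abbreviation TB' :: "('b, ('b \<times> 'b) pres) bimod" where "TB' \<equiv> tens K R B"
abbreviation D :: "('b, 'b \<Rightarrow> ('b \<times> 'b) pres) bimod" where "D \<equiv> DDer K R (ungraded B)"

text \<open>The identity serves as sign automorphism: everything outside weight 0 is zero. The
  results on double derivations then apply to B, with all signs disappearing.\<close>

sublocale U: superalg K R "ungraded B" "\<lambda>x. x" h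
proof (intro superalg.intro superalg_axioms.intro kalg.intro)
  show "k_algebra K R" by (rule kR)
  show "R_algebra K R (ungraded B)" using RA unfolding R_algebra_def by (simp add: ring_ungraded ring_hom_def)
  have wt_all: "(\<Union>p. wt (ungraded B) p) = carrier (ungraded B)"
    by (auto simp: placed_def split: if_splits)
  have "abelian_group (ungraded B)" using ring_ungraded[OF A.ring_axioms] by (rule ring.is_abelian_group)
  from span_closed[OF this subset_refl]
  show "carrier (ungraded B) = span (ungraded B) (\<Union>p. wt (ungraded B) p)"
    unfolding wt_all by (intro equalityI subsetI) (simp_all add: span_incl)
  show "(\<lambda>x. x) \<in> ring_hom (ungraded B) (ungraded B)" by (rule ring_hom_memI) simp_all
  show "h \<in> carrier K" by (rule h_in_K)
  show "kmap R (ungraded B) h \<oplus>\<^bsub>ungraded B\<^esub> kmap R (ungraded B) h = \<one>\<^bsub>ungraded B\<^esub>" using h_half_B by simp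
  fix p q :: int and a b
  show "\<zero>\<^bsub>ungraded B\<^esub> \<in> wt (ungraded B) p" by (simp add: placed_def)
  show "umap (ungraded B) t \<in> wt (ungraded B) 0" if "t \<in> carrier R" for t using that by (simp add: placed_def)
  assume "a \<in> wt (ungraded B) p"
  then have a: "a \<in> carrier B" "p \<noteq> 0 \<Longrightarrow> a = \<zero>\<^bsub>B\<^esub>" by (simp_all add: placed_def split: if_splits)
  show "a \<in> carrier (ungraded B)" using a by simp
  show "\<ominus>\<^bsub>ungraded B\<^esub> a \<in> wt (ungraded B) p" using a by (simp add: placed_def)
  show "a = ksgn (ungraded B) p a" using a by (cases "p = 0") (simp_all add: ksgn_def)
  {
    assume "b \<in> wt (ungraded B) p"
    then have "b \<in> carrier B" "p \<noteq> 0 \<Longrightarrow> b = \<zero>\<^bsub>B\<^esub>" by (simp_all add: placed_def split: if_splits)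
    with a show "a \<oplus>\<^bsub>ungraded B\<^esub> b \<in> wt (ungraded B) p" by (simp add: placed_def)
  }
  assume "b \<in> wt (ungraded B) q"
  then have b: "b \<in> carrier B" "q \<noteq> 0 \<Longrightarrow> b = \<zero>\<^bsub>B\<^esub>" by (simp_all add: placed_def split: if_splits)
  show "a \<otimes>\<^bsub>ungraded B\<^esub> b \<in> wt (ungraded B) (p + q)"
    using a b by (cases "p = 0"; cases "q = 0") (simp_all add: placed_def)
qed simp

lemma U_sg [simp]: "U.sg n b = b" by (simp add: U.sg_def)

lemma U_wt0: "b \<in> carrier B \<Longrightarrow> b \<in> wt (ungraded B) 0" by (simp add: placed_def)

lemma ilB: "\<lbrakk>a \<in> carrier B; u \<in> carrier B; v \<in> carrier B\<rbrakk> \<Longrightarrow> inner_l K R (ungraded B) a (pt u v) = pt u (a \<otimes>\<^bsub>B\<^esub> v)"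
  using U.il_wt[OF U_wt0, of a u v] by simp

lemma irB: "\<lbrakk>a \<in> carrier B; u \<in> carrier B; v \<in> carrier B\<rbrakk> \<Longrightarrow> inner_r K R (ungraded B) (pt u v) a = pt (u \<otimes>\<^bsub>B\<^esub> a) v"
  using U.ir_wt[OF U_wt0, of a u v] by simp

lemma U_TW: "tens_wt K R (ungraded B) n = (if n = 0 then carrier TB' else {\<zero>\<^bsub>TB'\<^esub>})"
proof (cases "n = 0")
  case True
  have "t \<in> tens_wt K R (ungraded B) 0" if "t \<in> carrier TB'" for t
  proof (rule U.TW_gen_map[OF T.presented_axioms _ _ that, unfolded ungraded_tens])
    show "(\<lambda>t. t) \<in> addhom TB' TB'" by (rule addhom_id)
    fix g assume "g \<in> carrier B \<times> carrier B"
    then show "gcls (tens_rels K R B) g \<in> tens_wt K R (ungraded B) 0"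
      using U.TW_incl[OF U_wt0 U_wt0] by fastforce
  qed
  moreover have "t \<in> carrier TB'" if "t \<in> tens_wt K R (ungraded B) 0" for t
    using U.TW_closed[OF that] by simp
  ultimately have "tens_wt K R (ungraded B) 0 = carrier TB'" by blast
  then show ?thesis using True by simp
next
  case False
  have g: "x = \<zero>\<^bsub>TB'\<^esub>" if "x \<in> {ptens K R (ungraded B) u v |u v p q. u \<in> wt (ungraded B) p \<and> v \<in> wt (ungraded B) q \<and> p + q = n}" for x
  proof -
    from that obtain u v p q where x: "x = pt u v" "u \<in> placed 0 B p" "v \<in> placed 0 B q" "p + q = n"
      unfolding ungraded_tens ungraded_simps by blast
    have uv: "u \<in> carrier B" "v \<in> carrier B" using x(2,3) by (simp_all add: placed_def split: if_splits)
    have "p \<noteq> 0 \<or> q \<noteq> 0" using False x(4) by linarith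
    then have "u = \<zero>\<^bsub>B\<^esub> \<or> v = \<zero>\<^bsub>B\<^esub>" using x(2,3) by (simp add: placed_def split: if_splits)
    then show ?thesis
    proof
      assume "u = \<zero>\<^bsub>B\<^esub>" then show ?thesis using x(1) U.pt_zero(1)[of v] uv by simp
    next
      assume "v = \<zero>\<^bsub>B\<^esub>" then show ?thesis using x(1) U.pt_zero(2)[of u] uv by simp
    qed
  qed
  have z: "t = \<zero>\<^bsub>TB'\<^esub>" if "t \<in> tens_wt K R (ungraded B) n" for t
    by (rule span_trivial[OF T.abelian_group_axioms that[unfolded tens_wt_def ungraded_tens(2)] g])
  have "tens_wt K R (ungraded B) n = {\<zero>\<^bsub>TB'\<^esub>}"
  proof (intro equalityI subsetI)
    fix t assume "t \<in> tens_wt K R (ungraded B) n"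
    from z[OF this] show "t \<in> {\<zero>\<^bsub>TB'\<^esub>}" by (simp only: singleton_iff)
  qed (use U.TW_zero[of n] in simp)
  then show ?thesis using False by simp
qed

text \<open>By \<open>U_TW\<close> the tensor square of B vanishes outside weight 0, so a double
  derivation of another weight is zero. Elements of \<open>D\<close> can thus be handled as single
  homogeneous derivations instead of sums.\<close>

lemma D_carrier: "carrier D = DDer_wt K R (ungraded B) 0"
proof
  show "DDer_wt K R (ungraded B) 0 \<subseteq> carrier D" by (rule subsetI) (rule U.DW_DD)
  show "carrier D \<subseteq> DDer_wt K R (ungraded B) 0"
  proof
    have *: "\<Theta> \<in> DDer_wt K R (ungraded B) 0" if "\<Theta> \<in> DDer_wt K R (ungraded B) n" for \<Theta> n
    proof (cases "n = 0")
      case False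
      have "\<Theta> x = \<zero>\<^bsub>D\<^esub> x" if "x \<in> carrier B" for x
        using U.DWD(3)[OF \<open>\<Theta> \<in> DDer_wt K R (ungraded B) n\<close> U_wt0[OF that]] False that
        by (simp add: U_TW U.DD_zero_apply)
      then have "\<Theta> = \<zero>\<^bsub>D\<^esub>"
        using that by (intro U.DD_ext[OF U.DW_DD[OF that] U.DW_DD[OF U.DW_zero[of n]]]) simp
      then show ?thesis using U.DW_zero by simp
    qed (use that in simp)
    fix \<Theta> assume "\<Theta> \<in> carrier D"
    then show "\<Theta> \<in> DDer_wt K R (ungraded B) 0" unfolding U.DD_simps(1)
    proof (induction rule: span_induct)
      case zero show ?case using U.DW_zero[of 0] by (simp add: U.DD_simps)
    next
      case (incl x) then show ?case using * by blast
    next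
      case (inv x)
      then obtain n where "x \<in> DDer_wt K R (ungraded B) n" by blast
      from *[OF this] have x: "x \<in> DDer_wt K R (ungraded B) 0" .
      show ?case using U.DW_inv[OF x] U.inv_DD[OF U.DW_DD[OF x]] by simp
    next
      case (add x y) then show ?case using U.DW_add[of x 0 y] by (simp add: U.DD_simps)
    qed
  qed
qed

lemma D_I:
  assumes "\<Delta> \<in> extensional (carrier B)" "\<Delta> \<in> addhom B TB'" "\<And>t. t \<in> carrier R \<Longrightarrow> \<Delta> (umap B t) = \<zero>\<^bsub>TB'\<^esub>"
    "\<And>x y. x \<in> carrier B \<Longrightarrow> y \<in> carrier B \<Longrightarrow> \<Delta> (x \<otimes>\<^bsub>B\<^esub> y) = ract TB' (\<Delta> x) y \<oplus>\<^bsub>TB'\<^esub> lact TB' x (\<Delta> y)"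
  shows "\<Delta> \<in> carrier D"
proof -
  have "\<Delta> \<in> addhom (ungraded B) TB'" using assms(2) by (simp add: hom_def)
  moreover have "\<Delta> x \<in> tens_wt K R (ungraded B) (p + 0)" if "x \<in> wt (ungraded B) p" for p x
    using that addhom_closed[OF assms(2)] addhom_zero[OF A.abelian_group_axioms T.abelian_group_axioms assms(2)]
    by (auto simp: U_TW placed_def split: if_splits)
  ultimately show ?thesis unfolding D_carrier using assms by (intro U.DWI) simp_all
qed

lemma D_D:
  assumes "\<Delta> \<in> carrier D"
  shows "\<Delta> \<in> extensional (carrier B)" "\<Delta> \<in> addhom B TB'" "\<And>t. t \<in> carrier R \<Longrightarrow> \<Delta> (umap B t) = \<zero>\<^bsub>TB'\<^esub>"
    "\<And>x y. x \<in> carrier B \<Longrightarrow> y \<in> carrier B \<Longrightarrow> \<Delta> (x \<otimes>\<^bsub>B\<^esub> y) = ract TB' (\<Delta> x) y \<oplus>\<^bsub>TB'\<^esub> lact TB' x (\<Delta> y)"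
  using U.DWD[OF assms[unfolded D_carrier]] by (simp_all add: hom_def)

lemma D_apply [simp]: "\<Delta> \<in> carrier D \<Longrightarrow> x \<in> carrier B \<Longrightarrow> \<Delta> x \<in> carrier TB'"
  by (rule addhom_closed[OF D_D(2)])

lemma D_act_closed:
  assumes "b \<in> carrier B" "\<Delta> \<in> carrier D"
  shows "lact D b \<Delta> \<in> carrier D" "ract D \<Delta> b \<in> carrier D"
  using U.DW_lact[OF U_wt0[OF assms(1)] assms(2)[unfolded D_carrier]]
    U.DW_ract[OF U_wt0[OF assms(1)] assms(2)[unfolded D_carrier]]
  by (simp_all add: D_carrier)

lemma D_act_apply:
  assumes "b \<in> carrier B" "\<Delta> \<in> carrier D" "x \<in> carrier B"
  shows "lact D b \<Delta> x = inner_l K R (ungraded B) b (\<Delta> x)" "ract D \<Delta> b x = inner_r K R (ungraded B) (\<Delta> x) b"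
  using assms U.ract_DD[OF U_wt0[OF assms(1)] U.DWD(2)[OF assms(2)[unfolded D_carrier]]]
  by (simp_all add: U.lact_DD)

lemmas inner_B = U.il_add[unfolded ungraded_simps ungraded_tens] U.ir_add[unfolded ungraded_simps ungraded_tens]
  U.il_mult[unfolded ungraded_simps ungraded_tens] U.ir_mult[unfolded ungraded_simps ungraded_tens]
  U.il_ir[unfolded ungraded_simps ungraded_tens]
  U.il_one[unfolded ungraded_simps ungraded_tens] U.ir_one[unfolded ungraded_simps ungraded_tens]
  U.il_closed[unfolded ungraded_simps ungraded_tens] U.ir_closed[unfolded ungraded_simps ungraded_tens]
  addhom_add[OF U.inner_l_char(1), unfolded ungraded_simps ungraded_tens]
  addhom_add[OF U.inner_r_char(1), unfolded ungraded_simps ungraded_tens]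

lemmas D_ext = U.DD_ext[unfolded ungraded_simps]

lemmas D_add_apply = U.DD_add_apply[unfolded ungraded_simps ungraded_tens]

lemma D_add_closed: "\<Delta> \<in> carrier D \<Longrightarrow> \<Delta>' \<in> carrier D \<Longrightarrow> \<Delta> \<oplus>\<^bsub>D\<^esub> \<Delta>' \<in> carrier D"
  by (rule abelian_groupE(1)[OF U.grp_DD])

sublocale DB: biact B D "lact D" "ract D"
proof (rule biact.intro[OF A.ring_axioms U.grp_DD])
  note c = D_act_closed D_add_closed and e = D_act_apply D_add_apply
  fix b v assume b: "b \<in> carrier B" and v: "v \<in> carrier D"
  show "lact D b v \<in> carrier D" "ract D v b \<in> carrier D" using b v by (auto intro: c)
next
  note c = D_act_closed D_add_closed and e = D_act_apply D_add_apply
  fix b v w assume b: "b \<in> carrier B" and v: "v \<in> carrier D" and w: "w \<in> carrier D"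
  show "lact D b (v \<oplus>\<^bsub>D\<^esub> w) = lact D b v \<oplus>\<^bsub>D\<^esub> lact D b w"
    by (rule D_ext) (use b v w in \<open>simp_all add: c e inner_B\<close>)
  show "ract D (v \<oplus>\<^bsub>D\<^esub> w) b = ract D v b \<oplus>\<^bsub>D\<^esub> ract D w b"
    by (rule D_ext) (use b v w in \<open>simp_all add: c e inner_B\<close>)
next
  note cl = D_act_closed D_add_closed and e = D_act_apply D_add_apply
  fix b c v assume b: "b \<in> carrier B" and c: "c \<in> carrier B" and v: "v \<in> carrier D"
  show "lact D (b \<oplus>\<^bsub>B\<^esub> c) v = lact D b v \<oplus>\<^bsub>D\<^esub> lact D c v"
    by (rule D_ext) (use b v c in \<open>simp_all add: cl e inner_B\<close>)
  show "ract D v (b \<oplus>\<^bsub>B\<^esub> c) = ract D v b \<oplus>\<^bsub>D\<^esub> ract D v c"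
    by (rule D_ext) (use b v c in \<open>simp_all add: cl e inner_B\<close>)
  show "lact D (b \<otimes>\<^bsub>B\<^esub> c) v = lact D b (lact D c v)"
    by (rule D_ext) (use b v c in \<open>simp_all add: cl e inner_B\<close>)
  show "ract D v (b \<otimes>\<^bsub>B\<^esub> c) = ract D (ract D v b) c"
    by (rule D_ext) (use b v c in \<open>simp_all add: cl e inner_B\<close>)
  show "ract D (lact D b v) c = lact D b (ract D v c)"
    by (rule D_ext) (use b v c in \<open>simp_all add: cl e inner_B\<close>)
next
  note cl = D_act_closed and e = D_act_apply
  fix v assume v: "v \<in> carrier D"
  show "lact D \<one>\<^bsub>B\<^esub> v = v"
    by (rule D_ext) (use v in \<open>simp_all add: cl e inner_B\<close>)
  show "ract D v \<one>\<^bsub>B\<^esub> = v"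
    by (rule D_ext) (use v in \<open>simp_all add: cl e inner_B\<close>)
qed

end

section \<open>Dual bases of projective bimodules\<close>

text \<open>A substitute for preservation of zero when the source is not known to be a group: it is
  applied to maps out of the free bimodule.\<close>

lemma addhom_idem_zero:
  assumes W: "abelian_group W" and f: "f \<in> addhom U W" and z: "z \<in> carrier U" "z \<oplus>\<^bsub>U\<^esub> z = z"
  shows "f z = \<zero>\<^bsub>W\<^esub>"
proof -
  interpret W: abelian_group W by fact
  have c: "f z \<in> carrier W" by (rule addhom_closed[OF f z(1)])
  have "f z \<oplus>\<^bsub>W\<^esub> f z = f z" using addhom_add[OF f z(1) z(1)] z(2) by simp
  then show ?thesis using W.add.l_cancel_one[OF c c] by simp
qed

context kalg
begin

lemma free_simps:
  "carrier (free_bimod K R A I) = {f \<in> I \<rightarrow>\<^sub>E carrier (tens K R A). finite {i \<in> I. f i \<noteq> \<zero>\<^bsub>tens K R A\<^esub>}}"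
  "add (free_bimod K R A I) f g = (\<lambda>i\<in>I. f i \<oplus>\<^bsub>tens K R A\<^esub> g i)"
  "lact (free_bimod K R A I) b f = (\<lambda>i\<in>I. lact (tens K R A) b (f i))"
  "ract (free_bimod K R A I) f b = (\<lambda>i\<in>I. ract (tens K R A) (f i) b)"
  by (simp_all add: free_bimod_def Let_def)

text \<open>The projection p supplies the elements, as images of the standard basis, and the section
  s supplies the coordinate functions. Finite generation cuts the index set down to a finite
  one.\<close>

lemma projective_dual_basis:
  fixes V :: "('a, 'm, 'w) bimod_scheme"
  assumes kb: "kbiact K R A V (lact V) (ract V)" and proj: "projective_bimod K R A V" and fg: "fin_gen_bimod A V"
  shows "\<exists>(J :: 'm set) x \<phi>. finite J \<and> (\<forall>k\<in>J. x k \<in> carrier V \<and> \<phi> k \<in> bimod_hom A V (tens K R A)) \<and>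
    (\<forall>v\<in>carrier V. v = (\<Oplus>\<^bsub>V\<^esub>k\<in>J. kbiact.tact K R A V (lact V) (ract V) (x k) (\<phi> k v)))"
proof -
  interpret V: kbiact K R A V "lact V" "ract V" by (rule kb)
  let ?T = "tens K R A"
  from proj obtain I :: "'m set" and s p where s: "s \<in> bimod_hom A V (free_bimod K R A I)"
    and p: "p \<in> bimod_hom A (free_bimod K R A I) V" and ps: "\<And>v. v \<in> carrier V \<Longrightarrow> p (s v) = v"
    unfolding projective_bimod_def by blast
  let ?F = "free_bimod K R A I"
  have sh: "s \<in> addhom V ?F" and ph: "p \<in> addhom ?F V"
    and sb: "\<And>b v. b \<in> carrier A \<Longrightarrow> v \<in> carrier V \<Longrightarrow> s (lact V b v) = lact ?F b (s v) \<and> s (ract V v b) = ract ?F (s v) b"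
    and pb: "\<And>b f. b \<in> carrier A \<Longrightarrow> f \<in> carrier ?F \<Longrightarrow> p (lact ?F b f) = lact V b (p f) \<and> p (ract ?F f b) = ract V (p f) b"
    using s p by (simp_all add: bimod_hom_def)
  have sc: "s v i \<in> carrier ?T" if "v \<in> carrier V" "i \<in> I" for v i
    using addhom_closed[OF sh that(1)] that(2) by (auto simp: free_simps)
  have \<phi>h: "(\<lambda>v. s v i) \<in> bimod_hom A V ?T" if i: "i \<in> I" for i
  proof -
    have "(\<lambda>v. s v i) \<in> addhom V ?T"
      by (rule addhomI) (simp_all add: sc i addhom_add[OF sh] free_simps)
    then show ?thesis using i by (simp add: bimod_hom_def sb free_simps)
  qed
  then have \<phi>a: "(\<lambda>v. s v i) \<in> addhom V ?T" if "i \<in> I" for i using that by (simp add: bimod_hom_def)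
  \<comment> \<open>The tensor \<open>t\<close> in the k-th copy of B (x) B.\<close>
  define e where "e k t = (\<lambda>i\<in>I. if i = k then t else \<zero>\<^bsub>?T\<^esub>)" for k t
  have ec: "e k t \<in> carrier ?F" if "k \<in> I" "t \<in> carrier ?T" for k t
  proof -
    have "{i \<in> I. e k t i \<noteq> \<zero>\<^bsub>?T\<^esub>} \<subseteq> {k}" by (auto simp: e_def)
    from finite_subset[OF this] have fin: "finite {i \<in> I. e k t i \<noteq> \<zero>\<^bsub>?T\<^esub>}" by simp
    have "e k t \<in> I \<rightarrow>\<^sub>E carrier ?T" using that by (simp add: e_def PiE_iff)
    with fin show ?thesis by (simp only: free_simps mem_Collect_eq simp_thms)
  qed
  have eh: "e k \<in> addhom ?T ?F" if "k \<in> I" for k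
  proof (rule addhomI)
    show "e k (t \<oplus>\<^bsub>?T\<^esub> t') = e k t \<oplus>\<^bsub>?F\<^esub> e k t'" if "t \<in> carrier ?T" "t' \<in> carrier ?T" for t t'
      using that by (auto simp: free_simps e_def restrict_def fun_eq_iff)
  qed (rule ec[OF that])
  define x where "x k = p (e k (pt \<one> \<one>))" for k
  have xc: "x k \<in> carrier V" if "k \<in> I" for k
    unfolding x_def by (rule addhom_closed[OF ph ec[OF that]]) simp
  have pe: "p (e k t) = V.tact (x k) t" if k: "k \<in> I" and t: "t \<in> carrier ?T" for k t
  proof -
    have "p (e k (pt b b')) = V.tact (x k) (pt b b')" if b: "b \<in> carrier A" "b' \<in> carrier A" for b b'
    proof -
      let ?o = "e k (pt \<one> \<one>)"
      have o: "?o \<in> carrier ?F" by (rule ec[OF k]) simp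
      have r: "ract ?F ?o b' = e k (pt \<one> b')"
        using b by (auto simp: free_simps e_def ract_tens_hom restrict_def fun_eq_iff)
      have rc: "e k (pt \<one> b') \<in> carrier ?F" by (rule ec[OF k]) (simp add: b)
      have "e k (pt b b') = lact ?F b (e k (pt \<one> b'))"
        using b by (auto simp: free_simps e_def lact_tens_hom restrict_def fun_eq_iff)
      then show ?thesis
        using pb[OF b(1) rc] pb[OF b(2) o] b xc[OF k] by (simp add: r V.tact_hom x_def)
    qed
    then show ?thesis by (rule tens_ext[OF V.grp_V addhom_comp[OF eh[OF k] ph] V.tact_hom(1)[OF xc[OF k]] _ t])
  qed
  \<comment> \<open>Coordinates are peeled off one at a time; the remaining element \<open>g\<close>
    has support in the smaller index set.\<close>
  have decomp: "p f = (\<Oplus>\<^bsub>V\<^esub>k\<in>J. V.tact (x k) (f k))"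
    if "finite J" "J \<subseteq> I" "f \<in> carrier ?F" "\<forall>i\<in>I - J. f i = \<zero>\<^bsub>?T\<^esub>" for J f
    using that
  proof (induction J arbitrary: f rule: finite_induct)
    case empty
    then have "f \<oplus>\<^bsub>?F\<^esub> f = f" by (auto simp: free_simps PiE_iff extensional_def restrict_def fun_eq_iff)
    then show ?case using addhom_idem_zero[OF V.grp_V ph empty(2)] by simp
  next
    case (insert k J)
    define g where "g = (\<lambda>i\<in>I. if i = k then \<zero>\<^bsub>?T\<^esub> else f i)"
    have fk: "f i \<in> carrier ?T" if "i \<in> I" for i using insert.prems(2) that by (auto simp: free_simps)
    have k: "k \<in> I" using insert.prems by simp
    have gc: "g \<in> carrier ?F"
    proof -
      have "{i \<in> I. g i \<noteq> \<zero>\<^bsub>?T\<^esub>} \<subseteq> J" using insert.prems(3) by (auto simp: g_def split: if_splits)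
      from finite_subset[OF this insert.hyps(1)] show ?thesis using fk by (simp add: free_simps g_def PiE_iff)
    qed
    have fe: "f = e k (f k) \<oplus>\<^bsub>?F\<^esub> g"
      using insert.prems(2) fk k by (auto simp: free_simps PiE_iff extensional_def restrict_def fun_eq_iff e_def g_def)
    have "p f = p (e k (f k)) \<oplus>\<^bsub>V\<^esub> p g"
      by (subst fe) (rule addhom_add[OF ph ec[OF k fk[OF k]] gc])
    moreover have "p g = (\<Oplus>\<^bsub>V\<^esub>k\<in>J. V.tact (x k) (g k))"
    proof (rule insert.IH[OF _ gc])
      show "J \<subseteq> I" using insert.prems(1) by simp
      show "\<forall>i\<in>I - J. g i = \<zero>\<^bsub>?T\<^esub>" using insert.prems(3) by (auto simp: g_def)
    qed
    moreover have "(\<Oplus>\<^bsub>V\<^esub>k\<in>J. V.tact (x k) (g k)) = (\<Oplus>\<^bsub>V\<^esub>k\<in>J. V.tact (x k) (f k))"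
      using insert.hyps(2) insert.prems(1) fk xc by (intro V.V.finsum_cong') (auto simp: g_def V.tact_closed)
    moreover have "(\<Oplus>\<^bsub>V\<^esub>k\<in>insert k J. V.tact (x k) (f k)) = V.tact (x k) (f k) \<oplus>\<^bsub>V\<^esub> (\<Oplus>\<^bsub>V\<^esub>k\<in>J. V.tact (x k) (f k))"
      using insert.hyps insert.prems(1) fk xc by (intro V.V.finsum_insert) (auto simp: V.tact_closed)
    ultimately show ?case by (simp add: pe[OF k fk[OF k]])
  qed
  from fg obtain U where U: "finite U" "U \<subseteq> carrier V"
    and gen: "carrier V = span V {ract V (lact V b u) c |b u c. b \<in> carrier A \<and> u \<in> U \<and> c \<in> carrier A}"
    unfolding fin_gen_bimod_def span_def by blast
  \<comment> \<open>The coordinates that are nonzero on some generator. A coordinate function is a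
    bimodule map, so outside \<open>J\<close> it vanishes on everything.\<close>
  define J where "J = (\<Union>u\<in>U. {i \<in> I. s u i \<noteq> \<zero>\<^bsub>?T\<^esub>})"
  have "finite {i \<in> I. s u i \<noteq> \<zero>\<^bsub>?T\<^esub>}" if "u \<in> U" for u
    using addhom_closed[OF sh, of u] that U(2) by (auto simp: free_simps)
  then have J: "finite J" "J \<subseteq> I" using U(1) by (auto simp: J_def)
  have out: "s v i = \<zero>\<^bsub>?T\<^esub>" if v: "v \<in> carrier V" and i: "i \<in> I - J" for v i
  proof -
    have iI: "i \<in> I" using i by simp
    let ?G = "{ract V (lact V b u) c |b u c. b \<in> carrier A \<and> u \<in> U \<and> c \<in> carrier A}"
    have g1: "?G \<subseteq> carrier V" using U(2) by auto
    have g2: "s y i = \<zero>\<^bsub>?T\<^esub>" if "y \<in> ?G" for y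
    proof -
      from that obtain b u c where y: "y = ract V (lact V b u) c" "b \<in> carrier A" "u \<in> U" "c \<in> carrier A" by blast
      then have "s u i = \<zero>\<^bsub>?T\<^esub>" "u \<in> carrier V" using i U(2) by (auto simp: J_def)
      then show ?thesis using y iI by (simp add: sb free_simps)
    qed
    show ?thesis
      by (rule addhom_eq_on_span[OF V.grp_V T.abelian_group_axioms \<phi>a[OF iI] addhom_const_zero[OF T.abelian_group_axioms] g1 g2])
        (use v gen in simp_all)
  qed
  have "v = (\<Oplus>\<^bsub>V\<^esub>k\<in>J. V.tact (x k) (s v k))" if v: "v \<in> carrier V" for v
    using decomp[OF J addhom_closed[OF sh v]] out[OF v] ps[OF v] by simp
  moreover have "\<forall>k\<in>J. x k \<in> carrier V \<and> (\<lambda>v. s v k) \<in> bimod_hom A V ?T" using J(2) xc \<phi>h by auto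
  ultimately show ?thesis using J(1)
    by (intro exI[of _ J] exI[of _ x] exI[of _ "\<lambda>k v. s v k"]) simp
qed

sublocale O1: oneforms A R
  by unfold_locales (rule umap_hom)

lemma umap_kmap: "c \<in> carrier K \<Longrightarrow> kmap R A c = umap A (umap R c)"
  by (simp add: kmap_def)

text \<open>For a scalar c, cx and xc have the same differential; since d kills c, the Leibniz rule
  turns it into c dx and into dx c.\<close>

sublocale OK: kbiact K R A "Om1 R A" "lact (Om1 R A)" "ract (Om1 R A)"
proof (intro kbiact.intro kbiact_axioms.intro)
  show "kalg K R A" by (rule kalg_axioms)
  show "biact A (Om1 R A) (lact (Om1 R A)) (ract (Om1 R A))" by (rule O1.OB.biact_axioms)
  fix c v assume c: "c \<in> carrier K" and v: "v \<in> carrier (Om1 R A)"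
  let ?k = "kmap R A c"
  have "lact (Om1 R A) ?k (O1.p1 a x b) = ract (Om1 R A) (O1.p1 a x b) ?k"
    if *: "a \<in> carrier A" "x \<in> carrier A" "b \<in> carrier A" for a x b
  proof -
    have d0: "O1.p1 a' ?k b' = \<zero>\<^bsub>Om1 R A\<^esub>" if "a' \<in> carrier A" "b' \<in> carrier A" for a' b'
      using O1.p1_rules(5)[of a' x b' "umap R c"] that * c by (simp add: umap_kmap kmap_in_R)
    have "O1.p1 (?k \<otimes> a) x b = O1.p1 a (?k \<otimes> x) b"
      using O1.p1_rules(4)[of a ?k b x] * c by (simp add: d0 kmap_comm)
    also have "\<dots> = O1.p1 a x (b \<otimes> ?k)"
      using O1.p1_rules(4)[of a x b ?k] * c kmap_comm[OF c *(2)] kmap_comm[OF c *(3)] by (simp add: d0)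
    finally show ?thesis using * c by (simp add: O1.Om1_hom)
  qed
  then show "lact (Om1 R A) ?k v = ract (Om1 R A) v ?k"
    by (rule O1.Om1_ext[OF O1.O.abelian_group_axioms O1.Om1_hom(1)[OF kmap_closed[OF c]] O1.Om1_hom(3)[OF kmap_closed[OF c]] _ v])
qed

text \<open>The differentials of ring generators suffice: the Leibniz rule reduces products, and the
  image of R contributes nothing.\<close>

lemma Om1_fin_gen:
  assumes "fin_gen_over R A"
  shows "fin_gen_bimod A (Om1 R A)"
proof -
  let ?O = "Om1 R A"
  from assms obtain F where F: "finite F" "F \<subseteq> carrier A" "carrier A = generate_ring A (umap A ` carrier R \<union> F)"
    unfolding fin_gen_over_def by blast
  define S where "S = {ract ?O (lact ?O b u) c |b u c. b \<in> carrier A \<and> u \<in> du R A ` F \<and> c \<in> carrier A}"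
  have Sc: "S \<subseteq> carrier ?O" using F(2) by (auto simp: S_def)
  have "\<forall>a\<in>carrier A. \<forall>c\<in>carrier A. O1.p1 a x c \<in> span ?O S" if "x \<in> generate_ring A (umap A ` carrier R \<union> F)" for x
    using that
  proof (induction rule: generate_ring.induct)
    case one
    have "O1.p1 a \<one> c = \<zero>\<^bsub>?O\<^esub>" if "a \<in> carrier A" "c \<in> carrier A" for a c
      using O1.p1_rules(4)[of a "\<one>" c "\<one>"] that O1.O.add.l_cancel_one[of "O1.p1 a \<one> c" "O1.p1 a \<one> c"] by simp
    then show ?case by (simp add: span_zero)
  next
    case (incl y)
    show ?case
    proof (intro ballI)
      fix a c assume ac: "a \<in> carrier A" "c \<in> carrier A"
      show "O1.p1 a y c \<in> span ?O S"
      proof (cases "y \<in> F")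
        case True
        then have "y \<in> carrier A" using F(2) by auto
        then have "O1.p1 a y c = ract ?O (lact ?O a (du R A y)) c" using ac by (simp add: du_def O1.Om1_hom)
        then have "O1.p1 a y c \<in> S" using True ac by (auto simp: S_def)
        then show ?thesis by (rule span_incl)
      next
        case False
        then obtain t where "t \<in> carrier R" "y = umap A t" using incl by auto
        then show ?thesis using ac O1.p1_rules(5)[of a a c t] by (simp add: span_zero)
      qed
    qed
  next
    case (a_inv y)
    have y: "y \<in> carrier A" using a_inv.hyps F(3) by simp
    have "O1.p1 a (\<ominus> y) c = \<ominus>\<^bsub>?O\<^esub> O1.p1 a y c" if "a \<in> carrier A" "c \<in> carrier A" for a c
    proof -
      have "(\<lambda>x. O1.p1 a x c) \<in> addhom A ?O" by (rule addhomI) (use that O1.p1_rules(2) in simp_all)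
      from addhom_inv[OF A.abelian_group_axioms O1.O.abelian_group_axioms this y] show ?thesis .
    qed
    then show ?case using a_inv.IH span_inv[OF O1.O.abelian_group_axioms Sc] by simp
  next
    case (eng_add y z)
    have yz: "y \<in> carrier A" "z \<in> carrier A" using eng_add.hyps F(3) by simp_all
    show ?case using eng_add.IH yz by (simp add: O1.p1_rules(2) span_add)
  next
    case (eng_mult y z)
    have yz: "y \<in> carrier A" "z \<in> carrier A" using eng_mult.hyps F(3) by simp_all
    show ?case using eng_mult.IH yz by (simp add: O1.p1_rules(4) span_add)
  qed
  then have p1S: "O1.p1 a x c \<in> span ?O S" if "a \<in> carrier A" "x \<in> carrier A" "c \<in> carrier A" for a x c
    using that F(3) by simp
  have "carrier ?O \<subseteq> span ?O S"
  proof
    fix \<xi> assume "\<xi> \<in> carrier ?O"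
    then have "\<xi> \<in> span ?O (gcls (Om1_rels R A) ` (carrier A \<times> carrier A \<times> carrier A))"
      using O1.O.carrier_span by simp
    then show "\<xi> \<in> span ?O S"
    proof (rule span_least)
      show "gcls (Om1_rels R A) ` (carrier A \<times> carrier A \<times> carrier A) \<subseteq> span ?O S" using p1S by auto
    qed (auto intro: span_zero span_add span_inv[OF O1.O.abelian_group_axioms Sc])
  qed
  moreover have "span ?O S \<subseteq> carrier ?O" using span_closed[OF O1.O.abelian_group_axioms Sc] by (rule subsetI)
  ultimately have "carrier ?O = span ?O S" by (rule equalityI)
  then show ?thesis unfolding fin_gen_bimod_def span_def S_def
    using F(1,2) by (intro exI[of _ "du R A ` F"]) auto
qed

end

lemma (in kbiact) tact_hom_left:
  assumes t: "t \<in> carrier (tens K R B)"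
  shows "(\<lambda>v. tact v t) \<in> addhom V V"
proof (rule addhomI)
  show "tact v t \<in> carrier V" if "v \<in> carrier V" for v by (rule tact_closed[OF that t])
  fix v w assume vw: "v \<in> carrier V" "w \<in> carrier V"
  then have vw': "v \<oplus>\<^bsub>V\<^esub> w \<in> carrier V" by simp
  have "tact (v \<oplus>\<^bsub>V\<^esub> w) (pt b b') = tact v (pt b b') \<oplus>\<^bsub>V\<^esub> tact w (pt b b')" if "b \<in> carrier B" "b' \<in> carrier B" for b b'
    using that vw by (simp add: tact_hom l_add r_add)
  then show "tact (v \<oplus>\<^bsub>V\<^esub> w) t = tact v t \<oplus>\<^bsub>V\<^esub> tact w t"
    by (rule tens_ext[OF grp_V tact_hom(1)[OF vw'] addhom_sum2[OF grp_V tact_hom(1)[OF vw(1)] tact_hom(1)[OF vw(2)]] _ t])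
qed

section \<open>Derivations with values in \<open>A \<otimes> A\<close>\<close>

lemma (in superalg) ind_ext_wt:
  assumes "induced A B V j" and W: "abelian_group W" and f: "f \<in> addhom (ind A j B V) W" and g: "g \<in> addhom (ind A j B V) W"
    and fg: "\<And>p q a v c. \<lbrakk>a \<in> wt A p; v \<in> carrier V; c \<in> wt A q\<rbrakk> \<Longrightarrow> f (pind A j B V a v c) = g (pind A j B V a v c)"
    and x: "x \<in> carrier (ind A j B V)"
  shows "f x = g x"
proof -
  interpret I: induced A B V j by fact
  have h1: "(\<lambda>a. I.pi3 a v c) \<in> addhom A (ind A j B V)" and h2: "I.pi3 c v \<in> addhom A (ind A j B V)"
    if "c \<in> carrier A" "v \<in> carrier V" for c v
    using that by (auto intro!: addhomI simp: I.pi3_rules)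
  have 1: "f (I.pi3 a v c) = g (I.pi3 a v c)" if "a \<in> wt A p" "v \<in> carrier V" "c \<in> carrier A" for p a v c
    by (rule A_ext[OF W addhom_comp[OF h2[OF wt_carrier[OF that(1)] that(2)] f] addhom_comp[OF h2[OF wt_carrier[OF that(1)] that(2)] g] fg[OF that(1,2)] that(3)])
  have 2: "f (I.pi3 a v c) = g (I.pi3 a v c)" if "a \<in> carrier A" "v \<in> carrier V" "c \<in> carrier A" for a v c
    by (rule A_ext[OF W addhom_comp[OF h1[OF that(3,2)] f] addhom_comp[OF h1[OF that(3,2)] g] 1[OF _ that(2,3)] that(1)])
  show ?thesis by (rule I.ind_ext[OF W f g 2 x])
qed

text \<open>An algebra A over the smooth algebra B, with B mapping into weight 0. The comparison of
  A (x)_B DDer B (x)_B A with derivations from B to A (x) A is carried out in this generality,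
  before A is a tensor algebra.\<close>

locale pairalg = B: base_alg K R B h + A: superalg K R A \<sigma> h
  for K :: "('k, 'x) ring_scheme" and R :: "('k, 'r, 'y) alg_scheme" and B :: "('r, 'b) alg" and h :: 'k
    and A :: "('r, 'a, 'z) galg_scheme" (structure) and \<sigma> +
  fixes j :: "'b \<Rightarrow> 'a"
  assumes j_hom: "j \<in> ring_hom B A" and j_wt: "\<And>b. b \<in> carrier B \<Longrightarrow> j b \<in> wt A 0"
    and j_umap: "\<And>t. t \<in> carrier R \<Longrightarrow> j (umap B t) = umap A t" and smooth_B: "smooth K R B"
begin

abbreviation TB where "TB \<equiv> tens K R B"
abbreviation TT where "TT \<equiv> tens K R A"
abbreviation D where "D \<equiv> DDer K R (ungraded B)"
abbreviation U where "U \<equiv> ind A j B D"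
abbreviation il where "il \<equiv> inner_l K R A"
abbreviation ir where "ir \<equiv> inner_r K R A"
abbreviation tm where "tm \<equiv> tens_map K R A j"

lemma j_closed [simp]: "b \<in> carrier B \<Longrightarrow> j b \<in> carrier A"
  by (rule ring_hom_closed[OF j_hom])

lemma j_kmap: "c \<in> carrier K \<Longrightarrow> j (kmap R B c) = kmap R A c"
  by (simp add: kmap_def j_umap B.kmap_in_R)

lemmas j_rules = ring_hom_add[OF j_hom] ring_hom_mult[OF j_hom] ring_hom_one[OF j_hom]

lemma sg_j [simp]: "b \<in> carrier B \<Longrightarrow> A.sg n (j b) = j b"
  by (simp add: A.sg_wt[OF j_wt] ksgn_def)

lemma tm_hom: "tm \<in> addhom TB TT" and tm_pt: "u \<in> carrier B \<Longrightarrow> v \<in> carrier B \<Longrightarrow> tm (B.pt u v) = A.pt (j u) (j v)"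
proof -
  have r0: "respects_rels TT (carrier B \<times> carrier B) (tens_rels K R B) (\<lambda>(u, v). A.pt (j u) (j v))"
    by (rule B.tens_respects[OF A.grp_T])
      (simp_all add: j_rules A.pt_add_left A.pt_add_right j_kmap A.pt_balanced)
  have r: "respects_rels TT (carrier B \<times> carrier B) (tens_rels K R B) (\<lambda>x. gcls (tens_rels K R A) (map_prod j j x))"
    using r0 by (simp add: case_prod_beta' map_prod_def)
  have m: "map_prod j j x \<in> carrier A \<times> carrier A" if "x \<in> carrier B \<times> carrier B" for x
    using that by auto
  note * = pmap_lift[OF B.T.presented_axioms A.T.presented_axioms m r]
  show "tm \<in> addhom TB TT" by (rule *(1))
  show "tm (B.pt u v) = A.pt (j u) (j v)" if "u \<in> carrier B" "v \<in> carrier B"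
    using *(2)[of "(u, v)"] that by simp
qed

lemma tm_closed [simp]: "t \<in> carrier TB \<Longrightarrow> tm t \<in> carrier TT"
  by (rule addhom_closed[OF tm_hom])

lemma il_jj:
  assumes "a \<in> carrier A" "b \<in> carrier B" "v \<in> carrier A"
  shows "il a (A.pt (j b) v) = A.pt (j b) (a \<otimes> v)" "ir (A.pt v (j b)) a = A.pt (v \<otimes> a) (j b)"
  using assms A.inner_l_char(2)[OF assms(1) j_wt[OF assms(2)] assms(3)] A.inner_r_char(2)[OF assms(1,3) j_wt[OF assms(2)]]
  by simp_all

lemma tm_inner:
  assumes b: "b \<in> carrier B" and t: "t \<in> carrier TB"
  shows "tm (inner_l K R (ungraded B) b t) = il (j b) (tm t)" "tm (inner_r K R (ungraded B) t b) = ir (tm t) (j b)"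
    "tm (lact TB b t) = lact TT (j b) (tm t)" "tm (ract TB t b) = ract TT (tm t) (j b)"
proof -
  have l: "inner_l K R (ungraded B) b \<in> addhom TB TB" "(\<lambda>t. inner_r K R (ungraded B) t b) \<in> addhom TB TB"
    using B.U.inner_l_char(1)[of b] B.U.inner_r_char(1)[of b] b by (simp_all only: ungraded_simps ungraded_tens)
  note jb = j_closed[OF b]
  show "tm (inner_l K R (ungraded B) b t) = il (j b) (tm t)"
    by (rule B.tens_ext[OF A.grp_T addhom_comp[OF l(1) tm_hom] addhom_comp[OF tm_hom A.inner_l_char(1)[OF jb]] _ t])
      (use b in \<open>simp add: B.ilB tm_pt il_jj j_rules\<close>)
  show "tm (inner_r K R (ungraded B) t b) = ir (tm t) (j b)"
    by (rule B.tens_ext[OF A.grp_T addhom_comp[OF l(2) tm_hom] addhom_comp[OF tm_hom A.inner_r_char(1)[OF jb]] _ t])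
      (use b in \<open>simp add: B.irB tm_pt il_jj j_rules\<close>)
  show "tm (lact TB b t) = lact TT (j b) (tm t)"
    by (rule B.tens_ext[OF A.grp_T addhom_comp[OF B.lact_tens_hom(1)[OF b] tm_hom] addhom_comp[OF tm_hom A.lact_tens_hom(1)[OF jb]] _ t])
      (use b in \<open>simp add: B.lact_tens_hom A.lact_tens_hom tm_pt j_rules\<close>)
  show "tm (ract TB t b) = ract TT (tm t) (j b)"
    by (rule B.tens_ext[OF A.grp_T addhom_comp[OF B.ract_tens_hom(1)[OF b] tm_hom] addhom_comp[OF tm_hom A.ract_tens_hom(1)[OF jb]] _ t])
      (use b in \<open>simp add: B.ract_tens_hom A.ract_tens_hom tm_pt j_rules\<close>)
qed

sublocale ID: induced A B "DDer K R (ungraded B)" j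
proof (intro induced.intro induced_axioms.intro)
  show "ring A" by (rule A.A.ring_axioms)
  show "biact B D (lact D) (ract D)" by (rule B.DB.biact_axioms)
qed (rule j_hom)

lemma biact_J: "biact A W l r \<Longrightarrow> biact B W (\<lambda>b. l (j b)) (\<lambda>w b. r w (j b))"
proof -
  assume "biact A W l r"
  then interpret W: biact A W l r .
  show ?thesis
    by (rule biact.intro[OF B.A.ring_axioms W.grp_V])
      (simp_all add: j_rules W.l_add W.r_add W.l_plus W.r_plus W.l_mult W.r_mult W.lr_assoc)
qed

text \<open>The outer structure of A (x) A restricted along \<open>j\<close>, which is the structure
  that derivations of B with values in A (x) A refer to.\<close>

sublocale JT: kbiact K R B "tens K R A" "\<lambda>b. lact (tens K R A) (j b)" "\<lambda>t b. ract (tens K R A) t (j b)"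
proof (intro kbiact.intro kbiact_axioms.intro)
  show "kalg K R B" by (rule B.kalg_axioms)
  show "biact B TT (\<lambda>b. lact TT (j b)) (\<lambda>t b. ract TT t (j b))" by (rule biact_J[OF A.TB.biact_axioms])
qed (simp add: j_kmap A.tens_central)

sublocale BT: kbiact K R B "tens K R B" "lact (tens K R B)" "ract (tens K R B)"
proof (intro kbiact.intro kbiact_axioms.intro)
  show "kalg K R B" by (rule B.kalg_axioms)
  show "biact B TB (lact TB) (ract TB)" by (rule B.TB.biact_axioms)
qed (simp add: B.tens_central)

lemma D_central:
  assumes c: "c \<in> carrier K" and \<Delta>: "\<Delta> \<in> carrier D"
  shows "lact D (kmap R B c) \<Delta> = ract D \<Delta> (kmap R B c)"
proof (rule B.D_ext)
  note k = B.kmap_closed[OF c]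
  show "lact D (kmap R B c) \<Delta> \<in> carrier D" "ract D \<Delta> (kmap R B c) \<in> carrier D"
    using k \<Delta> by (auto intro: B.D_act_closed)
  have l: "inner_l K R (ungraded B) (kmap R B c) \<in> addhom TB TB" "(\<lambda>t. inner_r K R (ungraded B) t (kmap R B c)) \<in> addhom TB TB"
    using B.U.inner_l_char(1)[of "kmap R B c"] B.U.inner_r_char(1)[of "kmap R B c"] k by (simp_all only: ungraded_simps ungraded_tens)
  have *: "inner_l K R (ungraded B) (kmap R B c) t = inner_r K R (ungraded B) t (kmap R B c)" if t: "t \<in> carrier TB" for t
    by (rule B.tens_ext[OF B.T.abelian_group_axioms l _ t]) (use k c in \<open>simp add: B.ilB B.irB B.pt_balanced\<close>)
  fix x assume x: "x \<in> carrier B"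
  show "lact D (kmap R B c) \<Delta> x = ract D \<Delta> (kmap R B c) x"
    using k \<Delta> x * by (simp add: B.D_act_apply)
qed

text \<open>\<open>b' \<otimes> b''\<close> acts on \<open>p \<otimes> q\<close> from the outside as \<open>q * (b' \<otimes> b'') * p\<close> does from the inside, up to a sign.\<close>

lemma il_ir_tact:
  assumes p: "p \<in> wt A m" and q: "q \<in> carrier A" and t: "t \<in> carrier TB"
  shows "il (A.sg m q) (ir (tm t) p) = JT.tact (A.pt p q) t"
proof -
  note pc = A.wt_carrier[OF p]
  note sq = A.sg_closed[OF q, of m]
  have "il (A.sg m q) (ir (tm (B.pt u v)) p) = JT.tact (A.pt p q) (B.pt u v)" if uv: "u \<in> carrier B" "v \<in> carrier B" for u v
  proof -
    have w: "j u \<otimes> p \<in> wt A m" using A.wt_mult[OF j_wt[OF uv(1)] p] by simp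
    \<comment> \<open>The inner action moves its argument past an element of weight m. The twist of
      \<open>q\<close> in the statement is there to cancel the resulting second twist.\<close>
    have "il (A.sg m q) (ir (tm (B.pt u v)) p) = A.pt (j u \<otimes> p) (q \<otimes> j v)"
      using uv pc q A.inner_l_char(2)[OF sq w j_closed[OF uv(2)]] A.sg_sg[OF q, of m m]
      by (simp add: tm_pt il_jj) (simp add: A.sg_def)
    then show ?thesis using uv pc q by (simp add: JT.tact_hom A.lact_tens_hom A.ract_tens_hom)
  qed
  then show ?thesis
    by (rule B.tens_ext[OF A.grp_T addhom_comp[OF addhom_comp[OF tm_hom A.inner_r_char(1)[OF pc]] A.inner_l_char(1)[OF sq]] JT.tact_hom(1)[OF A.pt_closed[OF pc q]] _ t])
qed

section \<open>Evaluation of \<open>A \<otimes>\<^sub>B DDer B \<otimes>\<^sub>B A\<close> on \<open>B\<close>\<close>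

abbreviation ev where "ev \<equiv> ev_der K R B A j"

text \<open>The prescription is balanced over B because \<open>tm\<close> intertwines the inner
  actions of B with those of A along \<open>j\<close>, and because left and right inner actions
  commute.\<close>

lemma ev_char:
  assumes b: "b \<in> carrier B"
  shows "ev b \<in> addhom U TT"
    and "\<And>a \<Delta> c. \<lbrakk>a \<in> carrier A; \<Delta> \<in> carrier D; c \<in> carrier A\<rbrakk> \<Longrightarrow> ev b (ID.pi3 a \<Delta> c) = il a (ir (tm (\<Delta> b)) c)"
proof -
  have D_add: "(\<Delta> \<oplus>\<^bsub>D\<^esub> \<Delta>') b = \<Delta> b \<oplus>\<^bsub>TB\<^esub> \<Delta>' b" for \<Delta> \<Delta>' by (rule B.D_add_apply[OF b])
  have "\<exists>L. L \<in> addhom U TT \<and> (\<forall>a\<in>carrier A. \<forall>\<Delta>\<in>carrier D. \<forall>c\<in>carrier A. L (ID.pi3 a \<Delta> c) = il a (ir (tm (\<Delta> b)) c))"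
  proof (rule ID.ind_lift[OF A.grp_T])
    fix a \<Delta> c assume a: "a \<in> carrier A" and \<Delta>: "\<Delta> \<in> carrier D" and c: "c \<in> carrier A"
    note t = tm_closed[OF B.D_apply[OF \<Delta> b]]
    show "il a (ir (tm (\<Delta> b)) c) \<in> carrier TT" using a c t by simp
    show "il (a \<oplus> a') (ir (tm (\<Delta> b)) c) = il a (ir (tm (\<Delta> b)) c) \<oplus>\<^bsub>TT\<^esub> il a' (ir (tm (\<Delta> b)) c)" if "a' \<in> carrier A" for a'
      by (rule A.il_add[OF a that A.ir_closed[OF c t]])
    show "il a (ir (tm (\<Delta> b)) (c \<oplus> c')) = il a (ir (tm (\<Delta> b)) c) \<oplus>\<^bsub>TT\<^esub> il a (ir (tm (\<Delta> b)) c')" if "c' \<in> carrier A" for c'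
      using A.ir_add[OF c that t] addhom_add[OF A.inner_l_char(1)[OF a] A.ir_closed[OF c t] A.ir_closed[OF that t]] by simp
    show "il a (ir (tm ((\<Delta> \<oplus>\<^bsub>D\<^esub> \<Delta>') b)) c) = il a (ir (tm (\<Delta> b)) c) \<oplus>\<^bsub>TT\<^esub> il a (ir (tm (\<Delta>' b)) c)" if \<Delta>': "\<Delta>' \<in> carrier D" for \<Delta>'
    proof -
      note t' = tm_closed[OF B.D_apply[OF \<Delta>' b]]
      show ?thesis
        using addhom_add[OF tm_hom B.D_apply[OF \<Delta> b] B.D_apply[OF \<Delta>' b]] addhom_add[OF A.inner_r_char(1)[OF c] t t']
          addhom_add[OF A.inner_l_char(1)[OF a] A.ir_closed[OF c t] A.ir_closed[OF c t']] by (simp add: D_add)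
    qed
    fix b' assume b': "b' \<in> carrier B"
    note jb = j_closed[OF b']
    show "il (a \<otimes> j b') (ir (tm (\<Delta> b)) c) = il a (ir (tm (lact D b' \<Delta> b)) c)"
      using A.il_mult[OF a jb A.ir_closed[OF c t]] A.il_ir[OF jb c t] tm_inner(1)[OF b' B.D_apply[OF \<Delta> b]]
        B.D_act_apply(1)[OF b' \<Delta> b] by simp
    show "il a (ir (tm (ract D \<Delta> b' b)) c) = il a (ir (tm (\<Delta> b)) (j b' \<otimes> c))"
      using A.ir_mult[OF jb c t] tm_inner(2)[OF b' B.D_apply[OF \<Delta> b]] B.D_act_apply(2)[OF b' \<Delta> b] by simp
  qed
  then obtain L where L: "L \<in> addhom U TT"
    "\<forall>a\<in>carrier A. \<forall>\<Delta>\<in>carrier D. \<forall>c\<in>carrier A. L (ID.pi3 a \<Delta> c) = il a (ir (tm (\<Delta> b)) c)"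
    by (elim exE conjE)
  have "ev b = restrict L (carrier U)"
    unfolding ev_der_def Let_def
  proof (rule the_add_map_eq[OF L(1) _ ID.I.abelian_group_axioms])
    show "\<forall>a\<in>carrier A. \<forall>\<Delta>\<in>carrier D. \<forall>c\<in>carrier A. restrict L (carrier U) (ID.pi3 a \<Delta> c) = il a (ir (tm (\<Delta> b)) c)"
      using L(2) by simp
    fix g assume g: "g \<in> addhom U TT" "\<forall>a\<in>carrier A. \<forall>\<Delta>\<in>carrier D. \<forall>c\<in>carrier A. g (ID.pi3 a \<Delta> c) = il a (ir (tm (\<Delta> b)) c)"
    have "g (ID.pi3 a \<Delta> c) = L (ID.pi3 a \<Delta> c)" if "a \<in> carrier A" "\<Delta> \<in> carrier D" "c \<in> carrier A" for a \<Delta> c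
      using g(2) L(2) that by simp
    then show "\<forall>x\<in>carrier U. g x = L x" by (intro ballI, rule ID.ind_ext[OF A.grp_T g(1) L(1)])
  qed
  then show "ev b \<in> addhom U TT"
    and "\<And>a \<Delta> c. \<lbrakk>a \<in> carrier A; \<Delta> \<in> carrier D; c \<in> carrier A\<rbrakk> \<Longrightarrow> ev b (ID.pi3 a \<Delta> c) = il a (ir (tm (\<Delta> b)) c)"
    using L(2) addhom_closed[OF L(1)] addhom_add[OF L(1)] by (auto intro!: addhomI)
qed

lemma ev_closed [simp]: "b \<in> carrier B \<Longrightarrow> x \<in> carrier U \<Longrightarrow> ev b x \<in> carrier TT"
  using addhom_closed[OF ev_char(1)] .

lemma ev_act:
  assumes b: "b \<in> carrier B" and y: "y \<in> carrier A" and x: "x \<in> carrier U"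
  shows "ev b (lact U y x) = il y (ev b x)" "ev b (ract U x y) = ir (ev b x) y"
proof -
  have "ev b (lact U y (ID.pi3 a \<Delta> c)) = il y (ev b (ID.pi3 a \<Delta> c))" "ev b (ract U (ID.pi3 a \<Delta> c) y) = ir (ev b (ID.pi3 a \<Delta> c)) y"
    if *: "a \<in> carrier A" "\<Delta> \<in> carrier D" "c \<in> carrier A" for a \<Delta> c
  proof -
    note t = tm_closed[OF B.D_apply[OF *(2) b]]
    show "ev b (lact U y (ID.pi3 a \<Delta> c)) = il y (ev b (ID.pi3 a \<Delta> c))"
      using * y b A.il_mult[OF y *(1) A.ir_closed[OF *(3) t]] by (simp add: ID.ind_hom ev_char)
    show "ev b (ract U (ID.pi3 a \<Delta> c) y) = ir (ev b (ID.pi3 a \<Delta> c)) y"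
      using * y b A.ir_mult[OF *(3) y t] A.il_ir[OF *(1) y A.ir_closed[OF *(3) t]] by (simp add: ID.ind_hom ev_char)
  qed
  note pp = this
  show "ev b (lact U y x) = il y (ev b x)"
    by (rule ID.ind_ext[OF A.grp_T addhom_comp[OF ID.ind_hom(1)[OF y] ev_char(1)[OF b]] addhom_comp[OF ev_char(1)[OF b] A.inner_l_char(1)[OF y]] pp(1) x])
  show "ev b (ract U x y) = ir (ev b x) y"
    by (rule ID.ind_ext[OF A.grp_T addhom_comp[OF ID.ind_hom(3)[OF y] ev_char(1)[OF b]] addhom_comp[OF ev_char(1)[OF b] A.inner_r_char(1)[OF y]] pp(2) x])
qed

text \<open>Sends p (x) q to q \<Delta> p up to sign; the factors change places because the outer
  structure on values corresponds to the inner one on derivations. By \<open>ev_G\<close> the result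
  evaluates at b to \<open>\<Delta> b\<close> with w put between its two factors, the shape of a
  term in a dual basis expansion.\<close>

definition G :: "('b \<Rightarrow> ('b \<times> 'b) pres) \<Rightarrow> ('a \<times> 'a) pres \<Rightarrow> _" where
  "G \<Delta> = (SOME L. L \<in> addhom TT U \<and> (\<forall>m. \<forall>p\<in>wt A m. \<forall>q\<in>carrier A. L (A.pt p q) = ID.pi3 (A.sg m q) \<Delta> p))"

lemma G_char:
  assumes \<Delta>: "\<Delta> \<in> carrier D"
  shows "G \<Delta> \<in> addhom TT U" "\<And>m p q. p \<in> wt A m \<Longrightarrow> q \<in> carrier A \<Longrightarrow> G \<Delta> (A.pt p q) = ID.pi3 (A.sg m q) \<Delta> p"
proof -
  have "\<exists>L. L \<in> addhom TT U \<and> (\<forall>m. \<forall>p\<in>wt A m. \<forall>q\<in>carrier A. L (A.pt p q) = (\<lambda>i p q. ID.pi3 (if i then q else \<sigma> q) \<Delta> p) (even m) p q)"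
  proof (rule A.tens_lift_parity(1)[OF ID.I.abelian_group_axioms])
    fix i u v c assume *: "u \<in> carrier A" "v \<in> carrier A" "c \<in> carrier K"
    let ?k = "kmap R A c" and ?kB = "kmap R B c"
    let ?w = "if i then v else \<sigma> v"
    have w: "?w \<in> carrier A" using * by simp
    note kB = B.kmap_closed[OF *(3)]
    have e: "(if i then ?k \<otimes> v else \<sigma> (?k \<otimes> v)) = ?w \<otimes> ?k"
      using * A.sg_kmap[of c 1] A.kmap_comm[of c v] A.kmap_comm[of c "\<sigma> v"]
      by (simp add: ring_hom_mult[OF A.\<sigma>_hom] A.sg_def)
    have "ID.pi3 ?w \<Delta> (u \<otimes> ?k) = ID.pi3 ?w \<Delta> (j ?kB \<otimes> u)"
      using * by (simp add: j_kmap A.kmap_comm)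
    also have "\<dots> = ID.pi3 ?w (lact D ?kB \<Delta>) u"
      using ID.pi3_rules(5)[OF w *(1) \<Delta> kB] D_central[OF *(3) \<Delta>] by simp
    also have "\<dots> = ID.pi3 (?w \<otimes> ?k) \<Delta> u"
      using ID.pi3_rules(4)[OF w *(1) \<Delta> kB] by (simp add: j_kmap *)
    finally show "ID.pi3 (if i then v else \<sigma> v) \<Delta> (u \<otimes> ?k) = ID.pi3 (if i then ?k \<otimes> v else \<sigma> (?k \<otimes> v)) \<Delta> u"
      unfolding e .
  qed (use \<Delta> in \<open>simp_all add: ID.pi3_rules ring_hom_add[OF A.\<sigma>_hom]\<close>)
  then have "\<exists>L. L \<in> addhom TT U \<and> (\<forall>m. \<forall>p\<in>wt A m. \<forall>q\<in>carrier A. L (A.pt p q) = ID.pi3 (A.sg m q) \<Delta> p)"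
    by (simp add: A.sg_def)
  note * = someI_ex[OF this, folded G_def]
  show "G \<Delta> \<in> addhom TT U" using * by (rule conjunct1)
  show "\<And>m p q. p \<in> wt A m \<Longrightarrow> q \<in> carrier A \<Longrightarrow> G \<Delta> (A.pt p q) = ID.pi3 (A.sg m q) \<Delta> p"
    using conjunct2[OF *] by simp
qed

lemma ev_G:
  assumes \<Delta>: "\<Delta> \<in> carrier D" and b: "b \<in> carrier B" and w: "w \<in> carrier TT"
  shows "ev b (G \<Delta> w) = JT.tact w (\<Delta> b)"
proof -
  note db = B.D_apply[OF \<Delta> b]
  have "ev b (G \<Delta> (A.pt p q)) = JT.tact (A.pt p q) (\<Delta> b)" if "p \<in> wt A m" "q \<in> wt A n" for p q m n
    using that A.wt_carrier[OF that(1)] A.wt_carrier[OF that(2)] \<Delta> b db by (simp add: G_char ev_char il_ir_tact)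
  then show ?thesis
    by (rule A.tens_ext_wt[OF A.grp_T addhom_comp[OF G_char(1)[OF \<Delta>] ev_char(1)[OF b]] JT.tact_hom_left[OF db] _ w])
qed

text \<open>The counterpart of \<open>G\<close> with coefficients in B, taking values in
  \<open>D\<close> itself. It expresses a double derivation of B through the dual basis.\<close>

definition Z :: "('b \<Rightarrow> ('b \<times> 'b) pres) \<Rightarrow> ('b \<times> 'b) pres \<Rightarrow> 'b \<Rightarrow> ('b \<times> 'b) pres" where
  "Z \<Delta> = (SOME L. L \<in> addhom TB D \<and> (\<forall>b\<in>carrier B. \<forall>b'\<in>carrier B. L (B.pt b b') = lact D b' (ract D \<Delta> b)))"

lemma Z_char:
  assumes \<Delta>: "\<Delta> \<in> carrier D"
  shows "Z \<Delta> \<in> addhom TB D" "\<And>b b'. b \<in> carrier B \<Longrightarrow> b' \<in> carrier B \<Longrightarrow> Z \<Delta> (B.pt b b') = lact D b' (ract D \<Delta> b)"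
proof -
  have "\<exists>L. L \<in> addhom TB D \<and> (\<forall>b\<in>carrier B. \<forall>b'\<in>carrier B. L (B.pt b b') = lact D b' (ract D \<Delta> b))"
  proof (rule B.tens_lift[OF B.U.grp_DD])
    fix b b' c assume *: "b \<in> carrier B" "b' \<in> carrier B" "c \<in> carrier K"
    let ?k = "kmap R B c"
    have k: "?k \<in> carrier B" using * by simp
    have "lact D (?k \<otimes>\<^bsub>B\<^esub> b') (ract D \<Delta> b) = lact D b' (lact D ?k (ract D \<Delta> b))"
      using * \<Delta> k by (simp add: B.kmap_comm B.DB.l_mult)
    also have "\<dots> = lact D b' (ract D \<Delta> (b \<otimes>\<^bsub>B\<^esub> ?k))"
      using * \<Delta> k D_central[OF *(3), of "ract D \<Delta> b"] by (simp add: B.DB.r_mult)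
    finally show "lact D b' (ract D \<Delta> (b \<otimes>\<^bsub>B\<^esub> ?k)) = lact D (?k \<otimes>\<^bsub>B\<^esub> b') (ract D \<Delta> b)" by (rule sym)
  qed (use \<Delta> in \<open>simp_all add: B.DB.l_plus B.DB.r_plus B.DB.l_add\<close>)
  note * = someI_ex[OF this, folded Z_def]
  show "Z \<Delta> \<in> addhom TB D" using * by (rule conjunct1)
  show "\<And>b b'. b \<in> carrier B \<Longrightarrow> b' \<in> carrier B \<Longrightarrow> Z \<Delta> (B.pt b b') = lact D b' (ract D \<Delta> b)"
    using conjunct2[OF *] by simp
qed

lemma Z_closed [simp]: "\<Delta> \<in> carrier D \<Longrightarrow> t \<in> carrier TB \<Longrightarrow> Z \<Delta> t \<in> carrier D"
  using addhom_closed[OF Z_char(1)] .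

lemma Z_apply:
  assumes \<Delta>: "\<Delta> \<in> carrier D" and t: "t \<in> carrier TB" and x: "x \<in> carrier B"
  shows "Z \<Delta> t x = BT.tact t (\<Delta> x)"
proof -
  note dx = B.D_apply[OF \<Delta> x]
  have ex: "(\<lambda>\<Delta>. \<Delta> x) \<in> addhom D TB" using B.U.DD_eval[of x] x by (simp only: ungraded_simps ungraded_tens)
  have i: "inner_l K R (ungraded B) b' (inner_r K R (ungraded B) s b) = BT.tact (B.pt b b') s"
    if b: "b \<in> carrier B" "b' \<in> carrier B" and s: "s \<in> carrier TB" for b b' s
  proof -
    have l: "inner_l K R (ungraded B) b' \<in> addhom TB TB" "(\<lambda>t. inner_r K R (ungraded B) t b) \<in> addhom TB TB"
      using B.U.inner_l_char(1)[of b'] B.U.inner_r_char(1)[of b] b by (simp_all only: ungraded_simps ungraded_tens)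
    show ?thesis
      by (rule B.tens_ext[OF B.T.abelian_group_axioms addhom_comp[OF l(2) l(1)] BT.tact_hom(1)[OF B.pt_closed[OF b]] _ s])
        (use b in \<open>simp add: B.ilB B.irB BT.tact_hom B.lact_tens_hom B.ract_tens_hom\<close>)
  qed
  have "Z \<Delta> (B.pt b b') x = BT.tact (B.pt b b') (\<Delta> x)" if "b \<in> carrier B" "b' \<in> carrier B" for b b'
    using that \<Delta> x i[OF that dx] by (simp add: Z_char B.D_act_apply)
  then show ?thesis
    by (rule B.tens_ext[OF B.T.abelian_group_axioms addhom_comp[OF Z_char(1)[OF \<Delta>] ex] BT.tact_hom_left[OF dx] _ t])
qed

text \<open>Coefficients from B can be pulled across the tensor signs over B into the middle factor,
  where they turn \<open>\<Delta>\<close> into \<open>Z \<Delta> t\<close>. This relates the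
  expansion over A to the one over B.\<close>

lemma G_inner:
  assumes \<Delta>: "\<Delta> \<in> carrier D" and a: "a \<in> carrier A" and c: "c \<in> wt A r" and t: "t \<in> carrier TB"
  shows "G \<Delta> (il a (ir (tm t) c)) = ID.pi3 a (Z \<Delta> t) c"
proof -
  note cc = A.wt_carrier[OF c]
  have p: "(\<lambda>\<Delta>. ID.pi3 a \<Delta> c) \<in> addhom D U"
    using a cc by (intro addhomI) (simp_all add: ID.pi3_rules)
  have "G \<Delta> (il a (ir (tm (B.pt u v)) c)) = ID.pi3 a (Z \<Delta> (B.pt u v)) c" if uv: "u \<in> carrier B" "v \<in> carrier B" for u v
  proof -
    have w: "j u \<otimes> c \<in> wt A r" using A.wt_mult[OF j_wt[OF uv(1)] c] by simp
    note wc = A.wt_carrier[OF w]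
    have "il a (ir (tm (B.pt u v)) c) = A.pt (j u \<otimes> c) (A.sg r a \<otimes> j v)"
      using uv cc a A.inner_l_char(2)[OF a w j_closed[OF uv(2)]] by (simp add: tm_pt il_jj)
    also have "G \<Delta> \<dots> = ID.pi3 (A.sg r (A.sg r a \<otimes> j v)) \<Delta> (j u \<otimes> c)"
      using uv a by (simp add: G_char(2)[OF \<Delta> w])
    also have "A.sg r (A.sg r a \<otimes> j v) = a \<otimes> j v"
      using uv a A.sg_sg[OF a, of r r] by (simp add: A.sg_mult) (simp add: A.sg_def)
    also have "ID.pi3 (a \<otimes> j v) \<Delta> (j u \<otimes> c) = ID.pi3 a (lact D v (ract D \<Delta> u)) c"
      using ID.pi3_rules(4)[OF a wc \<Delta> uv(2)] ID.pi3_rules(5)[OF a cc B.D_act_closed(1)[OF uv(2) \<Delta>] uv(1)]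
        B.DB.lr_assoc[OF uv(2,1) \<Delta>] by simp
    finally show ?thesis using uv \<Delta> by (simp add: Z_char)
  qed
  then show ?thesis
    by (rule B.tens_ext[OF ID.I.abelian_group_axioms addhom_comp[OF addhom_comp[OF addhom_comp[OF tm_hom A.inner_r_char(1)[OF cc]] A.inner_l_char(1)[OF a]] G_char(1)[OF \<Delta>]]
        addhom_comp[OF Z_char(1)[OF \<Delta>] p] _ t])
qed

end

section \<open>Evaluation on B is bijective onto the derivations from B to A (x) A\<close>

lemma addhom_diff:
  assumes "abelian_group W" "f \<in> addhom V W" "g \<in> addhom V W"
  shows "(\<lambda>x. f x \<ominus>\<^bsub>W\<^esub> g x) \<in> addhom V W"
  unfolding a_minus_def by (rule addhom_sum2[OF assms(1,2) addhom_neg[OF assms(1,3)]])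

lemma span_finsum:
  assumes V: "abelian_group V" and U: "U \<subseteq> carrier V" and I: "finite I" and f: "\<And>i. i \<in> I \<Longrightarrow> f i \<in> span V U"
  shows "finsum V f I \<in> span V U"
proof -
  interpret V: abelian_group V by fact
  show ?thesis using I f
  proof (induction rule: finite_induct)
    case (insert i I)
    have "f \<in> insert i I \<rightarrow> carrier V" using insert.prems span_closed[OF V U] by auto
    then show ?case using insert by (auto intro: span_add)
  qed (simp add: span_zero)
qed

text \<open>The bimodule map on one-forms that classifies the derivation \<delta>.\<close>

definition (in oneforms) ext1 :: "('w, 'u) ring_scheme \<Rightarrow> ('a \<Rightarrow> 'w \<Rightarrow> 'w) \<Rightarrow> ('w \<Rightarrow> 'a \<Rightarrow> 'w) \<Rightarrow> ('a \<Rightarrow> 'w) \<Rightarrow> ('a \<times> 'a \<times> 'a) pres \<Rightarrow> 'w" where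
  "ext1 W l r \<delta> = (SOME L. L \<in> addhom (Om1 R A) W \<and>
     (\<forall>a\<in>carrier A. \<forall>x\<in>carrier A. \<forall>c\<in>carrier A. L (p1 a x c) = l a (r (\<delta> x) c)))"

lemma (in oneforms) ext1_char:
  assumes W: "biact A W l r" and d: "\<delta> \<in> addhom A W"
    and leib: "\<forall>x\<in>carrier A. \<forall>y\<in>carrier A. \<delta> (x \<otimes> y) = r (\<delta> x) y \<oplus>\<^bsub>W\<^esub> l x (\<delta> y)"
    and DR: "\<forall>t\<in>carrier R. \<delta> (umap A t) = \<zero>\<^bsub>W\<^esub>"
  shows "ext1 W l r \<delta> \<in> addhom (Om1 R A) W"
    "\<And>a x c. \<lbrakk>a \<in> carrier A; x \<in> carrier A; c \<in> carrier A\<rbrakk> \<Longrightarrow> ext1 W l r \<delta> (p1 a x c) = l a (r (\<delta> x) c)"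
    "\<And>x. x \<in> carrier A \<Longrightarrow> ext1 W l r \<delta> (du R A x) = \<delta> x"
    "\<And>b \<xi>. b \<in> carrier A \<Longrightarrow> \<xi> \<in> carrier (Om1 R A) \<Longrightarrow> ext1 W l r \<delta> (lact (Om1 R A) b \<xi>) = l b (ext1 W l r \<delta> \<xi>)"
    "\<And>b \<xi>. b \<in> carrier A \<Longrightarrow> \<xi> \<in> carrier (Om1 R A) \<Longrightarrow> ext1 W l r \<delta> (ract (Om1 R A) \<xi> b) = r (ext1 W l r \<delta> \<xi>) b"
proof -
  interpret W: biact A W l r by fact
  note dc = addhom_closed[OF d]
  have "\<exists>L. L \<in> addhom (Om1 R A) W \<and> (\<forall>a\<in>carrier A. \<forall>x\<in>carrier A. \<forall>c\<in>carrier A. L (p1 a x c) = l a (r (\<delta> x) c))"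
    by (rule Om1_universal[OF W d]) (use leib DR in auto)
  note * = someI_ex[OF this, folded ext1_def]
  show 1: "ext1 W l r \<delta> \<in> addhom (Om1 R A) W" using * by (rule conjunct1)
  show 2: "ext1 W l r \<delta> (p1 a x c) = l a (r (\<delta> x) c)" if "a \<in> carrier A" "x \<in> carrier A" "c \<in> carrier A" for a x c
    using conjunct2[OF *] that by simp
  show "ext1 W l r \<delta> (du R A x) = \<delta> x" if "x \<in> carrier A" for x using that dc by (simp add: du_def 2)
  fix b \<xi> assume b: "b \<in> carrier A" and \<xi>: "\<xi> \<in> carrier (Om1 R A)"
  have e1: "ext1 W l r \<delta> (lact (Om1 R A) b (p1 a x c)) = l b (ext1 W l r \<delta> (p1 a x c))"
    and e2: "ext1 W l r \<delta> (ract (Om1 R A) (p1 a x c) b) = r (ext1 W l r \<delta> (p1 a x c)) b"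
    if "a \<in> carrier A" "x \<in> carrier A" "c \<in> carrier A" for a x c
    using that b dc by (simp_all add: 2 Om1_hom W.l_mult W.r_mult W.lr_assoc)
  show "ext1 W l r \<delta> (lact (Om1 R A) b \<xi>) = l b (ext1 W l r \<delta> \<xi>)"
    by (rule Om1_ext[OF W.grp_V addhom_comp[OF Om1_hom(1)[OF b] 1] addhom_comp[OF 1 W.l_hom[OF b]] e1 \<xi>])
  show "ext1 W l r \<delta> (ract (Om1 R A) \<xi> b) = r (ext1 W l r \<delta> \<xi>) b"
    by (rule Om1_ext[OF W.grp_V addhom_comp[OF Om1_hom(3)[OF b] 1] addhom_comp[OF 1 W.r_hom[OF b]] e2 \<xi>])
qed

context pairalg
begin

definition derT :: "('b \<Rightarrow> ('a \<times> 'a) pres) \<Rightarrow> bool" where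
  "derT \<delta> \<longleftrightarrow> \<delta> \<in> addhom B TT \<and> (\<forall>t\<in>carrier R. \<delta> (umap B t) = \<zero>\<^bsub>TT\<^esub>) \<and>
     (\<forall>x\<in>carrier B. \<forall>y\<in>carrier B. \<delta> (x \<otimes>\<^bsub>B\<^esub> y) = ract TT (\<delta> x) (j y) \<oplus>\<^bsub>TT\<^esub> lact TT (j x) (\<delta> y))"

abbreviation dT where "dT \<equiv> B.O1.ext1 TT (\<lambda>b. lact TT (j b)) (\<lambda>t b. ract TT t (j b))"
abbreviation dB where "dB \<equiv> B.O1.ext1 TB (lact TB) (ract TB)"

lemma dT_char:
  assumes "derT \<delta>"
  shows "dT \<delta> \<in> addhom (Om1 R B) TT"
    "\<And>a x c. \<lbrakk>a \<in> carrier B; x \<in> carrier B; c \<in> carrier B\<rbrakk> \<Longrightarrow> dT \<delta> (B.O1.p1 a x c) = lact TT (j a) (ract TT (\<delta> x) (j c))"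
    "\<And>x. x \<in> carrier B \<Longrightarrow> dT \<delta> (du R B x) = \<delta> x"
    "\<And>b \<xi>. b \<in> carrier B \<Longrightarrow> \<xi> \<in> carrier (Om1 R B) \<Longrightarrow> dT \<delta> (lact (Om1 R B) b \<xi>) = lact TT (j b) (dT \<delta> \<xi>) \<and>
       dT \<delta> (ract (Om1 R B) \<xi> b) = ract TT (dT \<delta> \<xi>) (j b)"
  using B.O1.ext1_char[OF JT.biact_axioms, of \<delta>] assms unfolding derT_def by simp_all

lemma dB_char:
  assumes "\<Delta> \<in> carrier D"
  shows "dB \<Delta> \<in> addhom (Om1 R B) TB"
    "\<And>a x c. \<lbrakk>a \<in> carrier B; x \<in> carrier B; c \<in> carrier B\<rbrakk> \<Longrightarrow> dB \<Delta> (B.O1.p1 a x c) = lact TB a (ract TB (\<Delta> x) c)"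
    "\<And>x. x \<in> carrier B \<Longrightarrow> dB \<Delta> (du R B x) = \<Delta> x"
    "\<And>b \<xi>. b \<in> carrier B \<Longrightarrow> \<xi> \<in> carrier (Om1 R B) \<Longrightarrow> dB \<Delta> (lact (Om1 R B) b \<xi>) = lact TB b (dB \<Delta> \<xi>) \<and>
       dB \<Delta> (ract (Om1 R B) \<xi> b) = ract TB (dB \<Delta> \<xi>) b"
  using B.O1.ext1_char[OF B.TB.biact_axioms B.D_D(2)[OF assms]] by (simp_all add: B.D_D(3,4)[OF assms])

text \<open>A dual basis of \<open>\<Omega>\<^sup>1 B\<close>, the coordinate functions being read as double derivations.\<close>

lemma Om1_dual_basis:
  "\<exists>(J :: ('b \<times> 'b \<times> 'b) pres set) \<omega> \<Delta>. finite J \<and> (\<forall>k\<in>J. \<omega> k \<in> carrier (Om1 R B) \<and> \<Delta> k \<in> carrier D) \<and>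
     (\<forall>\<delta>. derT \<delta> \<longrightarrow> (\<forall>x\<in>carrier B. \<delta> x = (\<Oplus>\<^bsub>TT\<^esub>k\<in>J. JT.tact (dT \<delta> (\<omega> k)) (\<Delta> k x)))) \<and>
     (\<forall>\<Delta>'\<in>carrier D. \<forall>x\<in>carrier B. \<Delta>' x = (\<Oplus>\<^bsub>TB\<^esub>k\<in>J. BT.tact (dB \<Delta>' (\<omega> k)) (\<Delta> k x)))"
proof -
  let ?O = "Om1 R B"
  have sm: "projective_bimod K R B ?O" "fin_gen_over R B" using smooth_B by (simp_all add: smooth_def)
  from B.projective_dual_basis[OF B.OK.kbiact_axioms sm(1) B.Om1_fin_gen[OF sm(2)]]
  obtain J :: "('b \<times> 'b \<times> 'b) pres set" and \<omega> \<phi> where J: "finite J"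
    and J1: "\<forall>k\<in>J. \<omega> k \<in> carrier ?O \<and> \<phi> k \<in> bimod_hom B ?O TB"
    and J2: "\<forall>v\<in>carrier ?O. v = (\<Oplus>\<^bsub>?O\<^esub>k\<in>J. B.OK.tact (\<omega> k) (\<phi> k v))"
    by (elim exE conjE)
  have \<omega>: "\<omega> k \<in> carrier ?O" and \<phi>: "\<phi> k \<in> addhom ?O TB"
    and \<phi>b: "\<And>b v. b \<in> carrier B \<Longrightarrow> v \<in> carrier ?O \<Longrightarrow> \<phi> k (lact ?O b v) = lact TB b (\<phi> k v) \<and> \<phi> k (ract ?O v b) = ract TB (\<phi> k v) b"
    if "k \<in> J" for k
    using J1 that by (simp_all add: bimod_hom_def)
  \<comment> \<open>A coordinate function on one-forms composed with the universal derivation is a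
    derivation from B to B (x) B.\<close>
  define \<Delta> where "\<Delta> k = (\<lambda>x\<in>carrier B. \<phi> k (du R B x))" for k
  have \<phi>c: "\<phi> k v \<in> carrier TB" if "k \<in> J" "v \<in> carrier ?O" for k v by (rule addhom_closed[OF \<phi>[OF that(1)] that(2)])
  have \<Delta>D: "\<Delta> k \<in> carrier D" if k: "k \<in> J" for k
  proof (rule B.D_I)
    show "\<Delta> k \<in> extensional (carrier B)" by (simp add: \<Delta>_def)
    show "\<Delta> k \<in> addhom B TB"
      by (rule addhomI) (simp_all add: \<Delta>_def \<phi>c[OF k] B.O1.du_rules addhom_add[OF \<phi>[OF k]])
    show "\<Delta> k (umap B t) = \<zero>\<^bsub>TB\<^esub>" if "t \<in> carrier R" for t
      using that B.O1.du_rules(3)[of "\<one>\<^bsub>B\<^esub>" "\<one>\<^bsub>B\<^esub>" t]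
      by (simp add: \<Delta>_def addhom_zero[OF B.O1.O.abelian_group_axioms B.T.abelian_group_axioms \<phi>[OF k]])
    show "\<Delta> k (x \<otimes>\<^bsub>B\<^esub> y) = ract TB (\<Delta> k x) y \<oplus>\<^bsub>TB\<^esub> lact TB x (\<Delta> k y)" if "x \<in> carrier B" "y \<in> carrier B" for x y
      using that by (simp add: \<Delta>_def B.O1.du_rules addhom_add[OF \<phi>[OF k]] \<phi>b[OF k])
  qed
  \<comment> \<open>Both expansions to be shown are this one, for the targets A (x) A and B (x) B: a
    bimodule map is applied to the dual basis expansion of dx and passes through \<open>tact\<close>
    by naturality.\<close>
  have main: "L (du R B x) = (\<Oplus>\<^bsub>W\<^esub>k\<in>J. kbiact.tact K R B W l r (L (\<omega> k)) (\<Delta> k x))"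
    if W: "kbiact K R B W l r" and L: "L \<in> addhom ?O W"
      and Lb: "\<And>b v. b \<in> carrier B \<Longrightarrow> v \<in> carrier ?O \<Longrightarrow> L (lact ?O b v) = l b (L v) \<and> L (ract ?O v b) = r (L v) b"
      and x: "x \<in> carrier B" for W :: "('w, 'u) ring_scheme" and l r L x
  proof -
    interpret W: kbiact K R B W l r by fact
    have dx: "du R B x \<in> carrier ?O" using x by simp
    have tc: "(\<lambda>k. B.OK.tact (\<omega> k) (\<phi> k (du R B x))) \<in> J \<rightarrow> carrier ?O"
      using \<omega> \<phi>c dx by (auto intro: B.OK.tact_closed)
    have "L (du R B x) = L (\<Oplus>\<^bsub>?O\<^esub>k\<in>J. B.OK.tact (\<omega> k) (\<phi> k (du R B x)))"
      using bspec[OF J2 dx] by (rule arg_cong)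
    also have "\<dots> = (\<Oplus>\<^bsub>W\<^esub>k\<in>J. L (B.OK.tact (\<omega> k) (\<phi> k (du R B x))))"
      by (rule addhom_finsum[OF B.O1.O.abelian_group_axioms W.grp_V L J tc])
    also have "\<dots> = (\<Oplus>\<^bsub>W\<^esub>k\<in>J. W.tact (L (\<omega> k)) (\<Delta> k x))"
    proof (rule W.V.finsum_cong')
      fix k assume k: "k \<in> J"
      show "L (B.OK.tact (\<omega> k) (\<phi> k (du R B x))) = W.tact (L (\<omega> k)) (\<Delta> k x)"
        using tact_natural[OF B.OK.kbiact_axioms W L Lb \<omega>[OF k] \<phi>c[OF k dx]] x by (simp add: \<Delta>_def)
    next
      show "(\<lambda>k. W.tact (L (\<omega> k)) (\<Delta> k x)) \<in> J \<rightarrow> carrier W"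
        using W.tact_closed[OF addhom_closed[OF L \<omega>] B.D_apply[OF \<Delta>D x]] by simp
    qed simp
    finally show ?thesis .
  qed
  have 1: "\<delta> x = (\<Oplus>\<^bsub>TT\<^esub>k\<in>J. JT.tact (dT \<delta> (\<omega> k)) (\<Delta> k x))" if "derT \<delta>" "x \<in> carrier B" for \<delta> x
    using main[OF JT.kbiact_axioms dT_char(1)[OF that(1)] dT_char(4)[OF that(1)] that(2)] dT_char(3)[OF that] by simp
  have 2: "\<Delta>' x = (\<Oplus>\<^bsub>TB\<^esub>k\<in>J. BT.tact (dB \<Delta>' (\<omega> k)) (\<Delta> k x))" if "\<Delta>' \<in> carrier D" "x \<in> carrier B" for \<Delta>' x
    using main[OF BT.kbiact_axioms dB_char(1)[OF that(1)] dB_char(4)[OF that(1)] that(2)] dB_char(3)[OF that] by simp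
  show ?thesis
    by (intro exI[of _ J] exI[of _ \<omega>] exI[of _ \<Delta>] conjI allI ballI impI J) (use \<omega> \<Delta>D 1 2 in auto)
qed

abbreviation UW where "UW \<equiv> ind_wt A j B D (placed 0 D)"

lemma UW_gens: "{ID.pi3 a v c |a v c p q r. a \<in> wt A p \<and> v \<in> placed 0 D q \<and> c \<in> wt A r \<and> p + q + r = n} \<subseteq> carrier U"
proof -
  have "\<zero>\<^bsub>D\<^esub> \<in> carrier D" by (rule abelian_groupE(2)[OF B.U.grp_DD])
  then show ?thesis by (auto simp: placed_def A.wt_carrier split: if_splits)
qed

lemma UW_incl: "\<lbrakk>a \<in> wt A p; \<Delta> \<in> carrier D; c \<in> wt A r\<rbrakk> \<Longrightarrow> ID.pi3 a \<Delta> c \<in> UW (p + r)"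
  unfolding ind_wt_def by (rule span_incl) (force simp: placed_def)

lemma G_wt:
  assumes \<Delta>: "\<Delta> \<in> carrier D" and w: "w \<in> A.TW n"
  shows "G \<Delta> w \<in> UW n"
  unfolding ind_wt_def
proof (rule A.TW_map[OF G_char(1)[OF \<Delta>] ID.I.abelian_group_axioms UW_gens _ w])
  fix p q u v assume u: "u \<in> wt A p" and v: "v \<in> wt A q" and "p + q = n"
  then have n: "n = q + p" by simp
  show "G \<Delta> (A.pt u v) \<in> span U {ID.pi3 a v c |a v c p q r. a \<in> wt A p \<and> v \<in> placed 0 D q \<and> c \<in> wt A r \<and> p + q + r = n}"
    using UW_incl[OF A.sg_wt_closed[OF v, of p] \<Delta> u] A.wt_carrier[OF v] unfolding n
    by (simp add: G_char(2)[OF \<Delta> u] ind_wt_def)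
qed

lemma dT_wt:
  assumes \<delta>: "derT \<delta>" and w: "\<And>b. b \<in> carrier B \<Longrightarrow> \<delta> b \<in> A.TW n" and \<xi>: "\<xi> \<in> carrier (Om1 R B)"
  shows "dT \<delta> \<xi> \<in> A.TW n"
proof (rule A.TW_gen_map[OF B.O1.O.presented_axioms dT_char(1)[OF \<delta>] _ \<xi>])
  fix g assume "g \<in> carrier B \<times> carrier B \<times> carrier B"
  then obtain a x c where g: "g = (a, x, c)" "a \<in> carrier B" "x \<in> carrier B" "c \<in> carrier B" by auto
  have "lact TT (j a) (ract TT (\<delta> x) (j c)) \<in> A.TW (n + 0 + 0)"
    by (intro A.TW_acts j_wt g w)
  then show "dT \<delta> (gcls (Om1_rels R B) g) \<in> A.TW n" using g by (simp add: dT_char(2)[OF \<delta>])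
qed

text \<open>The expansion of \<delta> over the dual basis is the evaluation of the sum of the
  elements \<open>G (\<Delta> k) (dT \<delta> (\<omega> k))\<close>. Since \<open>G\<close>
  preserves weights, the same preimage is homogeneous of weight n whenever \<delta> is, which is
  what \<open>eps_wt\<close> needs.\<close>

lemma ev_surj:
  assumes \<delta>: "derT \<delta>"
  shows "\<exists>x. x \<in> carrier U \<and> (\<forall>b\<in>carrier B. ev b x = \<delta> b) \<and> (\<forall>n. (\<forall>b\<in>carrier B. \<delta> b \<in> A.TW n) \<longrightarrow> x \<in> UW n)"
proof -
  from Om1_dual_basis obtain J :: "('b \<times> 'b \<times> 'b) pres set" and \<omega> \<Delta> where J: "finite J"
    and J1: "\<forall>k\<in>J. \<omega> k \<in> carrier (Om1 R B) \<and> \<Delta> k \<in> carrier D"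
    and J2: "\<forall>\<delta>. derT \<delta> \<longrightarrow> (\<forall>x\<in>carrier B. \<delta> x = (\<Oplus>\<^bsub>TT\<^esub>k\<in>J. JT.tact (dT \<delta> (\<omega> k)) (\<Delta> k x)))"
    by (elim exE conjE)
  have \<omega>: "\<omega> k \<in> carrier (Om1 R B)" and \<Delta>: "\<Delta> k \<in> carrier D" if "k \<in> J" for k using J1 that by auto
  have dc: "dT \<delta> (\<omega> k) \<in> carrier TT" if "k \<in> J" for k by (rule addhom_closed[OF dT_char(1)[OF \<delta>] \<omega>[OF that]])
  have gc: "(\<lambda>k. G (\<Delta> k) (dT \<delta> (\<omega> k))) \<in> J \<rightarrow> carrier U"
    using addhom_closed[OF G_char(1)[OF \<Delta>] dc] by simp
  let ?x = "\<Oplus>\<^bsub>U\<^esub>k\<in>J. G (\<Delta> k) (dT \<delta> (\<omega> k))"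
  have "?x \<in> carrier U" by (rule ID.I.finsum_closed[OF gc])
  moreover have "ev b ?x = \<delta> b" if b: "b \<in> carrier B" for b
  proof -
    have "ev b ?x = (\<Oplus>\<^bsub>TT\<^esub>k\<in>J. ev b (G (\<Delta> k) (dT \<delta> (\<omega> k))))"
      by (rule addhom_finsum[OF ID.I.abelian_group_axioms A.grp_T ev_char(1)[OF b] J gc])
    also have "\<dots> = (\<Oplus>\<^bsub>TT\<^esub>k\<in>J. JT.tact (dT \<delta> (\<omega> k)) (\<Delta> k b))"
    proof (rule A.T.finsum_cong')
      show "(\<lambda>k. JT.tact (dT \<delta> (\<omega> k)) (\<Delta> k b)) \<in> J \<rightarrow> carrier TT"
        using JT.tact_closed[OF dc B.D_apply[OF \<Delta> b]] by simp
    qed (simp_all add: ev_G[OF \<Delta> b dc])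
    also have "\<dots> = \<delta> b" using J2[rule_format, OF \<delta> b] by (rule sym)
    finally show ?thesis .
  qed
  moreover have "?x \<in> UW n" if "\<forall>b\<in>carrier B. \<delta> b \<in> A.TW n" for n
    unfolding ind_wt_def
  proof (rule span_finsum[OF ID.I.abelian_group_axioms UW_gens J])
    fix k assume k: "k \<in> J"
    show "G (\<Delta> k) (dT \<delta> (\<omega> k)) \<in> span U {ID.pi3 a v c |a v c p q r. a \<in> wt A p \<and> v \<in> placed 0 D q \<and> c \<in> wt A r \<and> p + q + r = n}"
      using G_wt[OF \<Delta>[OF k] dT_wt[OF \<delta> _ \<omega>[OF k], of n]] that by (simp add: ind_wt_def)
  qed
  ultimately show ?thesis by blast
qed

text \<open>Evaluation has to be extended from elements b to one-forms, because the dual basis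
  consists of one-forms. Each extension is a combination of terms b (ev x) b', so it vanishes
  wherever all evaluations do.\<close>

lemma ev_form:
  assumes \<xi>: "\<xi> \<in> carrier (Om1 R B)"
  shows "\<exists>E. E \<in> addhom U TT \<and> (\<forall>p q. \<forall>a\<in>wt A p. \<forall>\<Delta>\<in>carrier D. \<forall>c\<in>wt A q. E (ID.pi3 a \<Delta> c) = il a (ir (tm (dB \<Delta> \<xi>)) c)) \<and>
    (\<forall>x\<in>carrier U. (\<forall>b\<in>carrier B. ev b x = \<zero>\<^bsub>TT\<^esub>) \<longrightarrow> E x = \<zero>\<^bsub>TT\<^esub>)"
  using \<xi>
proof (induction rule: B.O1.O.gen_induct)
  case (gen g)
  then obtain b x b' where g: "g = (b, x, b')" and b: "b \<in> carrier B" and x: "x \<in> carrier B" and b': "b' \<in> carrier B" by auto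
  let ?E = "\<lambda>w. lact TT (j b) (ract TT (ev x w) (j b'))"
  note jb = j_closed[OF b] and jb' = j_closed[OF b']
  have h: "?E \<in> addhom U TT"
    by (rule addhom_comp[OF addhom_comp[OF ev_char(1)[OF x] A.ract_tens_hom(1)[OF jb']] A.lact_tens_hom(1)[OF jb]])
  have e: "?E (ID.pi3 a \<Delta> c) = il a (ir (tm (dB \<Delta> (B.O1.p1 b x b'))) c)"
    if a: "a \<in> wt A p" and \<Delta>: "\<Delta> \<in> carrier D" and c: "c \<in> wt A q" for p q a \<Delta> c
  proof -
    note ac = A.wt_carrier[OF a] and cc = A.wt_carrier[OF c] and dx = B.D_apply[OF \<Delta> x]
    note t = tm_closed[OF dx]
    note rc = B.TB.r_closed[OF b' dx]
    have "il a (ir (tm (dB \<Delta> (B.O1.p1 b x b'))) c) = il a (ir (lact TT (j b) (ract TT (tm (\<Delta> x)) (j b'))) c)"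
      by (simp add: dB_char(2)[OF \<Delta> b x b'] tm_inner(3)[OF b rc] tm_inner(4)[OF b' dx])
    also have "\<dots> = lact TT (j b) (ract TT (il a (ir (tm (\<Delta> x)) c)) (j b'))"
      using A.ir_lact[OF cc jb A.TB.r_closed[OF jb' t]] A.ir_ract[OF c jb' t]
        A.il_lact[OF a jb A.TB.r_closed[OF jb' A.ir_closed[OF cc t]]] A.il_ract[OF ac jb' A.ir_closed[OF cc t]] b b'
      by simp
    finally show ?thesis using ac cc \<Delta> x by (simp add: ev_char(2))
  qed
  have z: "?E w = \<zero>\<^bsub>TT\<^esub>" if "w \<in> carrier U" "\<forall>b\<in>carrier B. ev b w = \<zero>\<^bsub>TT\<^esub>" for w
    using that x jb jb' by simp
  show ?case unfolding g using h e z by (intro exI[of _ ?E] conjI allI ballI impI)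
next
  case (diff \<xi> \<eta>)
  from diff.IH(1) obtain E where E: "E \<in> addhom U TT"
    "\<forall>p q. \<forall>a\<in>wt A p. \<forall>\<Delta>\<in>carrier D. \<forall>c\<in>wt A q. E (ID.pi3 a \<Delta> c) = il a (ir (tm (dB \<Delta> \<xi>)) c)"
    "\<forall>x\<in>carrier U. (\<forall>b\<in>carrier B. ev b x = \<zero>\<^bsub>TT\<^esub>) \<longrightarrow> E x = \<zero>\<^bsub>TT\<^esub>" by (elim exE conjE)
  from diff.IH(2) obtain E' where E': "E' \<in> addhom U TT"
    "\<forall>p q. \<forall>a\<in>wt A p. \<forall>\<Delta>\<in>carrier D. \<forall>c\<in>wt A q. E' (ID.pi3 a \<Delta> c) = il a (ir (tm (dB \<Delta> \<eta>)) c)"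
    "\<forall>x\<in>carrier U. (\<forall>b\<in>carrier B. ev b x = \<zero>\<^bsub>TT\<^esub>) \<longrightarrow> E' x = \<zero>\<^bsub>TT\<^esub>" by (elim exE conjE)
  note gO = B.O1.O.abelian_group_axioms and gB = B.T.abelian_group_axioms and gT = A.grp_T
  let ?E = "\<lambda>x. E x \<ominus>\<^bsub>TT\<^esub> E' x"
  have h: "?E \<in> addhom U TT" by (rule addhom_diff[OF gT E(1) E'(1)])
  have e: "?E (ID.pi3 a \<Delta> c) = il a (ir (tm (dB \<Delta> (\<xi> \<ominus>\<^bsub>Om1 R B\<^esub> \<eta>))) c)"
    if a: "a \<in> wt A p" and \<Delta>: "\<Delta> \<in> carrier D" and c: "c \<in> wt A q" for p q a \<Delta> c
  proof -
    note ac = A.wt_carrier[OF a] and cc = A.wt_carrier[OF c]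
    note H = addhom_comp[OF addhom_comp[OF addhom_comp[OF dB_char(1)[OF \<Delta>] tm_hom] A.inner_r_char(1)[OF cc]] A.inner_l_char(1)[OF ac]]
    have "il a (ir (tm (dB \<Delta> (\<xi> \<ominus>\<^bsub>Om1 R B\<^esub> \<eta>))) c) = il a (ir (tm (dB \<Delta> \<xi>)) c) \<ominus>\<^bsub>TT\<^esub> il a (ir (tm (dB \<Delta> \<eta>)) c)"
      by (rule addhom_minus[OF gO gT H diff.hyps])
    then show ?thesis using E(2)[rule_format, OF a \<Delta> c] E'(2)[rule_format, OF a \<Delta> c] by simp
  qed
  have z: "?E w = \<zero>\<^bsub>TT\<^esub>" if "w \<in> carrier U" "\<forall>b\<in>carrier B. ev b w = \<zero>\<^bsub>TT\<^esub>" for w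
    using E(3)[rule_format, OF that(1)] E'(3)[rule_format, OF that(1)] that(2) by (simp add: A.T.minus_eq_zero_iff)
  show ?case using h e z by (intro exI[of _ ?E] conjI allI ballI impI)
next
  case zero
  note gO = B.O1.O.abelian_group_axioms and gB = B.T.abelian_group_axioms and gT = A.grp_T
  have e: "\<zero>\<^bsub>TT\<^esub> = il a (ir (tm (dB \<Delta> \<zero>\<^bsub>Om1 R B\<^esub>)) c)"
    if a: "a \<in> wt A p" and \<Delta>: "\<Delta> \<in> carrier D" and c: "c \<in> wt A q" for p q a \<Delta> c
    by (rule addhom_zero[OF gO gT addhom_comp[OF addhom_comp[OF addhom_comp[OF dB_char(1)[OF \<Delta>] tm_hom] A.inner_r_char(1)[OF A.wt_carrier[OF c]]] A.inner_l_char(1)[OF A.wt_carrier[OF a]]], symmetric])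
  show ?case using addhom_const_zero[OF gT] e by (intro exI[of _ "\<lambda>x. \<zero>\<^bsub>TT\<^esub>"] conjI allI ballI impI refl)
qed

text \<open>An element can be rebuilt from its evaluations: summing \<open>G (\<Delta> k)\<close>
  over the extended evaluations at \<omega>_k gives back x. If all evaluations vanish, so does this
  sum.\<close>

lemma ev_inj:
  assumes x: "x \<in> carrier U" and 0: "\<And>b. b \<in> carrier B \<Longrightarrow> ev b x = \<zero>\<^bsub>TT\<^esub>"
  shows "x = \<zero>\<^bsub>U\<^esub>"
proof -
  from Om1_dual_basis obtain J :: "('b \<times> 'b \<times> 'b) pres set" and \<omega> \<Delta> where J: "finite J"
    and J1: "\<forall>k\<in>J. \<omega> k \<in> carrier (Om1 R B) \<and> \<Delta> k \<in> carrier D"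
    and J2: "\<forall>\<Delta>'\<in>carrier D. \<forall>x\<in>carrier B. \<Delta>' x = (\<Oplus>\<^bsub>TB\<^esub>k\<in>J. BT.tact (dB \<Delta>' (\<omega> k)) (\<Delta> k x))"
    by (elim exE conjE)
  have \<omega>: "\<omega> k \<in> carrier (Om1 R B)" and \<Delta>: "\<Delta> k \<in> carrier D" if "k \<in> J" for k using J1 that by auto
  define P where "P k E \<longleftrightarrow> E \<in> addhom U TT \<and> (\<forall>p q. \<forall>a\<in>wt A p. \<forall>\<Delta>\<in>carrier D. \<forall>c\<in>wt A q. E (ID.pi3 a \<Delta> c) = il a (ir (tm (dB \<Delta> (\<omega> k))) c)) \<and>
    (\<forall>x\<in>carrier U. (\<forall>b\<in>carrier B. ev b x = \<zero>\<^bsub>TT\<^esub>) \<longrightarrow> E x = \<zero>\<^bsub>TT\<^esub>)" for k E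
  have "\<forall>k\<in>J. \<exists>E. P k E" using ev_form[OF \<omega>] unfolding P_def by (rule ballI)
  from bchoice[OF this] obtain E where "\<forall>k\<in>J. P k (E k)" ..
  then have E1: "E k \<in> addhom U TT"
    and E2: "\<And>p q a \<Delta> c. \<lbrakk>a \<in> wt A p; \<Delta> \<in> carrier D; c \<in> wt A q\<rbrakk> \<Longrightarrow> E k (ID.pi3 a \<Delta> c) = il a (ir (tm (dB \<Delta> (\<omega> k))) c)"
    and E3: "\<And>x. x \<in> carrier U \<Longrightarrow> (\<forall>b\<in>carrier B. ev b x = \<zero>\<^bsub>TT\<^esub>) \<Longrightarrow> E k x = \<zero>\<^bsub>TT\<^esub>" if "k \<in> J" for k
    using that unfolding P_def by blast+
  note gU = ID.I.abelian_group_axioms and gT = A.grp_T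
  have GE: "(\<lambda>x. G (\<Delta> k) (E k x)) \<in> addhom U U" if "k \<in> J" for k
    by (rule addhom_comp[OF E1[OF that] G_char(1)[OF \<Delta>[OF that]]])
  have H: "(\<lambda>x. \<Oplus>\<^bsub>U\<^esub>k\<in>J. G (\<Delta> k) (E k x)) \<in> addhom U U"
    by (rule addhom_finsum_maps[OF gU J GE])
  have e: "(\<Oplus>\<^bsub>U\<^esub>k\<in>J. G (\<Delta> k) (E k (ID.pi3 a \<Delta>' c))) = ID.pi3 a \<Delta>' c"
    if a: "a \<in> wt A p" and \<Delta>': "\<Delta>' \<in> carrier D" and c: "c \<in> wt A q" for p q a \<Delta>' c
  proof -
    note ac = A.wt_carrier[OF a] and cc = A.wt_carrier[OF c]
    have dc: "dB \<Delta>' (\<omega> k) \<in> carrier TB" if "k \<in> J" for k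
      by (rule addhom_closed[OF dB_char(1)[OF \<Delta>'] \<omega>[OF that]])
    have Zc: "(\<lambda>k. Z (\<Delta> k) (dB \<Delta>' (\<omega> k))) \<in> J \<rightarrow> carrier D"
      using Z_closed[OF \<Delta> dc] by simp
    have p: "(\<lambda>\<Delta>. ID.pi3 a \<Delta> c) \<in> addhom D U"
      using ac cc by (intro addhomI) (simp_all add: ID.pi3_rules)
    have "(\<Oplus>\<^bsub>U\<^esub>k\<in>J. G (\<Delta> k) (E k (ID.pi3 a \<Delta>' c))) = (\<Oplus>\<^bsub>U\<^esub>k\<in>J. ID.pi3 a (Z (\<Delta> k) (dB \<Delta>' (\<omega> k))) c)"
    proof (rule ID.I.finsum_cong')
      show "(\<lambda>k. ID.pi3 a (Z (\<Delta> k) (dB \<Delta>' (\<omega> k))) c) \<in> J \<rightarrow> carrier U"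
        using ID.pi3_closed[OF ac Z_closed[OF \<Delta> dc] cc] by simp
    qed (simp_all add: E2[OF _ a \<Delta>' c] G_inner[OF \<Delta> ac c dc])
    also have "\<dots> = ID.pi3 a (\<Oplus>\<^bsub>D\<^esub>k\<in>J. Z (\<Delta> k) (dB \<Delta>' (\<omega> k))) c"
      by (rule addhom_finsum[OF B.U.grp_DD gU p J Zc, symmetric])
    \<comment> \<open>The dual basis expansion of \<open>\<Delta>'\<close> itself; it closes the
      reconstruction on a pure tensor once \<open>G_inner\<close> has moved all coefficients to the
      middle.\<close>
    also have "(\<Oplus>\<^bsub>D\<^esub>k\<in>J. Z (\<Delta> k) (dB \<Delta>' (\<omega> k))) = \<Delta>'"
    proof (rule B.D_ext[OF B.DB.V.finsum_closed[OF Zc] \<Delta>'])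
      fix y assume y: "y \<in> carrier B"
      have ex: "(\<lambda>\<Delta>. \<Delta> y) \<in> addhom D TB" using B.U.DD_eval[of y] y by (simp only: ungraded_simps ungraded_tens)
      have "(\<Oplus>\<^bsub>D\<^esub>k\<in>J. Z (\<Delta> k) (dB \<Delta>' (\<omega> k))) y = (\<Oplus>\<^bsub>TB\<^esub>k\<in>J. Z (\<Delta> k) (dB \<Delta>' (\<omega> k)) y)"
        by (rule addhom_finsum[OF B.U.grp_DD B.T.abelian_group_axioms ex J Zc])
      also have "\<dots> = (\<Oplus>\<^bsub>TB\<^esub>k\<in>J. BT.tact (dB \<Delta>' (\<omega> k)) (\<Delta> k y))"
      proof (rule B.T.finsum_cong')
        show "(\<lambda>k. BT.tact (dB \<Delta>' (\<omega> k)) (\<Delta> k y)) \<in> J \<rightarrow> carrier TB"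
          using BT.tact_closed[OF dc B.D_apply[OF \<Delta> y]] by simp
      qed (simp_all add: Z_apply[OF \<Delta> dc y])
      also have "\<dots> = \<Delta>' y" using J2[rule_format, OF \<Delta>' y] by (rule sym)
      finally show "(\<Oplus>\<^bsub>D\<^esub>k\<in>J. Z (\<Delta> k) (dB \<Delta>' (\<omega> k))) y = \<Delta>' y" .
    qed
    finally show ?thesis .
  qed
  have "(\<Oplus>\<^bsub>U\<^esub>k\<in>J. G (\<Delta> k) (E k x)) = x"
    by (rule A.ind_ext_wt[OF ID.induced_axioms gU H addhom_id e x])
  moreover have "(\<Oplus>\<^bsub>U\<^esub>k\<in>J. G (\<Delta> k) (E k x)) = (\<Oplus>\<^bsub>U\<^esub>k\<in>J. \<zero>\<^bsub>U\<^esub>)"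
  proof (rule ID.I.finsum_cong')
    fix k assume k: "k \<in> J"
    have "E k x = \<zero>\<^bsub>TT\<^esub>" using E3[OF k x] 0 by simp
    then show "G (\<Delta> k) (E k x) = \<zero>\<^bsub>U\<^esub>" using addhom_zero[OF gT gU G_char(1)[OF \<Delta>[OF k]]] by simp
  qed simp_all
  ultimately show ?thesis by simp
qed

section \<open>The map \<open>\<epsilon>\<^sup>\<or>\<close>\<close>

abbreviation DD where "DD \<equiv> DDer K R A"
abbreviation DW where "DW \<equiv> DDer_wt K R A"
abbreviation eps where "eps \<equiv> eps_dual K R B A j"

text \<open>The image of B has weight 0, so the twists in the Leibniz rule disappear on it. The
  restriction to B is then an ordinary derivation even if \<open>\<Theta>\<close> is a sum of
  different weights.\<close>

lemma derT_DD:
  assumes \<Theta>: "\<Theta> \<in> carrier DD"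
  shows "derT (\<lambda>b. \<Theta> (j b))"
proof -
  note gT = A.grp_T
  note ex = A.DD_eval
  have add: "\<Theta> (x \<oplus> y) = \<Theta> x \<oplus>\<^bsub>TT\<^esub> \<Theta> y" if xy: "x \<in> carrier A" "y \<in> carrier A" for x y
    by (rule A.DD_hom_ext[OF gT ex[OF A.A.a_closed[OF xy]] addhom_sum2[OF gT ex[OF xy(1)] ex[OF xy(2)]] _ \<Theta>])
       (rule addhom_add[OF A.DWD(2) xy])
  have um: "\<Theta> (umap A t) = \<zero>\<^bsub>TT\<^esub>" if t: "t \<in> carrier R" for t
    by (rule A.DD_hom_ext[OF gT ex[OF A.umap_closed[OF t]] addhom_const_zero[OF gT] _ \<Theta>]) (rule A.DWD(4)[OF _ t])
  have leib: "\<Theta> (j x \<otimes> j y) = ract TT (\<Theta> (j x)) (j y) \<oplus>\<^bsub>TT\<^esub> lact TT (j x) (\<Theta> (j y))" if xy: "x \<in> carrier B" "y \<in> carrier B" for x y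
  proof -
    note jx = j_closed[OF xy(1)] and jy = j_closed[OF xy(2)]
    have "\<Theta>' (j x \<otimes> j y) = ract TT (\<Theta>' (j x)) (j y) \<oplus>\<^bsub>TT\<^esub> lact TT (j x) (\<Theta>' (j y))" if "\<Theta>' \<in> DW n" for n \<Theta>'
      using A.DWD(5)[OF that jx jy] xy by simp
    then show ?thesis
      by (rule A.DD_hom_ext[OF gT ex[OF A.A.m_closed[OF jx jy]] addhom_sum2[OF gT addhom_comp[OF ex[OF jx] A.ract_tens_hom(1)[OF jy]] addhom_comp[OF ex[OF jy] A.lact_tens_hom(1)[OF jx]]] _ \<Theta>])
  qed
  have "(\<lambda>b. \<Theta> (j b)) \<in> addhom B TT"
    by (rule addhomI) (simp_all add: j_rules add A.DD_apply[OF \<Theta>])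
  then show ?thesis by (simp add: derT_def j_umap um j_rules leib)
qed

lemma ev_unique:
  assumes "x \<in> carrier U" "y \<in> carrier U" "\<And>b. b \<in> carrier B \<Longrightarrow> ev b x = ev b y"
  shows "x = y"
proof -
  have "x \<ominus>\<^bsub>U\<^esub> y = \<zero>\<^bsub>U\<^esub>"
  proof (rule ev_inj)
    show "x \<ominus>\<^bsub>U\<^esub> y \<in> carrier U" using assms by simp
    fix b assume b: "b \<in> carrier B"
    have "ev b (x \<ominus>\<^bsub>U\<^esub> y) = ev b x \<ominus>\<^bsub>TT\<^esub> ev b y"
      by (rule addhom_minus[OF ID.I.abelian_group_axioms A.grp_T ev_char(1)[OF b] assms(1,2)])
    then show "ev b (x \<ominus>\<^bsub>U\<^esub> y) = \<zero>\<^bsub>TT\<^esub>" using assms b by (simp add: A.T.minus_eq_zero_iff)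
  qed
  then show ?thesis using assms by (simp add: ID.I.minus_eq_zero_iff)
qed

text \<open>Surjectivity and injectivity of evaluation give the existence and uniqueness behind the
  definite description in \<open>eps_dual\<close>.\<close>

lemma eps_char:
  assumes \<Theta>: "\<Theta> \<in> carrier DD"
  shows "eps \<Theta> \<in> carrier U" "\<And>b. b \<in> carrier B \<Longrightarrow> ev b (eps \<Theta>) = \<Theta> (j b)"
proof -
  from ev_surj[OF derT_DD[OF \<Theta>]] obtain x where x: "x \<in> carrier U" "\<forall>b\<in>carrier B. ev b x = \<Theta> (j b)" by (elim exE conjE)
  have "eps \<Theta> = x" unfolding eps_dual_def
  proof (rule the_equality)
    fix y assume "y \<in> carrier U \<and> (\<forall>b\<in>carrier B. ev b y = \<Theta> (j b))"
    then show "y = x" using x by (intro ev_unique) auto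
  qed (use x in blast)
  then show "eps \<Theta> \<in> carrier U" "\<And>b. b \<in> carrier B \<Longrightarrow> ev b (eps \<Theta>) = \<Theta> (j b)" using x by auto
qed

lemma eps_eqI:
  assumes "\<Theta> \<in> carrier DD" "x \<in> carrier U" "\<And>b. b \<in> carrier B \<Longrightarrow> ev b x = \<Theta> (j b)"
  shows "eps \<Theta> = x"
  using eps_char[OF assms(1)] assms(2,3) by (intro ev_unique) auto

lemma eps_addhom: "eps \<in> addhom DD U"
proof (rule addhomI)
  interpret DD: abelian_group DD by (rule A.grp_DD)
  fix \<Theta> \<Theta>' assume *: "\<Theta> \<in> carrier DD" "\<Theta>' \<in> carrier DD"
  show "eps \<Theta> \<in> carrier U" by (rule eps_char(1)[OF *(1)])
  show "eps (\<Theta> \<oplus>\<^bsub>DD\<^esub> \<Theta>') = eps \<Theta> \<oplus>\<^bsub>U\<^esub> eps \<Theta>'"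
    by (rule eps_eqI) (use * in \<open>simp_all add: eps_char addhom_add[OF ev_char(1)] A.DD_add_apply\<close>)
qed

lemma eps_wt:
  assumes \<Theta>: "\<Theta> \<in> DW n"
  shows "eps \<Theta> \<in> UW n"
proof -
  note c = A.DW_DD[OF \<Theta>]
  from ev_surj[OF derT_DD[OF c]] obtain x where x: "x \<in> carrier U" "\<forall>b\<in>carrier B. ev b x = \<Theta> (j b)"
    "\<forall>n. (\<forall>b\<in>carrier B. \<Theta> (j b) \<in> A.TW n) \<longrightarrow> x \<in> UW n" by (elim exE conjE)
  have "\<Theta> (j b) \<in> A.TW n" if "b \<in> carrier B" for b using A.DWD(3)[OF \<Theta> j_wt[OF that]] by simp
  then have "x \<in> UW n" using x(3) by blast
  moreover have "eps \<Theta> = x" by (rule eps_eqI[OF c x(1)]) (use x(2) in simp)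
  ultimately show ?thesis by simp
qed

lemma eps_lact:
  assumes a: "a \<in> wt A q" and \<Theta>: "\<Theta> \<in> DW n"
  shows "eps (lact DD a \<Theta>) = lact U a (eps \<Theta>)" "eps (ract DD \<Theta> a) = ract U (eps \<Theta>) a"
proof -
  note ac = A.wt_carrier[OF a] and c = A.DW_DD[OF \<Theta>]
  note e = eps_char[OF c]
  show "eps (lact DD a \<Theta>) = lact U a (eps \<Theta>)"
    by (rule eps_eqI[OF A.DW_DD[OF A.DW_lact[OF a \<Theta>]]]) (use ac e in \<open>simp_all add: ev_act A.lact_DD\<close>)
  show "eps (ract DD \<Theta> a) = ract U (eps \<Theta>) a"
    by (rule eps_eqI[OF A.DW_DD[OF A.DW_ract[OF a \<Theta>]]]) (use ac e in \<open>simp_all add: ev_act A.ract_DD[OF a A.DWD(2)[OF \<Theta>]]\<close>)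
qed

lemma eps_zero:
  assumes "\<Theta> \<in> carrier DD" "\<And>b. b \<in> carrier B \<Longrightarrow> \<Theta> (j b) = \<zero>\<^bsub>TT\<^esub>"
  shows "eps \<Theta> = \<zero>\<^bsub>U\<^esub>"
  by (rule eps_eqI[OF assms(1)])
    (simp_all add: assms(2) addhom_zero[OF ID.I.abelian_group_axioms A.grp_T ev_char(1)])

end

section \<open>The graded tensor algebra \<open>T\<^sub>B M\<close>\<close>

text \<open>The graded algebra and the tensor algebra beneath it are different records with the same
  operations. This lemma and the next transfer results between them.\<close>

lemma ring_cong:
  assumes "ring T" "carrier T' = carrier T" "monoid.mult T' = monoid.mult T" "one T' = one T" "ring.zero T' = ring.zero T" "add T' = add T"
  shows "ring T'"
proof -
  interpret ring T by fact
  show ?thesis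
  proof (intro ringI abelian_groupI monoidI)
    fix x assume "x \<in> carrier T'"
    then show "\<exists>y\<in>carrier T'. y \<oplus>\<^bsub>T'\<^esub> x = \<zero>\<^bsub>T'\<^esub>"
      using assms(2-) by (intro bexI[of _ "\<ominus>\<^bsub>T\<^esub> x"]) (simp_all add: l_neg)
  qed (use assms(2-) in \<open>simp_all add: a_ac m_assoc l_distr r_distr\<close>)
qed

lemma span_cong:
  assumes "carrier V' = carrier V" "\<zero>\<^bsub>V'\<^esub> = \<zero>\<^bsub>V\<^esub>" "add V' = add V"
  shows "span V' U = span V U"
proof -
  have inv: "\<ominus>\<^bsub>V'\<^esub> x = \<ominus>\<^bsub>V\<^esub> x" for x using assms by (simp add: a_inv_def m_inv_def)
  have neg: "\<ominus>\<^bsub>W\<^esub> x \<in> span W U" if "x \<in> U" for x and W :: "('w, 'z) ring_scheme" and U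
    unfolding span_def a_inv_def using generate.inv[OF that, of "add_monoid W"] .
  show ?thesis
  proof (intro equalityI subsetI)
    fix x assume "x \<in> span V' U"
    then show "x \<in> span V U"
      by (induction rule: span_induct) (simp_all add: assms inv span_zero span_incl neg span_add)
  next
    fix x assume "x \<in> span V U"
    then show "x \<in> span V' U"
    proof (induction rule: span_induct)
      case zero show ?case using span_zero[of V' U] assms by simp
    next
      case (inv x) then show ?case using neg[of x U V'] \<open>\<And>x. \<ominus>\<^bsub>V'\<^esub> x = \<ominus>\<^bsub>V\<^esub> x\<close> by simp
    next
      case (add x y) then show ?case using span_add[of x V' U y] assms by simp
    qed (rule span_incl)
  qed
qed

locale tbm = base_alg K R B h
  for K :: "('k, 'x) ring_scheme" and R :: "('k, 'r, 'y) alg_scheme" and B :: "('r, 'b) alg" and h :: 'k +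
  fixes N :: nat and E :: "nat \<Rightarrow> ('b, 'e) bimod"
  assumes E_bim: "\<And>i. i \<in> {1..N} \<Longrightarrow> bimodule K R B (E i)"
begin

abbreviation M where "M \<equiv> dsum N E"
abbreviation Mw where "Mw \<equiv> dsum_wt N E"
abbreviation TA where "TA \<equiv> tensor_alg B M"
abbreviation AA where "AA \<equiv> TBM B N E"
abbreviation j where "j \<equiv> TBM_base B N E"
abbreviation inc where "inc \<equiv> T_incl B M"

lemma E_biact: "i \<in> {1..N} \<Longrightarrow> biact B (E i) (lact (E i)) (ract (E i))"
  by (rule bimodule_biact[OF E_bim A.ring_axioms])

lemma E_central: "\<lbrakk>i \<in> {1..N}; c \<in> carrier K; v \<in> carrier (E i)\<rbrakk> \<Longrightarrow> lact (E i) (kmap R B c) v = ract (E i) v (kmap R B c)"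
  using E_bim[of i] by (simp add: bimodule_def)

lemma E_grp: "i \<in> {1..N} \<Longrightarrow> abelian_group (E i)"
  using biact.grp_V[OF E_biact] .

lemmas E_rules = biact.l_closed[OF E_biact] biact.r_closed[OF E_biact] biact.l_add[OF E_biact] biact.r_add[OF E_biact]
  biact.l_plus[OF E_biact] biact.r_plus[OF E_biact] biact.l_mult[OF E_biact] biact.r_mult[OF E_biact]
  biact.lr_assoc[OF E_biact] biact.l_one[OF E_biact] biact.r_one[OF E_biact]
  biact.l_zero[OF E_biact] biact.r_zero[OF E_biact]
  abelian_groupE(1)[OF E_grp] abelian_groupE(2)[OF E_grp] abelian_groupE(3)[OF E_grp] abelian_groupE(5)[OF E_grp]
  abelian_group.a_inv_closed[OF E_grp]

lemma E_comm: "\<lbrakk>i \<in> {1..N}; v \<in> carrier (E i); w \<in> carrier (E i)\<rbrakk> \<Longrightarrow> v \<oplus>\<^bsub>E i\<^esub> w = w \<oplus>\<^bsub>E i\<^esub> v"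
  using abelian_groupE(4)[OF E_grp] .

lemma M_simps:
  "carrier M = (\<Pi>\<^sub>E i\<in>{1..N}. carrier (E i))" "\<zero>\<^bsub>M\<^esub> = (\<lambda>i\<in>{1..N}. \<zero>\<^bsub>E i\<^esub>)"
  "m \<oplus>\<^bsub>M\<^esub> m' = (\<lambda>i\<in>{1..N}. m i \<oplus>\<^bsub>E i\<^esub> m' i)"
  "lact M b m = (\<lambda>i\<in>{1..N}. lact (E i) b (m i))" "ract M m b = (\<lambda>i\<in>{1..N}. ract (E i) (m i) b)"
  by (simp_all add: dsum_def)

lemma M_app: "m \<in> carrier M \<Longrightarrow> i \<in> {1..N} \<Longrightarrow> m i \<in> carrier (E i)"
  unfolding M_simps by (rule PiE_mem)

lemma M_eqI:
  assumes "m \<in> carrier M" "m' \<in> carrier M" "\<And>i. i \<in> {1..N} \<Longrightarrow> m i = m' i"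
  shows "m = m'"
  using assms unfolding M_simps by (rule PiE_ext)

lemma M_closed:
  "\<zero>\<^bsub>M\<^esub> \<in> carrier M" "m \<in> carrier M \<Longrightarrow> m' \<in> carrier M \<Longrightarrow> m \<oplus>\<^bsub>M\<^esub> m' \<in> carrier M"
  "b \<in> carrier B \<Longrightarrow> m \<in> carrier M \<Longrightarrow> lact M b m \<in> carrier M" "b \<in> carrier B \<Longrightarrow> m \<in> carrier M \<Longrightarrow> ract M m b \<in> carrier M"
  using M_app by (simp_all add: M_simps E_rules PiE_iff)

lemma M_ap:
  assumes "i \<in> {1..N}"
  shows "\<zero>\<^bsub>M\<^esub> i = \<zero>\<^bsub>E i\<^esub>" "(m \<oplus>\<^bsub>M\<^esub> m') i = m i \<oplus>\<^bsub>E i\<^esub> m' i" "lact M b m i = lact (E i) b (m i)" "ract M m b i = ract (E i) (m i) b"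
  using assms by (simp_all add: M_simps)

lemma M_grp: "abelian_group M"
proof (rule abelian_groupI)
  fix m assume m: "m \<in> carrier M"
  let ?n = "\<lambda>i\<in>{1..N}. \<ominus>\<^bsub>E i\<^esub> m i"
  have n: "?n \<in> carrier M" using M_app[OF m] by (simp add: M_simps PiE_iff E_rules)
  have "?n \<oplus>\<^bsub>M\<^esub> m = \<zero>\<^bsub>M\<^esub>"
    by (rule M_eqI[OF M_closed(2)[OF n m] M_closed(1)])
       (simp add: M_ap abelian_group.l_neg[OF E_grp] M_app[OF m])
  then show "\<exists>y\<in>carrier M. y \<oplus>\<^bsub>M\<^esub> m = \<zero>\<^bsub>M\<^esub>" using n by blast
  show "\<zero>\<^bsub>M\<^esub> \<oplus>\<^bsub>M\<^esub> m = m"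
    by (rule M_eqI) (simp_all add: M_closed m M_ap E_rules M_app[OF m])
next
  fix x y z assume *: "x \<in> carrier M" "y \<in> carrier M" "z \<in> carrier M"
  show "x \<oplus>\<^bsub>M\<^esub> y \<oplus>\<^bsub>M\<^esub> z = x \<oplus>\<^bsub>M\<^esub> (y \<oplus>\<^bsub>M\<^esub> z)"
    by (rule M_eqI) (simp_all add: M_closed * M_ap abelian_groupE(3)[OF E_grp] M_app[OF *(1)] M_app[OF *(2)] M_app[OF *(3)])
next
  fix x y assume *: "x \<in> carrier M" "y \<in> carrier M"
  show "x \<oplus>\<^bsub>M\<^esub> y = y \<oplus>\<^bsub>M\<^esub> x"
    by (rule M_eqI) (simp_all add: M_closed * M_ap E_comm M_app[OF *(1)] M_app[OF *(2)])
qed (simp_all add: M_closed)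

sublocale MB: talg B "dsum N E"
proof (intro talg.intro biact.intro)
  show "ring B" by (rule A.ring_axioms)
  show "abelian_group M" by (rule M_grp)
  fix b v assume bv: "b \<in> carrier B" "v \<in> carrier M"
  show "lact M b v \<in> carrier M" "ract M v b \<in> carrier M" using bv by (simp_all add: M_closed)
  show "lact M b (v \<oplus>\<^bsub>M\<^esub> w) = lact M b v \<oplus>\<^bsub>M\<^esub> lact M b w" if "w \<in> carrier M" for w
    by (rule M_eqI) (simp_all add: M_closed that bv M_ap E_rules M_app[OF that] M_app[OF bv(2)])
  show "ract M (v \<oplus>\<^bsub>M\<^esub> w) b = ract M v b \<oplus>\<^bsub>M\<^esub> ract M w b" if "w \<in> carrier M" for w
    by (rule M_eqI) (simp_all add: M_closed that bv M_ap E_rules M_app[OF that] M_app[OF bv(2)])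
next
  fix v assume v: "v \<in> carrier M"
  show "lact M \<one>\<^bsub>B\<^esub> v = v"
    by (rule M_eqI) (simp_all add: M_closed v M_ap E_rules M_app[OF v])
  show "ract M v \<one>\<^bsub>B\<^esub> = v"
    by (rule M_eqI) (simp_all add: M_closed v M_ap E_rules M_app[OF v])
next
  fix b c v assume bv: "b \<in> carrier B" "c \<in> carrier B" "v \<in> carrier M"
  show "lact M (b \<oplus>\<^bsub>B\<^esub> c) v = lact M b v \<oplus>\<^bsub>M\<^esub> lact M c v"
    by (rule M_eqI) (simp_all add: M_closed bv M_ap E_rules M_app[OF bv(3)])
  show "ract M v (b \<oplus>\<^bsub>B\<^esub> c) = ract M v b \<oplus>\<^bsub>M\<^esub> ract M v c"
    by (rule M_eqI) (simp_all add: M_closed bv M_ap E_rules M_app[OF bv(3)])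
  show "lact M (b \<otimes>\<^bsub>B\<^esub> c) v = lact M b (lact M c v)"
    by (rule M_eqI) (simp_all add: M_closed bv M_ap E_rules M_app[OF bv(3)])
  show "ract M v (b \<otimes>\<^bsub>B\<^esub> c) = ract M (ract M v b) c"
    by (rule M_eqI) (simp_all add: M_closed bv M_ap E_rules M_app[OF bv(3)])
  show "ract M (lact M b v) c = lact M b (ract M v c)"
    by (rule M_eqI) (simp_all add: M_closed bv M_ap E_rules M_app[OF bv(3)])
qed

lemmas grp_TA = MB.P.abelian_group_axioms

definition inE :: "nat \<Rightarrow> 'e \<Rightarrow> nat \<Rightarrow> 'e" where
  "inE i e = (\<lambda>k\<in>{1..N}. if k = i then e else \<zero>\<^bsub>E k\<^esub>)"

lemma inE_closed: "i \<in> {1..N} \<Longrightarrow> e \<in> carrier (E i) \<Longrightarrow> inE i e \<in> carrier M"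
  by (auto simp: inE_def M_simps PiE_iff intro: abelian_groupE(2)[OF E_grp])

lemma inE_ap: "k \<in> {1..N} \<Longrightarrow> inE i e k = (if k = i then e else \<zero>\<^bsub>E k\<^esub>)"
  by (simp add: inE_def)

lemma inE_wt: "i \<in> {1..N} \<Longrightarrow> e \<in> carrier (E i) \<Longrightarrow> inE i e \<in> Mw (int i)"
  by (simp add: dsum_wt_def inE_closed inE_ap)

lemma inE_rules:
  assumes i: "i \<in> {1..N}" and e: "e \<in> carrier (E i)"
  shows "e' \<in> carrier (E i) \<Longrightarrow> inE i (e \<oplus>\<^bsub>E i\<^esub> e') = inE i e \<oplus>\<^bsub>M\<^esub> inE i e'"
    "b \<in> carrier B \<Longrightarrow> inE i (lact (E i) b e) = lact M b (inE i e)"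
    "b \<in> carrier B \<Longrightarrow> inE i (ract (E i) e b) = ract M (inE i e) b"
proof -
  show "inE i (e \<oplus>\<^bsub>E i\<^esub> e') = inE i e \<oplus>\<^bsub>M\<^esub> inE i e'" if "e' \<in> carrier (E i)"
    by (rule M_eqI[OF inE_closed[OF i abelian_groupE(1)[OF E_grp[OF i] e that]]])
       (auto simp: M_ap inE_ap E_rules M_closed inE_closed[OF i] i e that)
  show "inE i (lact (E i) b e) = lact M b (inE i e)" if "b \<in> carrier B"
    by (rule M_eqI[OF inE_closed[OF i biact.l_closed[OF E_biact[OF i] that e]]])
       (auto simp: M_ap inE_ap E_rules M_closed inE_closed[OF i] i e that)
  show "inE i (ract (E i) e b) = ract M (inE i e) b" if "b \<in> carrier B"
    by (rule M_eqI[OF inE_closed[OF i biact.r_closed[OF E_biact[OF i] that e]]])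
       (auto simp: M_ap inE_ap E_rules M_closed inE_closed[OF i] i e that)
qed

lemma M_induct [consumes 1, case_names zero add inE]:
  assumes m: "m \<in> carrier M" and z: "P \<zero>\<^bsub>M\<^esub>"
    and a: "\<And>x y. \<lbrakk>x \<in> carrier M; y \<in> carrier M; P x; P y\<rbrakk> \<Longrightarrow> P (x \<oplus>\<^bsub>M\<^esub> y)"
    and e: "\<And>i e. i \<in> {1..N} \<Longrightarrow> e \<in> carrier (E i) \<Longrightarrow> P (inE i e)"
  shows "P m"
proof -
  \<comment> \<open>The first n components of m; going from n to n + 1 adds one element of a single
    summand.\<close>
  define tr where "tr n = (\<lambda>k\<in>{1..N}. if k \<le> n then m k else \<zero>\<^bsub>E k\<^esub>)" for n
  have trc: "tr n \<in> carrier M" for n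
    using M_app[OF m] by (auto simp: tr_def M_simps PiE_iff intro: abelian_groupE(2)[OF E_grp])
  have "n \<le> N \<Longrightarrow> P (tr n)" for n
  proof (induction n)
    case 0
    have "tr 0 = \<zero>\<^bsub>M\<^esub>" by (rule M_eqI[OF trc M_closed(1)]) (simp add: tr_def M_ap)
    then show ?case using z by simp
  next
    case (Suc n)
    have i: "Suc n \<in> {1..N}" using Suc.prems by simp
    note mi = M_app[OF m i]
    have "tr (Suc n) = tr n \<oplus>\<^bsub>M\<^esub> inE (Suc n) (m (Suc n))"
    proof (rule M_eqI[OF trc M_closed(2)[OF trc inE_closed[OF i mi]]])
      fix k assume k: "k \<in> {1..N}"
      then show "tr (Suc n) k = (tr n \<oplus>\<^bsub>M\<^esub> inE (Suc n) (m (Suc n))) k"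
        using M_app[OF m k] E_comm[OF k M_app[OF m k], of "\<zero>\<^bsub>E k\<^esub>"] by (auto simp: M_ap inE_ap tr_def E_rules)
    qed
    then show ?case using a[OF trc inE_closed[OF i mi] Suc.IH e[OF i mi]] Suc.prems by simp
  qed
  moreover have "tr N = m" by (rule M_eqI[OF trc m]) (simp add: tr_def)
  ultimately show ?thesis by auto
qed

lemma AA_simps [simp]:
  "carrier AA = carrier TA" "monoid.mult AA = monoid.mult TA" "one AA = one TA" "ring.zero AA = ring.zero TA"
  "add AA = add TA" "umap AA = umap TA"
  by (simp_all add: TBM_def tensor_galg_def alg.defs galg.defs)

lemma AA_inv [simp]: "\<ominus>\<^bsub>AA\<^esub> x = \<ominus>\<^bsub>TA\<^esub> x"
  by (simp add: a_inv_def m_inv_def)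

lemma wt_AA: "wt AA w = span TA (\<Union>n. T_part B M (placed 0 B) Mw w n)"
  by (simp add: TBM_def tensor_galg_def alg.defs galg.defs)

lemma umap_TA: "umap TA = (\<lambda>t. j (umap B t))"
  by (simp add: tensor_alg_def comp_def)

lemma ring_AA: "ring AA"
  by (rule ring_cong[OF MB.TR.ring_axioms]) simp_all

lemma kmap_AA: "kmap R AA c = j (kmap R B c)"
  by (simp add: kmap_def umap_TA)

lemma M_central: "c \<in> carrier K \<Longrightarrow> v \<in> carrier M \<Longrightarrow> lact M (kmap R B c) v = ract M v (kmap R B c)"
  by (rule M_eqI) (simp_all add: M_closed M_ap E_central M_app)

lemma AA_central:
  assumes c: "c \<in> carrier K" and x: "x \<in> carrier TA"
  shows "j (kmap R B c) \<otimes>\<^bsub>TA\<^esub> x = x \<otimes>\<^bsub>TA\<^esub> j (kmap R B c)"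
  using x
proof (induction rule: MB.TA_induct)
  case (base s)
  then show ?case using c by (simp add: ring_hom_mult[OF MB.base_ring_hom, symmetric] kmap_comm)
next
  case (incl v)
  then show ?case using c by (simp add: MB.incl_lact[symmetric] MB.incl_ract[symmetric] M_central)
next
  case (mult x y)
  have k: "j (kmap R B c) \<in> carrier TA" using c by simp
  have "j (kmap R B c) \<otimes>\<^bsub>TA\<^esub> (x \<otimes>\<^bsub>TA\<^esub> y) = (x \<otimes>\<^bsub>TA\<^esub> j (kmap R B c)) \<otimes>\<^bsub>TA\<^esub> y"
    using mult k MB.TR.m_assoc[of "j (kmap R B c)" x y] by simp
  then show ?case using mult k by (simp add: MB.TR.m_assoc)
next
  case (diff x y)
  have k: "j (kmap R B c) \<in> carrier TA" using c by simp
  then show ?case using diff by (simp add: a_minus_def MB.TR.r_distr MB.TR.l_distr MB.TR.r_minus MB.TR.l_minus)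
qed

lemma kalg_AA: "kalg K R AA"
proof (rule kalg.intro[OF kR])
  have 1: "umap AA \<in> ring_hom R AA"
  proof (rule ring_hom_memI)
    fix x y assume "x \<in> carrier R" "y \<in> carrier R"
    then show "umap AA x \<in> carrier AA" "umap AA (x \<otimes>\<^bsub>R\<^esub> y) = umap AA x \<otimes>\<^bsub>AA\<^esub> umap AA y"
      "umap AA (x \<oplus>\<^bsub>R\<^esub> y) = umap AA x \<oplus>\<^bsub>AA\<^esub> umap AA y"
      by (simp_all add: umap_TA ring_hom_mult[OF umap_hom] ring_hom_add[OF umap_hom] ring_hom_mult[OF MB.base_ring_hom] ring_hom_add[OF MB.base_ring_hom])
  qed (simp add: umap_TA ring_hom_one[OF umap_hom] ring_hom_one[OF MB.base_ring_hom])
  show "R_algebra K R AA"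
    using 1 ring_AA AA_central by (simp add: R_algebra_def kmap_AA)
qed

text \<open>Spanning words of weight w with an arbitrary coefficient from B. The defining grading
  also admits coefficients of other weights, but those are zero; see \<open>wt_H\<close>.\<close>

definition H :: "int \<Rightarrow> ('b \<times> (nat \<Rightarrow> 'e) list) pres set" where
  "H w = {MB.tg s vs |s vs qs. s \<in> carrier B \<and> list_all2 (\<lambda>v q. v \<in> Mw q) vs qs \<and> sum_list qs = w}"

lemma Mw_M: "v \<in> Mw q \<Longrightarrow> v \<in> carrier M"
  by (simp add: dsum_wt_def)

lemma Mw_list: "list_all2 (\<lambda>v q. v \<in> Mw q) vs qs \<Longrightarrow> vs \<in> lists (carrier M)"
  by (induction rule: list_all2_induct) (simp_all add: Mw_M)

lemma H_closed: "H w \<subseteq> carrier TA"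
  by (auto simp: H_def dest!: Mw_list intro!: MB.tg_closed)

lemma tg_zero: "vs \<in> lists (carrier M) \<Longrightarrow> MB.tg \<zero>\<^bsub>B\<^esub> vs = \<zero>\<^bsub>TA\<^esub>"
proof -
  assume vs: "vs \<in> lists (carrier M)"
  have h: "(\<lambda>s. MB.tg s vs) \<in> addhom B TA" by (rule addhomI) (use vs in \<open>simp_all add: MB.tg_add del: in_lists_conv_set\<close>)
  show ?thesis by (rule addhom_zero[OF A.abelian_group_axioms grp_TA h])
qed

lemma tg_zero_list: "\<lbrakk>s \<in> carrier B; us \<in> lists (carrier M); ws \<in> lists (carrier M)\<rbrakk> \<Longrightarrow> MB.tg s (us @ \<zero>\<^bsub>M\<^esub> # ws) = \<zero>\<^bsub>TA\<^esub>"
proof -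
  assume *: "s \<in> carrier B" "us \<in> lists (carrier M)" "ws \<in> lists (carrier M)"
  have h: "(\<lambda>v. MB.tg s (us @ v # ws)) \<in> addhom M TA"
    by (rule addhomI) (use * in \<open>simp_all add: MB.tg_add_list\<close>)
  show ?thesis by (rule addhom_zero[OF M_grp grp_TA h])
qed

lemma wt_H: "wt AA w = span TA (H w)"
proof
  note g = grp_TA
  have 1: "T_part B M (placed 0 B) Mw w n \<subseteq> span TA (H w)" for n
  proof
    fix x assume "x \<in> T_part B M (placed 0 B) Mw w n"
    then show "x \<in> span TA (H w)" unfolding T_part_def
    proof (rule span_least)
      show "{MB.tg s vs |s vs p qs. s \<in> placed 0 B p \<and> list_all2 (\<lambda>v q. v \<in> Mw q) vs qs \<and> length vs = n \<and> p + sum_list qs = w} \<subseteq> span TA (H w)"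
      proof clarify
        fix s vs p qs assume *: "s \<in> placed 0 B p" "list_all2 (\<lambda>v q. v \<in> Mw q) vs qs"
        show "MB.tg s vs \<in> span TA (H (p + sum_list qs))"
        proof (cases "p = 0")
          case True
          then have "MB.tg s vs \<in> H (p + sum_list qs)" using * by (auto simp: H_def placed_def)
          then show ?thesis by (rule span_incl)
        next
          case False
          then have "MB.tg s vs = \<zero>\<^bsub>TA\<^esub>" using *(1) tg_zero[OF Mw_list[OF *(2)]] by (simp add: placed_def)
          then show ?thesis by (simp only: span_zero)
        qed
      qed
    qed (auto intro: span_zero span_add span_inv[OF g H_closed])
  qed
  show "wt AA w \<subseteq> span TA (H w)"
  proof
    fix x assume "x \<in> wt AA w"
    then show "x \<in> span TA (H w)" unfolding wt_AA
      by (rule span_least) (use 1 in \<open>auto intro: span_zero span_add span_inv[OF g H_closed]\<close>)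
  qed
  have "H w \<subseteq> (\<Union>n. T_part B M (placed 0 B) Mw w n)"
  proof
    fix x assume "x \<in> H w"
    then obtain s vs qs where x: "x = MB.tg s vs" "s \<in> carrier B" "list_all2 (\<lambda>v q. v \<in> Mw q) vs qs" "sum_list qs = w"
      by (auto simp: H_def)
    then have "x \<in> T_part B M (placed 0 B) Mw w (length vs)"
      unfolding T_part_def by (intro span_incl CollectI exI[of _ s] exI[of _ vs] exI[of _ 0] exI[of _ qs]) (simp add: placed_def)
    then show "x \<in> (\<Union>n. T_part B M (placed 0 B) Mw w n)" by blast
  qed
  then show "span TA (H w) \<subseteq> wt AA w" unfolding wt_AA by (rule span_mono)
qed

lemma wt_TA: "x \<in> wt AA w \<Longrightarrow> x \<in> carrier TA"
  unfolding wt_H by (rule span_closed[OF grp_TA H_closed])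

lemma H_mult:
  assumes "x \<in> H p" "y \<in> H q"
  shows "x \<otimes>\<^bsub>TA\<^esub> y \<in> H (p + q)"
proof -
  from assms obtain s us ps t ws qs where x: "x = MB.tg s us" "s \<in> carrier B" "list_all2 (\<lambda>v q. v \<in> Mw q) us ps" "sum_list ps = p"
    and y: "y = MB.tg t ws" "t \<in> carrier B" "list_all2 (\<lambda>v q. v \<in> Mw q) ws qs" "sum_list qs = q"
    unfolding H_def by blast
  note us = Mw_list[OF x(3)] and ws = Mw_list[OF y(3)]
  have xy: "x \<otimes>\<^bsub>TA\<^esub> y = gcls (T_rels B M) (T_mult B M (s, us) (t, ws))"
    unfolding x(1) y(1) by (rule MB.mult_gcls) (use x(2) y(2) us ws in simp_all)
  show ?thesis
  proof (cases us rule: rev_cases)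
    case Nil
    then have "p = 0" using x(3,4) by simp
    then show ?thesis using Nil x(2) y unfolding xy H_def
      by (intro CollectI exI[of _ "s \<otimes>\<^bsub>B\<^esub> t"] exI[of _ ws] exI[of _ qs]) (simp add: T_mult_def)
  next
    case (snoc us' u)
    obtain ps' r where ps: "ps = ps' @ [r]" "list_all2 (\<lambda>v q. v \<in> Mw q) us' ps'" "u \<in> Mw r"
      using x(3) snoc by (auto simp: list_all2_append1 list_all2_Cons1)
    have "ract M u t \<in> Mw r"
      using ps(3) y(2) by (auto simp: dsum_wt_def M_closed M_ap E_rules)
    then have "list_all2 (\<lambda>v q. v \<in> Mw q) (us' @ ract M u t # ws) (ps' @ r # qs)"
      using ps(2) y(3) by (intro list_all2_appendI) simp_all
    then show ?thesis using snoc x(2,4) y(4) ps(1) unfolding xy H_def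
      by (intro CollectI exI[of _ s] exI[of _ "us' @ ract M u t # ws"] exI[of _ "ps' @ r # qs"]) (simp add: T_mult_def)
  qed
qed

lemma wt_AA_mult:
  assumes "x \<in> wt AA p" "y \<in> wt AA q"
  shows "x \<otimes>\<^bsub>TA\<^esub> y \<in> wt AA (p + q)"
proof -
  note g = grp_TA
  have 1: "u \<otimes>\<^bsub>TA\<^esub> y \<in> span TA (H (p + q))" if "u \<in> H p" for u
    by (rule addhom_span[OF g g MB.mult_lift(1)[OF subsetD[OF H_closed that]] H_closed _ H_closed])
      (use assms(2) that in \<open>auto simp: wt_H intro: span_incl H_mult\<close>)
  show ?thesis unfolding wt_H
    by (rule addhom_span[OF g g MB.mult_lift(2)[OF wt_TA[OF assms(2)]] H_closed[of p] 1 H_closed assms(1)[unfolded wt_H]])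
qed

lemma j_wt: "b \<in> carrier B \<Longrightarrow> j b \<in> wt AA 0"
  unfolding wt_H by (rule span_incl) (auto simp: H_def T_base_def intro!: exI[of _ b] exI[of _ "[]"])

lemma inc_wt: "v \<in> Mw q \<Longrightarrow> inc v \<in> wt AA q"
  unfolding wt_H by (rule span_incl) (auto simp: H_def T_incl_def intro!: exI[of _ "\<one>\<^bsub>B\<^esub>"] exI[of _ "[v]"] exI[of _ "[q]"])

text \<open>The span of the homogeneous elements is closed under products and contains B and every
  summand of M, hence all of T_B M.\<close>

lemma AA_span: "carrier TA = span TA (\<Union>p. wt AA p)"
proof
  note g = grp_TA
  let ?W = "\<Union>p. wt AA p"
  have W: "?W \<subseteq> carrier TA" using wt_TA by blast
  show "span TA ?W \<subseteq> carrier TA" by (rule subsetI) (rule span_closed[OF g W])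
  have mult: "x \<otimes>\<^bsub>TA\<^esub> y \<in> span TA ?W" if x: "x \<in> span TA ?W" and y: "y \<in> span TA ?W" for x y
  proof -
    have 1: "u \<otimes>\<^bsub>TA\<^esub> y \<in> span TA ?W" if u: "u \<in> ?W" for u
    proof (rule addhom_span[OF g g MB.mult_lift(1)[OF subsetD[OF W u]] W _ W y])
      fix v assume "v \<in> ?W"
      then show "u \<otimes>\<^bsub>TA\<^esub> v \<in> span TA ?W" using u wt_AA_mult by (intro span_incl) blast
    qed
    show ?thesis by (rule addhom_span[OF g g MB.mult_lift(2)[OF span_closed[OF g W y]] W 1 W x])
  qed
  show "carrier TA \<subseteq> span TA ?W"
  proof
    fix x assume "x \<in> carrier TA"
    then show "x \<in> span TA ?W"
    proof (induction rule: MB.TA_induct)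
      case (base s) then show ?case using j_wt by (intro span_incl) blast
    next
      case (incl v)
      then show ?case
      proof (induction rule: M_induct)
        case zero
        show ?case using addhom_zero[OF M_grp g MB.incl_addhom] by (simp add: span_zero)
      next
        case (add x y) then show ?case by (simp add: addhom_add[OF MB.incl_addhom] span_add)
      next
        case (inE i e) then show ?case using inc_wt[OF inE_wt[OF inE]] by (intro span_incl) blast
      qed
    next
      case (mult x y) then show ?case using \<open>\<And>x y. x \<in> span TA ?W \<Longrightarrow> y \<in> span TA ?W \<Longrightarrow> x \<otimes>\<^bsub>TA\<^esub> y \<in> span TA ?W\<close> by simp
    next
      case (diff x y) then show ?case unfolding a_minus_def by (intro span_add span_inv[OF g W])
    qed
  qed
qed

definition msgn :: "(nat \<Rightarrow> 'e) \<Rightarrow> nat \<Rightarrow> 'e" where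
  "msgn m = (\<lambda>k\<in>{1..N}. if even k then m k else \<ominus>\<^bsub>E k\<^esub> m k)"

lemma msgn_ap: "k \<in> {1..N} \<Longrightarrow> msgn m k = (if even k then m k else \<ominus>\<^bsub>E k\<^esub> m k)"
  by (simp add: msgn_def)

lemma msgn_closed: "m \<in> carrier M \<Longrightarrow> msgn m \<in> carrier M"
  using M_app by (auto simp: msgn_def M_simps PiE_iff intro!: abelian_group.a_inv_closed[OF E_grp])

lemma M_inv_ap: "m \<in> carrier M \<Longrightarrow> k \<in> {1..N} \<Longrightarrow> (\<ominus>\<^bsub>M\<^esub> m) k = \<ominus>\<^bsub>E k\<^esub> m k"
proof -
  assume m: "m \<in> carrier M" and k: "k \<in> {1..N}"
  have h: "(\<lambda>m. m k) \<in> addhom M (E k)" by (rule addhomI) (use k in \<open>simp_all add: M_app M_ap\<close>)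
  show ?thesis by (rule addhom_inv[OF M_grp E_grp[OF k] h m])
qed

lemma msgn_hom: "msgn \<in> addhom M M"
  by (rule addhomI[OF msgn_closed], assumption, rule M_eqI)
    (auto simp: msgn_closed M_closed M_ap msgn_ap abelian_group.minus_add[OF E_grp] M_app)

lemma msgn_act:
  assumes "b \<in> carrier B" "m \<in> carrier M"
  shows "msgn (lact M b m) = lact M b (msgn m)" "msgn (ract M m b) = ract M (msgn m) b"
proof -
  have n: "lact (E k) b (\<ominus>\<^bsub>E k\<^esub> m k) = \<ominus>\<^bsub>E k\<^esub> lact (E k) b (m k)" "ract (E k) (\<ominus>\<^bsub>E k\<^esub> m k) b = \<ominus>\<^bsub>E k\<^esub> ract (E k) (m k) b"
    if k: "k \<in> {1..N}" for k
    using addhom_inv[OF E_grp[OF k] E_grp[OF k] biact.l_hom[OF E_biact[OF k] assms(1)] M_app[OF assms(2) k]]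
      addhom_inv[OF E_grp[OF k] E_grp[OF k] biact.r_hom[OF E_biact[OF k] assms(1)] M_app[OF assms(2) k]] by simp_all
  show "msgn (lact M b m) = lact M b (msgn m)" "msgn (ract M m b) = ract M (msgn m) b"
    by (rule M_eqI; simp add: assms msgn_closed M_closed M_ap msgn_ap n)+
qed

lemma msgn_wt: "m \<in> Mw q \<Longrightarrow> msgn m = ksgn M q m"
proof (rule M_eqI)
  assume m: "m \<in> Mw q"
  note mc = Mw_M[OF m]
  show "msgn m \<in> carrier M" "ksgn M q m \<in> carrier M"
    using mc abelian_group.a_inv_closed[OF M_grp] by (simp_all add: msgn_closed ksgn_def)
  fix k assume k: "k \<in> {1..N}"
  have z: "\<ominus>\<^bsub>E k\<^esub> \<zero>\<^bsub>E k\<^esub> = \<zero>\<^bsub>E k\<^esub>" using addhom_zero[OF E_grp[OF k] E_grp[OF k] addhom_neg[OF E_grp[OF k] addhom_id]] .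
  show "msgn m k = ksgn M q m k"
  proof (cases "int k = q")
    case True
    then have "even q = even k" by auto
    then show ?thesis using k mc by (simp add: msgn_ap ksgn_def M_inv_ap)
  next
    case False
    then have "m k = \<zero>\<^bsub>E k\<^esub>" using m k by (simp add: dsum_wt_def)
    then show ?thesis using k mc z by (simp add: msgn_ap ksgn_def M_inv_ap)
  qed
qed

text \<open>The sign on the k-th summand of M commutes with the actions of B, so it induces a ring
  endomorphism of T_B M that fixes B. This is the sign automorphism required by
  \<open>superalg\<close>.\<close>

lemma sigma_ex: "\<exists>\<sigma>. \<sigma> \<in> ring_hom TA TA \<and> (\<forall>s\<in>carrier B. \<sigma> (j s) = j s) \<and> (\<forall>v\<in>carrier M. \<sigma> (inc v) = inc (msgn v))"
  by (rule MB.T_universal[OF MB.TR.ring_axioms MB.base_ring_hom addhom_comp[OF msgn_hom MB.incl_addhom]])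
    (simp_all add: msgn_act MB.incl_lact MB.incl_ract msgn_closed)

definition sig where "sig = (SOME \<sigma>. \<sigma> \<in> ring_hom TA TA \<and> (\<forall>s\<in>carrier B. \<sigma> (j s) = j s) \<and> (\<forall>v\<in>carrier M. \<sigma> (inc v) = inc (msgn v)))"

lemma sig: "sig \<in> ring_hom TA TA" "s \<in> carrier B \<Longrightarrow> sig (j s) = j s" "v \<in> carrier M \<Longrightarrow> sig (inc v) = inc (msgn v)"
  using someI_ex[OF sigma_ex, folded sig_def] by auto

lemma sig_addhom: "sig \<in> addhom TA TA"
  by (rule addhomI) (simp_all add: ring_hom_closed[OF sig(1)] ring_hom_add[OF sig(1)])

lemma sig_sig: "x \<in> carrier TA \<Longrightarrow> sig (sig x) = x"
proof (induction rule: MB.TA_induct)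
  case (incl v)
  have "msgn (msgn v) = v"
    by (rule M_eqI) (use incl in \<open>auto simp: msgn_closed msgn_ap abelian_group.minus_minus[OF E_grp] M_app\<close>)
  then show ?case using incl by (simp add: sig msgn_closed)
next
  case (mult x y) then show ?case by (simp add: ring_hom_mult[OF sig(1)] ring_hom_closed[OF sig(1)])
next
  case (diff x y) then show ?case
    using addhom_minus[OF grp_TA grp_TA sig_addhom] ring_hom_closed[OF sig(1)] by simp
qed (simp add: sig)

lemma ksgn_addhom: "abelian_group V \<Longrightarrow> ksgn V q \<in> addhom V V"
proof (cases "even q")
  case True then show ?thesis using addhom_id by (simp add: ksgn_def[abs_def])
next
  case False
  assume "abelian_group V"
  then show ?thesis using False addhom_neg[OF _ addhom_id, of V] by (simp add: ksgn_def[abs_def])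
qed

lemma sig_H: "s \<in> carrier B \<Longrightarrow> list_all2 (\<lambda>v q. v \<in> Mw q) vs qs \<Longrightarrow> sig (MB.tg s vs) = ksgn TA (sum_list qs) (MB.tg s vs)"
proof (induction vs arbitrary: qs rule: rev_induct)
  case Nil then show ?case using sig(2)[of s] by (simp add: ksgn_def T_base_def)
next
  case (snoc v vs)
  obtain ps r where q: "qs = ps @ [r]" "list_all2 (\<lambda>v q. v \<in> Mw q) vs ps" "v \<in> Mw r"
    using snoc.prems(2) by (auto simp: list_all2_append1 list_all2_Cons1)
  note vs = Mw_list[OF q(2)] and v = Mw_M[OF q(3)]
  have c: "MB.tg s vs \<in> carrier TA" "inc v \<in> carrier TA" using snoc.prems(1) vs v by simp_all
  have "inc (ksgn M r v) = ksgn TA r (inc v)"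
    using addhom_inv[OF M_grp grp_TA MB.incl_addhom v] by (simp add: ksgn_def)
  then have "sig (MB.tg s (vs @ [v])) = ksgn TA (sum_list ps) (MB.tg s vs) \<otimes>\<^bsub>TA\<^esub> ksgn TA r (inc v)"
    using snoc.IH[OF snoc.prems(1) q(2)] sig(3)[OF v] msgn_wt[OF q(3)] c
    by (simp only: MB.tg_snoc[OF snoc.prems(1) vs v] ring_hom_mult[OF sig(1)])
  also have "\<dots> = ksgn TA (sum_list qs) (MB.tg s vs \<otimes>\<^bsub>TA\<^esub> inc v)"
    using c q(1) by (simp add: ksgn_def MB.TR.l_minus MB.TR.r_minus)
  finally show ?case by (simp only: MB.tg_snoc[OF snoc.prems(1) vs v])
qed

lemma sig_wt: "x \<in> wt AA p \<Longrightarrow> sig x = ksgn TA p x"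
proof -
  assume x: "x \<in> wt AA p"
  note g = grp_TA
  have "sig y = ksgn TA p y" if "y \<in> H p" for y using that sig_H by (auto simp: H_def)
  then show ?thesis
    by (rule addhom_eq_on_span[OF g g sig_addhom ksgn_addhom[OF g] H_closed]) (use x in \<open>simp_all add: wt_H\<close>)
qed

lemma superalg_AA: "superalg K R AA sig h"
proof (intro superalg.intro superalg_axioms.intro kalg_AA)
  note g = grp_TA
  show "carrier AA = span AA (\<Union>p. wt AA p)"
    using AA_span span_cong[of AA TA] by simp
  show "sig \<in> ring_hom AA AA" using sig(1) by (simp add: ring_hom_def)
  show "h \<in> carrier K" by (rule h_in_K)
  show "kmap R AA h \<oplus>\<^bsub>AA\<^esub> kmap R AA h = \<one>\<^bsub>AA\<^esub>"
    using h_in_K h_half_B ring_hom_add[OF MB.base_ring_hom, of "kmap R B h" "kmap R B h"] ring_hom_one[OF MB.base_ring_hom]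
    by (simp add: kmap_AA)
  show "\<zero>\<^bsub>AA\<^esub> \<in> wt AA p" for p by (simp add: wt_H span_zero)
  show "a \<oplus>\<^bsub>AA\<^esub> b \<in> wt AA p" if "a \<in> wt AA p" "b \<in> wt AA p" for a b p using that by (simp add: wt_H span_add)
  show "\<ominus>\<^bsub>AA\<^esub> a \<in> wt AA p" if "a \<in> wt AA p" for a p using that by (simp add: wt_H span_inv[OF g H_closed])
  show "umap AA t \<in> wt AA 0" if "t \<in> carrier R" for t using that by (simp add: umap_TA j_wt)
  show "sig a = ksgn AA p a" if "a \<in> wt AA p" for a p using sig_wt[OF that] by (simp add: ksgn_def)
qed (simp_all add: wt_TA wt_AA_mult sig_sig)

end

locale bisym = tbm K R B h N E
  for K :: "('k, 'x) ring_scheme" and R :: "('k, 'r, 'y) alg_scheme" and B :: "('r, 'b) alg" and h :: 'k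
    and N :: nat and E :: "nat \<Rightarrow> ('b, 'e) bimod" +
  assumes smooth_B: "smooth K R B" and N_pos: "N > 0"
    and E_fg: "\<And>i. i \<in> {1..N} \<Longrightarrow> fin_gen_bimod B (E i)"
    and E_proj: "\<And>i. i \<in> {1..N} \<Longrightarrow> projective_bimod K R B (E i)"
begin

sublocale P: pairalg K R B h "TBM B N E" sig "TBM_base B N E"
proof (intro pairalg.intro pairalg_axioms.intro)
  show "base_alg K R B h" by (rule base_alg_axioms)
  show "superalg K R AA sig h" by (rule superalg_AA)
  show "j \<in> ring_hom B AA" using MB.base_ring_hom by (simp add: ring_hom_def)
  show "\<And>b. b \<in> carrier B \<Longrightarrow> j b \<in> wt AA 0" by (rule j_wt)
  show "\<And>t. t \<in> carrier R \<Longrightarrow> j (umap B t) = umap AA t" by (simp add: umap_TA)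
  show "smooth K R B" by (rule smooth_B)
qed

section \<open>Vanishing in low weights\<close>

lemma Mw_pos: "v \<in> Mw q \<Longrightarrow> v = \<zero>\<^bsub>M\<^esub> \<or> q \<ge> 1"
proof (rule disjCI)
  assume v: "v \<in> Mw q" and q: "\<not> q \<ge> 1"
  show "v = \<zero>\<^bsub>M\<^esub>"
    by (rule M_eqI[OF Mw_M[OF v] M_closed(1)]) (use v q in \<open>auto simp: M_ap dsum_wt_def\<close>)
qed

lemma Mw_list_pos: "list_all2 (\<lambda>v q. v \<in> Mw q) vs qs \<Longrightarrow> \<zero>\<^bsub>M\<^esub> \<in> set vs \<or> int (length vs) \<le> sum_list qs"
proof (induction rule: list_all2_induct)
  case (Cons x xs y ys) then show ?case using Mw_pos[of x y] by auto
qed simp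

text \<open>A word with a zero letter vanishes, and otherwise each letter contributes at least 1 to
  the weight because M starts in weight 1. In weight 0 only the empty word is left. Both the
  vanishing of A in negative weights and its being B in weight 0 follow.\<close>

lemma H_cases:
  assumes x: "x \<in> H w"
  shows "x = \<zero>\<^bsub>TA\<^esub> \<or> w > 0 \<or> (w = 0 \<and> x \<in> j ` carrier B)"
proof -
  from x obtain s vs qs where x: "x = MB.tg s vs" "s \<in> carrier B" "list_all2 (\<lambda>v q. v \<in> Mw q) vs qs" "sum_list qs = w"
    unfolding H_def by blast
  show ?thesis
  proof (cases "\<zero>\<^bsub>M\<^esub> \<in> set vs")
    case True
    then obtain us ws where "vs = us @ \<zero>\<^bsub>M\<^esub> # ws" by (meson split_list)
    then show ?thesis using x Mw_list[OF x(3)] tg_zero_list[of s us ws] by simp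
  next
    case False
    then have l: "int (length vs) \<le> w" using Mw_list_pos[OF x(3)] x(4) by simp
    show ?thesis
    proof (cases vs)
      case Nil
      then have "w = 0" using x(3,4) by simp
      then show ?thesis using Nil x by (auto simp: T_base_def)
    next
      case Cons then show ?thesis using l by simp
    qed
  qed
qed

lemma wt_neg:
  assumes "x \<in> wt AA w" "w < 0"
  shows "x = \<zero>\<^bsub>TA\<^esub>"
  by (rule span_trivial[OF grp_TA assms(1)[unfolded wt_H]]) (use H_cases assms(2) in force)

lemma wt_0:
  assumes "x \<in> wt AA 0"
  obtains b where "b \<in> carrier B" "x = j b"
proof -
  have j0: "\<zero>\<^bsub>TA\<^esub> = j \<zero>\<^bsub>B\<^esub>" by (rule ring_hom_zero[OF MB.base_ring_hom A.ring_axioms MB.TR.ring_axioms, symmetric])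
  have H0: "x \<in> j ` carrier B" if "x \<in> H 0" for x
    using H_cases[OF that] j0 by auto
  have jh: "j \<in> addhom B TA" by (rule addhomI) (simp_all add: ring_hom_add[OF MB.base_ring_hom])
  have "x \<in> j ` carrier B"
    by (rule span_image[OF A.abelian_group_axioms grp_TA jh _ _ _ _ _ assms[unfolded wt_H]]) (use H0 in auto)
  then show thesis using that by blast
qed

abbreviation TT where "TT \<equiv> tens K R AA"
abbreviation TW where "TW \<equiv> tens_wt K R AA"

lemmas grp_TT = P.A.grp_T

text \<open>If two weights have a negative sum, one of them is negative and that tensor factor is
  zero.\<close>

lemma TW_neg:
  assumes t: "t \<in> TW n" and n: "n < 0"
  shows "t = \<zero>\<^bsub>TT\<^esub>"
proof -
  have g: "x = \<zero>\<^bsub>TT\<^esub>" if x: "x \<in> {P.A.pt u v |u v p q. u \<in> wt AA p \<and> v \<in> wt AA q \<and> p + q = n}" for x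
  proof -
    from x obtain u v p q where u: "x = P.A.pt u v" "u \<in> wt AA p" "v \<in> wt AA q" "p + q = n" by blast
    have "p < 0 \<or> q < 0" using u(4) n by linarith
    then show ?thesis
    proof
      assume "p < 0"
      then show ?thesis using wt_neg[OF u(2)] P.A.pt_zero(1)[of v] P.A.wt_carrier[OF u(3)] u(1) by simp
    next
      assume "q < 0"
      then show ?thesis using wt_neg[OF u(3)] P.A.pt_zero(2)[of u] P.A.wt_carrier[OF u(2)] u(1) by simp
    qed
  qed
  show ?thesis by (rule span_trivial[OF grp_TT t[unfolded tens_wt_def] g])
qed

context
  fixes V :: "('b, 'm, 'w) bimod_scheme"
  assumes V: "biact B V (lact V) (ract V)"
begin

interpretation V: biact B V "lact V" "ract V" by (rule V)

lemma ind_V: "induced AA B V j"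
  by (intro induced.intro induced_axioms.intro V P.j_hom P.A.A.ring_axioms)

interpretation I: induced AA B V j by (rule ind_V)

text \<open>A bimodule V placed in weight n. The lemmas are applied to the double derivations of B
  with n = 0 and to E_N with n = N, the two ends of the induced isomorphism.\<close>

abbreviation VW where "VW n \<equiv> ind_wt AA j B V (placed n V)"

lemma VW_gens: "{I.pi3 a v c |a v c p q r. a \<in> wt AA p \<and> v \<in> placed n V q \<and> c \<in> wt AA r \<and> p + q + r = w} \<subseteq> carrier (ind AA j B V)"
  by (auto simp: placed_def P.A.wt_carrier wt_TA split: if_splits)

lemma VW_incl: "\<lbrakk>a \<in> wt AA p; v \<in> carrier V; c \<in> wt AA r\<rbrakk> \<Longrightarrow> I.pi3 a v c \<in> VW n (p + n + r)"
  unfolding ind_wt_def by (rule span_incl) (force simp: placed_def)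

lemma pi3_zero:
  assumes "a \<in> carrier AA" "v \<in> carrier V" "c \<in> carrier AA"
  shows "I.pi3 \<zero>\<^bsub>AA\<^esub> v c = \<zero>\<^bsub>ind AA j B V\<^esub>" "I.pi3 a \<zero>\<^bsub>V\<^esub> c = \<zero>\<^bsub>ind AA j B V\<^esub>" "I.pi3 a v \<zero>\<^bsub>AA\<^esub> = \<zero>\<^bsub>ind AA j B V\<^esub>"
proof -
  have 1: "(\<lambda>a. I.pi3 a v c) \<in> addhom AA (ind AA j B V)" by (rule addhomI) (use assms in \<open>simp_all only: I.pi3_rules I.pi3_closed\<close>)
  have 2: "(\<lambda>v. I.pi3 a v c) \<in> addhom V (ind AA j B V)" by (rule addhomI) (use assms in \<open>simp_all only: I.pi3_rules I.pi3_closed\<close>)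
  have 3: "(\<lambda>c. I.pi3 a v c) \<in> addhom AA (ind AA j B V)" by (rule addhomI) (use assms in \<open>simp_all only: I.pi3_rules I.pi3_closed\<close>)
  note gA = P.A.grp_A and gI = I.I.abelian_group_axioms
  show "I.pi3 \<zero>\<^bsub>AA\<^esub> v c = \<zero>\<^bsub>ind AA j B V\<^esub>" by (rule addhom_zero[OF gA gI 1])
  show "I.pi3 a \<zero>\<^bsub>V\<^esub> c = \<zero>\<^bsub>ind AA j B V\<^esub>" by (rule addhom_zero[OF V.grp_V gI 2])
  show "I.pi3 a v \<zero>\<^bsub>AA\<^esub> = \<zero>\<^bsub>ind AA j B V\<^esub>" by (rule addhom_zero[OF gA gI 3])
qed

text \<open>The lowest weight of A (x)_B V (x)_B A is n. There both outer factors have weight 0, so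
  they come from B and are absorbed into the middle.\<close>

lemma VW_gen_cases:
  assumes x: "x \<in> {I.pi3 a v c |a v c p q r. a \<in> wt AA p \<and> v \<in> placed n V q \<and> c \<in> wt AA r \<and> p + q + r = w}" and w: "w \<le> n"
  shows "x = \<zero>\<^bsub>ind AA j B V\<^esub> \<or> w = n \<and> (\<exists>v\<in>carrier V. x = I.pi3 \<one>\<^bsub>AA\<^esub> v \<one>\<^bsub>AA\<^esub>)"
proof -
  from x obtain a v c p q r where x: "x = I.pi3 a v c" and a: "a \<in> wt AA p" and v: "v \<in> placed n V q" and c: "c \<in> wt AA r"
    and pqr: "p + q + r = w" by blast
  note ac = P.A.wt_carrier[OF a] and cc = P.A.wt_carrier[OF c]
  have vc: "v \<in> carrier V" using v by (auto simp: placed_def split: if_splits)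
  show ?thesis
  proof (cases "q = n \<and> p \<ge> 0 \<and> r \<ge> 0")
    case True
    then have "p = 0" "r = 0" "w = n" using pqr w by auto
    obtain b where b: "b \<in> carrier B" "a = j b" using wt_0 a \<open>p = 0\<close> by blast
    obtain b' where b': "b' \<in> carrier B" "c = j b'" using wt_0 c \<open>r = 0\<close> by blast
    have "x = I.pi3 (\<one>\<^bsub>AA\<^esub> \<otimes>\<^bsub>AA\<^esub> j b) v (j b' \<otimes>\<^bsub>AA\<^esub> \<one>\<^bsub>AA\<^esub>)"
      unfolding x b(2) b'(2) using b(1) b'(1) by simp
    also have "\<dots> = I.pi3 \<one>\<^bsub>AA\<^esub> (lact V b v) (j b' \<otimes>\<^bsub>AA\<^esub> \<one>\<^bsub>AA\<^esub>)"
      by (rule I.pi3_rules(4)) (use b b' vc in simp_all)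
    also have "\<dots> = I.pi3 \<one>\<^bsub>AA\<^esub> (ract V (lact V b v) b') \<one>\<^bsub>AA\<^esub>"
      by (rule I.pi3_rules(5)[symmetric]) (use b b' vc in simp_all)
    finally show ?thesis using \<open>w = n\<close> b b' vc by (intro disjI2 conjI bexI[of _ "ract V (lact V b v) b'"]) simp_all
  next
    case False
    then consider "q \<noteq> n" | "p < 0" | "r < 0" by linarith
    then have "x = \<zero>\<^bsub>ind AA j B V\<^esub>"
    proof cases
      case 1
      then have "v = \<zero>\<^bsub>V\<^esub>" using v by (simp add: placed_def)
      then show ?thesis unfolding x using pi3_zero(2)[OF ac vc cc] by simp
    next
      case 2
      then have "a = \<zero>\<^bsub>AA\<^esub>" using wt_neg[OF a] by simp
      then show ?thesis unfolding x using pi3_zero(1)[OF ac vc cc] by simp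
    next
      case 3
      then have "c = \<zero>\<^bsub>AA\<^esub>" using wt_neg[OF c] by simp
      then show ?thesis unfolding x using pi3_zero(3)[OF ac vc cc] by simp
    qed
    then show ?thesis ..
  qed
qed

lemma VW_low:
  assumes x: "x \<in> VW n w" and w: "w < n"
  shows "x = \<zero>\<^bsub>ind AA j B V\<^esub>"
  by (rule span_trivial[OF I.I.abelian_group_axioms x[unfolded ind_wt_def]]) (use VW_gen_cases w in force)

lemma one_embed_hom: "(\<lambda>v. I.pi3 \<one>\<^bsub>AA\<^esub> v \<one>\<^bsub>AA\<^esub>) \<in> addhom V (ind AA j B V)"
  by (rule addhomI) (simp_all only: I.pi3_rules I.pi3_closed P.A.A.one_closed)

text \<open>Surjectivity is the description of the lowest weight. For injectivity the embedding gets
  a left inverse that sends a (x) v (x) c to p(a) v p(c), where p is the augmentation of T_B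
  M.\<close>

lemma VW_bij: "bij_betw (\<lambda>v. I.pi3 \<one>\<^bsub>AA\<^esub> v \<one>\<^bsub>AA\<^esub>) (carrier V) (VW n n)"
proof (rule bij_betwI')
  note gV = V.grp_V
  \<comment> \<open>The augmentation: the identity on B and zero on M.\<close>
  have "\<exists>p. p \<in> ring_hom TA B \<and> (\<forall>s\<in>carrier B. p (j s) = s) \<and> (\<forall>v\<in>carrier M. p (inc v) = \<zero>\<^bsub>B\<^esub>)"
    by (rule MB.T_universal[OF A.ring_axioms _ addhom_const_zero[OF A.abelian_group_axioms]])
      (auto intro!: ring_hom_memI)
  then obtain p where p: "p \<in> ring_hom TA B" "\<forall>s\<in>carrier B. p (j s) = s" by blast
  have pc: "p a \<in> carrier B" if "a \<in> carrier AA" for a using ring_hom_closed[OF p(1)] that by simp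
  have "\<exists>L. L \<in> addhom (ind AA j B V) V \<and> (\<forall>a\<in>carrier AA. \<forall>v\<in>carrier V. \<forall>c\<in>carrier AA. L (I.pi3 a v c) = lact V (p a) (ract V v (p c)))"
    by (rule I.ind_lift[OF gV])
      (use pc ring_hom_add[OF p(1)] ring_hom_mult[OF p(1)] p(2) in \<open>simp_all add: V.l_plus V.r_plus V.l_add V.r_add V.l_mult V.r_mult V.lr_assoc\<close>)
  then obtain L where L: "\<forall>a\<in>carrier AA. \<forall>v\<in>carrier V. \<forall>c\<in>carrier AA. L (I.pi3 a v c) = lact V (p a) (ract V v (p c))" by blast
  have L1: "L (I.pi3 \<one>\<^bsub>AA\<^esub> v \<one>\<^bsub>AA\<^esub>) = v" if "v \<in> carrier V" for v
  proof -
    have "L (I.pi3 \<one>\<^bsub>AA\<^esub> v \<one>\<^bsub>AA\<^esub>) = lact V (p \<one>\<^bsub>AA\<^esub>) (ract V v (p \<one>\<^bsub>AA\<^esub>))"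
      using L that P.A.A.one_closed by blast
    then show ?thesis using that ring_hom_one[OF p(1)] by simp
  qed
  fix v w assume v: "v \<in> carrier V" and w: "w \<in> carrier V"
  show "(I.pi3 \<one>\<^bsub>AA\<^esub> v \<one>\<^bsub>AA\<^esub> = I.pi3 \<one>\<^bsub>AA\<^esub> w \<one>\<^bsub>AA\<^esub>) = (v = w)"
    using L1[OF v] L1[OF w] by metis
next
  fix v assume "v \<in> carrier V"
  then show "I.pi3 \<one>\<^bsub>AA\<^esub> v \<one>\<^bsub>AA\<^esub> \<in> VW n n"
    using VW_incl[of "\<one>\<^bsub>AA\<^esub>" 0 v "\<one>\<^bsub>AA\<^esub>" 0 n] j_wt[OF A.one_closed] ring_hom_one[OF MB.base_ring_hom] by simp
next
  note gV = V.grp_V and gI = I.I.abelian_group_axioms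
  note eh = one_embed_hom
  fix x assume x: "x \<in> VW n n"
  have g: "\<exists>v\<in>carrier V. x = I.pi3 \<one>\<^bsub>AA\<^esub> v \<one>\<^bsub>AA\<^esub>"
    if "x \<in> {I.pi3 a v c |a v c p q r. a \<in> wt AA p \<and> v \<in> placed n V q \<and> c \<in> wt AA r \<and> p + q + r = n}" for x
    using VW_gen_cases[OF that] addhom_zero[OF gV gI eh] V.V.zero_closed by force
  have "x \<in> (\<lambda>v. I.pi3 \<one>\<^bsub>AA\<^esub> v \<one>\<^bsub>AA\<^esub>) ` carrier V"
    by (rule span_image[OF gV gI eh _ _ _ _ _ x[unfolded ind_wt_def]]) (rule subset_refl V.V.zero_closed V.V.a_closed V.V.a_inv_closed | assumption | (rule subsetI, drule g, blast))+
  then show "\<exists>v\<in>carrier V. x = I.pi3 \<one>\<^bsub>AA\<^esub> v \<one>\<^bsub>AA\<^esub>" by blast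
qed

end

section \<open>Derivations of \<open>T\<^sub>B M\<close>\<close>

lemma biact_TA: "biact AA W l r \<Longrightarrow> biact TA W l r"
  using MB.TR.ring_axioms unfolding biact_def by simp

text \<open>\<open>S\<close> is any grading of the target that is compatible with the two actions.\<close>

lemma derivation_wt:
  assumes dd: "dd \<in> addhom TA W" and W: "abelian_group W"
    and leib: "\<And>x y. x \<in> carrier TA \<Longrightarrow> y \<in> carrier TA \<Longrightarrow> dd (x \<otimes>\<^bsub>TA\<^esub> y) = r (dd x) y \<oplus>\<^bsub>W\<^esub> l x (dd y)"
    and S0: "\<And>p. \<zero>\<^bsub>W\<^esub> \<in> S p" and Sa: "\<And>p x y. x \<in> S p \<Longrightarrow> y \<in> S p \<Longrightarrow> x \<oplus>\<^bsub>W\<^esub> y \<in> S p"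
    and Si: "\<And>p x. x \<in> S p \<Longrightarrow> \<ominus>\<^bsub>W\<^esub> x \<in> S p"
    and Sr: "\<And>p q w y. w \<in> S p \<Longrightarrow> y \<in> wt AA q \<Longrightarrow> r w y \<in> S (p + q)"
    and Sl: "\<And>p q w x. x \<in> wt AA p \<Longrightarrow> w \<in> S q \<Longrightarrow> l x w \<in> S (p + q)"
    and Sb: "\<And>b. b \<in> carrier B \<Longrightarrow> dd (j b) \<in> S 0" and Sm: "\<And>q m. m \<in> Mw q \<Longrightarrow> dd (inc m) \<in> S q"
    and x: "x \<in> wt AA p"
  shows "dd x \<in> S p"
proof -
  note gT = grp_TA
  have tg: "dd (MB.tg s vs) \<in> S (sum_list qs) \<and> MB.tg s vs \<in> wt AA (sum_list qs)"
    if "s \<in> carrier B" "list_all2 (\<lambda>v q. v \<in> Mw q) vs qs" for s vs qs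
    using that
  proof (induction vs arbitrary: qs rule: rev_induct)
    case Nil then show ?case using Sb[of s] j_wt[of s] by (simp add: T_base_def)
  next
    case (snoc v vs)
    obtain ps q where q: "qs = ps @ [q]" "list_all2 (\<lambda>v q. v \<in> Mw q) vs ps" "v \<in> Mw q"
      using snoc.prems(2) by (auto simp: list_all2_append1 list_all2_Cons1)
    note vs = Mw_list[OF q(2)] and v = Mw_M[OF q(3)]
    from snoc.IH[OF snoc.prems(1) q(2)] have IH: "dd (MB.tg s vs) \<in> S (sum_list ps)" "MB.tg s vs \<in> wt AA (sum_list ps)" by auto
    have e: "MB.tg s (vs @ [v]) = MB.tg s vs \<otimes>\<^bsub>TA\<^esub> inc v" by (rule MB.tg_snoc[OF snoc.prems(1) vs v])
    have "dd (MB.tg s (vs @ [v])) = r (dd (MB.tg s vs)) (inc v) \<oplus>\<^bsub>W\<^esub> l (MB.tg s vs) (dd (inc v))"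
      unfolding e by (rule leib[OF wt_TA[OF IH(2)] MB.incl_closed[OF v]])
    moreover have "\<dots> \<in> S (sum_list ps + q)"
      by (rule Sa[OF Sr[OF IH(1) inc_wt[OF q(3)]] Sl[OF IH(2) Sm[OF q(3)]]])
    moreover have "MB.tg s (vs @ [v]) \<in> wt AA (sum_list ps + q)"
      unfolding e by (rule wt_AA_mult[OF IH(2) inc_wt[OF q(3)]])
    ultimately show ?case using q(1) by simp
  qed
  have g: "dd y \<in> S p" if "y \<in> H p" for y using that tg by (auto simp: H_def)
  from x show ?thesis unfolding wt_H
  proof (induction rule: span_induct)
    case zero show ?case using addhom_zero[OF gT W dd] S0 by simp
  next
    case (incl y) then show ?case by (rule g)
  next
    case (inv y) show ?case using addhom_inv[OF gT W dd subsetD[OF H_closed inv]] Si[OF g[OF inv]] by simp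
  next
    case (add y z)
    note c = span_closed[OF gT H_closed]
    show ?case using addhom_add[OF dd c[OF add.hyps(1)] c[OF add.hyps(2)]] Sa[OF add.IH] by simp
  qed
qed

abbreviation DD where "DD \<equiv> DDer K R AA"
abbreviation DW where "DW \<equiv> DDer_wt K R AA"
abbreviation sg where "sg \<equiv> P.A.sg"

text \<open>A double derivation of weight n is an ordinary derivation once the left action is
  twisted by \<open>sg n\<close>. The twisted action is again a bimodule structure because
  \<open>sg n\<close> is a ring homomorphism, so \<open>derivation_extends\<close> applies.\<close>

lemma DW_lift:
  assumes \<delta>: "P.derT \<delta>" and \<delta>w: "\<And>b. b \<in> carrier B \<Longrightarrow> \<delta> b \<in> TW n" and \<mu>: "\<mu> \<in> addhom M TT"
    and \<mu>w: "\<And>q m. m \<in> Mw q \<Longrightarrow> \<mu> m \<in> TW (q + n)"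
    and \<mu>l: "\<And>b m. b \<in> carrier B \<Longrightarrow> m \<in> carrier M \<Longrightarrow> \<mu> (lact M b m) = ract TT (\<delta> b) (inc m) \<oplus>\<^bsub>TT\<^esub> lact TT (j b) (\<mu> m)"
    and \<mu>r: "\<And>b m. b \<in> carrier B \<Longrightarrow> m \<in> carrier M \<Longrightarrow> \<mu> (ract M m b) = ract TT (\<mu> m) (j b) \<oplus>\<^bsub>TT\<^esub> lact TT (sg n (inc m)) (\<delta> b)"
  shows "\<exists>\<Theta>\<in>DW n. (\<forall>b\<in>carrier B. \<Theta> (j b) = \<delta> b) \<and> (\<forall>m\<in>carrier M. \<Theta> (inc m) = \<mu> m)"
proof -
  let ?l = "\<lambda>a. lact TT (sg n a)"
  have sgc: "sg n a \<in> carrier AA" if "a \<in> carrier AA" for a by (rule P.A.sg_closed[OF that])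
  have "biact AA TT ?l (ract TT)"
    by (rule biact.intro[OF P.A.A.ring_axioms grp_TT])
      (use sgc in \<open>simp_all only: P.A.TB.l_closed P.A.TB.r_closed P.A.TB.l_add P.A.TB.r_add P.A.TB.l_plus P.A.TB.r_plus P.A.TB.l_mult P.A.TB.r_mult
        P.A.TB.lr_assoc P.A.TB.r_one P.A.TB.l_one P.A.sg_add P.A.sg_mult P.A.sg_one\<close>)
  then have W: "biact TA TT ?l (ract TT)" by (rule biact_TA)
  have d: "\<delta> \<in> addhom B TT" "\<And>x y. x \<in> carrier B \<Longrightarrow> y \<in> carrier B \<Longrightarrow> \<delta> (x \<otimes>\<^bsub>B\<^esub> y) = ract TT (\<delta> x) (j y) \<oplus>\<^bsub>TT\<^esub> lact TT (sg n (j x)) (\<delta> y)"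
    "\<And>t. t \<in> carrier R \<Longrightarrow> \<delta> (umap B t) = \<zero>\<^bsub>TT\<^esub>"
    using \<delta> by (simp_all add: P.derT_def)
  have ml: "\<mu> (lact M b m) = ract TT (\<delta> b) (inc m) \<oplus>\<^bsub>TT\<^esub> lact TT (sg n (j b)) (\<mu> m)" if "b \<in> carrier B" "m \<in> carrier M" for b m
    using \<mu>l[OF that] that by simp
  have "\<exists>F. F \<in> addhom TA TT \<and> (\<forall>x\<in>carrier TA. \<forall>y\<in>carrier TA. F (x \<otimes>\<^bsub>TA\<^esub> y) = ract TT (F x) y \<oplus>\<^bsub>TT\<^esub> lact TT (sg n x) (F y)) \<and>
    (\<forall>s\<in>carrier B. F (j s) = \<delta> s) \<and> (\<forall>v\<in>carrier M. F (inc v) = \<mu> v)"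
    by (rule MB.derivation_extends[OF W d(1) \<mu>]) (rule d(2) ml \<mu>r; assumption)+
  then obtain \<Theta> where \<Theta>: "\<Theta> \<in> addhom TA TT" "\<forall>x\<in>carrier TA. \<forall>y\<in>carrier TA. \<Theta> (x \<otimes>\<^bsub>TA\<^esub> y) = ract TT (\<Theta> x) y \<oplus>\<^bsub>TT\<^esub> lact TT (sg n x) (\<Theta> y)"
    "\<forall>s\<in>carrier B. \<Theta> (j s) = \<delta> s" "\<forall>v\<in>carrier M. \<Theta> (inc v) = \<mu> v" by (elim exE conjE)
  have wt: "\<Theta> x \<in> TW (p + n)" if "x \<in> wt AA p" for p x
  \<comment> \<open>The grading of the target is shifted by n, which makes the extension
    weight-preserving.\<close>
  proof (rule derivation_wt[OF \<Theta>(1) grp_TT \<Theta>(2)[rule_format], where S = "\<lambda>p. TW (p + n)"])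
    show "\<Theta> (j b) \<in> TW (0 + n)" if "b \<in> carrier B" for b using \<delta>w[OF that] \<Theta>(3) that by simp
    show "\<Theta> (inc m) \<in> TW (q + n)" if "m \<in> Mw q" for q m using \<mu>w[OF that] \<Theta>(4) Mw_M[OF that] by simp
    show "ract TT w y \<in> TW (p + q + n)" if "w \<in> TW (p + n)" "y \<in> wt AA q" for p q w y
      using P.A.TW_acts(4)[OF that(2,1)] by (simp add: ac_simps)
    show "lact TT (sg n x) w \<in> TW (p + q + n)" if "x \<in> wt AA p" "w \<in> TW (q + n)" for p q w x
      using P.A.TW_acts(3)[OF P.A.sg_wt_closed[OF that(1)] that(2)] by (simp add: ac_simps)
    show "x \<in> wt AA p" by (rule that)
  qed (simp_all add: P.A.TW_zero P.A.TW_add P.A.TW_inv)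
  let ?T = "restrict \<Theta> (carrier AA)"
  have "?T \<in> DW n"
  proof (rule P.A.DWI)
    show "?T \<in> addhom AA TT" by (rule addhomI) (simp_all add: addhom_closed[OF \<Theta>(1)] addhom_add[OF \<Theta>(1)])
    show "?T (umap AA t) = \<zero>\<^bsub>TT\<^esub>" if "t \<in> carrier R" for t
      using d(3)[OF that] \<Theta>(3) that by (simp add: umap_TA)
    show "?T (x \<otimes>\<^bsub>AA\<^esub> y) = ract TT (?T x) y \<oplus>\<^bsub>TT\<^esub> lact TT (sg n x) (?T y)" if "x \<in> carrier AA" "y \<in> carrier AA" for x y
      using \<Theta>(2) that by simp
  qed (simp_all add: wt wt_TA)
  then show ?thesis using \<Theta>(3,4) by (intro bexI[of _ ?T]) simp_all
qed

lemma M_ext: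
  assumes W: "abelian_group W" and f: "f \<in> addhom M W" and g: "g \<in> addhom M W"
    and fg: "\<And>i e. i \<in> {1..N} \<Longrightarrow> e \<in> carrier (E i) \<Longrightarrow> f (inE i e) = g (inE i e)" and m: "m \<in> carrier M"
  shows "f m = g m"
  using m
proof (induction rule: M_induct)
  case zero show ?case using addhom_zero[OF M_grp W f] addhom_zero[OF M_grp W g] by simp
next
  case (add x y) then show ?case using addhom_add[OF f] addhom_add[OF g] by simp
qed (rule fg)

lemma DW_unique:
  assumes \<Theta>: "\<Theta> \<in> DW n" and \<Theta>': "\<Theta>' \<in> DW n" and b: "\<And>b. b \<in> carrier B \<Longrightarrow> \<Theta> (j b) = \<Theta>' (j b)"
    and m: "\<And>i e. i \<in> {1..N} \<Longrightarrow> e \<in> carrier (E i) \<Longrightarrow> \<Theta> (inc (inE i e)) = \<Theta>' (inc (inE i e))"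
  shows "\<Theta> = \<Theta>'"
proof (rule P.A.DD_ext[OF P.A.DW_DD[OF \<Theta>] P.A.DW_DD[OF \<Theta>']])
  have h: "\<Theta> \<in> addhom TA TT" "\<Theta>' \<in> addhom TA TT" using P.A.DWD(2)[OF \<Theta>] P.A.DWD(2)[OF \<Theta>'] by (simp_all add: hom_def)
  fix x assume "x \<in> carrier AA"
  then have "x \<in> carrier TA" by simp
  then show "\<Theta> x = \<Theta>' x"
  proof (induction rule: MB.TA_induct)
    case (incl v)
    show ?case by (rule M_ext[OF grp_TT addhom_comp[OF MB.incl_addhom h(1)] addhom_comp[OF MB.incl_addhom h(2)] _ incl]) (rule m)
  next
    case (mult x y)
    then show ?case using P.A.DWD(5)[OF \<Theta>, of x y] P.A.DWD(5)[OF \<Theta>', of x y] by simp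
  next
    case (diff x y)
    show ?case using diff addhom_minus[OF grp_TA grp_TT h(1)] addhom_minus[OF grp_TA grp_TT h(2)] by simp
  qed (rule b)
qed

section \<open>The maps \<open>\<nu>\<close> and \<open>pr\<^sub>N\<close>\<close>

abbreviation OA where "OA \<equiv> Om1 R AA"
abbreviation p1 where "p1 \<equiv> P.A.O1.p1"
abbreviation Y where "Y \<equiv> ind AA j B (E N)"
abbreviation YM where "YM \<equiv> ind AA j B M"

lemma N_in: "N \<in> {1..N}" using N_pos by simp

sublocale IE: induced "TBM B N E" B "E N" "TBM_base B N E"
  by (rule ind_V[OF E_biact[OF N_in]])

sublocale IM: induced "TBM B N E" B "dsum N E" "TBM_base B N E"
  by (rule ind_V[OF MB.biact_axioms])

text \<open>One-forms on T_B M are generated as a bimodule by the differentials of B and of the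
  summands of M. The Leibniz relator carries agreement from x and y to their product, for all outer
  coefficients at once.\<close>

lemma Om1_ext_gens:
  assumes W: "abelian_group W" and f: "f \<in> addhom OA W" and g: "g \<in> addhom OA W"
    and b: "\<And>p q a b c. \<lbrakk>a \<in> wt AA p; b \<in> carrier B; c \<in> wt AA q\<rbrakk> \<Longrightarrow> f (p1 a (j b) c) = g (p1 a (j b) c)"
    and m: "\<And>p q a i e c. \<lbrakk>a \<in> wt AA p; i \<in> {1..N}; e \<in> carrier (E i); c \<in> wt AA q\<rbrakk> \<Longrightarrow>
      f (p1 a (inc (inE i e)) c) = g (p1 a (inc (inE i e)) c)"
    and \<xi>: "\<xi> \<in> carrier OA"
  shows "f \<xi> = g \<xi>"
proof -
  note ra = addhom_add[OF f] addhom_add[OF g]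
  have hl: "(\<lambda>a. p1 a x c) \<in> addhom AA OA" and hr: "p1 c x \<in> addhom AA OA" and hm: "(\<lambda>x. p1 c x c') \<in> addhom AA OA"
    if "x \<in> carrier AA" "c \<in> carrier AA" "c' \<in> carrier AA" for x c c'
    using that P.A.O1.p1_rules(1-3) by (auto intro!: addhomI simp del: AA_simps)
  have ext: "f (p1 a x c) = g (p1 a x c)"
    if x: "x \<in> carrier AA" and h: "\<And>p q a c. a \<in> wt AA p \<Longrightarrow> c \<in> wt AA q \<Longrightarrow> f (p1 a x c) = g (p1 a x c)"
      and a: "a \<in> carrier AA" and c: "c \<in> carrier AA" for a x c
  proof -
    have 1: "f (p1 a x c) = g (p1 a x c)" if a: "a \<in> wt AA p" for p a
      by (rule P.A.A_ext[OF W addhom_comp[OF hr[OF x P.A.wt_carrier[OF a] c] f] addhom_comp[OF hr[OF x P.A.wt_carrier[OF a] c] g] h[OF a] c])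
    show ?thesis by (rule P.A.A_ext[OF W addhom_comp[OF hl[OF x c c] f] addhom_comp[OF hl[OF x c c] g] 1 a])
  qed
  have "\<forall>a\<in>carrier AA. \<forall>c\<in>carrier AA. f (p1 a x c) = g (p1 a x c)" if "x \<in> carrier TA" for x
    using that
  proof (induction rule: MB.TA_induct)
    case (base s)
    then show ?case using ext[of "j s"] b[of _ _ s] by simp
  next
    case (incl v)
    then show ?case
    proof (induction rule: M_induct)
      case zero
      show ?case
      proof (intro ballI)
        fix a c assume ac: "a \<in> carrier AA" "c \<in> carrier AA"
        have "inc \<zero>\<^bsub>M\<^esub> = \<zero>\<^bsub>AA\<^esub>" using addhom_zero[OF M_grp grp_TA MB.incl_addhom] by simp
        then have "p1 a (inc \<zero>\<^bsub>M\<^esub>) c = \<zero>\<^bsub>OA\<^esub>"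
          using addhom_zero[OF P.A.grp_A P.A.O1.O.abelian_group_axioms hm[OF ac(1) ac]] by simp
        then show "f (p1 a (inc \<zero>\<^bsub>M\<^esub>) c) = g (p1 a (inc \<zero>\<^bsub>M\<^esub>) c)"
          using addhom_zero[OF P.A.O1.O.abelian_group_axioms W f] addhom_zero[OF P.A.O1.O.abelian_group_axioms W g] by simp
      qed
    next
      case (add x y)
      then show ?case using P.A.O1.p1_rules(2)[of _ "inc x" _ "inc y"] ra by (simp add: addhom_add[OF MB.incl_addhom])
    next
      case (inE i e)
      then show ?case using ext[of "inc (inE i e)"] m[of _ _ i e] inE_closed[OF inE] by simp
    qed
  next
    case (mult x y)
    then show ?case using P.A.O1.p1_rules(4)[of _ x _ y] ra by simp
  next
    case (diff x y)
    show ?case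
    proof (intro ballI)
      fix a c assume ac: "a \<in> carrier AA" "c \<in> carrier AA"
      note H = addhom_minus[OF P.A.grp_A W addhom_comp[OF hm[OF ac(1) ac] f], of x y]
        addhom_minus[OF P.A.grp_A W addhom_comp[OF hm[OF ac(1) ac] g], of x y]
      show "f (p1 a (x \<ominus>\<^bsub>TA\<^esub> y) c) = g (p1 a (x \<ominus>\<^bsub>TA\<^esub> y) c)"
        using H diff ac by (simp add: a_minus_def)
    qed
  qed
  then show ?thesis using P.A.O1.Om1_ext[OF W f g _ \<xi>] by simp
qed

text \<open>There is a derivation of T_B M that kills B and sends m to 1 (x) m (x) 1, and \<nu> is
  the bimodule map classifying it. Uniqueness is \<open>Om1_ext_gens\<close>.\<close>

lemma nu_char:
  shows "nu R B N E \<in> addhom OA YM"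
    and "\<And>a x c. \<lbrakk>a \<in> carrier AA; x \<in> carrier AA; c \<in> carrier AA\<rbrakk> \<Longrightarrow>
      nu R B N E (p1 a x c) = lact YM a (ract YM (nu R B N E (du R AA x)) c)"
    and "\<And>b. b \<in> carrier B \<Longrightarrow> nu R B N E (du R AA (j b)) = \<zero>\<^bsub>YM\<^esub>"
    and "\<And>m. m \<in> carrier M \<Longrightarrow> nu R B N E (du R AA (inc m)) = IM.pi3 \<one>\<^bsub>AA\<^esub> m \<one>\<^bsub>AA\<^esub>"
proof -
  note gO = P.A.O1.O.abelian_group_axioms and gY = IM.I.abelian_group_axioms
  let ?o = "\<one>\<^bsub>AA\<^esub>"
  have o: "?o \<in> carrier AA" by (rule P.A.A.one_closed)
  have jc: "j b \<in> carrier AA" if "b \<in> carrier B" for b using that by simp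
  have ic: "inc m \<in> carrier AA" if "m \<in> carrier M" for m using that by simp
  have \<mu>: "(\<lambda>m. IM.pi3 ?o m ?o) \<in> addhom M YM" by (rule one_embed_hom[OF MB.biact_axioms])
  have "\<exists>dd. dd \<in> addhom TA YM \<and> (\<forall>x\<in>carrier TA. \<forall>y\<in>carrier TA. dd (x \<otimes>\<^bsub>TA\<^esub> y) = ract YM (dd x) y \<oplus>\<^bsub>YM\<^esub> lact YM x (dd y)) \<and>
    (\<forall>s\<in>carrier B. dd (j s) = \<zero>\<^bsub>YM\<^esub>) \<and> (\<forall>v\<in>carrier M. dd (inc v) = IM.pi3 ?o v ?o)"
  proof (rule MB.derivation_extends[OF biact_TA[OF IM.IB.biact_axioms] addhom_const_zero[OF gY] \<mu>])
    fix s v assume s: "s \<in> carrier B" and v: "v \<in> carrier M"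
    have 1: "IM.pi3 ?o (lact M s v) ?o = lact YM (j s) (IM.pi3 ?o v ?o)"
      using IM.pi3_rules(4)[OF o o v s] IM.ind_hom(2)[OF jc[OF s] o v o] jc[OF s] by simp
    have 2: "IM.pi3 ?o (ract M v s) ?o = ract YM (IM.pi3 ?o v ?o) (j s)"
      using IM.pi3_rules(5)[OF o o v s] IM.ind_hom(4)[OF jc[OF s] o v o] jc[OF s] by simp
    note c = IM.pi3_closed[OF o v o]
    show "IM.pi3 ?o (lact M s v) ?o = ract YM \<zero>\<^bsub>YM\<^esub> (inc v) \<oplus>\<^bsub>YM\<^esub> lact YM (j s) (IM.pi3 ?o v ?o)"
      unfolding 1 using IM.IB.r_zero[OF ic[OF v]] IM.IB.l_closed[OF jc[OF s] c] by simp
    show "IM.pi3 ?o (ract M v s) ?o = ract YM (IM.pi3 ?o v ?o) (j s) \<oplus>\<^bsub>YM\<^esub> lact YM (inc v) \<zero>\<^bsub>YM\<^esub>"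
      unfolding 2 using IM.IB.l_zero[OF ic[OF v]] IM.IB.r_closed[OF jc[OF s] c] by simp
  next
    fix s t assume "s \<in> carrier B" "t \<in> carrier B"
    then show "\<zero>\<^bsub>YM\<^esub> = ract YM \<zero>\<^bsub>YM\<^esub> (j t) \<oplus>\<^bsub>YM\<^esub> lact YM (j s) \<zero>\<^bsub>YM\<^esub>" using IM.IB.r_zero[OF jc] IM.IB.l_zero[OF jc] by simp
  qed
  then obtain dd where dd: "dd \<in> addhom TA YM" "\<forall>x\<in>carrier TA. \<forall>y\<in>carrier TA. dd (x \<otimes>\<^bsub>TA\<^esub> y) = ract YM (dd x) y \<oplus>\<^bsub>YM\<^esub> lact YM x (dd y)"
    "\<forall>s\<in>carrier B. dd (j s) = \<zero>\<^bsub>YM\<^esub>" "\<forall>v\<in>carrier M. dd (inc v) = IM.pi3 ?o v ?o" by (elim exE conjE)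
  have dd': "dd \<in> addhom AA YM" using dd(1) by (simp add: hom_def)
  have Dl: "\<forall>x\<in>carrier AA. \<forall>y\<in>carrier AA. dd (x \<otimes>\<^bsub>AA\<^esub> y) = ract YM (dd x) y \<oplus>\<^bsub>YM\<^esub> lact YM x (dd y)"
    using dd(2) by simp
  have Du: "\<forall>t\<in>carrier R. dd (umap AA t) = \<zero>\<^bsub>YM\<^esub>" using dd(3) by (simp add: umap_TA)
  note X = P.A.O1.ext1_char[OF IM.IB.biact_axioms dd' Dl Du]
  let ?L = "P.A.O1.ext1 YM (lact YM) (ract YM) dd"
  let ?f = "restrict ?L (carrier OA)"
  have ap: "?f \<xi> = ?L \<xi>" if "\<xi> \<in> carrier OA" for \<xi> using that by simp
  have duc: "du R AA x \<in> carrier OA" if "x \<in> carrier AA" for x by (rule P.A.O1.du_closed[OF that])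
  have "nu R B N E = ?f"
    unfolding nu_def Let_def
  proof (rule the_add_map_eq[OF X(1) _ gO])
    show "?f \<in> bimod_hom AA OA YM \<and> (\<forall>m\<in>carrier M. ?f (du R AA (inc m)) = IM.pi3 ?o m ?o) \<and> (\<forall>b\<in>carrier B. ?f (du R AA (j b)) = \<zero>\<^bsub>YM\<^esub>)"
    proof (intro conjI ballI)
      have "?f \<in> addhom OA YM" by (rule addhomI) (simp_all add: addhom_closed[OF X(1)] addhom_add[OF X(1)])
      moreover have "?f (lact OA b v) = lact YM b (?f v)" "?f (ract OA v b) = ract YM (?f v) b" if "b \<in> carrier AA" "v \<in> carrier OA" for b v
        using X(4,5)[OF that] P.A.O1.OB.l_closed[OF that] P.A.O1.OB.r_closed[OF that] that by (simp_all only: ap)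
      ultimately show "?f \<in> bimod_hom AA OA YM" by (simp add: bimod_hom_def)
      show "?f (du R AA (inc m)) = IM.pi3 ?o m ?o" if "m \<in> carrier M" for m
        using X(3)[OF ic[OF that]] dd(4) that by (simp only: ap[OF duc[OF ic[OF that]]])
      show "?f (du R AA (j b)) = \<zero>\<^bsub>YM\<^esub>" if "b \<in> carrier B" for b
        using X(3)[OF jc[OF that]] dd(3) that by (simp only: ap[OF duc[OF jc[OF that]]])
    qed
    fix g assume g: "g \<in> addhom OA YM" "g \<in> bimod_hom AA OA YM \<and> (\<forall>m\<in>carrier M. g (du R AA (inc m)) = IM.pi3 ?o m ?o) \<and> (\<forall>b\<in>carrier B. g (du R AA (j b)) = \<zero>\<^bsub>YM\<^esub>)"
    have gp: "g (p1 a x c) = lact YM a (ract YM (g (du R AA x)) c)" if "a \<in> carrier AA" "x \<in> carrier AA" "c \<in> carrier AA" for a x c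
    proof -
      have gb: "g (lact OA b v) = lact YM b (g v)" "g (ract OA v b) = ract YM (g v) b" if "b \<in> carrier AA" "v \<in> carrier OA" for b v
        using g(2) that by (simp_all add: bimod_hom_def)
      show ?thesis
        using gb(1)[OF that(1) P.A.O1.OB.r_closed[OF that(3) duc[OF that(2)]]] gb(2)[OF that(3) duc[OF that(2)]]
        by (simp only: P.A.O1.p1_eq[OF that])
    qed
    show "\<forall>\<xi>\<in>carrier OA. g \<xi> = ?L \<xi>"
    proof (intro ballI, rule Om1_ext_gens[OF gY g(1) X(1)])
      fix p q a b c assume *: "a \<in> wt AA p" "b \<in> carrier B" "c \<in> wt AA q"
      note ac = P.A.wt_carrier[OF *(1)] and cc = P.A.wt_carrier[OF *(3)]
      show "g (p1 a (j b) c) = ?L (p1 a (j b) c)"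
        unfolding gp[OF ac jc[OF *(2)] cc] X(2)[OF ac jc[OF *(2)] cc] using g(2) dd(3) *(2) by simp
    next
      fix p q a i e c assume *: "a \<in> wt AA p" "i \<in> {1..N}" "e \<in> carrier (E i)" "c \<in> wt AA q"
      note ac = P.A.wt_carrier[OF *(1)] and cc = P.A.wt_carrier[OF *(4)] and mc = inE_closed[OF *(2,3)]
      show "g (p1 a (inc (inE i e)) c) = ?L (p1 a (inc (inE i e)) c)"
        unfolding gp[OF ac ic[OF mc] cc] X(2)[OF ac ic[OF mc] cc] using g(2) dd(4) mc by simp
    qed
  qed
  then have nu: "nu R B N E \<xi> = ?L \<xi>" if "\<xi> \<in> carrier OA" for \<xi> using that by simp
  show "nu R B N E \<in> addhom OA YM"
    by (rule addhomI) (simp_all add: nu addhom_closed[OF X(1)] addhom_add[OF X(1)])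
  show "nu R B N E (p1 a x c) = lact YM a (ract YM (nu R B N E (du R AA x)) c)" if "a \<in> carrier AA" "x \<in> carrier AA" "c \<in> carrier AA" for a x c
    unfolding nu[OF P.A.O1.p1_closed[OF that]] nu[OF duc[OF that(2)]] X(2)[OF that] X(3)[OF that(2)] ..
  show "nu R B N E (du R AA (j b)) = \<zero>\<^bsub>YM\<^esub>" if "b \<in> carrier B" for b
    unfolding nu[OF duc[OF jc[OF that]]] X(3)[OF jc[OF that]] using dd(3) that by simp
  show "nu R B N E (du R AA (inc m)) = IM.pi3 ?o m ?o" if "m \<in> carrier M" for m
    unfolding nu[OF duc[OF ic[OF that]]] X(3)[OF ic[OF that]] using dd(4) that by simp
qed

lemma prN_char:
  shows "prN B N E \<in> addhom YM Y"
    and "\<And>a m c. \<lbrakk>a \<in> carrier AA; m \<in> carrier M; c \<in> carrier AA\<rbrakk> \<Longrightarrow> prN B N E (IM.pi3 a m c) = IE.pi3 a (m N) c"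
proof -
  have aN: "(m \<oplus>\<^bsub>M\<^esub> m') N = m N \<oplus>\<^bsub>E N\<^esub> m' N" "lact M b m N = lact (E N) b (m N)" "ract M m b N = ract (E N) (m N) b" for m m' b
    using M_ap[OF N_in] by simp_all
  note cN = M_app[OF _ N_in]
  have r0: "respects_rels Y (carrier AA \<times> carrier M \<times> carrier AA) (ind_rels AA j B M) (\<lambda>(a, m, c). IE.pi3 a (m N) c)"
    by (rule IM.ind_respects[OF IE.I.abelian_group_axioms]) (simp_all only: aN cN IE.pi3_rules IE.pi3_closed)
  have r: "respects_rels Y (carrier AA \<times> carrier M \<times> carrier AA) (ind_rels AA j B M) (\<lambda>x. gcls (ind_rels AA j B (E N)) ((\<lambda>(a, m, c). (a, m N, c)) x))"
    using r0 by (simp only: case_prod_beta')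
  have hc: "(\<lambda>(a, m, c). (a, m N, c)) x \<in> carrier AA \<times> carrier (E N) \<times> carrier AA" if "x \<in> carrier AA \<times> carrier M \<times> carrier AA" for x
    using that cN by auto
  note * = pmap_lift[OF IM.I.presented_axioms IE.I.presented_axioms hc r]
  show "prN B N E \<in> addhom YM Y" unfolding prN_def using *(1) .
  show "prN B N E (IM.pi3 a m c) = IE.pi3 a (m N) c" if "a \<in> carrier AA" "m \<in> carrier M" "c \<in> carrier AA" for a m c
    unfolding prN_def using *(2)[of "(a, m, c)"] that by simp
qed

end

section \<open>The composite of \<nu> with the projection to the summand of weight N\<close>

lemma ksgn_twice: "abelian_group V \<Longrightarrow> v \<in> carrier V \<Longrightarrow> ksgn V n (ksgn V n v) = v"
  by (simp add: ksgn_def abelian_group.minus_minus)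

lemma addhom_ksgn:
  "\<lbrakk>abelian_group V; abelian_group W; f \<in> addhom V W; x \<in> carrier V\<rbrakk> \<Longrightarrow> f (ksgn V n x) = ksgn W n (f x)"
  by (simp add: ksgn_def addhom_inv)

context bisym
begin

abbreviation UU where "UU \<equiv> ind AA j B D"
abbreviation eps where "eps \<equiv> P.eps"
abbreviation UW where "UW \<equiv> P.UW"
abbreviation YW where "YW \<equiv> ind_wt AA j B (E N) (placed (int N) (E N))"
abbreviation OW where "OW \<equiv> Om1_wt R AA"
abbreviation tm where "tm \<equiv> P.tm"
abbreviation iE where "iE i e \<equiv> inc (inE i e)"

abbreviation YG where "YG w \<equiv> {IE.pi3 a v c |a v c p q r. a \<in> wt AA p \<and> v \<in> placed (int N) (E N) q \<and> c \<in> wt AA r \<and> p + q + r = w}"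
abbreviation OG where "OG w \<equiv> {p1 a x c |a x c p q r. a \<in> wt AA p \<and> x \<in> wt AA q \<and> c \<in> wt AA r \<and> p + q + r = w}"

definition NU where "NU = (\<lambda>\<xi>. prN B N E (nu R B N E \<xi>))"

lemmas grp_OA = P.A.O1.O.abelian_group_axioms and grp_Y = IE.I.abelian_group_axioms
  and grp_YM = IM.I.abelian_group_axioms and grp_UU = P.ID.I.abelian_group_axioms
  and grp_DD = P.A.grp_DD and grp_AA = P.A.grp_A
lemmas wtc = P.A.wt_carrier
lemmas one_AA = P.A.A.one_closed

lemma NU_hom: "NU \<in> addhom OA Y"
  unfolding NU_def by (rule addhom_comp[OF nu_char(1) prN_char(1)])

lemma jc: "b \<in> carrier B \<Longrightarrow> j b \<in> carrier AA"
  by (rule P.j_closed)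

lemma ic: "m \<in> carrier M \<Longrightarrow> inc m \<in> carrier AA"
  by simp

lemma iEc: "i \<in> {1..N} \<Longrightarrow> e \<in> carrier (E i) \<Longrightarrow> iE i e \<in> carrier AA"
  by (rule ic[OF inE_closed])

lemma iEw: "i \<in> {1..N} \<Longrightarrow> e \<in> carrier (E i) \<Longrightarrow> iE i e \<in> wt AA (int i)"
  by (rule inc_wt[OF inE_wt])

lemma iE_hom: "i \<in> {1..N} \<Longrightarrow> iE i \<in> addhom (E i) AA"
proof (rule addhomI)
  assume i: "i \<in> {1..N}"
  show "iE i e \<in> carrier AA" if "e \<in> carrier (E i)" for e by (rule iEc[OF i that])
  fix e e' assume e: "e \<in> carrier (E i)" "e' \<in> carrier (E i)"
  show "iE i (e \<oplus>\<^bsub>E i\<^esub> e') = iE i e \<oplus>\<^bsub>AA\<^esub> iE i e'"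
    using inE_rules(1)[OF i e] addhom_add[OF MB.incl_addhom inE_closed[OF i e(1)] inE_closed[OF i e(2)]] by simp
qed

lemma iE_act:
  assumes i: "i \<in> {1..N}" and b: "b \<in> carrier B" and e: "e \<in> carrier (E i)"
  shows "iE i (lact (E i) b e) = j b \<otimes>\<^bsub>AA\<^esub> iE i e" "iE i (ract (E i) e b) = iE i e \<otimes>\<^bsub>AA\<^esub> j b"
  using inE_rules(2,3)[OF i e b] MB.incl_lact[OF b inE_closed[OF i e]] MB.incl_ract[OF b inE_closed[OF i e]] by simp_all

lemma one_wt: "\<one>\<^bsub>AA\<^esub> \<in> wt AA 0"
  using j_wt[OF A.one_closed] ring_hom_one[OF MB.base_ring_hom] by simp

lemma prN_act:
  assumes a: "a \<in> carrier AA" and y: "y \<in> carrier YM"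
  shows "prN B N E (lact YM a y) = lact Y a (prN B N E y)" "prN B N E (ract YM y a) = ract Y (prN B N E y) a"
proof -
  show "prN B N E (lact YM a y) = lact Y a (prN B N E y)"
    by (rule IM.ind_ext[OF grp_Y addhom_comp[OF IM.ind_hom(1)[OF a] prN_char(1)] addhom_comp[OF prN_char(1) IE.ind_hom(1)[OF a]] _ y])
      (simp only: IM.ind_hom(2)[OF a] prN_char(2) IE.ind_hom(2)[OF a] M_app[OF _ N_in] P.A.A.m_closed[OF a])
  show "prN B N E (ract YM y a) = ract Y (prN B N E y) a"
    by (rule IM.ind_ext[OF grp_Y addhom_comp[OF IM.ind_hom(3)[OF a] prN_char(1)] addhom_comp[OF prN_char(1) IE.ind_hom(3)[OF a]] _ y])
      (simp only: IM.ind_hom(4)[OF a] prN_char(2) IE.ind_hom(4)[OF a] M_app[OF _ N_in] P.A.A.m_closed[OF _ a])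
qed

lemma NU_p1:
  assumes "a \<in> carrier AA" "x \<in> carrier AA" "c \<in> carrier AA"
  shows "NU (p1 a x c) = lact Y a (ract Y (NU (du R AA x)) c)"
proof -
  have n: "nu R B N E (du R AA x) \<in> carrier YM" by (rule addhom_closed[OF nu_char(1) P.A.O1.du_closed[OF assms(2)]])
  show ?thesis unfolding NU_def nu_char(2)[OF assms] prN_act(1)[OF assms(1) IM.IB.r_closed[OF assms(3) n]] prN_act(2)[OF assms(3) n] ..
qed

lemma NU_du_closed: "x \<in> carrier AA \<Longrightarrow> NU (du R AA x) \<in> carrier Y"
  by (rule addhom_closed[OF NU_hom P.A.O1.du_closed])

lemma NU_act:
  assumes b: "b \<in> carrier AA" and \<xi>: "\<xi> \<in> carrier OA"
  shows "NU (lact OA b \<xi>) = lact Y b (NU \<xi>)" "NU (ract OA \<xi> b) = ract Y (NU \<xi>) b"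
proof -
  note h = P.A.O1.Om1_hom[OF b]
  note c = IE.IB.l_closed IE.IB.r_closed NU_du_closed P.A.A.m_closed
  show "NU (lact OA b \<xi>) = lact Y b (NU \<xi>)"
    by (rule P.A.O1.Om1_ext[OF grp_Y addhom_comp[OF h(1) NU_hom] addhom_comp[OF NU_hom IE.ind_hom(1)[OF b]] _ \<xi>])
      (simp only: h(2) NU_p1 c b IE.IB.l_mult)
  show "NU (ract OA \<xi> b) = ract Y (NU \<xi>) b"
    by (rule P.A.O1.Om1_ext[OF grp_Y addhom_comp[OF h(3) NU_hom] addhom_comp[OF NU_hom IE.ind_hom(3)[OF b]] _ \<xi>])
      (simp only: h(4) NU_p1 c b IE.IB.r_mult IE.IB.lr_assoc)
qed

lemma NU_jb: "b \<in> carrier B \<Longrightarrow> NU (du R AA (j b)) = \<zero>\<^bsub>Y\<^esub>"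
  unfolding NU_def using nu_char(3) addhom_zero[OF grp_YM grp_Y prN_char(1)] by simp

lemma NU_inc: "m \<in> carrier M \<Longrightarrow> NU (du R AA (inc m)) = IE.pi3 \<one>\<^bsub>AA\<^esub> (m N) \<one>\<^bsub>AA\<^esub>"
  unfolding NU_def using nu_char(4) prN_char(2)[OF one_AA _ one_AA] by simp

lemmas EN_biact = E_biact[OF N_in]

text \<open>The composite sees only differentials from the top summand. This makes it onto, and
  identifies what a map has to kill in order to factor through it.\<close>

lemma NU_inE:
  assumes a: "a \<in> carrier AA" and i: "i \<in> {1..N}" and e: "e \<in> carrier (E i)" and c: "c \<in> carrier AA"
  shows "NU (p1 a (iE i e) c) = (if i = N then IE.pi3 a e c else \<zero>\<^bsub>Y\<^esub>)"
proof (cases "i = N")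
  case True
  then have eN: "e \<in> carrier (E N)" using e by simp
  have "NU (du R AA (iE i e)) = IE.pi3 \<one>\<^bsub>AA\<^esub> e \<one>\<^bsub>AA\<^esub>"
    unfolding NU_inc[OF inE_closed[OF i e]] by (simp only: inE_ap[OF N_in] True if_True simp_thms)
  then have "NU (p1 a (iE i e) c) = lact Y a (ract Y (IE.pi3 \<one>\<^bsub>AA\<^esub> e \<one>\<^bsub>AA\<^esub>) c)"
    by (simp only: NU_p1[OF a iEc[OF i e] c])
  also have "\<dots> = IE.pi3 a e c"
    by (simp only: IE.ind_hom(4)[OF c one_AA eN one_AA] P.A.A.l_one[OF c] IE.ind_hom(2)[OF a one_AA eN c] P.A.A.r_one[OF a])
  finally show ?thesis using True by (simp only: if_True simp_thms)
next
  case False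
  have "NU (du R AA (iE i e)) = IE.pi3 \<one>\<^bsub>AA\<^esub> \<zero>\<^bsub>E N\<^esub> \<one>\<^bsub>AA\<^esub>"
    unfolding NU_inc[OF inE_closed[OF i e]] using False by (simp add: inE_ap[OF N_in])
  also have "\<dots> = \<zero>\<^bsub>Y\<^esub>" by (rule pi3_zero(2)[OF EN_biact one_AA abelian_groupE(2)[OF E_grp[OF N_in]] one_AA])
  finally show ?thesis using False IE.IB.r_zero[OF c] IE.IB.l_zero[OF a]
    by (simp only: NU_p1[OF a iEc[OF i e] c] if_False)
qed

lemma YW_gens: "YG w \<subseteq> carrier Y"
  by (rule VW_gens[OF EN_biact])

lemma YW_zero: "\<zero>\<^bsub>Y\<^esub> \<in> YW n" and YW_add: "x \<in> YW n \<Longrightarrow> y \<in> YW n \<Longrightarrow> x \<oplus>\<^bsub>Y\<^esub> y \<in> YW n"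
  unfolding ind_wt_def by (rule span_zero, rule span_add)

lemma YW_inv: "x \<in> YW n \<Longrightarrow> \<ominus>\<^bsub>Y\<^esub> x \<in> YW n"
  unfolding ind_wt_def by (rule span_inv[OF grp_Y YW_gens])

lemma placed_EN: "v \<in> placed (int N) (E N) q \<Longrightarrow> v \<in> carrier (E N)"
  using abelian_groupE(2)[OF E_grp[OF N_in]] by (auto simp: placed_def split: if_splits)

lemma YW_act:
  assumes a: "a \<in> wt AA p" and y: "y \<in> YW q"
  shows "lact Y a y \<in> YW (p + q)" "ract Y y a \<in> YW (q + p)"
proof -
  note ac = wtc[OF a]
  show "lact Y a y \<in> YW (p + q)" using y unfolding ind_wt_def
  proof (rule addhom_span[OF grp_Y grp_Y IE.ind_hom(1)[OF ac] YW_gens _ YW_gens, rotated])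
    fix x assume "x \<in> YG q"
    then obtain a' v c p' q' r where x: "x = IE.pi3 a' v c" and a': "a' \<in> wt AA p'" and v: "v \<in> placed (int N) (E N) q'"
      and c: "c \<in> wt AA r" and s: "p' + q' + r = q" by blast
    show "lact Y a x \<in> span Y (YG (p + q))"
      unfolding x IE.ind_hom(2)[OF ac wtc[OF a'] placed_EN[OF v] wtc[OF c]]
      by (rule span_incl, intro CollectI exI conjI, rule refl, rule P.A.wt_mult[OF a a'], rule v, rule c, use s in simp)
  qed
  show "ract Y y a \<in> YW (q + p)" using y unfolding ind_wt_def
  proof (rule addhom_span[OF grp_Y grp_Y IE.ind_hom(3)[OF ac] YW_gens _ YW_gens, rotated])
    fix x assume "x \<in> YG q"
    then obtain a' v c p' q' r where x: "x = IE.pi3 a' v c" and a': "a' \<in> wt AA p'" and v: "v \<in> placed (int N) (E N) q'"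
      and c: "c \<in> wt AA r" and s: "p' + q' + r = q" by blast
    show "ract Y x a \<in> span Y (YG (q + p))"
      unfolding x IE.ind_hom(4)[OF ac wtc[OF a'] placed_EN[OF v] wtc[OF c]]
      by (rule span_incl, intro CollectI exI conjI, rule refl, rule a', rule v, rule P.A.wt_mult[OF c a], use s in simp)
  qed
qed

text \<open>The composite of \<open>NU\<close> with d is a derivation of T_B M, so its weight is
  controlled by its values on B and M.\<close>

lemma NU_du_wt:
  assumes x: "x \<in> wt AA p"
  shows "NU (du R AA x) \<in> YW p"
proof (rule derivation_wt[where W = Y and l = "lact Y" and r = "ract Y" and S = YW and dd = "\<lambda>x. NU (du R AA x)", OF _ grp_Y _ _ _ _ _ _ _ _ x])
  have "(\<lambda>x. NU (du R AA x)) \<in> addhom AA Y"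
    by (rule addhomI) (simp_all only: NU_du_closed P.A.O1.du_rules(1) addhom_add[OF NU_hom] P.A.O1.du_closed)
  then show "(\<lambda>x. NU (du R AA x)) \<in> addhom TA Y" by (simp add: hom_def)
next
  fix x y assume "x \<in> carrier TA" "y \<in> carrier TA"
  then have xy: "x \<in> carrier AA" "y \<in> carrier AA" by simp_all
  have "NU (du R AA (x \<otimes>\<^bsub>AA\<^esub> y)) = ract Y (NU (du R AA x)) y \<oplus>\<^bsub>Y\<^esub> lact Y x (NU (du R AA y))"
    by (simp only: P.A.O1.du_rules(2)[OF xy] addhom_add[OF NU_hom P.A.O1.OB.r_closed P.A.O1.OB.l_closed] xy P.A.O1.du_closed NU_act)
  then show "NU (du R AA (x \<otimes>\<^bsub>TA\<^esub> y)) = ract Y (NU (du R AA x)) y \<oplus>\<^bsub>Y\<^esub> lact Y x (NU (du R AA y))" by simp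
next
  fix b assume "b \<in> carrier B" then show "NU (du R AA (j b)) \<in> YW 0" by (simp only: NU_jb YW_zero)
next
  fix q m assume m: "m \<in> Mw q"
  show "NU (du R AA (inc m)) \<in> YW q"
  proof (cases "q = int N")
    case True
    show ?thesis unfolding NU_inc[OF Mw_M[OF m]] True
      using VW_incl[OF EN_biact one_wt M_app[OF Mw_M[OF m] N_in] one_wt, of "int N"] by simp
  next
    case False
    then have "m N = \<zero>\<^bsub>E N\<^esub>" using m N_in by (simp add: dsum_wt_def)
    then show ?thesis unfolding NU_inc[OF Mw_M[OF m]]
      using pi3_zero(2)[OF EN_biact one_AA abelian_groupE(2)[OF E_grp[OF N_in]] one_AA] YW_zero by simp
  qed
qed (simp_all only: YW_zero YW_add YW_inv YW_act)

lemma OW_gens: "OG n \<subseteq> carrier OA"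
  by (auto simp only: P.A.O1.p1_closed wtc)

lemma OW_incl: "\<lbrakk>a \<in> wt AA p; x \<in> wt AA q; c \<in> wt AA r\<rbrakk> \<Longrightarrow> p1 a x c \<in> OW (p + q + r)"
  unfolding Om1_wt_def by (rule span_incl) blast

lemma OW_du: "x \<in> wt AA q \<Longrightarrow> du R AA x \<in> OW q"
  unfolding du_def using OW_incl[OF one_wt _ one_wt] by force

text \<open>For the inclusion that is not just preservation of weight, a (x) e (x) c is hit by the
  form a de c of the same weight. Equality is needed because \<open>shift_iso\<close> asks for the
  images of the weight spaces.\<close>

lemma NU_OW: "NU ` OW n = YW n"
proof (intro equalityI subsetI)
  fix y assume "y \<in> NU ` OW n"
  then obtain \<xi> where \<xi>: "y = NU \<xi>" "\<xi> \<in> OW n" by blast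
  have "NU \<xi> \<in> span Y (YG n)"
  proof (rule addhom_span[OF grp_OA grp_Y NU_hom OW_gens _ YW_gens])
    show "\<xi> \<in> span OA (OG n)"
      using \<xi>(2) unfolding Om1_wt_def .
    fix g assume "g \<in> OG n"
    then obtain a x c p q r where g: "g = p1 a x c" "a \<in> wt AA p" "x \<in> wt AA q" "c \<in> wt AA r" "p + q + r = n" by blast
    have "NU g \<in> YW (p + (q + r))"
      unfolding g(1) NU_p1[OF wtc[OF g(2)] wtc[OF g(3)] wtc[OF g(4)]]
      by (rule YW_act(1)[OF g(2) YW_act(2)[OF g(4) NU_du_wt[OF g(3)]]])
    then show "NU g \<in> span Y (YG n)"
      using g(5) by (simp add: ind_wt_def add.assoc)
  qed
  then show "y \<in> YW n" unfolding \<xi>(1) ind_wt_def .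
next
  note OWc = span_closed[OF grp_OA OW_gens, folded Om1_wt_def]
  have z: "\<zero>\<^bsub>Y\<^esub> \<in> NU ` OW n"
    using addhom_zero[OF grp_OA grp_Y NU_hom] by (intro image_eqI[of _ _ "\<zero>\<^bsub>OA\<^esub>"]) (simp_all add: Om1_wt_def span_zero)
  fix y assume "y \<in> YW n"
  then show "y \<in> NU ` OW n" unfolding ind_wt_def
  proof (rule span_image[OF grp_OA grp_Y NU_hom, rotated -1])
    show "YG n \<subseteq> NU ` OW n"
    proof
      fix y assume "y \<in> YG n"
      then obtain a v c p q r where g: "y = IE.pi3 a v c" "a \<in> wt AA p" "v \<in> placed (int N) (E N) q" "c \<in> wt AA r" "p + q + r = n" by blast
      note ac = wtc[OF g(2)] and cc = wtc[OF g(4)] and vc = placed_EN[OF g(3)]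
      show "y \<in> NU ` OW n"
      proof (cases "q = int N")
        case True
        show ?thesis
        proof (rule image_eqI)
          show "y = NU (p1 a (iE N v) c)" using NU_inE[OF ac N_in vc cc] g(1) by (simp only: if_True simp_thms)
          show "p1 a (iE N v) c \<in> OW n" using OW_incl[OF g(2) iEw[OF N_in vc] g(4)] g(5) True by simp
        qed
      next
        case False
        then have "v = \<zero>\<^bsub>E N\<^esub>" using g(3) by (simp add: placed_def)
        then show ?thesis using z pi3_zero(2)[OF EN_biact ac vc cc] g(1) by simp
      qed
    qed
  qed (use OWc span_inv[OF grp_OA OW_gens] in \<open>auto simp: Om1_wt_def intro: span_zero span_add\<close>)
qed

lemma NU_surj: "y \<in> carrier Y \<Longrightarrow> \<exists>\<xi>\<in>carrier OA. NU \<xi> = y"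
proof (induction rule: IE.I.gen_induct)
  case (gen g)
  then obtain a e c where g: "g = (a, e, c)" "a \<in> carrier AA" "e \<in> carrier (E N)" "c \<in> carrier AA" by auto
  show ?case
    by (rule bexI[of _ "p1 a (iE N e) c"]) (simp_all only: g NU_inE[OF g(2) N_in g(3,4)] if_True simp_thms P.A.O1.p1_closed iEc[OF N_in g(3)])
next
  case (diff x y)
  then obtain \<xi> \<eta> where "\<xi> \<in> carrier OA" "NU \<xi> = x" "\<eta> \<in> carrier OA" "NU \<eta> = y" by blast
  then show ?case using addhom_minus[OF grp_OA grp_Y NU_hom, of \<xi> \<eta>] P.A.O1.O.minus_closed[of \<xi> \<eta>] by blast
next
  case zero
  show ?case using addhom_zero[OF grp_OA grp_Y NU_hom] P.A.O1.O.zero_closed by blast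
qed

lemma tm_wt: "t \<in> carrier (tens K R B) \<Longrightarrow> tm t \<in> TW 0"
proof (rule P.A.TW_gen_map[OF T.presented_axioms P.tm_hom])
  fix g assume "g \<in> carrier B \<times> carrier B"
  then obtain u v where g: "g = (u, v)" "u \<in> carrier B" "v \<in> carrier B" by auto
  show "tm (gcls (tens_rels K R B) g) \<in> TW 0" using P.tm_pt[OF g(2,3)] P.A.TW_incl[OF j_wt[OF g(2)] j_wt[OF g(3)]] g(1) by simp
qed

lemma E_kbiact: "i \<in> {1..N} \<Longrightarrow> kbiact K R B (E i) (lact (E i)) (ract (E i))"
  by (intro kbiact.intro kbiact_axioms.intro kalg_axioms E_biact E_central)

lemma E_dual_basis:
  assumes i: "i \<in> {1..N}"
  shows "\<exists>(J :: 'e set) x \<phi>. finite J \<and> (\<forall>k\<in>J. x k \<in> carrier (E i) \<and> \<phi> k \<in> bimod_hom B (E i) (tens K R B)) \<and>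
    (\<forall>v\<in>carrier (E i). v = (\<Oplus>\<^bsub>E i\<^esub>k\<in>J. kbiact.tact K R B (E i) (lact (E i)) (ract (E i)) (x k) (\<phi> k v)))"
  by (rule projective_dual_basis[OF E_kbiact[OF i] E_proj[OF i] E_fg[OF i]])

end

text \<open>\<open>io\<close> stands for iota(\<omega>), regarded simply as a graded isomorphism
  that raises weight by N.\<close>

locale bisym_iota = bisym K R B h N E
  for K :: "('k, 'x) ring_scheme" and R :: "('k, 'r, 'y) alg_scheme" and B :: "('r, 'b) alg" and h :: 'k
    and N :: nat and E :: "nat \<Rightarrow> ('b, 'e) bimod" +
  fixes io
  assumes io: "io \<in> shift_iso AA (int N) DD DW OA OW"
begin

lemma io_rules:
  shows "io \<in> addhom DD OA" "bij_betw io (carrier DD) (carrier OA)" "\<And>p. io ` DW p = OW (p + int N)"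
    "\<And>a \<Theta>. a \<in> carrier AA \<Longrightarrow> \<Theta> \<in> carrier DD \<Longrightarrow> io (lact DD a \<Theta>) = lact OA a (io \<Theta>)"
    "\<And>a \<Theta>. a \<in> carrier AA \<Longrightarrow> \<Theta> \<in> carrier DD \<Longrightarrow> io (ract DD \<Theta> a) = ract OA (io \<Theta>) (sg (int N) a)"
  using io P.A.twist_eq unfolding shift_iso_def by (simp_all del: AA_simps)

definition Phi where "Phi = (\<lambda>\<Theta>. NU (io \<Theta>))"

lemma Phi_hom: "Phi \<in> addhom DD Y"
  unfolding Phi_def by (rule addhom_comp[OF io_rules(1) NU_hom])

lemma io_closed: "\<Theta> \<in> carrier DD \<Longrightarrow> io \<Theta> \<in> carrier OA"
  by (rule addhom_closed[OF io_rules(1)])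

lemma Phi_act:
  assumes "a \<in> carrier AA" "\<Theta> \<in> carrier DD"
  shows "Phi (lact DD a \<Theta>) = lact Y a (Phi \<Theta>)" "Phi (ract DD \<Theta> a) = ract Y (Phi \<Theta>) (sg (int N) a)"
  unfolding Phi_def
  by (simp_all only: io_rules(4,5)[OF assms] NU_act(1)[OF assms(1) io_closed[OF assms(2)]] NU_act(2)[OF P.A.sg_closed[OF assms(1)] io_closed[OF assms(2)]])

lemma Phi_wt: "Phi ` DW p = YW (p + int N)"
  using io_rules(3)[of p] NU_OW[of "p + int N"] unfolding Phi_def by (simp add: image_image[symmetric])

section \<open>Double derivations vanishing on \<open>B\<close>\<close>

lemma DW_finsum:
  assumes I: "finite I" and f: "\<And>i. i \<in> I \<Longrightarrow> f i \<in> DW n"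
  shows "finsum DD f I \<in> DW n"
proof -
  interpret DD: abelian_group DD by (rule grp_DD)
  show ?thesis using I f
  proof (induction rule: finite_induct)
    case empty then show ?case by (simp add: P.A.DW_zero)
  next
    case (insert i I)
    have "f \<in> insert i I \<rightarrow> carrier DD" using insert.prems P.A.DW_DD by blast
    then show ?case using insert by (auto intro: P.A.DW_add)
  qed
qed

text \<open>Vertical double derivations with support in one summand: zero on B and on the other
  summands, and equal to \<open>L\<close> on E_i.\<close>

definition vert :: "int \<Rightarrow> nat \<Rightarrow> ('e \<Rightarrow> _) \<Rightarrow> _ \<Rightarrow> bool" where
  "vert n i L \<Theta> \<longleftrightarrow> \<Theta> \<in> DW n \<and> (\<forall>b\<in>carrier B. \<Theta> (j b) = \<zero>\<^bsub>TT\<^esub>) \<and>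
     (\<forall>i'\<in>{1..N}. \<forall>e\<in>carrier (E i'). \<Theta> (iE i' e) = (if i' = i then L e else \<zero>\<^bsub>TT\<^esub>))"

text \<open>A coordinate function on E_i, extended by zero to B and to the other summands, is
  compatible with the Leibniz rule because it is B-linear on both sides. It takes weight i to weight
  0, hence its weight -i.\<close>

lemma basic_der:
  assumes i: "i \<in> {1..N}" and \<phi>: "\<phi> \<in> bimod_hom B (E i) (tens K R B)"
  shows "\<exists>\<Theta>. vert (- int i) i (\<lambda>e. tm (\<phi> e)) \<Theta>"
proof -
  note gE = E_grp[OF i] and gB = T.abelian_group_axioms
  have \<phi>h: "\<phi> \<in> addhom (E i) (tens K R B)" using \<phi> by (simp add: bimod_hom_def)
  have \<phi>b: "\<phi> (lact (E i) b e) = lact (tens K R B) b (\<phi> e)" "\<phi> (ract (E i) e b) = ract (tens K R B) (\<phi> e) b"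
    if "b \<in> carrier B" "e \<in> carrier (E i)" for b e using \<phi> that by (simp_all add: bimod_hom_def)
  have z: "tm (\<phi> \<zero>\<^bsub>E i\<^esub>) = \<zero>\<^bsub>TT\<^esub>"
    using addhom_zero[OF gE gB \<phi>h] addhom_zero[OF gB grp_TT P.tm_hom] by simp
  have c: "\<phi> (m i) \<in> carrier (tens K R B)" if "m \<in> carrier M" for m by (rule addhom_closed[OF \<phi>h M_app[OF that i]])
  have tc: "tm (\<phi> (m i)) \<in> carrier TT" if "m \<in> carrier M" for m by (rule P.tm_closed[OF c[OF that]])
  have z0: "\<zero>\<^bsub>TT\<^esub> \<in> carrier TT" by (rule P.A.T.zero_closed)
  have "\<exists>\<Theta>\<in>DW (- int i). (\<forall>b\<in>carrier B. \<Theta> (j b) = \<zero>\<^bsub>TT\<^esub>) \<and> (\<forall>m\<in>carrier M. \<Theta> (inc m) = tm (\<phi> (m i)))"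
  proof (rule DW_lift)
    show "P.derT (\<lambda>b. \<zero>\<^bsub>TT\<^esub>)"
      unfolding P.derT_def using addhom_const_zero[OF grp_TT] P.A.TB.l_zero[OF jc] P.A.TB.r_zero[OF jc] z0
      by (auto simp del: AA_simps)
    show "\<zero>\<^bsub>TT\<^esub> \<in> TW (- int i)" by (rule P.A.TW_zero)
    show "(\<lambda>m. tm (\<phi> (m i))) \<in> addhom M TT"
      by (rule addhomI) (simp_all only: tc M_ap[OF i] addhom_add[OF \<phi>h] M_app[OF _ i] addhom_add[OF P.tm_hom] c)
    show "tm (\<phi> (m i)) \<in> TW (q + - int i)" if m: "m \<in> Mw q" for q m
    proof (cases "q = int i")
      case True then show ?thesis using tm_wt[OF c[OF Mw_M[OF m]]] by simp
    next
      case False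
      then have "m i = \<zero>\<^bsub>E i\<^esub>" using m i by (simp add: dsum_wt_def)
      then show ?thesis using z P.A.TW_zero by simp
    qed
    fix b m assume b: "b \<in> carrier B" and m: "m \<in> carrier M"
    note inc = ic[OF m]
    show "tm (\<phi> (lact M b m i)) = ract TT \<zero>\<^bsub>TT\<^esub> (inc m) \<oplus>\<^bsub>TT\<^esub> lact TT (j b) (tm (\<phi> (m i)))"
      unfolding M_ap[OF i] \<phi>b[OF b M_app[OF m i]] P.tm_inner(3)[OF b c[OF m]] P.A.TB.r_zero[OF inc]
      by (rule P.A.T.l_zero[OF P.A.TB.l_closed[OF jc[OF b] tc[OF m]], symmetric])
    show "tm (\<phi> (ract M m b i)) = ract TT (tm (\<phi> (m i))) (j b) \<oplus>\<^bsub>TT\<^esub> lact TT (sg (- int i) (inc m)) \<zero>\<^bsub>TT\<^esub>"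
      unfolding M_ap[OF i] \<phi>b[OF b M_app[OF m i]] P.tm_inner(4)[OF b c[OF m]] P.A.TB.l_zero[OF P.A.sg_closed[OF inc]]
      by (rule P.A.T.r_zero[OF P.A.TB.r_closed[OF jc[OF b] tc[OF m]], symmetric])
  qed
  then obtain \<Theta> where \<Theta>: "\<Theta> \<in> DW (- int i)" "\<forall>b\<in>carrier B. \<Theta> (j b) = \<zero>\<^bsub>TT\<^esub>" "\<forall>m\<in>carrier M. \<Theta> (inc m) = tm (\<phi> (m i))" by blast
  have "vert (- int i) i (\<lambda>e. tm (\<phi> e)) \<Theta>"
    unfolding vert_def using \<Theta>(1,2) \<Theta>(3)[rule_format, OF inE_closed] z by (auto simp: inE_ap[OF i])
  then show ?thesis by blast
qed

lemma low_Phi: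
  assumes i: "i \<in> {1..N}" and \<Theta>: "\<Theta> \<in> DW (- int i)"
  shows "Phi \<Theta> = \<zero>\<^bsub>Y\<^esub>"
proof (rule VW_low[OF EN_biact])
  show "Phi \<Theta> \<in> YW (- int i + int N)" using Phi_wt[of "- int i"] \<Theta> by blast
  show "- int i + int N < int N" using i by simp
qed

lemma DW_ksgn: "\<Theta> \<in> DW n \<Longrightarrow> ksgn DD q \<Theta> \<in> DW n"
  by (simp add: ksgn_def P.A.DW_inv)

text \<open>Multiplying a basic derivation by elements of A from both sides realises every
  coefficient w in A (x) A. The resulting weight may be large, so that \<open>Phi\<close> kills it
  is no longer a matter of weights: it follows from the linearity of \<open>Phi\<close>.\<close>

lemma basic_der_act:
  assumes i: "i \<in> {1..N}" and \<phi>: "\<phi> \<in> bimod_hom B (E i) (tens K R B)" and w: "w \<in> TW q"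
  shows "\<exists>\<Theta>. vert (q - int i) i (\<lambda>e. P.JT.tact w (\<phi> e)) \<Theta> \<and> Phi \<Theta> = \<zero>\<^bsub>Y\<^esub>"
proof -
  let ?P = "\<lambda>w. \<exists>\<Theta>. vert (q - int i) i (\<lambda>e. P.JT.tact w (\<phi> e)) \<Theta> \<and> Phi \<Theta> = \<zero>\<^bsub>Y\<^esub>"
  let ?G = "{P.A.pt u v |u v p p'. u \<in> wt AA p \<and> v \<in> wt AA p' \<and> p + p' = q}"
  have \<phi>h: "\<phi> \<in> addhom (E i) (tens K R B)" using \<phi> by (simp add: bimod_hom_def)
  note \<phi>c = addhom_closed[OF \<phi>h]
  have th: "(\<lambda>w. P.JT.tact w (\<phi> e)) \<in> addhom TT TT" if "e \<in> carrier (E i)" for e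
    by (rule P.JT.tact_hom_left[OF \<phi>c[OF that]])
  note gT = grp_TT
  note Gc = P.A.TW_gens[of q]
  obtain \<Theta>1 where v1: "vert (- int i) i (\<lambda>e. tm (\<phi> e)) \<Theta>1" using basic_der[OF i \<phi>] by blast
  then have \<Theta>1: "\<Theta>1 \<in> DW (- int i)" and \<Theta>1j: "\<And>b. b \<in> carrier B \<Longrightarrow> \<Theta>1 (j b) = \<zero>\<^bsub>TT\<^esub>"
    and \<Theta>1i: "\<And>i' e. i' \<in> {1..N} \<Longrightarrow> e \<in> carrier (E i') \<Longrightarrow> \<Theta>1 (iE i' e) = (if i' = i then tm (\<phi> e) else \<zero>\<^bsub>TT\<^esub>)"
    by (simp_all add: vert_def)
  note \<Theta>1h = P.A.DWD(2)[OF \<Theta>1]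
  have gen: "?P x" if "x \<in> ?G" for x
  proof -
    from that obtain u v p p' where x: "x = P.A.pt u v" and u: "u \<in> wt AA p" and v: "v \<in> wt AA p'" and pq: "p + p' = q" by blast
    note uc = wtc[OF u] and vc = wtc[OF v] and svc = P.A.sg_closed[OF wtc[OF v]]
    let ?R = "ract DD \<Theta>1 u"
    let ?T2 = "lact DD (sg p v) ?R"
    \<comment> \<open>Evaluating the right multiple by \<open>u\<close> at an element of weight i
      produces the sign with exponent p * i; it is compensated here. The twist of \<open>v\<close>
      is the one required by \<open>il_ir_tact\<close>.\<close>
    let ?T3 = "ksgn DD (p * int i) ?T2"
    have R: "?R \<in> DW (- int i + p)" by (rule P.A.DW_ract[OF u \<Theta>1])
    have T2: "?T2 \<in> DW (- int i + p + p')" by (rule P.A.DW_lact[OF P.A.sg_wt_closed[OF v] R])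
    have T3: "?T3 \<in> DW (q - int i)" using DW_ksgn[OF T2] pq by (simp add: algebra_simps)
    have S: "(\<lambda>t. P.il (sg p v) (P.ir t u)) \<in> addhom TT TT"
      by (rule addhom_comp[OF P.A.inner_r_char(1)[OF uc] P.A.inner_l_char(1)[OF svc]])
    have ap2: "?T2 y = P.il (sg p v) (P.ir (\<Theta>1 (sg p y)) u)" if "y \<in> carrier AA" for y
      unfolding P.A.lact_DD P.A.ract_DD[OF u \<Theta>1h] using that by (simp only: restrict_apply if_True)
    have ap3: "?T3 y = ksgn TT (p * int i) (?T2 y)" if y: "y \<in> carrier AA" for y
      by (rule addhom_ksgn[OF grp_DD gT P.A.DD_eval[OF y] P.A.DW_DD[OF T2]])
    have kz: "ksgn TT n \<zero>\<^bsub>TT\<^esub> = \<zero>\<^bsub>TT\<^esub>" for n by (rule addhom_zero[OF gT gT ksgn_addhom[OF gT]])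
    have "?T3 (j b) = \<zero>\<^bsub>TT\<^esub>" if b: "b \<in> carrier B" for b
      unfolding ap3[OF jc[OF b]] ap2[OF jc[OF b]] P.sg_j[OF b] \<Theta>1j[OF b] addhom_zero[OF gT gT S] by (rule kz)
    moreover have "?T3 (iE i' e) = (if i' = i then P.JT.tact x (\<phi> e) else \<zero>\<^bsub>TT\<^esub>)"
      if i': "i' \<in> {1..N}" and e: "e \<in> carrier (E i')" for i' e
    proof -
      let ?y = "iE i' e"
      note yc = iEc[OF i' e]
      have "?T2 ?y = P.il (sg p v) (P.ir (ksgn TT (p * int i') (\<Theta>1 ?y)) u)"
        unfolding ap2[OF yc] P.A.sg_wt[OF iEw[OF i' e]] addhom_ksgn[OF grp_AA gT \<Theta>1h yc] ..
      also have "\<dots> = ksgn TT (p * int i') (P.il (sg p v) (P.ir (\<Theta>1 ?y) u))"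
        by (rule addhom_ksgn[OF gT gT S addhom_closed[OF \<Theta>1h yc]])
      finally have 2: "?T2 ?y = ksgn TT (p * int i') (P.il (sg p v) (P.ir (\<Theta>1 ?y) u))" .
      show ?thesis
      proof (cases "i' = i")
        case True
        then have ei: "e \<in> carrier (E i)" using e by simp
        have "P.il (sg p v) (P.ir (\<Theta>1 ?y) u) = P.JT.tact x (\<phi> e)"
          unfolding x using \<Theta>1i[OF i' e] True P.il_ir_tact[OF u vc \<phi>c[OF ei]] by simp
        moreover have "P.JT.tact x (\<phi> e) \<in> carrier TT"
          unfolding x by (rule P.JT.tact_closed[OF P.A.pt_closed[OF uc vc] \<phi>c[OF ei]])
        ultimately show ?thesis unfolding ap3[OF yc] 2 using True by (simp add: ksgn_twice[OF gT])
      next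
        case False
        then have "P.il (sg p v) (P.ir (\<Theta>1 ?y) u) = \<zero>\<^bsub>TT\<^esub>"
          using \<Theta>1i[OF i' e] addhom_zero[OF gT gT S] by simp
        then show ?thesis unfolding ap3[OF yc] 2 using False by (simp add: kz)
      qed
    qed
    moreover have "Phi ?T3 = \<zero>\<^bsub>Y\<^esub>"
    proof -
      have "Phi ?T2 = \<zero>\<^bsub>Y\<^esub>"
        unfolding Phi_act(1)[OF svc P.A.DW_DD[OF R]] Phi_act(2)[OF uc P.A.DW_DD[OF \<Theta>1]] low_Phi[OF i \<Theta>1]
          IE.IB.r_zero[OF P.A.sg_closed[OF uc]] by (rule IE.IB.l_zero[OF svc])
      then show ?thesis
        unfolding addhom_ksgn[OF grp_DD grp_Y Phi_hom P.A.DW_DD[OF T2]]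
        using addhom_zero[OF grp_Y grp_Y ksgn_addhom[OF grp_Y]] by simp
    qed
    ultimately show ?thesis using T3 unfolding vert_def by blast
  qed
  have tz: "P.JT.tact \<zero>\<^bsub>TT\<^esub> (\<phi> e) = \<zero>\<^bsub>TT\<^esub>" if "e \<in> carrier (E i)" for e by (rule addhom_zero[OF gT gT th[OF that]])
  from w show ?thesis unfolding tens_wt_def
  proof (induction rule: span_induct)
    case zero
    have "vert (q - int i) i (\<lambda>e. P.JT.tact \<zero>\<^bsub>TT\<^esub> (\<phi> e)) \<zero>\<^bsub>DD\<^esub>"
      unfolding vert_def using P.A.DW_zero P.A.DD_zero_apply[OF jc] P.A.DD_zero_apply[OF iEc] tz by simp
    then show ?case using addhom_zero[OF grp_DD grp_Y Phi_hom] by blast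
  next
    case (incl x) then show ?case by (rule gen)
  next
    case (inv x)
    then obtain \<Theta> where \<Theta>: "vert (q - int i) i (\<lambda>e. P.JT.tact x (\<phi> e)) \<Theta>" "Phi \<Theta> = \<zero>\<^bsub>Y\<^esub>" using gen by blast
    have d: "\<Theta> \<in> carrier DD" using \<Theta>(1) P.A.DW_DD unfolding vert_def by blast
    have ti: "P.JT.tact (\<ominus>\<^bsub>TT\<^esub> x) (\<phi> e) = \<ominus>\<^bsub>TT\<^esub> P.JT.tact x (\<phi> e)" if "e \<in> carrier (E i)" for e
      by (rule addhom_inv[OF gT gT th[OF that] subsetD[OF Gc inv]])
    note z = P.A.T.zero_inv
    note zY = IE.I.zero_inv
    have "vert (q - int i) i (\<lambda>e. P.JT.tact (\<ominus>\<^bsub>TT\<^esub> x) (\<phi> e)) (\<ominus>\<^bsub>DD\<^esub> \<Theta>)"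
      using \<Theta>(1) P.A.DW_inv P.A.DD_inv_apply[OF d jc] P.A.DD_inv_apply[OF d iEc] ti z unfolding vert_def by simp
    moreover have "Phi (\<ominus>\<^bsub>DD\<^esub> \<Theta>) = \<zero>\<^bsub>Y\<^esub>" using addhom_inv[OF grp_DD grp_Y Phi_hom d] \<Theta>(2) zY by simp
    ultimately show ?case by blast
  next
    case (add x y)
    then obtain \<Theta> \<Theta>' where \<Theta>: "vert (q - int i) i (\<lambda>e. P.JT.tact x (\<phi> e)) \<Theta>" "Phi \<Theta> = \<zero>\<^bsub>Y\<^esub>"
      "vert (q - int i) i (\<lambda>e. P.JT.tact y (\<phi> e)) \<Theta>'" "Phi \<Theta>' = \<zero>\<^bsub>Y\<^esub>" by blast
    have d: "\<Theta> \<in> carrier DD" "\<Theta>' \<in> carrier DD" using \<Theta>(1,3) P.A.DW_DD unfolding vert_def by blast+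
    note xy = span_closed[OF gT Gc add.hyps(1)] span_closed[OF gT Gc add.hyps(2)]
    have ta: "P.JT.tact (x \<oplus>\<^bsub>TT\<^esub> y) (\<phi> e) = P.JT.tact x (\<phi> e) \<oplus>\<^bsub>TT\<^esub> P.JT.tact y (\<phi> e)" if "e \<in> carrier (E i)" for e
      by (rule addhom_add[OF th[OF that] xy])
    have "vert (q - int i) i (\<lambda>e. P.JT.tact (x \<oplus>\<^bsub>TT\<^esub> y) (\<phi> e)) (\<Theta> \<oplus>\<^bsub>DD\<^esub> \<Theta>')"
      using \<Theta>(1,3) P.A.DW_add P.A.DD_add_apply[OF jc] P.A.DD_add_apply[OF iEc] ta P.A.T.l_zero[OF P.A.T.zero_closed] unfolding vert_def by simp
    moreover have "Phi (\<Theta> \<oplus>\<^bsub>DD\<^esub> \<Theta>') = \<zero>\<^bsub>Y\<^esub>" using addhom_add[OF Phi_hom d] \<Theta>(2,4) IE.I.l_zero[OF IE.I.zero_closed] by simp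
    ultimately show ?case by blast
  qed
qed

lemma DW_sum_eval:
  assumes I: "finite I" and f: "\<And>i. i \<in> I \<Longrightarrow> f i \<in> DW n" and y: "y \<in> carrier AA"
  shows "finsum DD f I y = (\<Oplus>\<^bsub>TT\<^esub>i\<in>I. f i y)"
  by (rule addhom_finsum[OF grp_DD grp_TT P.A.DD_eval[OF y] I]) (use f P.A.DW_DD in blast)

lemma Phi_sum_zero:
  assumes I: "finite I" and f: "\<And>i. i \<in> I \<Longrightarrow> f i \<in> DW n" and z: "\<And>i. i \<in> I \<Longrightarrow> Phi (f i) = \<zero>\<^bsub>Y\<^esub>"
  shows "Phi (finsum DD f I) = \<zero>\<^bsub>Y\<^esub>"
proof -
  have "Phi (finsum DD f I) = (\<Oplus>\<^bsub>Y\<^esub>i\<in>I. Phi (f i))"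
    by (rule addhom_finsum[OF grp_DD grp_Y Phi_hom I]) (use f P.A.DW_DD in blast)
  also have "\<dots> = (\<Oplus>\<^bsub>Y\<^esub>i\<in>I. \<zero>\<^bsub>Y\<^esub>)" by (rule IE.I.finsum_cong') (simp_all add: z)
  also have "\<dots> = \<zero>\<^bsub>Y\<^esub>" by (rule IE.I.finsum_zero)
  finally show ?thesis .
qed

text \<open>On E_i a derivation that vanishes on B is a bimodule map, so the dual basis expresses it
  as a sum of maps with coefficients \<Theta>(x_k) in A (x) A. Each summand extends to a derivation
  killed by \<open>Phi\<close>.\<close>

lemma kernel_component:
  assumes \<Theta>: "\<Theta> \<in> DW n" and \<Theta>j: "\<And>b. b \<in> carrier B \<Longrightarrow> \<Theta> (j b) = \<zero>\<^bsub>TT\<^esub>" and i: "i \<in> {1..N}"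
  shows "\<exists>\<Theta>'. vert n i (\<lambda>e. \<Theta> (iE i e)) \<Theta>' \<and> Phi \<Theta>' = \<zero>\<^bsub>Y\<^esub>"
proof -
  let ?L = "\<lambda>e. \<Theta> (iE i e)"
  interpret Ei: kbiact K R B "E i" "lact (E i)" "ract (E i)" by (rule E_kbiact[OF i])
  from E_dual_basis[OF i] obtain J :: "'e set" and x \<phi> where J: "finite J"
    and J1: "\<forall>k\<in>J. x k \<in> carrier (E i) \<and> \<phi> k \<in> bimod_hom B (E i) (tens K R B)"
    and J2: "\<forall>v\<in>carrier (E i). v = (\<Oplus>\<^bsub>E i\<^esub>k\<in>J. Ei.tact (x k) (\<phi> k v))"
    by (elim exE conjE)
  have x: "x k \<in> carrier (E i)" and \<phi>: "\<phi> k \<in> bimod_hom B (E i) (tens K R B)" if "k \<in> J" for k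
    using J1 that by auto
  note eq = J2[rule_format]
  have \<phi>c: "\<phi> k e \<in> carrier (tens K R B)" if "k \<in> J" "e \<in> carrier (E i)" for k e
    using \<phi>[OF that(1)] that(2) by (auto simp: bimod_hom_def intro: addhom_closed)
  note \<Theta>h = P.A.DWD(2)[OF \<Theta>]
  have Lh: "?L \<in> addhom (E i) TT" by (rule addhom_comp[OF iE_hom[OF i] \<Theta>h])
  \<comment> \<open>In each Leibniz expansion the term with the differentiated element of B is zero,
    and the remaining multiplier has weight 0 and is not twisted.\<close>
  have Lb: "?L (lact (E i) b e) = lact TT (j b) (?L e) \<and> ?L (ract (E i) e b) = ract TT (?L e) (j b)"
    if b: "b \<in> carrier B" and e: "e \<in> carrier (E i)" for b e
  proof
    note y = iEc[OF i e] and Lc = addhom_closed[OF Lh e]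
    have "?L (lact (E i) b e) = ract TT \<zero>\<^bsub>TT\<^esub> (iE i e) \<oplus>\<^bsub>TT\<^esub> lact TT (j b) (?L e)"
      by (simp only: iE_act(1)[OF i b e] P.A.DWD(5)[OF \<Theta> jc[OF b] y] \<Theta>j[OF b] P.sg_j[OF b])
    then show "?L (lact (E i) b e) = lact TT (j b) (?L e)"
      by (simp only: P.A.TB.r_zero[OF y] P.A.T.l_zero[OF P.A.TB.l_closed[OF jc[OF b] Lc]])
    have "?L (ract (E i) e b) = ract TT (?L e) (j b) \<oplus>\<^bsub>TT\<^esub> lact TT (sg n (iE i e)) \<zero>\<^bsub>TT\<^esub>"
      by (simp only: iE_act(2)[OF i b e] P.A.DWD(5)[OF \<Theta> y jc[OF b]] \<Theta>j[OF b])
    then show "?L (ract (E i) e b) = ract TT (?L e) (j b)"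
      by (simp only: P.A.TB.l_zero[OF P.A.sg_closed[OF y]] P.A.T.r_zero[OF P.A.TB.r_closed[OF jc[OF b] Lc]])
  qed
  have "\<exists>\<Theta>'. vert n i (\<lambda>e. P.JT.tact (?L (x k)) (\<phi> k e)) \<Theta>' \<and> Phi \<Theta>' = \<zero>\<^bsub>Y\<^esub>" if k: "k \<in> J" for k
    using basic_der_act[OF i \<phi>[OF k] P.A.DWD(3)[OF \<Theta> iEw[OF i x[OF k]]]] by simp
  then obtain T where T: "\<And>k. k \<in> J \<Longrightarrow> vert n i (\<lambda>e. P.JT.tact (?L (x k)) (\<phi> k e)) (T k)" "\<And>k. k \<in> J \<Longrightarrow> Phi (T k) = \<zero>\<^bsub>Y\<^esub>"
    by metis
  have TD: "T k \<in> DW n" if "k \<in> J" for k using T(1)[OF that] by (simp add: vert_def)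
  have ev: "finsum DD T J y = (\<Oplus>\<^bsub>TT\<^esub>k\<in>J. T k y)" if "y \<in> carrier AA" for y by (rule DW_sum_eval[OF J TD that])
  have "vert n i ?L (finsum DD T J)"
    unfolding vert_def
  proof (intro conjI ballI)
    show "finsum DD T J \<in> DW n" by (rule DW_finsum[OF J TD])
    fix b assume b: "b \<in> carrier B"
    have "(\<Oplus>\<^bsub>TT\<^esub>k\<in>J. T k (j b)) = (\<Oplus>\<^bsub>TT\<^esub>k\<in>J. \<zero>\<^bsub>TT\<^esub>)"
      by (rule P.A.T.finsum_cong') (use T(1) b in \<open>simp_all add: vert_def\<close>)
    then show "finsum DD T J (j b) = \<zero>\<^bsub>TT\<^esub>" unfolding ev[OF jc[OF b]] by (simp only: P.A.T.finsum_zero)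
  next
    fix i' e assume i': "i' \<in> {1..N}" and e: "e \<in> carrier (E i')"
    show "finsum DD T J (iE i' e) = (if i' = i then ?L e else \<zero>\<^bsub>TT\<^esub>)"
      unfolding ev[OF iEc[OF i' e]]
    proof (cases "i' = i")
      case True
      then have ei: "e \<in> carrier (E i)" using e by simp
      have tc: "(\<lambda>k. Ei.tact (x k) (\<phi> k e)) \<in> J \<rightarrow> carrier (E i)" using Ei.tact_closed[OF x \<phi>c] ei by blast
      have tk: "?L (Ei.tact (x k) (\<phi> k e)) = P.JT.tact (?L (x k)) (\<phi> k e)" if "k \<in> J" for k
        by (rule tact_natural[OF Ei.kbiact_axioms P.JT.kbiact_axioms Lh Lb x[OF that] \<phi>c[OF that ei]])
      have "?L e = ?L (\<Oplus>\<^bsub>E i\<^esub>k\<in>J. Ei.tact (x k) (\<phi> k e))" by (rule arg_cong[OF eq[OF ei]])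
      also have "\<dots> = (\<Oplus>\<^bsub>TT\<^esub>k\<in>J. ?L (Ei.tact (x k) (\<phi> k e)))" by (rule addhom_finsum[OF E_grp[OF i] grp_TT Lh J tc])
      also have "\<dots> = (\<Oplus>\<^bsub>TT\<^esub>k\<in>J. T k (iE i' e))"
      proof (rule P.A.T.finsum_cong')
        show "(\<lambda>k. T k (iE i' e)) \<in> J \<rightarrow> carrier TT" using P.A.DW_apply[OF TD iEc[OF i' e]] by blast
        fix k assume k: "k \<in> J"
        show "?L (Ei.tact (x k) (\<phi> k e)) = T k (iE i' e)" unfolding tk[OF k] using T(1)[OF k] i ei True unfolding vert_def by simp
      qed simp
      finally show "(\<Oplus>\<^bsub>TT\<^esub>k\<in>J. T k (iE i' e)) = (if i' = i then ?L e else \<zero>\<^bsub>TT\<^esub>)" using True by simp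
    next
      case False
      have "(\<Oplus>\<^bsub>TT\<^esub>k\<in>J. T k (iE i' e)) = (\<Oplus>\<^bsub>TT\<^esub>k\<in>J. \<zero>\<^bsub>TT\<^esub>)"
        by (rule P.A.T.finsum_cong') (use T(1) i' e False in \<open>simp_all add: vert_def\<close>)
      then show "(\<Oplus>\<^bsub>TT\<^esub>k\<in>J. T k (iE i' e)) = (if i' = i then ?L e else \<zero>\<^bsub>TT\<^esub>)"
        using False by (simp add: P.A.T.finsum_zero)
    qed
  qed
  moreover have "Phi (finsum DD T J) = \<zero>\<^bsub>Y\<^esub>" by (rule Phi_sum_zero[OF J TD T(2)])
  ultimately show ?thesis by blast
qed

text \<open>The vertical pieces for i = 1, ..., N add up to \<Theta>, because a double derivation is
  determined on B and on the summands of M.\<close>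

lemma kernel:
  assumes \<Theta>: "\<Theta> \<in> DW n" and \<Theta>j: "\<And>b. b \<in> carrier B \<Longrightarrow> \<Theta> (j b) = \<zero>\<^bsub>TT\<^esub>"
  shows "Phi \<Theta> = \<zero>\<^bsub>Y\<^esub>"
proof -
  have "\<forall>i\<in>{1..N}. \<exists>\<Theta>'. vert n i (\<lambda>e. \<Theta> (iE i e)) \<Theta>' \<and> Phi \<Theta>' = \<zero>\<^bsub>Y\<^esub>"
    using kernel_component[OF \<Theta> \<Theta>j] by blast
  then obtain T where T: "\<And>i. i \<in> {1..N} \<Longrightarrow> vert n i (\<lambda>e. \<Theta> (iE i e)) (T i)" "\<And>i. i \<in> {1..N} \<Longrightarrow> Phi (T i) = \<zero>\<^bsub>Y\<^esub>"
    by metis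
  have TD: "T i \<in> DW n" if "i \<in> {1..N}" for i using T(1)[OF that] by (simp add: vert_def)
  have fin: "finite {1..N}" by simp
  have ev: "finsum DD T {1..N} y = (\<Oplus>\<^bsub>TT\<^esub>k\<in>{1..N}. T k y)" if "y \<in> carrier AA" for y by (rule DW_sum_eval[OF fin TD that])
  have "\<Theta> = finsum DD T {1..N}"
  proof (rule DW_unique[OF \<Theta> DW_finsum[OF fin TD]])
    fix b assume b: "b \<in> carrier B"
    have "(\<Oplus>\<^bsub>TT\<^esub>k\<in>{1..N}. T k (j b)) = (\<Oplus>\<^bsub>TT\<^esub>k\<in>{1..N}. \<zero>\<^bsub>TT\<^esub>)"
      by (rule P.A.T.finsum_cong') (use T(1) b in \<open>simp_all add: vert_def\<close>)
    then show "\<Theta> (j b) = finsum DD T {1..N} (j b)"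
      unfolding ev[OF jc[OF b]] \<Theta>j[OF b] by (simp only: P.A.T.finsum_zero)
  next
    fix i e assume i: "i \<in> {1..N}" and e: "e \<in> carrier (E i)"
    note c = addhom_closed[OF P.A.DWD(2)[OF \<Theta>] iEc[OF i e]]
    have "(\<Oplus>\<^bsub>TT\<^esub>k\<in>{1..N}. T k (iE i e)) = (\<Oplus>\<^bsub>TT\<^esub>k\<in>{1..N}. if i = k then \<Theta> (iE i e) else \<zero>\<^bsub>TT\<^esub>)"
    proof (rule P.A.T.finsum_cong')
      show "(\<lambda>k. if i = k then \<Theta> (iE i e) else \<zero>\<^bsub>TT\<^esub>) \<in> {1..N} \<rightarrow> carrier TT" using c by (auto simp del: One_nat_def)
      fix k assume "k \<in> {1..N}"
      then show "T k (iE i e) = (if i = k then \<Theta> (iE i e) else \<zero>\<^bsub>TT\<^esub>)"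
        using T(1) i e unfolding vert_def by auto
    qed simp
    also have "\<dots> = \<Theta> (iE i e)"
      by (rule P.A.T.finsum_singleton[OF i fin, of "\<lambda>_. \<Theta> (iE i e)"]) (use c in blast)
    finally show "\<Theta> (iE i e) = finsum DD T {1..N} (iE i e)"
      unfolding ev[OF iEc[OF i e]] by (rule sym)
  qed
  then show ?thesis using Phi_sum_zero[OF fin TD T(2)] by simp
qed

end

context bisym
begin

section \<open>Lifting double derivations from \<open>B\<close> to \<open>T\<^sub>B M\<close>\<close>

abbreviation TBB where "TBB \<equiv> tens K R B"

lemma jm:
  assumes "b \<in> carrier B" "c \<in> carrier B"
  shows "j (b \<oplus>\<^bsub>B\<^esub> c) = j b \<oplus>\<^bsub>AA\<^esub> j c" "j (b \<otimes>\<^bsub>B\<^esub> c) = j b \<otimes>\<^bsub>AA\<^esub> j c"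
  by (rule P.j_rules(1)[OF assms], rule P.j_rules(2)[OF assms])

text \<open>The local form of a connection: \<open>p y q \<mapsto> \<delta>(p) y q + p y \<delta>(q)\<close>, with \<open>y\<close> treated as flat.\<close>

lemma leibniz_piece:
  assumes \<delta>: "P.derT \<delta>" and \<delta>w: "\<And>b. b \<in> carrier B \<Longrightarrow> \<delta> b \<in> TW 0" and y: "y \<in> wt AA w"
    and g: "g \<in> addhom TBB AA" and gpt: "\<And>p q. p \<in> carrier B \<Longrightarrow> q \<in> carrier B \<Longrightarrow> g (pt p q) = j p \<otimes>\<^bsub>AA\<^esub> (y \<otimes>\<^bsub>AA\<^esub> j q)"
  shows "\<exists>\<beta>\<in>addhom TBB TT. (\<forall>t\<in>carrier TBB. \<beta> t \<in> TW w) \<and>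
    (\<forall>b\<in>carrier B. \<forall>t\<in>carrier TBB. \<beta> (lact TBB b t) = ract TT (\<delta> b) (g t) \<oplus>\<^bsub>TT\<^esub> lact TT (j b) (\<beta> t) \<and>
       \<beta> (ract TBB t b) = ract TT (\<beta> t) (j b) \<oplus>\<^bsub>TT\<^esub> lact TT (g t) (\<delta> b))"
proof -
  have \<delta>h: "\<delta> \<in> addhom B TT" and \<delta>R: "\<And>r. r \<in> carrier R \<Longrightarrow> \<delta> (umap B r) = \<zero>\<^bsub>TT\<^esub>"
    and \<delta>L: "\<And>b c. b \<in> carrier B \<Longrightarrow> c \<in> carrier B \<Longrightarrow> \<delta> (b \<otimes>\<^bsub>B\<^esub> c) = ract TT (\<delta> b) (j c) \<oplus>\<^bsub>TT\<^esub> lact TT (j b) (\<delta> c)"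
    using \<delta> by (simp_all add: P.derT_def)
  note yc = wtc[OF y]
  note \<delta>c = addhom_closed[OF \<delta>h]
  note mc = P.A.A.m_closed and ma = P.A.A.m_assoc
  note cl = jc \<delta>c yc mc P.A.TB.l_closed P.A.TB.r_closed A.m_closed A.a_closed
  let ?h = "\<lambda>p q. ract TT (\<delta> p) (y \<otimes>\<^bsub>AA\<^esub> j q) \<oplus>\<^bsub>TT\<^esub> lact TT (j p \<otimes>\<^bsub>AA\<^esub> y) (\<delta> q)"
  have swap: "(a \<oplus>\<^bsub>TT\<^esub> b) \<oplus>\<^bsub>TT\<^esub> (c \<oplus>\<^bsub>TT\<^esub> d) = (a \<oplus>\<^bsub>TT\<^esub> c) \<oplus>\<^bsub>TT\<^esub> (b \<oplus>\<^bsub>TT\<^esub> d)"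
    if "a \<in> carrier TT" "b \<in> carrier TT" "c \<in> carrier TT" "d \<in> carrier TT" for a b c d
    using that by (simp add: P.A.T.a_ac)
  have "\<exists>L. L \<in> addhom TBB TT \<and> (\<forall>u\<in>carrier B. \<forall>v\<in>carrier B. L (pt u v) = ?h u v)"
  proof (rule tens_lift[OF grp_TT])
    fix u v assume u: "u \<in> carrier B" and v: "v \<in> carrier B"
    show "?h u v \<in> carrier TT" by (rule P.A.T.a_closed) (simp_all only: cl u v)
    show "?h (u \<oplus>\<^bsub>B\<^esub> u') v = ?h u v \<oplus>\<^bsub>TT\<^esub> ?h u' v" if u': "u' \<in> carrier B" for u'
      by (subst swap) (simp_all only: cl u v u' addhom_add[OF \<delta>h] jm P.A.A.l_distr P.A.TB.r_add P.A.TB.l_plus)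
    show "?h u (v \<oplus>\<^bsub>B\<^esub> v') = ?h u v \<oplus>\<^bsub>TT\<^esub> ?h u v'" if v': "v' \<in> carrier B" for v'
      by (subst swap) (simp_all only: cl u v v' addhom_add[OF \<delta>h] jm P.A.A.r_distr P.A.TB.l_add P.A.TB.r_plus)
    fix c assume c: "c \<in> carrier K"
    let ?k = "kmap R B c"
    have k: "?k \<in> carrier B" by (rule kmap_closed[OF c])
    \<comment> \<open>Scalars act through R, on which \<delta> vanishes. They can therefore be moved
      across the tensor sign past \<open>y\<close>, as needed for a map defined on a tensor product
      over k.\<close>
    have k0: "\<delta> ?k = \<zero>\<^bsub>TT\<^esub>" using \<delta>R[OF kmap_in_R[OF c]] by (simp add: kmap_def)
    have 1: "\<delta> (u \<otimes>\<^bsub>B\<^esub> ?k) = ract TT (\<delta> u) (j ?k)"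
      unfolding \<delta>L[OF u k] k0 P.A.TB.l_zero[OF jc[OF u]] by (rule P.A.T.r_zero) (simp only: cl u k)
    have 2: "\<delta> (?k \<otimes>\<^bsub>B\<^esub> v) = lact TT (j ?k) (\<delta> v)"
      unfolding \<delta>L[OF k v] k0 P.A.TB.r_zero[OF jc[OF v]] by (rule P.A.T.l_zero) (simp only: cl v k)
    have cm: "j ?k \<otimes>\<^bsub>AA\<^esub> y = y \<otimes>\<^bsub>AA\<^esub> j ?k" using P.A.kmap_comm[OF c yc] by (simp only: kmap_AA)
    have cm': "j ?k \<otimes>\<^bsub>AA\<^esub> (y \<otimes>\<^bsub>AA\<^esub> j v) = y \<otimes>\<^bsub>AA\<^esub> (j ?k \<otimes>\<^bsub>AA\<^esub> j v)"
      using cm ma[OF jc[OF k] yc jc[OF v]] ma[OF yc jc[OF k] jc[OF v]] by simp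
    have cm'': "(j u \<otimes>\<^bsub>AA\<^esub> j ?k) \<otimes>\<^bsub>AA\<^esub> y = (j u \<otimes>\<^bsub>AA\<^esub> y) \<otimes>\<^bsub>AA\<^esub> j ?k"
      using cm ma[OF jc[OF u] jc[OF k] yc] ma[OF jc[OF u] yc jc[OF k]] by simp
    show "?h (u \<otimes>\<^bsub>B\<^esub> ?k) v = ?h u (?k \<otimes>\<^bsub>B\<^esub> v)"
      by (simp only: 1 2 jm u v k P.A.TB.r_mult[symmetric] P.A.TB.l_mult[symmetric] cl cm' cm'')
  qed
  then obtain \<beta> where \<beta>: "\<beta> \<in> addhom TBB TT" and \<beta>pt: "\<And>u v. u \<in> carrier B \<Longrightarrow> v \<in> carrier B \<Longrightarrow> \<beta> (pt u v) = ?h u v" by blast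
  have "\<beta> t \<in> TW w" if "t \<in> carrier TBB" for t
  proof (rule P.A.TW_gen_map[OF T.presented_axioms \<beta> _ that])
    fix x assume "x \<in> carrier B \<times> carrier B"
    then obtain u v where x: "x = (u, v)" "u \<in> carrier B" "v \<in> carrier B" by auto
    have "ract TT (\<delta> u) (y \<otimes>\<^bsub>AA\<^esub> j v) \<in> TW (0 + (w + 0))"
      by (rule P.A.TW_acts(4)[OF P.A.wt_mult[OF y j_wt[OF x(3)]] \<delta>w[OF x(2)]])
    moreover have "lact TT (j u \<otimes>\<^bsub>AA\<^esub> y) (\<delta> v) \<in> TW (0 + (0 + w))"
      by (rule P.A.TW_acts(3)[OF P.A.wt_mult[OF j_wt[OF x(2)] y] \<delta>w[OF x(3)]])
    ultimately show "\<beta> (gcls (tens_rels K R B) x) \<in> TW w" unfolding x(1) \<beta>pt[OF x(2,3)] by (intro P.A.TW_add) simp_all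
  qed
  moreover have "\<beta> (lact TBB b t) = ract TT (\<delta> b) (g t) \<oplus>\<^bsub>TT\<^esub> lact TT (j b) (\<beta> t)"
    if b: "b \<in> carrier B" and t: "t \<in> carrier TBB" for b t
  proof (rule tens_ext[OF grp_TT addhom_comp[OF lact_tens_hom(1)[OF b] \<beta>]
        addhom_sum2[OF grp_TT addhom_comp[OF g P.A.TB.r_hom_left[OF \<delta>c[OF b]]] addhom_comp[OF \<beta> P.A.TB.l_hom[OF jc[OF b]]]] _ t])
    fix p q assume p: "p \<in> carrier B" and q: "q \<in> carrier B"
    have "\<beta> (lact TBB b (pt p q)) = ?h (b \<otimes>\<^bsub>B\<^esub> p) q"
      by (simp only: lact_tens_hom(2)[OF b p q] \<beta>pt A.m_closed b p q)
    also have "\<dots> = ract TT (\<delta> b) (g (pt p q)) \<oplus>\<^bsub>TT\<^esub> lact TT (j b) (\<beta> (pt p q))"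
      by (simp only: \<beta>pt gpt \<delta>L jm b p q cl P.A.TB.r_add P.A.TB.l_add P.A.TB.r_mult P.A.TB.l_mult P.A.TB.lr_assoc P.A.T.a_assoc)
    finally show "\<beta> (lact TBB b (pt p q)) = ract TT (\<delta> b) (g (pt p q)) \<oplus>\<^bsub>TT\<^esub> lact TT (j b) (\<beta> (pt p q))" .
  qed
  moreover have "\<beta> (ract TBB t b) = ract TT (\<beta> t) (j b) \<oplus>\<^bsub>TT\<^esub> lact TT (g t) (\<delta> b)"
    if b: "b \<in> carrier B" and t: "t \<in> carrier TBB" for b t
  proof (rule tens_ext[OF grp_TT addhom_comp[OF ract_tens_hom(1)[OF b] \<beta>]
        addhom_sum2[OF grp_TT addhom_comp[OF \<beta> P.A.TB.r_hom[OF jc[OF b]]] addhom_comp[OF g P.A.TB.l_hom_left[OF \<delta>c[OF b]]]] _ t])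
    fix p q assume p: "p \<in> carrier B" and q: "q \<in> carrier B"
    have "\<beta> (ract TBB (pt p q) b) = ?h p (q \<otimes>\<^bsub>B\<^esub> b)"
      by (simp only: ract_tens_hom(2)[OF b p q] \<beta>pt A.m_closed b p q)
    also have "\<dots> = ract TT (\<beta> (pt p q)) (j b) \<oplus>\<^bsub>TT\<^esub> lact TT (g (pt p q)) (\<delta> b)"
      by (simp only: \<beta>pt gpt \<delta>L jm b p q cl P.A.TB.r_add P.A.TB.l_add P.A.TB.r_mult P.A.TB.l_mult P.A.TB.lr_assoc P.A.T.a_assoc)
    finally show "\<beta> (ract TBB (pt p q) b) = ract TT (\<beta> (pt p q)) (j b) \<oplus>\<^bsub>TT\<^esub> lact TT (g (pt p q)) (\<delta> b)" .
  qed
  ultimately show ?thesis using \<beta> by blast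
qed

text \<open>E_i is only projective, so the connection is a sum of the local ones, each composed with
  a coordinate function. The extra Leibniz terms add up correctly because the elements
  \<open>Ei.tact (x k) (\<phi> k e)\<close> sum to e.\<close>

lemma leibniz_component:
  assumes \<delta>: "P.derT \<delta>" and \<delta>w: "\<And>b. b \<in> carrier B \<Longrightarrow> \<delta> b \<in> TW 0" and i: "i \<in> {1..N}"
  shows "\<exists>\<nu>\<in>addhom (E i) TT. (\<forall>e\<in>carrier (E i). \<nu> e \<in> TW (int i)) \<and>
    (\<forall>b\<in>carrier B. \<forall>e\<in>carrier (E i). \<nu> (lact (E i) b e) = ract TT (\<delta> b) (iE i e) \<oplus>\<^bsub>TT\<^esub> lact TT (j b) (\<nu> e) \<and>
       \<nu> (ract (E i) e b) = ract TT (\<nu> e) (j b) \<oplus>\<^bsub>TT\<^esub> lact TT (iE i e) (\<delta> b))"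
proof -
  interpret Ei: kbiact K R B "E i" "lact (E i)" "ract (E i)" by (rule E_kbiact[OF i])
  from E_dual_basis[OF i] obtain J :: "'e set" and x \<phi> where J: "finite J"
    and J1: "\<forall>k\<in>J. x k \<in> carrier (E i) \<and> \<phi> k \<in> bimod_hom B (E i) TBB"
    and J2: "\<forall>v\<in>carrier (E i). v = (\<Oplus>\<^bsub>E i\<^esub>k\<in>J. Ei.tact (x k) (\<phi> k v))"
    by (elim exE conjE)
  have x: "x k \<in> carrier (E i)" and \<phi>h: "\<phi> k \<in> addhom (E i) TBB"
    and \<phi>b: "\<And>b e. b \<in> carrier B \<Longrightarrow> e \<in> carrier (E i) \<Longrightarrow> \<phi> k (lact (E i) b e) = lact TBB b (\<phi> k e) \<and> \<phi> k (ract (E i) e b) = ract TBB (\<phi> k e) b"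
    if "k \<in> J" for k
    using J1 that by (auto simp: bimod_hom_def)
  note \<phi>c = addhom_closed[OF \<phi>h]
  have \<delta>c: "\<delta> b \<in> carrier TT" if "b \<in> carrier B" for b by (rule P.A.TW_closed[OF \<delta>w[OF that]])
  let ?g = "\<lambda>k t. iE i (Ei.tact (x k) t)"
  have gh: "?g k \<in> addhom TBB AA" if "k \<in> J" for k
    by (rule addhom_comp[OF Ei.tact_hom(1)[OF x[OF that]] iE_hom[OF i]])
  have gpt: "?g k (pt p q) = j p \<otimes>\<^bsub>AA\<^esub> (iE i (x k) \<otimes>\<^bsub>AA\<^esub> j q)" if k: "k \<in> J" and p: "p \<in> carrier B" and q: "q \<in> carrier B" for k p q
    unfolding Ei.tact_hom(2)[OF x[OF k] p q] iE_act(1)[OF i p Ei.r_closed[OF q x[OF k]]] iE_act(2)[OF i q x[OF k]] ..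
  have "\<forall>k\<in>J. \<exists>\<beta>\<in>addhom TBB TT. (\<forall>t\<in>carrier TBB. \<beta> t \<in> TW (int i)) \<and>
    (\<forall>b\<in>carrier B. \<forall>t\<in>carrier TBB. \<beta> (lact TBB b t) = ract TT (\<delta> b) (?g k t) \<oplus>\<^bsub>TT\<^esub> lact TT (j b) (\<beta> t) \<and>
       \<beta> (ract TBB t b) = ract TT (\<beta> t) (j b) \<oplus>\<^bsub>TT\<^esub> lact TT (?g k t) (\<delta> b))"
    using leibniz_piece[OF \<delta> \<delta>w iEw[OF i x] gh gpt] by blast
  from bchoice[OF this[unfolded Bex_def]] obtain \<beta> where
    \<beta>: "\<forall>k\<in>J. \<beta> k \<in> addhom TBB TT \<and> (\<forall>t\<in>carrier TBB. \<beta> k t \<in> TW (int i)) \<and>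
    (\<forall>b\<in>carrier B. \<forall>t\<in>carrier TBB. \<beta> k (lact TBB b t) = ract TT (\<delta> b) (?g k t) \<oplus>\<^bsub>TT\<^esub> lact TT (j b) (\<beta> k t) \<and>
       \<beta> k (ract TBB t b) = ract TT (\<beta> k t) (j b) \<oplus>\<^bsub>TT\<^esub> lact TT (?g k t) (\<delta> b))" by blast
  let ?\<nu> = "\<lambda>e. \<Oplus>\<^bsub>TT\<^esub>k\<in>J. \<beta> k (\<phi> k e)"
  have bh: "(\<lambda>e. \<beta> k (\<phi> k e)) \<in> addhom (E i) TT" if "k \<in> J" for k using addhom_comp[OF \<phi>h[OF that]] \<beta> that by blast
  have bw: "\<beta> k (\<phi> k e) \<in> TW (int i)" if "k \<in> J" "e \<in> carrier (E i)" for k e using \<beta> \<phi>c[OF that] that(1) by blast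
  have bc: "(\<lambda>k. \<beta> k (\<phi> k e)) \<in> J \<rightarrow> carrier TT" if "e \<in> carrier (E i)" for e using P.A.TW_closed[OF bw[OF _ that]] by blast
  have gc: "(\<lambda>k. ?g k (\<phi> k e)) \<in> J \<rightarrow> carrier AA" if "e \<in> carrier (E i)" for e using addhom_closed[OF gh \<phi>c[OF _ that]] by blast
  \<comment> \<open>The dual basis expansion pushed into A. It collects the factors next to
    \<delta>(b) from all k into e itself.\<close>
  have gsum: "(\<Oplus>\<^bsub>AA\<^esub>k\<in>J. ?g k (\<phi> k e)) = iE i e" if e: "e \<in> carrier (E i)" for e
  proof -
    have tc: "(\<lambda>k. Ei.tact (x k) (\<phi> k e)) \<in> J \<rightarrow> carrier (E i)" using Ei.tact_closed[OF x \<phi>c[OF _ e]] by blast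
    have "iE i e = iE i (\<Oplus>\<^bsub>E i\<^esub>k\<in>J. Ei.tact (x k) (\<phi> k e))" by (rule arg_cong[OF J2[rule_format, OF e]])
    then show ?thesis using addhom_finsum[OF E_grp[OF i] grp_AA iE_hom[OF i] J tc] by (simp only:)
  qed
  show ?thesis
  proof (intro bexI[of _ ?\<nu>] conjI ballI)
    show "?\<nu> \<in> addhom (E i) TT" by (rule addhom_finsum_maps[OF grp_TT J bh])
    show "?\<nu> e \<in> TW (int i)" if e: "e \<in> carrier (E i)" for e
      unfolding tens_wt_def by (rule span_finsum[OF grp_TT P.A.TW_gens J]) (use bw[OF _ e] in \<open>simp add: tens_wt_def\<close>)
    fix b e assume b: "b \<in> carrier B" and e: "e \<in> carrier (E i)"
    have h1: "ract TT (\<delta> b) \<in> addhom AA TT" by (rule P.A.TB.r_hom_left[OF \<delta>c[OF b]])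
    have h2: "lact TT (j b) \<in> addhom TT TT" by (rule P.A.TB.l_hom[OF jc[OF b]])
    have h3: "(\<lambda>t. ract TT t (j b)) \<in> addhom TT TT" by (rule P.A.TB.r_hom[OF jc[OF b]])
    have h4: "(\<lambda>a. lact TT a (\<delta> b)) \<in> addhom AA TT" by (rule P.A.TB.l_hom_left[OF \<delta>c[OF b]])
    have c1: "(\<lambda>k. ract TT (\<delta> b) (?g k (\<phi> k e))) \<in> J \<rightarrow> carrier TT" using addhom_closed[OF h1] gc[OF e] by blast
    have c2: "(\<lambda>k. lact TT (j b) (\<beta> k (\<phi> k e))) \<in> J \<rightarrow> carrier TT" using addhom_closed[OF h2] bc[OF e] by blast
    have c3: "(\<lambda>k. ract TT (\<beta> k (\<phi> k e)) (j b)) \<in> J \<rightarrow> carrier TT" using addhom_closed[OF h3] bc[OF e] by blast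
    have c4: "(\<lambda>k. lact TT (?g k (\<phi> k e)) (\<delta> b)) \<in> J \<rightarrow> carrier TT" using addhom_closed[OF h4] gc[OF e] by blast
    have "?\<nu> (lact (E i) b e) = (\<Oplus>\<^bsub>TT\<^esub>k\<in>J. ract TT (\<delta> b) (?g k (\<phi> k e)) \<oplus>\<^bsub>TT\<^esub> lact TT (j b) (\<beta> k (\<phi> k e)))"
    proof (rule P.A.T.finsum_cong')
      show "(\<lambda>k. ract TT (\<delta> b) (?g k (\<phi> k e)) \<oplus>\<^bsub>TT\<^esub> lact TT (j b) (\<beta> k (\<phi> k e))) \<in> J \<rightarrow> carrier TT"
        using c1 c2 P.A.T.a_closed by blast
      show "\<beta> k (\<phi> k (lact (E i) b e)) = ract TT (\<delta> b) (?g k (\<phi> k e)) \<oplus>\<^bsub>TT\<^esub> lact TT (j b) (\<beta> k (\<phi> k e))" if "k \<in> J" for k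
        using \<beta> \<phi>b[OF that b e] that b \<phi>c[OF that e] by simp
    qed simp
    also have "\<dots> = ract TT (\<delta> b) (\<Oplus>\<^bsub>AA\<^esub>k\<in>J. ?g k (\<phi> k e)) \<oplus>\<^bsub>TT\<^esub> lact TT (j b) (?\<nu> e)"
      unfolding P.A.T.finsum_addf[OF c1 c2] addhom_finsum[OF grp_AA grp_TT h1 J gc[OF e]] addhom_finsum[OF grp_TT grp_TT h2 J bc[OF e]] ..
    finally show "?\<nu> (lact (E i) b e) = ract TT (\<delta> b) (iE i e) \<oplus>\<^bsub>TT\<^esub> lact TT (j b) (?\<nu> e)" unfolding gsum[OF e] .
    have "?\<nu> (ract (E i) e b) = (\<Oplus>\<^bsub>TT\<^esub>k\<in>J. ract TT (\<beta> k (\<phi> k e)) (j b) \<oplus>\<^bsub>TT\<^esub> lact TT (?g k (\<phi> k e)) (\<delta> b))"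
    proof (rule P.A.T.finsum_cong')
      show "(\<lambda>k. ract TT (\<beta> k (\<phi> k e)) (j b) \<oplus>\<^bsub>TT\<^esub> lact TT (?g k (\<phi> k e)) (\<delta> b)) \<in> J \<rightarrow> carrier TT"
        using c3 c4 P.A.T.a_closed by blast
      show "\<beta> k (\<phi> k (ract (E i) e b)) = ract TT (\<beta> k (\<phi> k e)) (j b) \<oplus>\<^bsub>TT\<^esub> lact TT (?g k (\<phi> k e)) (\<delta> b)" if "k \<in> J" for k
        using \<beta> \<phi>b[OF that b e] that b \<phi>c[OF that e] by simp
    qed simp
    also have "\<dots> = ract TT (?\<nu> e) (j b) \<oplus>\<^bsub>TT\<^esub> lact TT (\<Oplus>\<^bsub>AA\<^esub>k\<in>J. ?g k (\<phi> k e)) (\<delta> b)"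
      unfolding P.A.T.finsum_addf[OF c3 c4] addhom_finsum[OF grp_AA grp_TT h4 J gc[OF e]] addhom_finsum[OF grp_TT grp_TT h3 J bc[OF e]] ..
    finally show "?\<nu> (ract (E i) e b) = ract TT (?\<nu> e) (j b) \<oplus>\<^bsub>TT\<^esub> lact TT (iE i e) (\<delta> b)" unfolding gsum[OF e] .
  qed
qed

text \<open>The connections on the summands are added up to a map on M and handed to
  \<open>DW_lift\<close>. In weight 0 there is no sign in the Leibniz rule.\<close>

lemma derivation_lift:
  assumes \<delta>: "P.derT \<delta>" and \<delta>w: "\<And>b. b \<in> carrier B \<Longrightarrow> \<delta> b \<in> TW 0"
  shows "\<exists>\<Theta>\<in>DW 0. \<forall>b\<in>carrier B. \<Theta> (j b) = \<delta> b"
proof -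
  let ?P = "\<lambda>i \<nu>. \<nu> \<in> addhom (E i) TT \<and> (\<forall>e\<in>carrier (E i). \<nu> e \<in> TW (int i)) \<and>
    (\<forall>b\<in>carrier B. \<forall>e\<in>carrier (E i). \<nu> (lact (E i) b e) = ract TT (\<delta> b) (iE i e) \<oplus>\<^bsub>TT\<^esub> lact TT (j b) (\<nu> e) \<and>
       \<nu> (ract (E i) e b) = ract TT (\<nu> e) (j b) \<oplus>\<^bsub>TT\<^esub> lact TT (iE i e) (\<delta> b))"
  have "\<forall>i\<in>{1..N}. \<exists>\<nu>. ?P i \<nu>"
    by (rule ballI, rule leibniz_component[OF \<delta> _, unfolded Bex_def]) (rule \<delta>w)
  from bchoice[OF this] obtain \<nu> where \<nu>: "\<forall>i\<in>{1..N}. ?P i (\<nu> i)" by (elim exE)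
  have fin: "finite {1..N}" by simp
  have nh: "\<nu> i \<in> addhom (E i) TT" if "i \<in> {1..N}" for i using \<nu>[rule_format, OF that] by (rule conjunct1)
  note \<nu>w = \<nu>[rule_format, THEN conjunct2, THEN conjunct1, rule_format] and \<nu>a = \<nu>[rule_format, THEN conjunct2, THEN conjunct2, rule_format]
  note nc = addhom_closed[OF nh]
  have \<delta>c: "\<delta> b \<in> carrier TT" if "b \<in> carrier B" for b by (rule P.A.TW_closed[OF \<delta>w[OF that]])
  let ?\<mu> = "\<lambda>m. \<Oplus>\<^bsub>TT\<^esub>i\<in>{1..N}. \<nu> i (m i)"
  have \<mu>: "?\<mu> \<in> addhom M TT"
  proof (rule addhom_finsum_maps[OF grp_TT fin])
    fix i assume i: "i \<in> {1..N}"
    have "(\<lambda>m. m i) \<in> addhom M (E i)" by (rule addhomI) (use M_app[OF _ i] M_ap[OF i] in simp_all)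
    then show "(\<lambda>m. \<nu> i (m i)) \<in> addhom M TT" by (rule addhom_comp[OF _ nh[OF i]])
  qed
  have \<mu>E: "?\<mu> (inE i e) = \<nu> i e" if i: "i \<in> {1..N}" and e: "e \<in> carrier (E i)" for i e
  proof -
    have "?\<mu> (inE i e) = (\<Oplus>\<^bsub>TT\<^esub>k\<in>{1..N}. if i = k then \<nu> i e else \<zero>\<^bsub>TT\<^esub>)"
    proof (rule P.A.T.finsum_cong')
      show "(\<lambda>k. if i = k then \<nu> i e else \<zero>\<^bsub>TT\<^esub>) \<in> {1..N} \<rightarrow> carrier TT" using nc[OF i e] by (auto simp del: One_nat_def)
      show "\<nu> k (inE i e k) = (if i = k then \<nu> i e else \<zero>\<^bsub>TT\<^esub>)" if k: "k \<in> {1..N}" for k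
        using addhom_zero[OF E_grp[OF k] grp_TT nh[OF k]] by (auto simp: inE_ap[OF k])
    qed simp
    also have "\<dots> = \<nu> i e"
      by (rule P.A.T.finsum_singleton[OF i fin, of "\<lambda>_. \<nu> i e"]) (use nc[OF i e] in blast)
    finally show ?thesis .
  qed
  note h1 = P.A.TB.r_hom_left[OF \<delta>c] and h4 = P.A.TB.l_hom_left[OF \<delta>c]
  have ih: "inc \<in> addhom M AA" using MB.incl_addhom by (simp add: hom_def)
  note ext = M_ext[OF grp_TT]
  have "\<exists>\<Theta>\<in>DW 0. (\<forall>b\<in>carrier B. \<Theta> (j b) = \<delta> b) \<and> (\<forall>m\<in>carrier M. \<Theta> (inc m) = ?\<mu> m)"
  proof (rule DW_lift[OF \<delta> \<delta>w \<mu>])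
    fix q m assume m: "m \<in> Mw q"
    have "?\<mu> m \<in> TW q" unfolding tens_wt_def
    proof (rule span_finsum[OF grp_TT P.A.TW_gens fin], fold tens_wt_def)
      fix i assume i: "i \<in> {1..N}"
      show "\<nu> i (m i) \<in> TW q"
      proof (cases "int i = q")
        case True then show ?thesis using \<nu>w[OF i M_app[OF Mw_M[OF m] i]] by simp
      next
        case False
        then have "m i = \<zero>\<^bsub>E i\<^esub>" using m i by (simp add: dsum_wt_def)
        then show ?thesis using addhom_zero[OF E_grp[OF i] grp_TT nh[OF i]] P.A.TW_zero by simp
      qed
    qed
    then show "?\<mu> m \<in> TW (q + 0)" by simp
  next
    fix b m assume b: "b \<in> carrier B" and m: "m \<in> carrier M"
    show "?\<mu> (lact M b m) = ract TT (\<delta> b) (inc m) \<oplus>\<^bsub>TT\<^esub> lact TT (j b) (?\<mu> m)"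
    proof (rule ext[OF addhom_comp[OF MB.l_hom[OF b] \<mu>]
          addhom_sum2[OF grp_TT addhom_comp[OF ih h1[OF b]] addhom_comp[OF \<mu> P.A.TB.l_hom[OF jc[OF b]]]] _ m])
      fix i e assume i: "i \<in> {1..N}" and e: "e \<in> carrier (E i)"
      show "?\<mu> (lact M b (inE i e)) = ract TT (\<delta> b) (iE i e) \<oplus>\<^bsub>TT\<^esub> lact TT (j b) (?\<mu> (inE i e))"
        unfolding inE_rules(2)[OF i e b, symmetric] \<mu>E[OF i e] \<mu>E[OF i biact.l_closed[OF E_biact[OF i] b e]]
        by (rule \<nu>a[OF i b e, THEN conjunct1])
    qed
    have "?\<mu> (ract M m b) = ract TT (?\<mu> m) (j b) \<oplus>\<^bsub>TT\<^esub> lact TT (inc m) (\<delta> b)"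
    proof (rule ext[OF addhom_comp[OF MB.r_hom[OF b] \<mu>]
          addhom_sum2[OF grp_TT addhom_comp[OF \<mu> P.A.TB.r_hom[OF jc[OF b]]] addhom_comp[OF ih h4[OF b]]] _ m])
      fix i e assume i: "i \<in> {1..N}" and e: "e \<in> carrier (E i)"
      show "?\<mu> (ract M (inE i e) b) = ract TT (?\<mu> (inE i e)) (j b) \<oplus>\<^bsub>TT\<^esub> lact TT (iE i e) (\<delta> b)"
        unfolding inE_rules(3)[OF i e b, symmetric] \<mu>E[OF i e] \<mu>E[OF i biact.r_closed[OF E_biact[OF i] b e]]
        by (rule \<nu>a[OF i b e, THEN conjunct2])
    qed
    then show "?\<mu> (ract M m b) = ract TT (?\<mu> m) (j b) \<oplus>\<^bsub>TT\<^esub> lact TT (sg 0 (inc m)) (\<delta> b)" by simp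
  qed
  then show ?thesis by blast
qed

text \<open>The lift has image 1 (x) \<Delta> (x) 1 under \<open>eps\<close>. These elements
  generate the target as an A-bimodule, which makes \<open>eps\<close> onto.\<close>

lemma D_lift:
  assumes \<Delta>: "\<Delta> \<in> carrier D"
  shows "\<exists>\<Theta>\<in>DW 0. (\<forall>b\<in>carrier B. \<Theta> (j b) = tm (\<Delta> b)) \<and> eps \<Theta> = P.ID.pi3 \<one>\<^bsub>AA\<^esub> \<Delta> \<one>\<^bsub>AA\<^esub>"
proof -
  have dc: "\<Delta> b \<in> carrier TBB" if "b \<in> carrier B" for b by (rule D_apply[OF \<Delta> that])
  have d: "P.derT (\<lambda>b. tm (\<Delta> b))"
    unfolding P.derT_def
  proof (intro conjI ballI)
    show "(\<lambda>b. tm (\<Delta> b)) \<in> addhom B TT" by (rule addhom_comp[OF D_D(2)[OF \<Delta>] P.tm_hom])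
    show "tm (\<Delta> (umap B t)) = \<zero>\<^bsub>TT\<^esub>" if "t \<in> carrier R" for t
      unfolding D_D(3)[OF \<Delta> that] by (rule addhom_zero[OF T.abelian_group_axioms grp_TT P.tm_hom])
    show "tm (\<Delta> (x \<otimes>\<^bsub>B\<^esub> y)) = ract TT (tm (\<Delta> x)) (j y) \<oplus>\<^bsub>TT\<^esub> lact TT (j x) (tm (\<Delta> y))"
      if x: "x \<in> carrier B" and y: "y \<in> carrier B" for x y
      unfolding D_D(4)[OF \<Delta> x y] addhom_add[OF P.tm_hom TB.r_closed[OF y dc[OF x]] TB.l_closed[OF x dc[OF y]]]
        P.tm_inner(3)[OF x dc[OF y]] P.tm_inner(4)[OF y dc[OF x]] ..
  qed
  obtain \<Theta> where \<Theta>: "\<Theta> \<in> DW 0" "\<forall>b\<in>carrier B. \<Theta> (j b) = tm (\<Delta> b)" using derivation_lift[OF d tm_wt[OF dc]] by blast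
  have "eps \<Theta> = P.ID.pi3 \<one>\<^bsub>AA\<^esub> \<Delta> \<one>\<^bsub>AA\<^esub>"
  proof (rule P.eps_eqI[OF P.A.DW_DD[OF \<Theta>(1)] P.ID.pi3_closed[OF one_AA \<Delta> one_AA]])
    fix b assume b: "b \<in> carrier B"
    note t = P.tm_closed[OF dc[OF b]]
    show "P.ev b (P.ID.pi3 \<one>\<^bsub>AA\<^esub> \<Delta> \<one>\<^bsub>AA\<^esub>) = \<Theta> (j b)"
      unfolding P.ev_char(2)[OF b one_AA \<Delta> one_AA] P.A.ir_one[OF t] P.A.il_one[OF t] using \<Theta>(2) b by simp
  qed
  then show ?thesis using \<Theta> by blast
qed

lemma wt_induct [consumes 1, case_names zero wt add]:
  assumes a: "a \<in> carrier AA" and z: "P \<zero>\<^bsub>AA\<^esub>" and w: "\<And>p a. a \<in> wt AA p \<Longrightarrow> P a"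
    and ad: "\<And>x y. \<lbrakk>x \<in> carrier AA; y \<in> carrier AA; P x; P y\<rbrakk> \<Longrightarrow> P (x \<oplus>\<^bsub>AA\<^esub> y)"
  shows "P a"
proof -
  have c: "(\<Union>p. wt AA p) \<subseteq> carrier TA" using wt_TA by blast
  note g = grp_TA
  from a have "a \<in> span TA (\<Union>p. wt AA p)" using AA_span by simp
  then show ?thesis
  proof (induction rule: span_induct)
    case zero show ?case using z by simp
  next
    case (incl x) then show ?case using w by blast
  next
    case (inv x) then show ?case using w P.A.wt_inv by fastforce
  next
    case (add x y) then show ?case using ad span_closed[OF g c] by simp
  qed
qed

lemma eps_act_pi3:
  assumes a: "a \<in> wt AA p" and c: "c \<in> wt AA q" and \<Theta>: "\<Theta> \<in> DW n" and \<Delta>: "\<Delta> \<in> carrier D"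
    and e: "eps \<Theta> = P.ID.pi3 \<one>\<^bsub>AA\<^esub> \<Delta> \<one>\<^bsub>AA\<^esub>"
  shows "eps (lact DD a (ract DD \<Theta> c)) = P.ID.pi3 a \<Delta> c"
  by (simp only: P.eps_lact(1)[OF a P.A.DW_ract[OF c \<Theta>]] P.eps_lact(2)[OF c \<Theta>] e P.ID.ind_hom(4)[OF wtc[OF c] one_AA \<Delta> one_AA]
      P.A.A.l_one[OF wtc[OF c]] P.ID.ind_hom(2)[OF wtc[OF a] one_AA \<Delta> wtc[OF c]] P.A.A.r_one[OF wtc[OF a]])

lemma eps_surj: "x \<in> carrier UU \<Longrightarrow> x \<in> eps ` carrier DD"
proof (induction rule: P.ID.I.gen_induct)
  interpret DD: abelian_group DD by (rule grp_DD)
  note eh = P.eps_addhom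
  have z: "\<zero>\<^bsub>UU\<^esub> \<in> eps ` carrier DD" using addhom_zero[OF grp_DD grp_UU eh] DD.zero_closed by force
  have ad: "x \<oplus>\<^bsub>UU\<^esub> y \<in> eps ` carrier DD" if "x \<in> eps ` carrier DD" "y \<in> eps ` carrier DD" for x y
    using that addhom_add[OF eh] DD.a_closed by (auto intro!: image_eqI)
  case (gen g)
  then obtain a \<Delta> c where g: "g = (a, \<Delta>, c)" and a: "a \<in> carrier AA" and \<Delta>: "\<Delta> \<in> carrier D" and c: "c \<in> carrier AA" by auto
  have hw: "P.ID.pi3 a \<Delta> c \<in> eps ` carrier DD" if aw: "a \<in> wt AA p" and cw: "c \<in> wt AA q" for a c p q
  proof -
    from D_lift[OF \<Delta>] obtain \<Theta> where \<Theta>: "\<Theta> \<in> DW 0" "eps \<Theta> = P.ID.pi3 \<one>\<^bsub>AA\<^esub> \<Delta> \<one>\<^bsub>AA\<^esub>" by blast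
    note r = P.A.DW_ract[OF cw \<Theta>(1)]
    have "eps (lact DD a (ract DD \<Theta> c)) = P.ID.pi3 a \<Delta> c" by (rule eps_act_pi3[OF aw cw \<Theta>(1) \<Delta> \<Theta>(2)])
    then show ?thesis using P.A.DW_DD[OF P.A.DW_lact[OF aw r]] by force
  qed
  \<comment> \<open>Linearity of \<open>eps\<close> is available for homogeneous elements of A only,
    so the right and then the left coefficient are decomposed into homogeneous ones.\<close>
  have ha: "P.ID.pi3 a \<Delta> c \<in> eps ` carrier DD" if aw: "a \<in> wt AA p" for a p
    using c
  proof (induction rule: wt_induct)
    case zero show ?case unfolding pi3_zero(3)[OF DB.biact_axioms wtc[OF aw] \<Delta> one_AA] by (rule z)
  next
    case (wt q c) then show ?case by (rule hw[OF aw])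
  next
    case (add x y) then show ?case unfolding P.ID.pi3_rules(3)[OF wtc[OF aw] add(1) \<Delta> add(2)] by (intro ad)
  qed
  have "P.ID.pi3 a \<Delta> c \<in> eps ` carrier DD" using a
  proof (induction rule: wt_induct)
    case zero show ?case unfolding pi3_zero(1)[OF DB.biact_axioms one_AA \<Delta> c] by (rule z)
  next
    case (wt q c) then show ?case by (rule ha)
  next
    case (add x y) then show ?case unfolding P.ID.pi3_rules(1)[OF add(1) c \<Delta> add(2)] by (intro ad)
  qed
  then show ?case unfolding g .
next
  interpret DD: abelian_group DD by (rule grp_DD)
  case (diff x y)
  then show ?case using addhom_minus[OF grp_DD grp_UU P.eps_addhom] DD.minus_closed by (auto intro!: image_eqI)
next
  interpret DD: abelian_group DD by (rule grp_DD)
  case zero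
  show ?case using addhom_zero[OF grp_DD grp_UU P.eps_addhom] DD.zero_closed by force
qed

end

context bisym_iota
begin

section \<open>The induced map and its inverse\<close>

text \<open>Two derivations of the same weight with the same image under \<open>eps\<close> agree on
  B, so \<open>kernel\<close> applies to their difference. The common weight matters, because
  \<open>kernel\<close> speaks of homogeneous derivations.\<close>

lemma Phi_eps_eq:
  assumes \<Theta>: "\<Theta> \<in> DW n" and \<Theta>': "\<Theta>' \<in> DW n" and e: "eps \<Theta> = eps \<Theta>'"
  shows "Phi \<Theta> = Phi \<Theta>'"
proof -
  note d = P.A.DW_DD[OF \<Theta>] and d' = P.A.DW_DD[OF \<Theta>']
  interpret DD: abelian_group DD by (rule grp_DD)
  have "\<Theta> \<ominus>\<^bsub>DD\<^esub> \<Theta>' \<in> DW n" unfolding a_minus_def by (rule P.A.DW_add[OF \<Theta> P.A.DW_inv[OF \<Theta>']])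
  moreover have "(\<Theta> \<ominus>\<^bsub>DD\<^esub> \<Theta>') (j b) = \<zero>\<^bsub>TT\<^esub>" if b: "b \<in> carrier B" for b
  proof -
    have "\<Theta> (j b) = \<Theta>' (j b)" using P.eps_char(2)[OF d b] P.eps_char(2)[OF d' b] e by simp
    then show ?thesis
      unfolding addhom_minus[OF grp_DD grp_TT P.A.DD_eval[OF jc[OF b]] d d']
      using P.A.T.minus_eq_zero_iff[OF P.A.DD_apply[OF d jc[OF b]] P.A.DD_apply[OF d' jc[OF b]]] by simp
  qed
  ultimately have "Phi (\<Theta> \<ominus>\<^bsub>DD\<^esub> \<Theta>') = \<zero>\<^bsub>Y\<^esub>" by (rule kernel)
  then show ?thesis
    unfolding addhom_minus[OF grp_DD grp_Y Phi_hom d d']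
    using IE.I.minus_eq_zero_iff[OF addhom_closed[OF Phi_hom d] addhom_closed[OF Phi_hom d']] by simp
qed

text \<open>The map is first given on derivations of B, by lifting them and applying
  \<open>Phi\<close>. It is then extended to a (x) \<Delta> (x) c by linearity, and finally compared
  with \<open>Phi\<close> on all of the source.\<close>

lemma induced_map_exists: "\<exists>t\<in>addhom UU Y. (\<forall>\<Theta>\<in>carrier DD. t (eps \<Theta>) = Phi \<Theta>) \<and> (\<forall>n. UW n \<subseteq> eps ` DW n)"
proof -
  let ?o = "\<one>\<^bsub>AA\<^esub>"
  have "\<forall>\<Delta>\<in>carrier D. \<exists>\<Theta>. \<Theta> \<in> DW 0 \<and> eps \<Theta> = P.ID.pi3 ?o \<Delta> ?o" using D_lift by blast
  from bchoice[OF this] obtain \<theta> where "\<forall>\<Delta>\<in>carrier D. \<theta> \<Delta> \<in> DW 0 \<and> eps (\<theta> \<Delta>) = P.ID.pi3 ?o \<Delta> ?o" by (elim exE)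
  then have \<theta>: "\<theta> \<Delta> \<in> DW 0" and \<theta>e: "eps (\<theta> \<Delta>) = P.ID.pi3 ?o \<Delta> ?o" if "\<Delta> \<in> carrier D" for \<Delta> using that by blast+
  note \<theta>D = P.A.DW_DD[OF \<theta>]
  \<comment> \<open>The lifts are chosen freely, but by \<open>Phi_eps_eq\<close> the value does not
    depend on them; additivity and linearity of \<open>F\<close> follow although the choice
    \<open>\<theta>\<close> has neither.\<close>
  define F where "F \<Delta> = Phi (\<theta> \<Delta>)" for \<Delta>
  have Fc: "F \<Delta> \<in> carrier Y" if "\<Delta> \<in> carrier D" for \<Delta> unfolding F_def by (rule addhom_closed[OF Phi_hom \<theta>D[OF that]])
  have F_add: "F (\<Delta> \<oplus>\<^bsub>D\<^esub> \<Delta>') = F \<Delta> \<oplus>\<^bsub>Y\<^esub> F \<Delta>'" if \<Delta>: "\<Delta> \<in> carrier D" and \<Delta>': "\<Delta>' \<in> carrier D" for \<Delta> \<Delta>'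
  proof -
    note s = D_add_closed[OF \<Delta> \<Delta>']
    have "eps (\<theta> (\<Delta> \<oplus>\<^bsub>D\<^esub> \<Delta>')) = eps (\<theta> \<Delta> \<oplus>\<^bsub>DD\<^esub> \<theta> \<Delta>')"
      unfolding \<theta>e[OF s] P.ID.pi3_rules(2)[OF one_AA one_AA \<Delta> \<Delta>'] addhom_add[OF P.eps_addhom \<theta>D[OF \<Delta>] \<theta>D[OF \<Delta>']] \<theta>e[OF \<Delta>] \<theta>e[OF \<Delta>'] ..
    then show ?thesis unfolding F_def addhom_add[OF Phi_hom \<theta>D[OF \<Delta>] \<theta>D[OF \<Delta>'], symmetric]
      by (rule Phi_eps_eq[OF \<theta>[OF s] P.A.DW_add[OF \<theta>[OF \<Delta>] \<theta>[OF \<Delta>']]])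
  qed
  have F_l: "F (lact D b \<Delta>) = lact Y (j b) (F \<Delta>)" if b: "b \<in> carrier B" and \<Delta>: "\<Delta> \<in> carrier D" for b \<Delta>
  proof -
    note s = D_act_closed(1)[OF b \<Delta>] and jb = jc[OF b]
    have w: "lact DD (j b) (\<theta> \<Delta>) \<in> DW 0" using P.A.DW_lact[OF j_wt[OF b] \<theta>[OF \<Delta>]] by simp
    have "P.ID.pi3 (j b \<otimes>\<^bsub>AA\<^esub> ?o) \<Delta> ?o = P.ID.pi3 (?o \<otimes>\<^bsub>AA\<^esub> j b) \<Delta> ?o"
      by (simp only: P.A.A.r_one[OF jb] P.A.A.l_one[OF jb])
    then have "eps (\<theta> (lact D b \<Delta>)) = eps (lact DD (j b) (\<theta> \<Delta>))"
      by (simp only: \<theta>e[OF s] P.eps_lact(1)[OF j_wt[OF b] \<theta>[OF \<Delta>]] \<theta>e[OF \<Delta>] P.ID.ind_hom(2)[OF jb one_AA \<Delta> one_AA]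
          P.ID.pi3_rules(4)[OF one_AA one_AA \<Delta> b])
    then have "F (lact D b \<Delta>) = Phi (lact DD (j b) (\<theta> \<Delta>))" unfolding F_def by (rule Phi_eps_eq[OF \<theta>[OF s] w])
    then show ?thesis unfolding F_def Phi_act(1)[OF jb \<theta>D[OF \<Delta>]] .
  qed
  have F_r: "F (ract D \<Delta> b) = ract Y (F \<Delta>) (j b)" if b: "b \<in> carrier B" and \<Delta>: "\<Delta> \<in> carrier D" for b \<Delta>
  proof -
    note s = D_act_closed(2)[OF b \<Delta>] and jb = jc[OF b]
    have w: "ract DD (\<theta> \<Delta>) (j b) \<in> DW 0" using P.A.DW_ract[OF j_wt[OF b] \<theta>[OF \<Delta>]] by simp
    have "P.ID.pi3 ?o \<Delta> (?o \<otimes>\<^bsub>AA\<^esub> j b) = P.ID.pi3 ?o \<Delta> (j b \<otimes>\<^bsub>AA\<^esub> ?o)"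
      by (simp only: P.A.A.r_one[OF jb] P.A.A.l_one[OF jb])
    then have "eps (\<theta> (ract D \<Delta> b)) = eps (ract DD (\<theta> \<Delta>) (j b))"
      by (simp only: \<theta>e[OF s] P.eps_lact(2)[OF j_wt[OF b] \<theta>[OF \<Delta>]] \<theta>e[OF \<Delta>] P.ID.ind_hom(4)[OF jb one_AA \<Delta> one_AA]
          P.ID.pi3_rules(5)[OF one_AA one_AA \<Delta> b])
    then have "F (ract D \<Delta> b) = Phi (ract DD (\<theta> \<Delta>) (j b))" unfolding F_def by (rule Phi_eps_eq[OF \<theta>[OF s] w])
    then show ?thesis unfolding F_def Phi_act(2)[OF jb \<theta>D[OF \<Delta>]] P.sg_j[OF b] .
  qed
  \<comment> \<open>The right coefficient is twisted because \<open>Phi\<close>, like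
    iota(\<omega>), is right linear only up to the sign of passing \<omega>, which has weight
    N.\<close>
  let ?s = "sg (int N)"
  let ?h = "\<lambda>a \<Delta> c. lact Y a (ract Y (F \<Delta>) (?s c))"
  note sc = P.A.sg_closed[of _ "int N"]
  note cl = IE.IB.l_closed IE.IB.r_closed Fc sc jc D_add_closed D_act_closed
  have "\<exists>L. L \<in> addhom UU Y \<and> (\<forall>a\<in>carrier AA. \<forall>\<Delta>\<in>carrier D. \<forall>c\<in>carrier AA. L (P.ID.pi3 a \<Delta> c) = ?h a \<Delta> c)"
    by (rule P.ID.ind_lift[OF grp_Y])
      (simp_all only: cl F_add F_l F_r P.A.sg_add P.A.sg_mult P.sg_j IE.IB.l_plus IE.IB.r_plus IE.IB.l_add IE.IB.r_add IE.IB.l_mult IE.IB.r_mult IE.IB.lr_assoc)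
  then obtain t where t: "t \<in> addhom UU Y" and tp: "\<forall>a\<in>carrier AA. \<forall>\<Delta>\<in>carrier D. \<forall>c\<in>carrier AA. t (P.ID.pi3 a \<Delta> c) = ?h a \<Delta> c" by (elim exE conjE)
  interpret DD: abelian_group DD by (rule grp_DD)
  note eh = P.eps_addhom
  let ?G = "\<lambda>n. {P.ID.pi3 a v c |a v c p q r. a \<in> wt AA p \<and> v \<in> placed 0 D q \<and> c \<in> wt AA r \<and> p + q + r = n}"
  have z0: "\<exists>\<Theta>\<in>DW n. eps \<Theta> = \<zero>\<^bsub>UU\<^esub> \<and> t \<zero>\<^bsub>UU\<^esub> = Phi \<Theta>" for n
    by (rule bexI[OF _ P.A.DW_zero])
      (simp only: addhom_zero[OF grp_DD grp_UU eh] addhom_zero[OF grp_DD grp_Y Phi_hom] addhom_zero[OF grp_UU grp_Y t] simp_thms)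
  have gen: "\<exists>\<Theta>\<in>DW n. eps \<Theta> = x \<and> t x = Phi \<Theta>" if "x \<in> ?G n" for x n
  proof -
    from that obtain a \<Delta> c p q r where x: "x = P.ID.pi3 a \<Delta> c" and a: "a \<in> wt AA p" and \<Delta>': "\<Delta> \<in> placed 0 D q" and c: "c \<in> wt AA r" and pqr: "p + q + r = n"
      by blast
    have \<Delta>: "\<Delta> \<in> carrier D" using \<Delta>' DB.V.zero_closed by (auto simp: placed_def split: if_splits)
    show ?thesis
    proof (cases "q = 0")
      case True
      note w = P.A.DW_ract[OF c \<theta>[OF \<Delta>]]
      have "lact DD a (ract DD (\<theta> \<Delta>) c) \<in> DW n" using P.A.DW_lact[OF a w] pqr True by (simp add: algebra_simps)
      moreover have "eps (lact DD a (ract DD (\<theta> \<Delta>) c)) = x" unfolding x by (rule eps_act_pi3[OF a c \<theta>[OF \<Delta>] \<Delta> \<theta>e[OF \<Delta>]])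
      moreover have "t x = Phi (lact DD a (ract DD (\<theta> \<Delta>) c))"
        unfolding x tp[rule_format, OF wtc[OF a] \<Delta> wtc[OF c]] Phi_act(1)[OF wtc[OF a] P.A.DW_DD[OF w]] Phi_act(2)[OF wtc[OF c] \<theta>D[OF \<Delta>]] F_def ..
      ultimately show ?thesis by blast
    next
      case False
      then have "\<Delta> = \<zero>\<^bsub>D\<^esub>" using \<Delta>' by (simp add: placed_def)
      then have "x = \<zero>\<^bsub>UU\<^esub>" using x pi3_zero(2)[OF DB.biact_axioms wtc[OF a] \<Delta> wtc[OF c]] by simp
      then show ?thesis
        using z0 by simp
    qed
  qed
  \<comment> \<open>A homogeneous element has a preimage of the same weight on which the map agrees
    with \<open>Phi\<close>. The equal weights allow this preimage to be compared with any other by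
    \<open>Phi_eps_eq\<close>.\<close>
  have UWlift: "\<exists>\<Theta>\<in>DW n. eps \<Theta> = x \<and> t x = Phi \<Theta>" if "x \<in> UW n" for x n
    using that unfolding ind_wt_def
  proof (induction rule: span_induct)
    case zero
    show ?case by (rule z0)
  next
    case (incl x) then show ?case by (rule gen)
  next
    case (inv x)
    from gen[OF inv] obtain \<Theta> where \<Theta>: "\<Theta> \<in> DW n" "eps \<Theta> = x" "t x = Phi \<Theta>" by blast
    have xc: "x \<in> carrier UU" using addhom_closed[OF eh P.A.DW_DD[OF \<Theta>(1)]] \<Theta>(2) by simp
    show ?case
      by (rule bexI[OF _ P.A.DW_inv[OF \<Theta>(1)]])
        (simp only: addhom_inv[OF grp_DD grp_UU eh P.A.DW_DD[OF \<Theta>(1)]] addhom_inv[OF grp_DD grp_Y Phi_hom P.A.DW_DD[OF \<Theta>(1)]] addhom_inv[OF grp_UU grp_Y t xc] \<Theta>(2,3) simp_thms)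
  next
    case (add x y)
    from add.IH obtain \<Theta> \<Theta>' where \<Theta>: "\<Theta> \<in> DW n" "eps \<Theta> = x" "t x = Phi \<Theta>" "\<Theta>' \<in> DW n" "eps \<Theta>' = y" "t y = Phi \<Theta>'" by blast
    note d = P.A.DW_DD[OF \<Theta>(1)] P.A.DW_DD[OF \<Theta>(4)]
    have xc: "x \<in> carrier UU" "y \<in> carrier UU" using addhom_closed[OF eh d(1)] addhom_closed[OF eh d(2)] \<Theta>(2,5) by simp_all
    show ?case
      by (rule bexI[OF _ P.A.DW_add[OF \<Theta>(1,4)]])
        (simp only: addhom_add[OF eh d] addhom_add[OF Phi_hom d] addhom_add[OF t xc] \<Theta>(2,3,5,6) simp_thms)
  qed
  have "t (eps \<Theta>) = Phi \<Theta>" if "\<Theta> \<in> carrier DD" for \<Theta>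
  proof (rule P.A.DD_hom_ext[OF grp_Y addhom_comp[OF eh t] Phi_hom _ that])
    fix n \<Theta> assume \<Theta>: "\<Theta> \<in> DW n"
    from UWlift[OF P.eps_wt[OF \<Theta>]] obtain \<Theta>' where \<Theta>': "\<Theta>' \<in> DW n" "eps \<Theta>' = eps \<Theta>" "t (eps \<Theta>) = Phi \<Theta>'" by blast
    show "t (eps \<Theta>) = Phi \<Theta>" unfolding \<Theta>'(3) by (rule Phi_eps_eq[OF \<Theta>'(1) \<Theta> \<Theta>'(2)])
  qed
  moreover have "UW n \<subseteq> eps ` DW n" for n using UWlift by blast
  ultimately show ?thesis using t by blast
qed

section \<open>The inverse of the induced map\<close>

definition kap where "kap \<xi> = eps (inv_into (carrier DD) io \<xi>)"

lemma kap_io: "\<Theta> \<in> carrier DD \<Longrightarrow> kap (io \<Theta>) = eps \<Theta>"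
  unfolding kap_def using inv_into_f_f[OF bij_betw_imp_inj_on[OF io_rules(2)]] by simp

lemma io_onto: "\<xi> \<in> carrier OA \<Longrightarrow> \<exists>\<Theta>\<in>carrier DD. io \<Theta> = \<xi>"
proof -
  assume "\<xi> \<in> carrier OA"
  then have "\<xi> \<in> io ` carrier DD" by (simp only: bij_betw_imp_surj_on[OF io_rules(2)])
  then show ?thesis by (rule imageE) (rule bexI, erule sym)
qed

lemma kap_hom: "kap \<in> addhom OA UU"
proof (rule addhomI)
  interpret DD: abelian_group DD by (rule grp_DD)
  show "kap \<xi> \<in> carrier UU" if "\<xi> \<in> carrier OA" for \<xi>
  proof -
    from io_onto[OF that] obtain \<Theta> where \<Theta>: "\<Theta> \<in> carrier DD" "io \<Theta> = \<xi>" by blast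
    show ?thesis unfolding \<Theta>(2)[symmetric] kap_io[OF \<Theta>(1)] by (rule P.eps_char(1)[OF \<Theta>(1)])
  qed
  fix \<xi> \<eta> assume "\<xi> \<in> carrier OA" "\<eta> \<in> carrier OA"
  then obtain \<Theta> \<Theta>' where \<Theta>: "\<Theta> \<in> carrier DD" "io \<Theta> = \<xi>" "\<Theta>' \<in> carrier DD" "io \<Theta>' = \<eta>" using io_onto by blast
  show "kap (\<xi> \<oplus>\<^bsub>OA\<^esub> \<eta>) = kap \<xi> \<oplus>\<^bsub>UU\<^esub> kap \<eta>"
    using addhom_add[OF P.eps_addhom \<Theta>(1,3)]
    by (simp only: \<Theta>(2,4)[symmetric] addhom_add[OF io_rules(1) \<Theta>(1,3), symmetric] kap_io[OF DD.a_closed[OF \<Theta>(1,3)]] kap_io[OF \<Theta>(1)] kap_io[OF \<Theta>(3)])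
qed

lemma sgN_sgN: "c \<in> carrier AA \<Longrightarrow> sg (int N) (sg (int N) c) = c"
  unfolding P.A.sg_sg by (simp add: P.A.sg_def)

lemma du_lift:
  assumes "x \<in> wt AA q"
  obtains \<Theta> where "\<Theta> \<in> DW (q - int N)" "io \<Theta> = du R AA x"
proof -
  have "du R AA x \<in> io ` DW (q - int N)" using OW_du[OF assms] io_rules(3)[of "q - int N"] by simp
  then show ?thesis using that by blast
qed

text \<open>The inverse of \<open>io\<close> inherits right linearity up to twist, and the twist by
  N is its own inverse; so the right coefficient c reappears as \<open>sg (int N) c\<close>.\<close>

lemma kap_p1:
  assumes a: "a \<in> wt AA p" and x: "x \<in> wt AA q" and c: "c \<in> wt AA r"
  shows "kap (p1 a x c) = lact UU a (ract UU (kap (du R AA x)) (sg (int N) c))"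
proof -
  obtain \<Theta> where \<Theta>: "\<Theta> \<in> DW (q - int N)" "io \<Theta> = du R AA x" using du_lift[OF x] .
  let ?c = "sg (int N) c"
  have cw: "?c \<in> wt AA r" by (rule P.A.sg_wt_closed[OF c])
  note d = P.A.DW_DD[OF \<Theta>(1)] and r = P.A.DW_ract[OF cw \<Theta>(1)]
  have "p1 a x c = io (lact DD a (ract DD \<Theta> ?c))"
    unfolding io_rules(4)[OF wtc[OF a] P.A.DW_DD[OF r]] io_rules(5)[OF wtc[OF cw] d] sgN_sgN[OF wtc[OF c]] \<Theta>(2)
    by (rule P.A.O1.p1_eq[OF wtc[OF a] wtc[OF x] wtc[OF c]])
  then have "kap (p1 a x c) = eps (lact DD a (ract DD \<Theta> ?c))"
    using kap_io[OF P.A.DW_DD[OF P.A.DW_lact[OF a r]]] by simp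
  also have "\<dots> = lact UU a (ract UU (eps \<Theta>) ?c)"
    unfolding P.eps_lact(1)[OF a r] P.eps_lact(2)[OF cw \<Theta>(1)] ..
  finally show ?thesis using kap_io[OF d] \<Theta>(2) by simp
qed

lemma kap_low:
  assumes x: "x \<in> wt AA q" and q: "q < int N"
  shows "kap (du R AA x) = \<zero>\<^bsub>UU\<^esub>"
proof -
  obtain \<Theta> where \<Theta>: "\<Theta> \<in> DW (q - int N)" "io \<Theta> = du R AA x" using du_lift[OF x] .
  note d = P.A.DW_DD[OF \<Theta>(1)]
  have "eps \<Theta> = \<zero>\<^bsub>UU\<^esub>"
  proof (rule P.eps_zero[OF d])
    fix b assume b: "b \<in> carrier B"
    show "\<Theta> (j b) = \<zero>\<^bsub>TT\<^esub>" by (rule TW_neg[OF P.A.DWD(3)[OF \<Theta>(1) j_wt[OF b]]]) (use q in simp)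
  qed
  then show ?thesis using kap_io[OF d] \<Theta>(2) by simp
qed

text \<open>The map \<open>s\<close> sends a (x) e (x) c to a \<open>kap\<close>(de) c with c
  twisted. It agrees with \<open>kap\<close> on the generating one-forms: on those from B and from
  the lower summands both sides are zero by \<open>kap_low\<close>.\<close>

lemma retraction_exists: "\<exists>s. \<forall>\<xi>\<in>carrier OA. s (NU \<xi>) = kap \<xi>"
proof -
  let ?o = "\<one>\<^bsub>AA\<^esub>" and ?s = "sg (int N)"
  let ?g = "\<lambda>e. kap (du R AA (iE N e))"
  note duc = P.A.O1.du_closed
  have gc: "?g e \<in> carrier UU" if "e \<in> carrier (E N)" for e by (rule addhom_closed[OF kap_hom duc[OF iEc[OF N_in that]]])
  have ga: "?g (e \<oplus>\<^bsub>E N\<^esub> e') = ?g e \<oplus>\<^bsub>UU\<^esub> ?g e'" if e: "e \<in> carrier (E N)" and e': "e' \<in> carrier (E N)" for e e'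
    unfolding addhom_add[OF iE_hom[OF N_in] e e'] P.A.O1.du_rules(1)[OF iEc[OF N_in e] iEc[OF N_in e']]
    by (rule addhom_add[OF kap_hom duc[OF iEc[OF N_in e]] duc[OF iEc[OF N_in e']]])
  note lU = P.ID.IB.l_closed and rU = P.ID.IB.r_closed
  \<comment> \<open>The Leibniz rule seen through \<open>kap\<close>. It shows that e goes to
    \<open>kap\<close>(de) linearly over B, once the differentials of B are killed.\<close>
  have split: "kap (du R AA (x \<otimes>\<^bsub>AA\<^esub> y)) = ract UU (kap (du R AA x)) (?s y) \<oplus>\<^bsub>UU\<^esub> lact UU x (kap (du R AA y))"
    if x: "x \<in> wt AA p" and y: "y \<in> wt AA q" for x y p q
  proof -
    note xc = wtc[OF x] and yc = wtc[OF y]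
    have kx: "kap (du R AA x) \<in> carrier UU" "kap (du R AA y) \<in> carrier UU"
      by (rule addhom_closed[OF kap_hom duc[OF xc]], rule addhom_closed[OF kap_hom duc[OF yc]])
    have e: "du R AA (x \<otimes>\<^bsub>AA\<^esub> y) = p1 ?o x y \<oplus>\<^bsub>OA\<^esub> p1 x y ?o"
      unfolding du_def using P.A.O1.p1_rules(4)[OF one_AA xc one_AA yc] P.A.A.r_one[OF yc] P.A.A.l_one[OF xc] by (simp only:)
    show ?thesis
      unfolding e addhom_add[OF kap_hom P.A.O1.p1_closed[OF one_AA xc yc] P.A.O1.p1_closed[OF xc yc one_AA]]
        kap_p1[OF one_wt x y] kap_p1[OF x y one_wt] P.A.sg_one P.ID.IB.r_one[OF kx(2)] P.ID.IB.l_one[OF rU[OF P.A.sg_closed[OF yc] kx(1)]]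
      ..
  qed
  \<comment> \<open>Positivity of N puts the weight of B strictly below N, so that
    \<open>kap_low\<close> covers the differentials of elements of B.\<close>
  have N0: "0 < int N" using N_pos by simp
  have gl: "?g (lact (E N) b e) = lact UU (j b) (?g e)" if b: "b \<in> carrier B" and e: "e \<in> carrier (E N)" for b e
    unfolding iE_act(1)[OF N_in b e] split[OF j_wt[OF b] iEw[OF N_in e]] kap_low[OF j_wt[OF b] N0]
      P.ID.IB.r_zero[OF P.A.sg_closed[OF iEc[OF N_in e]]]
    by (rule P.ID.I.l_zero[OF lU[OF jc[OF b] gc[OF e]]])
  have gr: "?g (ract (E N) e b) = ract UU (?g e) (j b)" if b: "b \<in> carrier B" and e: "e \<in> carrier (E N)" for b e
    unfolding iE_act(2)[OF N_in b e] split[OF iEw[OF N_in e] j_wt[OF b]] kap_low[OF j_wt[OF b] N0]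
      P.ID.IB.l_zero[OF iEc[OF N_in e]] P.sg_j[OF b]
    by (rule P.ID.I.r_zero[OF rU[OF jc[OF b] gc[OF e]]])
  let ?h = "\<lambda>a e c. lact UU a (ract UU (?g e) (?s c))"
  have EN: "\<And>e e'. e \<in> carrier (E N) \<Longrightarrow> e' \<in> carrier (E N) \<Longrightarrow> e \<oplus>\<^bsub>E N\<^esub> e' \<in> carrier (E N)"
    by (rule abelian_groupE(1)[OF E_grp[OF N_in]])
  note cl = lU rU gc P.A.sg_closed[of _ "int N"] jc EN biact.l_closed[OF EN_biact] biact.r_closed[OF EN_biact]
  have "\<exists>L. L \<in> addhom Y UU \<and> (\<forall>a\<in>carrier AA. \<forall>e\<in>carrier (E N). \<forall>c\<in>carrier AA. L (IE.pi3 a e c) = ?h a e c)"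
    by (rule IE.ind_lift[OF grp_UU])
      (simp_all only: cl ga gl gr P.A.sg_add P.A.sg_mult P.sg_j P.ID.IB.l_plus P.ID.IB.r_plus P.ID.IB.l_add P.ID.IB.r_add P.ID.IB.l_mult P.ID.IB.r_mult P.ID.IB.lr_assoc)
  then obtain s where s: "s \<in> addhom Y UU" and sp: "\<forall>a\<in>carrier AA. \<forall>e\<in>carrier (E N). \<forall>c\<in>carrier AA. s (IE.pi3 a e c) = ?h a e c" by (elim exE conjE)
  have zero: "lact UU a (ract UU \<zero>\<^bsub>UU\<^esub> c) = \<zero>\<^bsub>UU\<^esub>" if "a \<in> carrier AA" "c \<in> carrier AA" for a c
    unfolding P.ID.IB.r_zero[OF that(2)] by (rule P.ID.IB.l_zero[OF that(1)])
  have zero': "lact Y a (ract Y \<zero>\<^bsub>Y\<^esub> c) = \<zero>\<^bsub>Y\<^esub>" if "a \<in> carrier AA" "c \<in> carrier AA" for a c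
    unfolding IE.IB.r_zero[OF that(2)] by (rule IE.IB.l_zero[OF that(1)])
  have s0: "s \<zero>\<^bsub>Y\<^esub> = \<zero>\<^bsub>UU\<^esub>" by (rule addhom_zero[OF grp_Y grp_UU s])
  have "s (NU \<xi>) = kap \<xi>" if "\<xi> \<in> carrier OA" for \<xi>
  proof (rule Om1_ext_gens[OF grp_UU addhom_comp[OF NU_hom s] kap_hom _ _ that])
    fix p q a b c assume a: "a \<in> wt AA p" and b: "b \<in> carrier B" and c: "c \<in> wt AA q"
    show "s (NU (p1 a (j b) c)) = kap (p1 a (j b) c)"
      unfolding NU_p1[OF wtc[OF a] jc[OF b] wtc[OF c]] NU_jb[OF b] zero'[OF wtc[OF a] wtc[OF c]] s0
        kap_p1[OF a j_wt[OF b] c] kap_low[OF j_wt[OF b] N0] zero[OF wtc[OF a] P.A.sg_closed[OF wtc[OF c]]] ..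
  next
    fix p q a i e c assume a: "a \<in> wt AA p" and i: "i \<in> {1..N}" and e: "e \<in> carrier (E i)" and c: "c \<in> wt AA q"
    show "s (NU (p1 a (iE i e) c)) = kap (p1 a (iE i e) c)"
    proof (cases "i = N")
      case True
      then have eN: "e \<in> carrier (E N)" using e by simp
      show ?thesis unfolding NU_inE[OF wtc[OF a] i e wtc[OF c]] kap_p1[OF a iEw[OF i e] c]
        using sp[rule_format, OF wtc[OF a] eN wtc[OF c]] by (simp only: True if_True simp_thms)
    next
      case False
      then have "int i < int N" using i by simp
      then show ?thesis unfolding NU_inE[OF wtc[OF a] i e wtc[OF c]] kap_p1[OF a iEw[OF i e] c]
        using kap_low[OF iEw[OF i e]] s0 zero[OF wtc[OF a] P.A.sg_closed[OF wtc[OF c]]] False by (simp only: if_False simp_thms)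
    qed
  qed
  then show ?thesis by blast
qed

text \<open>Injectivity: s(t(eps \<Theta>)) = s(NU(io \<Theta>)) = kap(io \<Theta>) = eps \<Theta>,
  and \<open>eps\<close> is onto. Surjectivity comes from that of \<open>NU\<close> and
  \<open>io\<close>. The weights match because \<open>eps\<close> maps each weight space onto the
  corresponding one.\<close>

lemma induced_iso:
  "\<exists>t. t \<in> extensional (carrier UU) \<and> t \<in> addhom UU Y \<and> (\<forall>\<Theta>\<in>carrier DD. t (eps \<Theta>) = Phi \<Theta>) \<and>
     t \<in> shift_iso AA (int N) UU UW Y YW"
proof -
  obtain t1 where t1: "t1 \<in> addhom UU Y" and te1: "\<And>\<Theta>. \<Theta> \<in> carrier DD \<Longrightarrow> t1 (eps \<Theta>) = Phi \<Theta>"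
    and UWs: "\<And>n. UW n \<subseteq> eps ` DW n" using induced_map_exists by blast
  obtain s where s: "\<And>\<xi>. \<xi> \<in> carrier OA \<Longrightarrow> s (NU \<xi>) = kap \<xi>" using retraction_exists by blast
  define t where "t = restrict t1 (carrier UU)"
  have t: "t \<in> addhom UU Y" unfolding t_def
    by (rule addhomI) (simp_all add: addhom_closed[OF t1] addhom_add[OF t1])
  have te: "t (eps \<Theta>) = Phi \<Theta>" if "\<Theta> \<in> carrier DD" for \<Theta> unfolding t_def using te1[OF that] P.eps_char(1)[OF that] by simp
  have st: "s (t x) = x" if x: "x \<in> carrier UU" for x
  proof -
    from eps_surj[OF x] obtain \<Theta> where \<Theta>: "x = eps \<Theta>" "\<Theta> \<in> carrier DD" by blast
    show ?thesis unfolding \<Theta>(1) te[OF \<Theta>(2)] Phi_def s[OF io_closed[OF \<Theta>(2)]] by (rule kap_io[OF \<Theta>(2)])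
  qed
  have ts: "\<exists>x\<in>carrier UU. t x = y" if y: "y \<in> carrier Y" for y
  proof -
    from NU_surj[OF y] obtain \<xi> where \<xi>: "\<xi> \<in> carrier OA" "NU \<xi> = y" by blast
    from io_onto[OF \<xi>(1)] obtain \<Theta> where \<Theta>: "\<Theta> \<in> carrier DD" "io \<Theta> = \<xi>" by blast
    have "t (eps \<Theta>) = y" unfolding te[OF \<Theta>(1)] Phi_def \<Theta>(2) by (rule \<xi>(2))
    then show ?thesis using P.eps_char(1)[OF \<Theta>(1)] by blast
  qed
  have bij: "bij_betw t (carrier UU) (carrier Y)"
    unfolding bij_betw_def
  proof
    show "inj_on t (carrier UU)" by (rule inj_on_inverseI[of _ s]) (rule st)
    show "t ` carrier UU = carrier Y" using addhom_closed[OF t] ts by blast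
  qed
  note eh = P.eps_addhom
  have eW: "eps ` DW n = UW n" for n using UWs[of n] P.eps_wt by blast
  have tW: "t ` UW n = YW (n + int N)" for n
  proof -
    have "t ` UW n = (\<lambda>\<Theta>. t (eps \<Theta>)) ` DW n" unfolding eW[symmetric] image_image ..
    also have "\<dots> = Phi ` DW n" by (rule image_cong[OF refl te[OF P.A.DW_DD]])
    finally show ?thesis unfolding Phi_wt .
  qed
  have tl: "t (lact UU a x) = lact Y a (t x)" and tr: "t (ract UU x a) = ract Y (t x) (sg (int N) a)"
    if a: "a \<in> carrier AA" and x: "x \<in> carrier UU" for a x
  proof -
    \<comment> \<open>Linearity is first checked for homogeneous coefficients and homogeneous
      derivations, where \<open>eps\<close> is known to be linear, and then extended in each
      variable by additivity.\<close>
    have homog: "t (lact UU a (eps \<Theta>)) = lact Y a (t (eps \<Theta>))" "t (ract UU (eps \<Theta>) a) = ract Y (t (eps \<Theta>)) (sg (int N) a)"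
      if a: "a \<in> wt AA p" and \<Theta>: "\<Theta> \<in> DW n" for a p \<Theta> n
    proof -
      note d = P.A.DW_DD[OF \<Theta>]
      show "t (lact UU a (eps \<Theta>)) = lact Y a (t (eps \<Theta>))"
        unfolding P.eps_lact(1)[OF a \<Theta>, symmetric] te[OF P.A.DW_DD[OF P.A.DW_lact[OF a \<Theta>]]] te[OF d] by (rule Phi_act(1)[OF wtc[OF a] d])
      show "t (ract UU (eps \<Theta>) a) = ract Y (t (eps \<Theta>)) (sg (int N) a)"
        unfolding P.eps_lact(2)[OF a \<Theta>, symmetric] te[OF P.A.DW_DD[OF P.A.DW_ract[OF a \<Theta>]]] te[OF d] by (rule Phi_act(2)[OF wtc[OF a] d])
    qed
    from eps_surj[OF x] obtain \<Theta>0 where \<Theta>0: "x = eps \<Theta>0" "\<Theta>0 \<in> carrier DD" by blast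
    have hw: "t (lact UU a x) = lact Y a (t x) \<and> t (ract UU x a) = ract Y (t x) (sg (int N) a)" if a: "a \<in> wt AA p" for a p
      unfolding \<Theta>0(1)
    proof
      note ac = wtc[OF a]
      show "t (lact UU a (eps \<Theta>0)) = lact Y a (t (eps \<Theta>0))"
        by (rule P.A.DD_hom_ext[OF grp_Y addhom_comp[OF addhom_comp[OF eh P.ID.ind_hom(1)[OF ac]] t] addhom_comp[OF addhom_comp[OF eh t] IE.ind_hom(1)[OF ac]] homog(1)[OF a] \<Theta>0(2)])
      show "t (ract UU (eps \<Theta>0) a) = ract Y (t (eps \<Theta>0)) (sg (int N) a)"
        by (rule P.A.DD_hom_ext[OF grp_Y addhom_comp[OF addhom_comp[OF eh P.ID.ind_hom(3)[OF ac]] t] addhom_comp[OF addhom_comp[OF eh t] IE.ind_hom(3)[OF P.A.sg_closed[OF ac]]] homog(2)[OF a] \<Theta>0(2)])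
    qed
    note txc = addhom_closed[OF t x]
    show "t (lact UU a x) = lact Y a (t x)"
      by (rule P.A.A_ext[OF grp_Y addhom_comp[OF P.ID.IB.l_hom_left[OF x] t] IE.IB.l_hom_left[OF txc] conjunct1[OF hw] a])
    show "t (ract UU x a) = ract Y (t x) (sg (int N) a)"
      by (rule P.A.A_ext[OF grp_Y addhom_comp[OF P.ID.IB.r_hom_left[OF x] t] addhom_comp[OF P.A.sg_addhom IE.IB.r_hom_left[OF txc]] conjunct2[OF hw] a])
  qed
  have "t \<in> shift_iso AA (int N) UU UW Y YW"
    unfolding shift_iso_def using t bij tW tl tr P.A.twist_eq by (simp del: AA_simps)
  moreover have "t \<in> extensional (carrier UU)" unfolding t_def by simp
  ultimately show ?thesis using t te by blast
qed

text \<open>Source and target have copies of the double derivations of B and of E_N as their lowest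
  weight spaces, in weights 0 and N. The isomorphism matches these spaces, and \<open>t0\<close> is
  what it becomes through the two embeddings. Over B the twist is trivial, so right linearity holds
  without signs.\<close>

lemma restricted_iso:
  assumes t: "t \<in> shift_iso AA (int N) UU UW Y YW"
  shows "\<exists>t0\<in>bimod_iso B D (E N). \<forall>\<Delta>\<in>carrier D. t (P.ID.pi3 \<one>\<^bsub>AA\<^esub> \<Delta> \<one>\<^bsub>AA\<^esub>) = IE.pi3 \<one>\<^bsub>AA\<^esub> (t0 \<Delta>) \<one>\<^bsub>AA\<^esub>"
proof -
  let ?o = "\<one>\<^bsub>AA\<^esub>"
  let ?e = "\<lambda>e. IE.pi3 ?o e ?o" and ?d = "\<lambda>\<Delta>. P.ID.pi3 ?o \<Delta> ?o"
  have th: "t \<in> addhom UU Y" and tb: "bij_betw t (carrier UU) (carrier Y)" and tW: "t ` UW 0 = YW (0 + int N)"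
    and tl: "\<And>a x. a \<in> carrier AA \<Longrightarrow> x \<in> carrier UU \<Longrightarrow> t (lact UU a x) = lact Y a (t x)"
    and tr: "\<And>a x. a \<in> carrier AA \<Longrightarrow> x \<in> carrier UU \<Longrightarrow> t (ract UU x a) = ract Y (t x) (twist AA (int N) a)"
    using t unfolding shift_iso_def by blast+
  note bd = VW_bij[OF DB.biact_axioms, of 0] and be = VW_bij[OF EN_biact, of "int N"]
  have UWc: "UW 0 \<subseteq> carrier UU" unfolding ind_wt_def using span_closed[OF grp_UU P.UW_gens] by blast
  have bt: "bij_betw t (UW 0) (YW (int N))"
    unfolding bij_betw_def using inj_on_subset[OF bij_betw_imp_inj_on[OF tb] UWc] tW by simp
  define t0 where "t0 \<Delta> = inv_into (carrier (E N)) ?e (t (?d \<Delta>))" for \<Delta>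
  have b0: "bij_betw t0 (carrier D) (carrier (E N))"
    using bij_betw_trans[OF bij_betw_trans[OF bd bt] bij_betw_inv_into[OF be]] unfolding t0_def comp_def .
  have t0: "?e (t0 \<Delta>) = t (?d \<Delta>)" if "\<Delta> \<in> carrier D" for \<Delta>
    unfolding t0_def
  proof (rule f_inv_into_f)
    show "t (?d \<Delta>) \<in> ?e ` carrier (E N)"
      using bij_betwE[OF bt] bij_betwE[OF bd] that bij_betw_imp_surj_on[OF be] by blast
  qed
  have t0c: "t0 \<Delta> \<in> carrier (E N)" if "\<Delta> \<in> carrier D" for \<Delta> using bij_betwE[OF b0] that by blast
  have inj: "e = e'" if "?e e = ?e e'" "e \<in> carrier (E N)" "e' \<in> carrier (E N)" for e e'
    using inj_onD[OF bij_betw_imp_inj_on[OF be]] that by blast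
  note dc = P.ID.pi3_closed[OF one_AA _ one_AA]
  have "t0 \<in> addhom D (E N)"
  proof (rule addhomI)
    fix \<Delta> \<Delta>' assume \<Delta>: "\<Delta> \<in> carrier D" and \<Delta>': "\<Delta>' \<in> carrier D"
    note s = D_add_closed[OF \<Delta> \<Delta>']
    have "?e (t0 (\<Delta> \<oplus>\<^bsub>D\<^esub> \<Delta>')) = ?e (t0 \<Delta> \<oplus>\<^bsub>E N\<^esub> t0 \<Delta>')"
      unfolding t0[OF s] P.ID.pi3_rules(2)[OF one_AA one_AA \<Delta> \<Delta>'] addhom_add[OF th dc[OF \<Delta>] dc[OF \<Delta>']] t0[OF \<Delta>, symmetric] t0[OF \<Delta>', symmetric]
      by (rule IE.pi3_rules(2)[OF one_AA one_AA t0c[OF \<Delta>] t0c[OF \<Delta>'], symmetric])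
    then show "t0 (\<Delta> \<oplus>\<^bsub>D\<^esub> \<Delta>') = t0 \<Delta> \<oplus>\<^bsub>E N\<^esub> t0 \<Delta>'" by (rule inj[OF _ t0c[OF s] abelian_groupE(1)[OF E_grp[OF N_in] t0c[OF \<Delta>] t0c[OF \<Delta>']]])
  qed (rule t0c)
  moreover have "t0 (lact D b \<Delta>) = lact (E N) b (t0 \<Delta>)" "t0 (ract D \<Delta> b) = ract (E N) (t0 \<Delta>) b"
    if b: "b \<in> carrier B" and \<Delta>: "\<Delta> \<in> carrier D" for b \<Delta>
  proof -
    note jb = jc[OF b] and tc = t0c[OF \<Delta>] and al = D_act_closed[OF b \<Delta>]
    have dl: "?d (lact D b \<Delta>) = lact UU (j b) (?d \<Delta>)" "?d (ract D \<Delta> b) = ract UU (?d \<Delta>) (j b)"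
      using P.ID.pi3_rules(4)[OF one_AA one_AA \<Delta> b] P.ID.pi3_rules(5)[OF one_AA one_AA \<Delta> b]
      by (simp_all only: P.ID.ind_hom(2)[OF jb one_AA \<Delta> one_AA] P.ID.ind_hom(4)[OF jb one_AA \<Delta> one_AA] P.A.A.r_one[OF jb] P.A.A.l_one[OF jb])
    have el: "?e (lact (E N) b (t0 \<Delta>)) = lact Y (j b) (?e (t0 \<Delta>))" "?e (ract (E N) (t0 \<Delta>) b) = ract Y (?e (t0 \<Delta>)) (j b)"
      using IE.pi3_rules(4)[OF one_AA one_AA tc b] IE.pi3_rules(5)[OF one_AA one_AA tc b]
      by (simp_all only: IE.ind_hom(2)[OF jb one_AA tc one_AA] IE.ind_hom(4)[OF jb one_AA tc one_AA] P.A.A.r_one[OF jb] P.A.A.l_one[OF jb])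
    have "?e (t0 (lact D b \<Delta>)) = ?e (lact (E N) b (t0 \<Delta>))"
      unfolding t0[OF al(1)] dl(1) tl[OF jb dc[OF \<Delta>]] el(1) t0[OF \<Delta>] ..
    then show "t0 (lact D b \<Delta>) = lact (E N) b (t0 \<Delta>)" by (rule inj[OF _ t0c[OF al(1)] biact.l_closed[OF EN_biact b tc]])
    have "?e (t0 (ract D \<Delta> b)) = ?e (ract (E N) (t0 \<Delta>) b)"
      unfolding t0[OF al(2)] dl(2) tr[OF jb dc[OF \<Delta>]] el(2) t0[OF \<Delta>] P.A.twist_eq[OF jb] P.sg_j[OF b] ..
    then show "t0 (ract D \<Delta> b) = ract (E N) (t0 \<Delta>) b" by (rule inj[OF _ t0c[OF al(2)] biact.r_closed[OF EN_biact b tc]])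
  qed
  ultimately have "t0 \<in> bimod_iso B D (E N)" using b0 by (simp add: bimod_iso_def bimod_hom_def)
  then show ?thesis using t0 by (intro bexI[of _ t0]) simp_all
qed

end

section \<open>One half in B, and the theorem\<close>

lemma kalg_half:
  fixes K :: "('k, 'x) ring_scheme" and B :: "('r, 'b) alg"
  assumes K: "field K" and c: "char_zero K" and R: "k_algebra K R" and B: "R_algebra K R B"
  obtains h where "h \<in> carrier K" "kmap R B h \<oplus>\<^bsub>B\<^esub> kmap R B h = \<one>\<^bsub>B\<^esub>"
proof -
  interpret K: field K by (rule K)
  have "add_pow K (2::nat) \<one>\<^bsub>K\<^esub> \<noteq> \<zero>\<^bsub>K\<^esub>" using c by (simp add: char_zero_def)
  then have 2: "\<one>\<^bsub>K\<^esub> \<oplus>\<^bsub>K\<^esub> \<one>\<^bsub>K\<^esub> \<noteq> \<zero>\<^bsub>K\<^esub>" by (simp add: numeral_2_eq_2)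
  then have u: "\<one>\<^bsub>K\<^esub> \<oplus>\<^bsub>K\<^esub> \<one>\<^bsub>K\<^esub> \<in> Units K" by (simp add: K.field_Units)
  define h where "h = inv\<^bsub>K\<^esub> (\<one>\<^bsub>K\<^esub> \<oplus>\<^bsub>K\<^esub> \<one>\<^bsub>K\<^esub>)"
  have h: "h \<in> carrier K" unfolding h_def using u by simp
  have "h \<otimes>\<^bsub>K\<^esub> (\<one>\<^bsub>K\<^esub> \<oplus>\<^bsub>K\<^esub> \<one>\<^bsub>K\<^esub>) = \<one>\<^bsub>K\<^esub>" unfolding h_def using u by (rule K.Units_l_inv)
  then have hh: "h \<oplus>\<^bsub>K\<^esub> h = \<one>\<^bsub>K\<^esub>" using h by (simp add: K.r_distr)
  have R1: "umap R \<in> ring_hom K R" and B1: "umap B \<in> ring_hom R B" using R B by (simp_all add: k_algebra_def R_algebra_def)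
  have "kmap R B h \<oplus>\<^bsub>B\<^esub> kmap R B h = kmap R B (h \<oplus>\<^bsub>K\<^esub> h)"
    unfolding kmap_def using ring_hom_add[OF R1 h h] ring_hom_add[OF B1 ring_hom_closed[OF R1 h] ring_hom_closed[OF R1 h]] by simp
  also have "\<dots> = \<one>\<^bsub>B\<^esub>" unfolding hh kmap_def using ring_hom_one[OF R1] ring_hom_one[OF B1] by simp
  finally show ?thesis using that h by blast
qed

theorem theorem5p4:
  fixes K :: "'k ring" and R :: "('k, 'r) alg" and B :: "('r, 'b) alg"
    and N :: nat and E :: "nat \<Rightarrow> ('b, 'e) bimod"
    and \<omega> :: "('b \<times> (nat \<Rightarrow> 'e) list) pres forms set"
  assumes "field K" and "char_zero K"
    and "k_algebra K R" and "finite_dim K R" and "semisimple_ring R"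
    and "R_algebra K R B" and "smooth K R B"
    and "N > 0"
    and "\<And>i. i \<in> {1..N} \<Longrightarrow>
           bimodule K R B (E i) \<and> fin_gen_bimod B (E i) \<and> projective_bimod K R B (E i)"
  defines "A \<equiv> TBM B N E" and "j \<equiv> TBM_base B N E" and "D \<equiv> DDer K R (ungraded B)"
  assumes "bisymplectic K R A (int N) \<omega>"
  shows "\<exists>t. induced_by_iota K R B N E \<omega> t \<and>
             (\<forall>t'. induced_by_iota K R B N E \<omega> t' \<longrightarrow> t' = t) \<and>
             t \<in> shift_iso A (int N)
                   (ind A j B D) (ind_wt A j B D (placed 0 D))
                   (ind A j B (E N)) (ind_wt A j B (E N) (placed (int N) (E N))) \<and>
             bij_betw (\<lambda>\<Delta>. pind A j B D \<one>\<^bsub>A\<^esub> \<Delta> \<one>\<^bsub>A\<^esub>) (carrier D)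
               (ind_wt A j B D (placed 0 D) 0) \<and>
             bij_betw (\<lambda>e. pind A j B (E N) \<one>\<^bsub>A\<^esub> e \<one>\<^bsub>A\<^esub>) (carrier (E N))
               (ind_wt A j B (E N) (placed (int N) (E N)) (int N)) \<and>
             (\<exists>t0 \<in> bimod_iso B D (E N). \<forall>\<Delta>\<in>carrier D.
                t (pind A j B D \<one>\<^bsub>A\<^esub> \<Delta> \<one>\<^bsub>A\<^esub>) = pind A j B (E N) \<one>\<^bsub>A\<^esub> (t0 \<Delta>) \<one>\<^bsub>A\<^esub>)"
proof -
  obtain h where h: "h \<in> carrier K" "kmap R B h \<oplus>\<^bsub>B\<^esub> kmap R B h = \<one>\<^bsub>B\<^esub>"
    using kalg_half[OF assms(1-3,6)] .
  interpret S: bisym_iota K R B h N E "iota K R (TBM B N E) \<omega>"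
  proof (intro_locales)
    show "kalg K R B" by (rule kalg.intro[OF assms(3,6)])
    show "base_alg_axioms K R B h" by (rule base_alg_axioms.intro[OF h])
    show "tbm_axioms K R B N E" by (rule tbm_axioms.intro) (use assms(9) in blast)
    show "bisym_axioms K R B N E" by (rule bisym_axioms.intro) (use assms(7-9) in blast)+
    show "bisym_iota_axioms K R B N E (iota K R (TBM B N E) \<omega>)"
      by (rule bisym_iota_axioms.intro) (use assms(13) in \<open>simp add: bisymplectic_def A_def\<close>)
  qed
  \<comment> \<open>\<open>Phi\<close> is by definition the composite of iota(\<omega>), \<nu> and
    pr_N, so the defining condition of an induced map is literally that t after \<open>eps\<close>
    is \<open>Phi\<close>.\<close>
  have ind: "induced_by_iota K R B N E \<omega> t \<longleftrightarrow>
      t \<in> extensional (carrier S.UU) \<and> t \<in> addhom S.UU S.Y \<and> (\<forall>\<Theta>\<in>carrier S.DD. t (S.eps \<Theta>) = S.Phi \<Theta>)" for t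
    unfolding induced_by_iota_def Let_def S.Phi_def S.NU_def A_def ..
  obtain t where t: "t \<in> extensional (carrier S.UU)" "t \<in> addhom S.UU S.Y" "\<forall>\<Theta>\<in>carrier S.DD. t (S.eps \<Theta>) = S.Phi \<Theta>"
    and iso: "t \<in> shift_iso S.AA (int N) S.UU S.UW S.Y S.YW"
    using S.induced_iso by blast
  \<comment> \<open>Since \<open>eps\<close> is onto, the condition determines the map on its whole
    carrier; extensionality fixes it elsewhere.\<close>
  have uniq: "t' = t" if t': "induced_by_iota K R B N E \<omega> t'" for t'
  proof (rule extensionalityI)
    show "t' \<in> extensional (carrier S.UU)" "t \<in> extensional (carrier S.UU)" using t(1) t' unfolding ind by blast+
    fix x assume "x \<in> carrier S.UU"
    then obtain \<Theta> where "x = S.eps \<Theta>" "\<Theta> \<in> carrier S.DD" using S.eps_surj by blast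
    then show "t' x = t x" using t(3) t' unfolding ind by simp
  qed
  have 1: "induced_by_iota K R B N E \<omega> t" unfolding ind using t by blast
  show ?thesis
    unfolding A_def j_def D_def
    by (intro exI[of _ t] conjI allI impI, rule 1, erule uniq, rule iso, rule S.VW_bij[OF S.DB.biact_axioms],
        rule S.VW_bij[OF S.EN_biact], rule S.restricted_iso[OF iso])
qed

end
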